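(* (1) There is no completely regular code with intersection array $\{11,4;3,6\}$ in $H(12,2)$ or in $H(13,2)$, i.e., no completely regular code with quotient matrix $$\begin{pmatrix}1&11&0\\3&5&4\\0&6&6\end{pmatrix}\ \text{in } H(12,2),\qquad \begin{pmatrix}2&11&0\\3&6&4\\0&6&7\end{pmatrix}\ \text{in } H(13,2).$$ (2) There is no completely regular code with intersection array $\{10,3;4,7\}$ in $H(12,2)$ or in $H(13,2)$, i.e., no completely regular code with quotient matrix $$\begin{pmatrix}2&10&0\\4&5&3\\0&7&5\end{pmatrix}\ \text{in } H(12,2),\qquad \begin{pmatrix}3&10&0\\4&6&3\\0&7&6\end{pmatrix}\ \text{in } H(13,2).$$
   Context: The Hamming graph $H(n,2)$ (the $n$-cube) has vertex set $\{0,1\}^n$, two words being adjacent iff they differ in exactly one position. A partition $(C_0,\dots,C_{k-1})$ of the vertex set of a graph into nonempty sets is equitable with quotient matrix $(S_{i,j})$ if every vertex of $C_i$ has exactly $S_{i,j}$ neighbors in $C_j$ for all $i,j$. For a nonempty vertex set $C$ of a graph, let $C^{(i)}$ be the set of vertices at graph distance exactly $i$ from $C$; the covering radius $\rho$ is the largest $i$ with $C^{(i)}\neq\emptyset$. The set $C$ is a completely regular code if the distance partition $(C^{(0)},\dots,C^{(\rho)})$ is equitable. Its quotient matrix $S$ is tridiagonal, and the intersection array is $\{b_0,\dots,b_{\rho-1};c_1,\dots,c_\rho\}=\{S_{0,1},S_{1,2},\dots,S_{\rho-1,\rho};S_{1,0},S_{2,1},\dots,S_{\rho,\rho-1}\}$;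 the diagonal entries are determined by the degree of the graph. *)

theory Defs
  imports "Graph_Theory.Graph_Theory" "Jordan_Normal_Form.Matrix"
begin

text \<open>
  Undirected graphs are symmetric digraphs, as in the library locale \<open>pair_graph\<close>. The definitions
  below are meant for finite graphs; \<open>card\<close> and \<open>GREATEST\<close> carry their intended meaning there.
\<close>

definition hypercube :: "nat \<Rightarrow> bool list pair_pre_digraph" where
  "hypercube n =
     \<lparr> pverts = {x. length x = n},
       parcs = {(x, y). length x = n \<and> length y = n \<and> card {i. i < n \<and> x ! i \<noteq> y ! i} = 1} \<rparr>"

lemma pair_graph_hypercube: "pair_graph (hypercube n)"
proof -
  have fin: "finite {x :: bool list. length x = n}"
    using finite_lists_length_eq[of "UNIV :: bool set" n] by simp
  have sub: "parcs (hypercube n) \<subseteq> {x. length x = n} \<times> {x. length x = n}"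
    by (auto simp: hypercube_def)
  have "finite (parcs (hypercube n))"
    by (rule finite_subset[OF sub]) (simp add: fin)
  moreover have "symmetric (with_proj (hypercube n))"
  proof -
    have "{i. i < n \<and> y ! i \<noteq> x ! i} = {i. i < n \<and> x ! i \<noteq> y ! i}" for x y :: "bool list"
      by blast
    then show ?thesis
      unfolding symmetric_def sym_def hypercube_def with_proj_simps by simp
  qed
  ultimately show ?thesis
  proof unfold_locales
    show "finite (pverts (hypercube n))"
      using fin by (simp add: hypercube_def)
    show "e \<in> parcs (hypercube n) \<Longrightarrow> fst e \<in> pverts (hypercube n)" for e
      by (auto simp: hypercube_def)
    show "e \<in> parcs (hypercube n) \<Longrightarrow> snd e \<in> pverts (hypercube n)" for e
      by (auto simp: hypercube_def)
    show "e \<in> parcs (hypercube n) \<Longrightarrow> fst e \<noteq> snd e" for e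
    proof
      assume "e \<in> parcs (hypercube n)" and eq: "fst e = snd e"
      then have "card {i. i < n \<and> fst e ! i \<noteq> snd e ! i} = 1"
        unfolding hypercube_def by (cases e) simp
      then show False
        unfolding eq by simp
    qed
  qed
qed

text \<open>Graph distance is the library's shortest-path cost \<open>\<mu>\<close> with all arcs of cost 1.\<close>

definition set_dist :: "('a, 'b) pre_digraph \<Rightarrow> 'a set \<Rightarrow> 'a \<Rightarrow> ereal" where
  "set_dist G C v = (INF u\<in>C. wf_digraph.\<mu> G (\<lambda>_. 1) u v)"

definition dist_layer :: "('a, 'b) pre_digraph \<Rightarrow> 'a set \<Rightarrow> nat \<Rightarrow> 'a set" where
  "dist_layer G C i = {v \<in> verts G. set_dist G C v = ereal (real i)}"

lemma dist_layer_altdef: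
  assumes "wf_digraph G"
  shows "dist_layer G C i =
    {v \<in> verts G. (\<exists>u\<in>C. \<exists>p. pre_digraph.awalk G u p v \<and> length p = i) \<and>
      (\<forall>u\<in>C. \<forall>p. pre_digraph.awalk G u p v \<longrightarrow> i \<le> length p)}"
proof -
  interpret wf_digraph G by fact
  have cost: "awalk_cost (\<lambda>_. 1) p = real (length p)" for p :: "'b list"
    by (induction p) auto
  have "set_dist G C v = ereal (real i) \<longleftrightarrow>
      (\<exists>u\<in>C. \<exists>p. awalk u p v \<and> length p = i) \<and> (\<forall>u\<in>C. \<forall>p. awalk u p v \<longrightarrow> i \<le> length p)"
    (is "?L \<longleftrightarrow> ?R") for v
  proof
    assume ?L
    then have lower: "i \<le> length p" if "u \<in> C" "awalk u p v" for u p
    proof -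
      have "set_dist G C v \<le> \<mu> (\<lambda>_. 1) u v"
        unfolding set_dist_def using that(1) by (rule INF_lower)
      also have "\<dots> \<le> ereal (real (length p))"
        using min_cost_le_walk_cost[OF that(2), of "\<lambda>_. 1"] by (simp add: cost)
      finally show ?thesis using \<open>?L\<close> by simp
    qed
    have "set_dist G C v < ereal (real (Suc i))"
      using \<open>?L\<close> by simp
    then obtain u where u: "u \<in> C" "\<mu> (\<lambda>_. 1) u v < ereal (real (Suc i))"
      unfolding set_dist_def INF_less_iff by blast
    then obtain p where p: "awalk u p v" "length p < Suc i"
      unfolding \<mu>_def INF_less_iff cost by auto
    show ?R using lower u p by (metis le_antisym less_Suc_eq_le)
  next
    assume ?R
    then obtain u p where up: "u \<in> C" "awalk u p v" "length p = i" by blast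
    show ?L unfolding set_dist_def
    proof (rule antisym)
      have "(INF u\<in>C. \<mu> (\<lambda>_. 1) u v) \<le> \<mu> (\<lambda>_. 1) u v"
        using up(1) by (rule INF_lower)
      also have "\<dots> \<le> ereal (real i)"
        using min_cost_le_walk_cost[OF up(2), of "\<lambda>_. 1"] up by (simp add: cost)
      finally show "(INF u\<in>C. \<mu> (\<lambda>_. 1) u v) \<le> ereal (real i)" .
      show "ereal (real i) \<le> (INF u\<in>C. \<mu> (\<lambda>_. 1) u v)"
        unfolding \<mu>_def cost by (intro INF_greatest) (use \<open>?R\<close> in simp)
    qed
  qed
  then show ?thesis unfolding dist_layer_def by blast
qed

definition covering_radius :: "('a, 'b) pre_digraph \<Rightarrow> 'a set \<Rightarrow> nat" where
  "covering_radius G C = (GREATEST i. dist_layer G C i \<noteq> {})"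

text \<open>
  The partition \<open>P 0, \<dots>, P (k - 1)\<close> is a function on \<open>nat\<close> of which only the values below \<open>k\<close> matter.
\<close>

definition equitable_partition ::
    "('a, 'b) pre_digraph \<Rightarrow> nat \<Rightarrow> (nat \<Rightarrow> 'a set) \<Rightarrow> nat mat \<Rightarrow> bool" where
  "equitable_partition G k P S \<longleftrightarrow>
     (\<forall>i<k. P i \<noteq> {}) \<and> disjoint_family_on P {..<k} \<and> (\<Union>i<k. P i) = verts G \<and>
     S \<in> carrier_mat k k \<and>
     (\<forall>i<k. \<forall>j<k. \<forall>v\<in>P i. card {w \<in> P j. v \<rightarrow>\<^bsub>G\<^esub> w} = S $$ (i, j))"

definition completely_regular_code :: "('a, 'b) pre_digraph \<Rightarrow> 'a set \<Rightarrow> bool" where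
  "completely_regular_code G C \<longleftrightarrow>
     C \<noteq> {} \<and> C \<subseteq> verts G \<and>
     (\<exists>S. equitable_partition G (covering_radius G C + 1) (dist_layer G C) S)"

definition has_quotient_matrix :: "('a, 'b) pre_digraph \<Rightarrow> 'a set \<Rightarrow> nat mat \<Rightarrow> bool" where
  "has_quotient_matrix G C S \<longleftrightarrow>
     equitable_partition G (covering_radius G C + 1) (dist_layer G C) S"

text \<open>
  The lists \<open>bs\<close> and \<open>cs\<close> hold \<open>b\<^sub>0, \<dots>, b\<^sub>\<rho>\<^sub>-\<^sub>1\<close> and \<open>c\<^sub>1, \<dots>, c\<^sub>\<rho>\<close>, so \<open>c\<^sub>i\<close> sits at list position \<open>i - 1\<close>.
\<close>

definition has_intersection_array ::
    "('a, 'b) pre_digraph \<Rightarrow> 'a set \<Rightarrow> nat list \<Rightarrow> nat list \<Rightarrow> bool" where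
  "has_intersection_array G C bs cs \<longleftrightarrow>
     (\<exists>S. has_quotient_matrix G C S \<and>
          bs = map (\<lambda>i. S $$ (i, i + 1)) [0..<covering_radius G C] \<and>
          cs = map (\<lambda>i. S $$ (i + 1, i)) [0..<covering_radius G C])"

end

theory Submission
  imports Defs
begin

text \<open>
  A code in the 12-cube becomes one in the 13-cube by adding a coordinate that the code ignores; this
  adds 1 to the diagonal of the quotient matrix and keeps the intersection array. So both parts are
  about the 13-cube, and the intersection arrays describe the colourings of its vertices with three
  colours \<open>K0\<close>, \<open>K1\<close>, \<open>K2\<close> (the distance layers) in which the numbers of neighbours of
  each colour are the rows of a fixed matrix \<open>S\<close>, named \<open>s1\<close> and \<open>s2\<close> in the two parts.

  The proof looks at the faces of such a colouring. Three local laws restrict the pattern of colours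
  on a face. The neighbours of a vertex inside the face must not exceed the allowed number of each
  colour (\<open>neighbours_bound\<close>). The square of \<open>S\<close> gives the number of walks of length two
  from a vertex to a colour; what the face already uses up leaves room for the vertices that lie two
  steps outside it, and that room cannot be negative (\<open>second_neighbours_bound\<close>). Finally, the
  matrix has eigenvalue 5, so its eigenvector \<open>g\<close> turns the colouring into an eigenfunction of the
  13-cube for the eigenvalue 5, a combination of the characters of weight 4; these are blind to
  at least one of any five directions, and therefore the alternating sum of \<open>g\<close> over each
  5-dimensional face vanishes (\<open>alt_five\<close>).

  A pattern of colours is called dead if no face of any colouring carries it. Let a \<open>k\<close>-face carry
  the pattern \<open>p\<close>. It has \<open>13 - k\<close> parallel neighbours, and the colours on them, summed over
  all the neighbours, are known from \<open>S\<close>. Hence for every linear weight on colourings of a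
  \<open>k\<close>-face some neighbour has at least the average weight. If no colouring \<open>q\<close> of the
  neighbour with at least this weight is compatible with \<open>p\<close>, then \<open>p\<close> is dead. Compatibility
  of \<open>p\<close> and \<open>q\<close> is refuted by the three laws in the \<open>(k + 1)\<close>-face spanned by both, or by a
  face of it that carries a pattern already known to be dead. A finite case distinction on the colours
  of \<open>q\<close>, with such a refutation at each leaf, is a certificate for the death of \<open>p\<close>
  (\<open>dead_by_certificate\<close>).

  A chain of certificates for patterns of dimension at most 4 ends with one for a single edge whose
  ends have the colours \<open>K1\<close> and \<open>K2\<close>. As every vertex of colour \<open>K1\<close> has neighbours of
  colour \<open>K2\<close>, there is no colouring.
\<close>

section \<open>Colourings of the 13-cube\<close>

definition flip :: "nat \<Rightarrow> (nat \<Rightarrow> bool) \<Rightarrow> nat \<Rightarrow> bool" where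
  "flip i x = x(i := \<not> x i)"

lemma flip_flip [simp]: "flip i (flip i x) = x"
  by (auto simp: flip_def fun_eq_iff)

lemma flip_commute: "flip i (flip j x) = flip j (flip i x)"
  by (auto simp: flip_def fun_eq_iff)

text \<open>
  The value \<open>KX\<close> stands for a colour that is not known. Colourings do not use it; it occurs in
  partially filled patterns only.
\<close>

datatype cell = K0 | K1 | K2 | KX

text \<open>
  Points of the cube are functions on all of \<open>nat\<close>, of which the 13 directions below 13 matter;
  the other coordinates just give more copies of the cube.
\<close>

definition colouring :: "(cell \<Rightarrow> cell \<Rightarrow> int) \<Rightarrow> ((nat \<Rightarrow> bool) \<Rightarrow> cell) \<Rightarrow> bool" where
  "colouring S f \<longleftrightarrow> (\<forall>x. f x \<noteq> KX) \<and>
     (\<forall>x c. c \<noteq> KX \<longrightarrow> int (card {i. i < 13 \<and> f (flip i x) = c}) = S (f x) c)"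

definition delta :: "cell \<Rightarrow> cell \<Rightarrow> int" where
  "delta c a = (if a = c then 1 else 0)"

lemma colouring_sum:
  assumes "colouring S f"
  shows "(\<Sum>i<13. g (f (flip i x))) = S (f x) K0 * g K0 + S (f x) K1 * g K1 + S (f x) K2 * g K2"
proof -
  let ?A = "\<lambda>c. {i. i < 13 \<and> f (flip i x) = c}"
  have fin: "finite (?A c)" for c by simp
  have "{..<13::nat} = ?A K0 \<union> ?A K1 \<union> ?A K2"
  proof -
    have "f (flip i x) = K0 \<or> f (flip i x) = K1 \<or> f (flip i x) = K2" for i
      using assms cell.exhaust unfolding colouring_def by metis
    then show ?thesis by auto
  qed
  then have "(\<Sum>i<13. g (f (flip i x))) = (\<Sum>i\<in>?A K0 \<union> ?A K1 \<union> ?A K2. g (f (flip i x)))"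
    by (rule arg_cong)
  also have "\<dots> = (\<Sum>i\<in>?A K0. g (f (flip i x))) + (\<Sum>i\<in>?A K1. g (f (flip i x)))
      + (\<Sum>i\<in>?A K2. g (f (flip i x)))"
    by (subst sum.union_disjoint; (subst sum.union_disjoint)?; auto)
  also have "\<dots> = int (card (?A K0)) * g K0 + int (card (?A K1)) * g K1 + int (card (?A K2)) * g K2"
    by simp
  finally show ?thesis
    using assms by (simp add: colouring_def)
qed

lemma colouring_sum_delta:
  assumes "colouring S f" "c \<noteq> KX"
  shows "(\<Sum>i<13. delta c (f (flip i x))) = S (f x) c"
  using colouring_sum[OF assms(1), of "delta c" x] assms(2)
  by (cases c) (auto simp: delta_def)

section \<open>Patterns on faces\<close>

datatype cube = Lf cell | Nd cube cube

text \<open>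
  The face through \<open>x\<close> with the directions \<open>ds\<close>, as a binary tree of colours: the head of
  \<open>ds\<close> is the branching at the root, and \<open>x\<close> is the leftmost leaf.
\<close>

fun cube_at :: "((nat \<Rightarrow> bool) \<Rightarrow> cell) \<Rightarrow> nat list \<Rightarrow> (nat \<Rightarrow> bool) \<Rightarrow> cube" where
  "cube_at f [] x = Lf (f x)"
| "cube_at f (d # ds) x = Nd (cube_at f ds x) (cube_at f ds (flip d x))"

text \<open>
  A list of steps, one for each direction, is read in two ways. The letters \<open>L\<close> and \<open>R\<close> lead to
  a vertex of the face, left or right at each branching. The letter \<open>S\<close> marks a direction that spans
  a smaller face through this vertex, while \<open>F\<close> marks a direction that is fixed on it. A list without
  \<open>F\<close> is the address of a vertex seen in the whole face.
\<close>

datatype step = SL | SR | FL | FR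

fun goto :: "step list \<Rightarrow> nat list \<Rightarrow> (nat \<Rightarrow> bool) \<Rightarrow> nat \<Rightarrow> bool" where
  "goto (SR # ss) (d # ds) x = goto ss ds (flip d x)"
| "goto (FR # ss) (d # ds) x = goto ss ds (flip d x)"
| "goto (SL # ss) (d # ds) x = goto ss ds x"
| "goto (FL # ss) (d # ds) x = goto ss ds x"
| "goto _ _ x = x"

fun frees :: "step list \<Rightarrow> nat list \<Rightarrow> nat list" where
  "frees (SL # ss) (d # ds) = d # frees ss ds"
| "frees (SR # ss) (d # ds) = d # frees ss ds"
| "frees (FL # ss) (d # ds) = frees ss ds"
| "frees (FR # ss) (d # ds) = frees ss ds"
| "frees _ _ = []"

lemma goto_flip: "goto ss ds (flip d x) = flip d (goto ss ds x)"
  by (induction ss ds x rule: goto.induct) (auto simp: flip_commute)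

lemma set_frees: "set (frees ss ds) \<subseteq> set ds"
  by (induction ss ds rule: frees.induct) auto

lemma distinct_frees: "distinct ds \<Longrightarrow> distinct (frees ss ds)"
  by (induction ss ds rule: frees.induct) (auto dest!: subsetD[OF set_frees])

text \<open>
  The functions \<open>at0\<close>, \<open>at1\<close> and \<open>at2\<close> sum \<open>g\<close> over the vertices at distance 0, 1
  and 2 from the addressed vertex within the addressed face, by recursion over the tree.
\<close>

fun at0 :: "(cell \<Rightarrow> int) \<Rightarrow> step list \<Rightarrow> cube \<Rightarrow> int" where
  "at0 g [] (Lf a) = g a"
| "at0 g (SL # ss) (Nd l r) = at0 g ss l"
| "at0 g (SR # ss) (Nd l r) = at0 g ss r"
| "at0 g (FL # ss) (Nd l r) = at0 g ss l"
| "at0 g (FR # ss) (Nd l r) = at0 g ss r"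
| "at0 g _ _ = 0"

fun at1 :: "(cell \<Rightarrow> int) \<Rightarrow> step list \<Rightarrow> cube \<Rightarrow> int" where
  "at1 g (SL # ss) (Nd l r) = at1 g ss l + at0 g ss r"
| "at1 g (SR # ss) (Nd l r) = at1 g ss r + at0 g ss l"
| "at1 g (FL # ss) (Nd l r) = at1 g ss l"
| "at1 g (FR # ss) (Nd l r) = at1 g ss r"
| "at1 g _ _ = 0"

fun at2 :: "(cell \<Rightarrow> int) \<Rightarrow> step list \<Rightarrow> cube \<Rightarrow> int" where
  "at2 g (SL # ss) (Nd l r) = at2 g ss l + at1 g ss r"
| "at2 g (SR # ss) (Nd l r) = at2 g ss r + at1 g ss l"
| "at2 g (FL # ss) (Nd l r) = at2 g ss l"
| "at2 g (FR # ss) (Nd l r) = at2 g ss r"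
| "at2 g _ _ = 0"

lemma at0_cube_at: "length ss = length ds \<Longrightarrow> at0 g ss (cube_at f ds x) = g (f (goto ss ds x))"
  by (induction ss ds x rule: goto.induct) auto

lemma at1_cube_at: "length ss = length ds \<Longrightarrow>
    at1 g ss (cube_at f ds x) = (\<Sum>i\<leftarrow>frees ss ds. g (f (flip i (goto ss ds x))))"
  by (induction ss ds x rule: goto.induct) (auto simp: at0_cube_at goto_flip)

fun pair_sum :: "(nat \<Rightarrow> nat \<Rightarrow> int) \<Rightarrow> nat list \<Rightarrow> int" where
  "pair_sum h [] = 0"
| "pair_sum h (d # ds) = (\<Sum>e\<leftarrow>ds. h d e) + pair_sum h ds"

lemma at2_cube_at: "length ss = length ds \<Longrightarrow>
    at2 g ss (cube_at f ds x) = pair_sum (\<lambda>i j. g (f (flip i (flip j (goto ss ds x))))) (frees ss ds)"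
  by (induction ss ds x rule: goto.induct)
    (auto simp: at1_cube_at goto_flip flip_commute intro!: arg_cong[where f = sum_list])

text \<open>
  With an address of the wrong length all three sums are 0. The local laws thereby hold for every
  address that a certificate may contain.
\<close>

lemma at_length:
  assumes "length ss \<noteq> length ds"
  shows "at0 g ss (cube_at f ds x) = 0" "at1 g ss (cube_at f ds x) = 0" "at2 g ss (cube_at f ds x) = 0"
proof -
  have 0: "at0 g ss (cube_at f ds x) = 0" if "length ss \<noteq> length ds" for ss ds x
    using that
  proof (induction ss arbitrary: ds x)
    case Nil then show ?case by (cases ds) auto
  next
    case (Cons s ss) then show ?case by (cases ds; cases s) auto
  qed
  have 1: "at1 g ss (cube_at f ds x) = 0" if "length ss \<noteq> length ds" for ss ds x
    using that
  proof (induction ss arbitrary: ds x)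
    case Nil then show ?case by (cases ds) auto
  next
    case (Cons s ss) then show ?case by (cases ds; cases s) (auto simp: 0)
  qed
  have 2: "at2 g ss (cube_at f ds x) = 0" if "length ss \<noteq> length ds" for ss ds x
    using that
  proof (induction ss arbitrary: ds x)
    case Nil then show ?case by (cases ds) auto
  next
    case (Cons s ss) then show ?case by (cases ds; cases s) (auto simp: 1)
  qed
  show "at0 g ss (cube_at f ds x) = 0" "at1 g ss (cube_at f ds x) = 0" "at2 g ss (cube_at f ds x) = 0"
    using 0 1 2 assms by auto
qed

lemma sum_list_uminus: "(\<Sum>i\<leftarrow>l. - h i) = - (\<Sum>i\<leftarrow>l. (h i :: int))"
  by (induction l) auto

lemma sum_list_distinct:
  "distinct ds \<Longrightarrow> (\<Sum>i\<leftarrow>ds. h i) = (\<Sum>i\<in>set ds. (h i :: int))"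
  by (simp add: sum_list_distinct_conv_sum_set)

lemma pair_sum_distinct:
  assumes "distinct ds" "\<And>i j. h i j = h j i"
  shows "(\<Sum>i\<in>set ds. \<Sum>j\<in>set ds - {i}. h i j) = 2 * pair_sum h ds"
  using assms(1)
proof (induction ds)
  case (Cons d ds)
  have fin: "finite (set ds)" and d: "d \<notin> set ds" using Cons by auto
  have "(\<Sum>i\<in>set (d # ds). \<Sum>j\<in>set (d # ds) - {i}. h i j)
      = (\<Sum>j\<in>set ds. h d j) + (\<Sum>i\<in>set ds. \<Sum>j\<in>insert d (set ds - {i}). h i j)"
    using d by (auto simp: insert_Diff_if intro!: sum.cong arg_cong2[where f = "(+)"])
  also have "(\<Sum>i\<in>set ds. \<Sum>j\<in>insert d (set ds - {i}). h i j)
      = (\<Sum>i\<in>set ds. h i d + (\<Sum>j\<in>set ds - {i}. h i j))"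
    using d by (intro sum.cong) auto
  also have "\<dots> = (\<Sum>i\<in>set ds. h d i) + 2 * pair_sum h ds"
    using Cons by (simp add: sum.distrib assms(2)[of _ d])
  finally show ?case using Cons.prems by (simp add: sum_list_distinct)
qed simp

section \<open>The local laws\<close>

lemma neighbours_bound:
  assumes "colouring S f" "c \<noteq> KX" "distinct E" "set E \<subseteq> {..<13}"
  shows "S (f y) c - (\<Sum>i\<leftarrow>E. delta c (f (flip i y))) \<ge> 0"
proof -
  have "(\<Sum>i\<in>set E. delta c (f (flip i y))) \<le> (\<Sum>i<13. delta c (f (flip i y)))"
    using assms(4) by (intro sum_mono2) (auto simp: delta_def)
  then show ?thesis
    using colouring_sum_delta[OF assms(1,2)] assms(3) by (simp add: sum_list_distinct)
qed

text \<open>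
  The left-hand side is twice the number of vertices of colour \<open>c\<close> that are reached from \<open>y\<close>
  along two different directions outside \<open>E\<close>. Walks of length two from \<open>y\<close> to the colour \<open>c\<close>
  are counted by the square of \<open>S\<close>; those that return to \<open>y\<close>, and those with one or both
  directions in \<open>E\<close>, are subtracted. Walks with one direction in \<open>E\<close> are counted from the
  neighbours of \<open>y\<close> in \<open>E\<close>.
\<close>

lemma second_neighbours_bound:
  assumes col: "colouring S f" and c: "c \<noteq> KX" and E: "distinct E" "set E \<subseteq> {..<13}"
  shows "S (f y) K0 * S K0 c + S (f y) K1 * S K1 c + S (f y) K2 * S K2 c
      - (13 - 2 * int (length E)) * delta c (f y)
      - 2 * (\<Sum>i\<leftarrow>E. S (f (flip i y)) c)
      + 2 * pair_sum (\<lambda>i j. delta c (f (flip i (flip j y)))) E \<ge> 0"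
proof -
  let ?d = "\<lambda>i j. delta c (f (flip i (flip j y)))"
  define O' where "O' = {..<13} - set E"
  have fin: "finite O'" and un: "{..<13} = O' \<union> set E" and dj: "O' \<inter> set E = {}"
    using E by (auto simp: O'_def)
  have cardO: "int (card O') = 13 - int (length E)"
    using E card_Diff_subset[of "set E" "{..<13}"] card_mono[of "{..<13}" "set E"]
    by (simp add: O'_def distinct_card of_nat_diff)
  have split: "(\<Sum>i<13. h i) = (\<Sum>i\<in>O'. h i) + (\<Sum>i\<in>set E. h i)" for h :: "nat \<Rightarrow> int"
    unfolding un using fin dj by (intro sum.union_disjoint) auto
  have row: "(\<Sum>j<13. ?d j i) = S (f (flip i y)) c" for i
    by (rule colouring_sum_delta[OF col c])
  have sym: "?d i j = ?d j i" for i j by (simp add: flip_commute)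
  have self: "?d i i = delta c (f y)" for i by simp
  have X: "(\<Sum>i\<in>O'. \<Sum>j\<in>O' - {i}. ?d j i) \<ge> 0"
    by (intro sum_nonneg) (auto simp: delta_def)
  have "(\<Sum>j\<in>O' - {i}. ?d j i) = S (f (flip i y)) c - delta c (f y) - (\<Sum>j\<in>set E. ?d j i)"
    if "i \<in> O'" for i
    using row[of i] split[of "\<lambda>j. ?d j i"] sum.remove[OF fin that, of "\<lambda>j. ?d j i"] by simp
  then have "(\<Sum>i\<in>O'. \<Sum>j\<in>O' - {i}. ?d j i)
      = (\<Sum>i\<in>O'. S (f (flip i y)) c) - int (card O') * delta c (f y) - (\<Sum>i\<in>O'. \<Sum>j\<in>set E. ?d j i)"
    by (simp add: sum_subtractf)
  also have "(\<Sum>i\<in>O'. \<Sum>j\<in>set E. ?d j i) = (\<Sum>j\<in>set E. \<Sum>i\<in>O'. ?d i j)"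
    by (subst sum.swap) (simp add: flip_commute)
  also have "\<dots> = (\<Sum>j\<in>set E. S (f (flip j y)) c - delta c (f y) - (\<Sum>i\<in>set E - {j}. ?d j i))"
  proof (intro sum.cong refl)
    fix j assume j: "j \<in> set E"
    have "(\<Sum>i\<in>set E. ?d i j) = delta c (f y) + (\<Sum>i\<in>set E - {j}. ?d j i)"
      using sum.remove[OF _ j, of "\<lambda>i. ?d i j"] by (simp add: sym[of _ j])
    then show "(\<Sum>i\<in>O'. ?d i j) = S (f (flip j y)) c - delta c (f y) - (\<Sum>i\<in>set E - {j}. ?d j i)"
      using row[of j] split[of "\<lambda>i. ?d i j"] by simp
  qed
  also have "\<dots> = (\<Sum>j\<in>set E. S (f (flip j y)) c) - int (length E) * delta c (f y) - 2 * pair_sum ?d E"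
    using pair_sum_distinct[OF E(1), of ?d] sym E(1) by (simp add: sum_subtractf distinct_card)
  finally have "(\<Sum>i\<in>O'. \<Sum>j\<in>O' - {i}. ?d j i) = (\<Sum>i\<in>O'. S (f (flip i y)) c)
      - int (card O') * delta c (f y) - ((\<Sum>j\<in>set E. S (f (flip j y)) c)
      - int (length E) * delta c (f y) - 2 * pair_sum ?d E)" .
  moreover have "(\<Sum>i\<in>O'. S (f (flip i y)) c) = S (f y) K0 * S K0 c + S (f y) K1 * S K1 c
      + S (f y) K2 * S K2 c - (\<Sum>j\<in>set E. S (f (flip j y)) c)"
    using colouring_sum[OF col, of "\<lambda>a. S a c" y] split[of "\<lambda>i. S (f (flip i y)) c"] by simp
  ultimately show ?thesis
    using X E(1) by (simp add: sum_list_distinct cardO algebra_simps)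
qed

fun alt :: "(cell \<Rightarrow> int) \<Rightarrow> cube \<Rightarrow> int" where
  "alt g (Lf a) = g a"
| "alt g (Nd l r) = alt g l - alt g r"

lemma alt_flip: "d \<in> set ds \<Longrightarrow> alt g (cube_at f ds (flip d x)) = - alt g (cube_at f ds x)"
proof (induction ds arbitrary: x)
  case (Cons e ds)
  show ?case
  proof (cases "d = e")
    case False
    then show ?thesis
      using Cons.IH[of x] Cons.IH[of "flip e x"] Cons.prems by (simp add: flip_commute[of e d])
  qed simp
qed simp

lemma alt_neighbours:
  assumes "colouring S f"
    and "\<And>a. a \<noteq> KX \<Longrightarrow> S a K0 * g K0 + S a K1 * g K1 + S a K2 * g K2 = e * g a"
  shows "(\<Sum>i<13. alt g (cube_at f ds (flip i x))) = e * alt g (cube_at f ds x)"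
proof (induction ds arbitrary: x)
  case Nil
  have "f x \<noteq> KX" using assms(1) by (simp add: colouring_def)
  then show ?case using colouring_sum[OF assms(1), of g x] assms(2) by simp
next
  case (Cons d ds)
  show ?case
    using Cons[of x] Cons[of "flip d x"]
    by (simp add: sum_subtractf flip_commute[of d] algebra_simps)
qed

lemma alt_bounded:
  assumes "\<And>a. \<bar>g a\<bar> \<le> B"
  shows "\<bar>alt g (cube_at f ds x)\<bar> \<le> 2 ^ length ds * B"
proof (induction ds arbitrary: x)
  case (Cons d ds)
  have "\<bar>alt g (cube_at f ds x) - alt g (cube_at f ds (flip d x))\<bar>
      \<le> \<bar>alt g (cube_at f ds x)\<bar> + \<bar>alt g (cube_at f ds (flip d x))\<bar>"
    by (rule abs_triangle_ineq4)
  also have "\<dots> \<le> 2 ^ length ds * B + 2 ^ length ds * B"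
    by (intro add_mono Cons)
  finally show ?case by (simp add: algebra_simps)
qed (use assms in simp)

text \<open>
  Regarded as a function of the base point, the alternating sum over a face is an eigenfunction as
  well, and each step in one of the five directions of the face changes its sign. So the steps in the
  other eight directions add up to \<open>5 + 5 = 10\<close> times its value. At a point where the absolute value
  is largest, eight terms cannot do that unless they are 0.
\<close>

lemma alt_five:
  assumes col: "colouring S f"
    and eig: "\<And>a. a \<noteq> KX \<Longrightarrow> S a K0 * g K0 + S a K1 * g K1 + S a K2 * g K2 = 5 * g a"
    and ds: "distinct ds" "set ds \<subseteq> {..<13}" "length ds = 5"
  shows "alt g (cube_at f ds x) = 0"
proof -
  let ?u = "\<lambda>x. alt g (cube_at f ds x)"
  let ?B = "\<bar>g K0\<bar> + \<bar>g K1\<bar> + \<bar>g K2\<bar> + \<bar>g KX\<bar>"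
  (* The values of \<open>?u\<close> are bounded integers, so a largest absolute value is attained. *)
  have "\<bar>g a\<bar> \<le> ?B" for a by (cases a) auto
  then have "\<forall>y. True \<longrightarrow> nat \<bar>?u y\<bar> < Suc (nat (2 ^ 5 * ?B))"
    using alt_bounded[of g ?B f ds] ds(3) by (simp add: less_Suc_eq_le nat_mono)
  then obtain z where z: "\<And>y. nat \<bar>?u y\<bar> \<le> nat \<bar>?u z\<bar>"
    using ex_has_greatest_nat[of "\<lambda>_. True" undefined "\<lambda>y. nat \<bar>?u y\<bar>"] by blast
  have un: "{..<13} = ({..<13} - set ds) \<union> set ds" using ds by auto
  have cardO: "card ({..<13} - set ds) = 8"
    using ds by (simp add: card_Diff_subset distinct_card)
  have "5 * ?u z = (\<Sum>i<13. ?u (flip i z))"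
    by (rule alt_neighbours[OF col eig, symmetric])
  also have "\<dots> = (\<Sum>i\<in>{..<13} - set ds. ?u (flip i z)) + (\<Sum>i\<in>set ds. ?u (flip i z))"
    by (subst un) (intro sum.union_disjoint; auto)
  also have "(\<Sum>i\<in>set ds. ?u (flip i z)) = - 5 * ?u z"
    using ds by (simp add: alt_flip distinct_card)
  finally have "10 * \<bar>?u z\<bar> = \<bar>\<Sum>i\<in>{..<13} - set ds. ?u (flip i z)\<bar>" by simp
  also have "\<dots> \<le> (\<Sum>i\<in>{..<13} - set ds. \<bar>?u (flip i z)\<bar>)" by (rule sum_abs)
  also have "\<dots> \<le> (\<Sum>i\<in>{..<13} - set ds. \<bar>?u z\<bar>)"
    using z by (intro sum_mono) (simp add: nat_le_eq_zle)
  also have "\<dots> = 8 * \<bar>?u z\<bar>" by (simp add: cardO)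
  finally have "?u z = 0" by simp
  then show ?thesis using z[of x] by simp
qed

section \<open>Partially known patterns\<close>

fun fits :: "cube \<Rightarrow> cube \<Rightarrow> bool" where
  "fits (Lf a) (Lf b) \<longleftrightarrow> a = KX \<or> a = b"
| "fits (Nd l r) (Nd l' r') \<longleftrightarrow> fits l l' \<and> fits r r'"
| "fits _ _ \<longleftrightarrow> False"

text \<open>
  Dead patterns are those that no face of a colouring refines. For a pattern without \<open>KX\<close> this says
  that it does not occur.
\<close>

definition dead :: "(cell \<Rightarrow> cell \<Rightarrow> int) \<Rightarrow> cube \<Rightarrow> bool" where
  "dead S p \<longleftrightarrow> (\<forall>f ds x. colouring S f \<longrightarrow> distinct ds \<longrightarrow> set ds \<subseteq> {..<13} \<longrightarrow>
     \<not> fits p (cube_at f ds x))"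

lemma fits_refl: "fits t t"
  by (induction t) auto

lemma fits_at:
  assumes "fits p t" and g: "\<And>a. g a \<le> g KX"
  shows "at0 g ss t \<le> at0 g ss p" "at1 g ss t \<le> at1 g ss p" "at2 g ss t \<le> at2 g ss p"
proof -
  have 0: "at0 g ss t \<le> at0 g ss p" if "fits p t" for ss p t
    using that
  proof (induction ss arbitrary: p t)
    case Nil then show ?case using g by (cases p; cases t) auto
  next
    case (Cons s ss) then show ?case by (cases p; cases t; cases s) auto
  qed
  have 1: "at1 g ss t \<le> at1 g ss p" if "fits p t" for ss p t
    using that
  proof (induction ss arbitrary: p t)
    case Nil then show ?case by (cases p; cases t) auto
  next
    case (Cons s ss) then show ?case by (cases p; cases t; cases s) (auto intro!: add_mono 0)
  qed
  have 2: "at2 g ss t \<le> at2 g ss p" if "fits p t" for ss p t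
    using that
  proof (induction ss arbitrary: p t)
    case Nil then show ?case by (cases p; cases t) auto
  next
    case (Cons s ss) then show ?case by (cases p; cases t; cases s) (auto intro!: add_mono 1)
  qed
  show "at0 g ss t \<le> at0 g ss p" "at1 g ss t \<le> at1 g ss p" "at2 g ss t \<le> at2 g ss p"
    using 0 1 2 assms(1) by auto
qed

fun alt_max :: "(cell \<Rightarrow> int) \<Rightarrow> cube \<Rightarrow> int" and alt_min :: "(cell \<Rightarrow> int) \<Rightarrow> cube \<Rightarrow> int" where
  "alt_max g (Lf a) = (case a of KX \<Rightarrow> max (g K0) (max (g K1) (g K2)) | _ \<Rightarrow> g a)"
| "alt_max g (Nd l r) = alt_max g l - alt_min g r"
| "alt_min g (Lf a) = (case a of KX \<Rightarrow> min (g K0) (min (g K1) (g K2)) | _ \<Rightarrow> g a)"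
| "alt_min g (Nd l r) = alt_min g l - alt_max g r"

fun total :: "cube \<Rightarrow> bool" where
  "total (Lf a) \<longleftrightarrow> a \<noteq> KX"
| "total (Nd l r) \<longleftrightarrow> total l \<and> total r"

lemma total_cube_at: "colouring S f \<Longrightarrow> total (cube_at f ds x)"
  by (induction ds arbitrary: x) (auto simp: colouring_def)

lemma fits_total: "total p \<Longrightarrow> fits p t \<Longrightarrow> p = t"
  by (induction p t rule: fits.induct) auto

lemma fits_alt: "fits p t \<Longrightarrow> total t \<Longrightarrow> alt_min g p \<le> alt g t \<and> alt g t \<le> alt_max g p"
proof (induction p t rule: fits.induct)
  case (1 a b)
  then show ?case by (cases a; cases b) auto
next
  case (2 l r l' r')
  then show ?case by fastforce
qed auto

text \<open>
  The pattern on the addressed smaller face, reflected so that the addressed vertex comes first.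
\<close>

fun face :: "step list \<Rightarrow> cube \<Rightarrow> cube" where
  "face (FL # ss) (Nd l r) = face ss l"
| "face (FR # ss) (Nd l r) = face ss r"
| "face (SL # ss) (Nd l r) = Nd (face ss l) (face ss r)"
| "face (SR # ss) (Nd l r) = Nd (face ss r) (face ss l)"
| "face _ t = t"

lemma fits_face: "fits p t \<Longrightarrow> fits (face ss p) (face ss t)"
proof (induction ss arbitrary: p t)
  case (Cons s ss) then show ?case by (cases p; cases t; cases s) auto
qed auto

lemma face_cube_at:
  assumes "distinct ds"
  shows "\<exists>ds' z. distinct ds' \<and> set ds' \<subseteq> set ds \<and> (\<forall>i x. z (flip i x) = flip i (z x)) \<and>
    (\<forall>x. face ss (cube_at f ds x) = cube_at f ds' (z x))"
  using assms
proof (induction ss arbitrary: ds)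
  case Nil
  then show ?case by (intro exI[of _ ds] exI[of _ id]) auto
next
  case (Cons s ss)
  show ?case
  proof (cases ds)
    case Nil
    then show ?thesis by (intro exI[of _ "[]"] exI[of _ id]) auto
  next
    case (Cons d es)
    then obtain es' z where z: "distinct es'" "set es' \<subseteq> set es" "\<And>i x. z (flip i x) = flip i (z x)"
        "\<And>x. face ss (cube_at f es x) = cube_at f es' (z x)"
      using Cons.IH[of es] Cons.prems by auto
    have d: "d \<notin> set es'" using Cons.prems z(2) Cons by auto
    show ?thesis
    proof (cases s)
      case SL then show ?thesis using z d Cons by (intro exI[of _ "d # es'"] exI[of _ z]) auto
    next
      case SR then show ?thesis using z d Cons
        by (intro exI[of _ "d # es'"] exI[of _ "\<lambda>x. flip d (z x)"]) (auto simp: flip_commute)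
    next
      case FL then show ?thesis using z Cons by (intro exI[of _ es'] exI[of _ z]) auto
    next
      case FR then show ?thesis using z Cons
        by (intro exI[of _ es'] exI[of _ "\<lambda>x. flip d (z x)"]) (auto simp: flip_commute)
    qed
  qed
qed

text \<open>
  Exchanges of two adjacent directions, at three depths; together with reflections they generate all
  symmetries of a face of dimension at most 4. They bring a smaller face into the form in which it was
  shown to be dead.
\<close>

datatype swap = S0 | S1 | S2

fun swap0 :: "cube \<Rightarrow> cube" where
  "swap0 (Nd (Nd a b) (Nd c d)) = Nd (Nd a c) (Nd b d)"
| "swap0 t = t"

fun below :: "(cube \<Rightarrow> cube) \<Rightarrow> cube \<Rightarrow> cube" where
  "below h (Nd l r) = Nd (h l) (h r)"
| "below h (Lf a) = Lf a"

fun swap_at :: "swap \<Rightarrow> cube \<Rightarrow> cube" where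
  "swap_at S0 t = swap0 t"
| "swap_at S1 t = below swap0 t"
| "swap_at S2 t = below (below swap0) t"

fun swaps :: "swap list \<Rightarrow> cube \<Rightarrow> cube" where
  "swaps [] t = t"
| "swaps (s # ss) t = swaps ss (swap_at s t)"

definition permutes_cube :: "(cube \<Rightarrow> cube) \<Rightarrow> bool" where
  "permutes_cube h \<longleftrightarrow> (\<forall>p t. fits p t \<longrightarrow> fits (h p) (h t)) \<and>
     (\<forall>f ds. \<exists>ds'. set ds' = set ds \<and> (distinct ds \<longrightarrow> distinct ds') \<and> (\<forall>x. h (cube_at f ds x) = cube_at f ds' x))"

lemma permutes_swap0: "permutes_cube swap0"
  unfolding permutes_cube_def
proof (intro conjI allI impI)
  fix p t assume "fits p t"
  then show "fits (swap0 p) (swap0 t)"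
  proof (induction p t rule: fits.induct)
    case (2 l r l' r')
    then show ?case by (cases l; cases r; cases l'; cases r') auto
  qed auto
next
  fix f ds
  show "\<exists>ds'. set ds' = set ds \<and> (distinct ds \<longrightarrow> distinct ds') \<and> (\<forall>x. swap0 (cube_at f ds x) = cube_at f ds' x)"
  proof (cases ds)
    case (Cons d es)
    show ?thesis
    proof (cases es)
      case Nil
      then show ?thesis using Cons by (intro exI[of _ ds]) auto
    next
      case (Cons e fs)
      then show ?thesis using \<open>ds = d # es\<close>
        by (intro exI[of _ "e # d # fs"]) (auto simp: flip_commute)
    qed
  qed (auto intro!: exI[of _ ds])
qed

lemma permutes_below:
  assumes "permutes_cube h"
  shows "permutes_cube (below h)"
  unfolding permutes_cube_def
proof (intro conjI allI impI)
  fix p t assume "fits p t"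
  then show "fits (below h p) (below h t)"
    using assms by (cases p; cases t) (auto simp: permutes_cube_def)
next
  fix f ds
  show "\<exists>ds'. set ds' = set ds \<and> (distinct ds \<longrightarrow> distinct ds') \<and> (\<forall>x. below h (cube_at f ds x) = cube_at f ds' x)"
  proof (cases ds)
    case (Cons d es)
    obtain es' where "set es' = set es" "distinct es \<longrightarrow> distinct es'" "\<And>x. h (cube_at f es x) = cube_at f es' x"
      using assms unfolding permutes_cube_def by blast
    then show ?thesis using Cons by (intro exI[of _ "d # es'"]) auto
  qed (auto intro!: exI[of _ ds])
qed

lemma permutes_swaps: "permutes_cube (swaps ss)"
proof (induction ss)
  case Nil
  show ?case by (auto simp: permutes_cube_def)
next
  case (Cons s ss)
  have "permutes_cube (swap_at s)"
    using permutes_swap0 permutes_below by (cases s) (auto simp: fun_eq_iff[symmetric] permutes_cube_def)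
  then show ?case using Cons unfolding permutes_cube_def by (simp, metis)
qed

section \<open>Certificates for dead patterns\<close>

text \<open>
  An entry \<open>E a u v w\<close> gives the weights \<open>u\<close>, \<open>v\<close>, \<open>w\<close> to the colours \<open>K0\<close>,
  \<open>K1\<close>, \<open>K2\<close> of the vertex with address \<open>a\<close>. An unknown colour counts with the largest of
  them, which makes the score an upper bound for all ways to fill in the pattern.
\<close>

datatype entry = E "step list" int int int

fun weight :: "int \<Rightarrow> int \<Rightarrow> int \<Rightarrow> cell \<Rightarrow> int" where
  "weight u v w K0 = u"
| "weight u v w K1 = v"
| "weight u v w K2 = w"
| "weight u v w KX = max u (max v w)"

fun score :: "entry list \<Rightarrow> cube \<Rightarrow> int" where
  "score [] t = 0"
| "score (E a u v w # es) t = at0 (weight u v w) a t + score es t"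

text \<open>
  What the scores of all parallel neighbours of a face add up to: the neighbours of each vertex
  outside the face are all its neighbours without those inside.
\<close>

fun demand :: "(cell \<Rightarrow> cell \<Rightarrow> int) \<Rightarrow> entry list \<Rightarrow> cube \<Rightarrow> int" where
  "demand S [] t = 0"
| "demand S (E a u v w # es) t =
     at0 (\<lambda>c. S c K0 * u + S c K1 * v + S c K2 * w) a t - at1 (weight u v w) a t + demand S es t"

fun crossing :: "step list \<Rightarrow> bool" where
  "crossing [] \<longleftrightarrow> True"
| "crossing (SL # ss) \<longleftrightarrow> crossing ss"
| "crossing (SR # ss) \<longleftrightarrow> crossing ss"
| "crossing _ \<longleftrightarrow> False"

lemma frees_crossing: "crossing ss \<Longrightarrow> length ss = length ds \<Longrightarrow> frees ss ds = ds"
  by (induction ss ds rule: frees.induct) auto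

fun put :: "cell \<Rightarrow> step list \<Rightarrow> cube \<Rightarrow> cube" where
  "put c [] (Lf a) = Lf c"
| "put c (SL # ss) (Nd l r) = Nd (put c ss l) r"
| "put c (SR # ss) (Nd l r) = Nd l (put c ss r)"
| "put c _ t = t"

lemma fits_put:
  assumes "fits p t" "total t"
  shows "\<exists>c. c \<noteq> KX \<and> fits (put c a p) t"
  using assms
proof (induction a arbitrary: p t)
  case Nil
  then show ?case by (cases p; cases t) auto
next
  case (Cons s a)
  then show ?case by (cases p; cases t; cases s) (fastforce+)
qed

text \<open>
  Here an unknown colour counts in favour of the inequality, so that a violation on a partially filled
  pattern persists however the pattern is completed.
\<close>

fun w1 :: "cell \<Rightarrow> cell \<Rightarrow> int" where
  "w1 c KX = 0"
| "w1 c a = (if a = c then - 1 else 0)"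

fun w2 :: "cell \<Rightarrow> cell \<Rightarrow> int" where
  "w2 c KX = 2"
| "w2 c a = (if a = c then 2 else 0)"

fun known :: "(cell \<Rightarrow> int) \<Rightarrow> cell \<Rightarrow> int" where
  "known g KX = max (g K0) (max (g K1) (g K2))"
| "known g K0 = g K0"
| "known g K1 = g K1"
| "known g K2 = g K2"

lemma known_le: "known g a \<le> known g KX"
  by (cases a) auto

lemma known_eq: "a \<noteq> KX \<Longrightarrow> known g a = g a"
  by (cases a) auto

lemma weight_le: "weight u v w a \<le> weight u v w KX"
  by (cases a) auto

definition centre :: "(cell \<Rightarrow> cell \<Rightarrow> int) \<Rightarrow> cell \<Rightarrow> int \<Rightarrow> cell \<Rightarrow> int" where
  "centre Q c m a = Q a c - (if a = c then m else 0)"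

definition ring :: "(cell \<Rightarrow> cell \<Rightarrow> int) \<Rightarrow> cell \<Rightarrow> cell \<Rightarrow> int" where
  "ring S c a = - 2 * S a c"

definition col :: "(cell \<Rightarrow> cell \<Rightarrow> int) \<Rightarrow> cell \<Rightarrow> cell \<Rightarrow> int" where
  "col S c a = S a c"

text \<open>
  The coefficient \<open>13 - 2 k\<close> of \<open>second_neighbours_bound\<close> for the \<open>k\<close> spanning directions
  of an address.
\<close>

fun margin :: "step list \<Rightarrow> int" where
  "margin [] = 13"
| "margin (SL # ss) = margin ss - 2"
| "margin (SR # ss) = margin ss - 2"
| "margin (s # ss) = margin ss"

lemma margin_frees: "length ss = length ds \<Longrightarrow> margin ss = 13 - 2 * int (length (frees ss ds))"
  by (induction ss ds rule: frees.induct) auto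

text \<open>
  Certificates that a given pattern \<open>p\<close> and a partially filled parallel neighbour \<open>q\<close> do not go
  together with a score of at least the average. \<open>B\<close> distinguishes the three colours of one vertex
  of \<open>q\<close>. The leaves \<open>V0\<close>, \<open>V1\<close>, \<open>V2\<close> name a vertex and a colour for which
  \<open>neighbours_bound\<close> fails, and \<open>U0\<close>, \<open>U1\<close>, \<open>U2\<close> do so for
  \<open>second_neighbours_bound\<close>. At \<open>Y\<close> the alternating sum over a 5-face cannot vanish, at \<open>Z\<close>
  the score is too small, and \<open>N\<close> points to a face, up to exchanges of directions, that is already
  known to be dead.
\<close>

datatype cert =
    B "step list" cert cert cert
  | V0 "step list" | V1 "step list" | V2 "step list"
  | U0 "step list" | U1 "step list" | U2 "step list"
  | Y
  | Z
  | N "step list" "swap list"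

definition crowded :: "(cell \<Rightarrow> cell \<Rightarrow> int) \<Rightarrow> cell \<Rightarrow> step list \<Rightarrow> cube \<Rightarrow> bool" where
  "crowded S c a p \<longleftrightarrow> at0 (known (col S c)) a p + at1 (w1 c) a p < 0"

definition crowded2 :: "(cell \<Rightarrow> cell \<Rightarrow> int) \<Rightarrow> (cell \<Rightarrow> cell \<Rightarrow> int) \<Rightarrow> cell \<Rightarrow> step list \<Rightarrow> cube \<Rightarrow> bool" where
  "crowded2 S Q c a p \<longleftrightarrow>
     at0 (known (centre Q c (margin a))) a p + at1 (known (ring S c)) a p + at2 (w2 c) a p < 0"

text \<open>
  The parameter \<open>five\<close> tells that \<open>p\<close> has dimension 4, so that \<open>p\<close> and \<open>q\<close> form a
  5-face; \<open>m\<close> is the number of parallel neighbours and \<open>v\<close> the sum of their scores.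
\<close>

fun chk :: "(cell \<Rightarrow> cell \<Rightarrow> int) \<Rightarrow> (cell \<Rightarrow> cell \<Rightarrow> int) \<Rightarrow> (cell \<Rightarrow> int) \<Rightarrow> bool \<Rightarrow>
    entry list \<Rightarrow> int \<Rightarrow> int \<Rightarrow> cube \<Rightarrow> cert \<Rightarrow> cube \<Rightarrow> bool" where
  "chk S Q g five es m v p (B a c0 c1 c2) q \<longleftrightarrow>
     chk S Q g five es m v p c0 (put K0 a q) \<and> chk S Q g five es m v p c1 (put K1 a q) \<and>
     chk S Q g five es m v p c2 (put K2 a q)"
| "chk S Q g five es m v p (V0 a) q \<longleftrightarrow> crowded S K0 a (Nd p q)"
| "chk S Q g five es m v p (V1 a) q \<longleftrightarrow> crowded S K1 a (Nd p q)"
| "chk S Q g five es m v p (V2 a) q \<longleftrightarrow> crowded S K2 a (Nd p q)"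
| "chk S Q g five es m v p (U0 a) q \<longleftrightarrow> crowded2 S Q K0 a (Nd p q)"
| "chk S Q g five es m v p (U1 a) q \<longleftrightarrow> crowded2 S Q K1 a (Nd p q)"
| "chk S Q g five es m v p (U2 a) q \<longleftrightarrow> crowded2 S Q K2 a (Nd p q)"
| "chk S Q g five es m v p Y q \<longleftrightarrow> five \<and> (alt_max g (Nd p q) < 0 \<or> 0 < alt_min g (Nd p q))"
| "chk S Q g five es m v p Z q \<longleftrightarrow> m * score es q < v"
| "chk S Q g five es m v p (N a ss) q \<longleftrightarrow> dead S (swaps ss (face a (Nd p q)))"

fun blank :: "cube \<Rightarrow> cube" where
  "blank (Lf a) = Lf KX"
| "blank (Nd l r) = Nd (blank l) (blank r)"

lemma fits_blank: "fits (blank (cube_at f ds x)) (cube_at f ds y)"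
  by (induction ds arbitrary: x y) auto

fun depth :: "cube \<Rightarrow> int" where
  "depth (Lf a) = 0"
| "depth (Nd l r) = depth l + 1"

lemma depth_cube_at: "depth (cube_at f ds x) = int (length ds)"
  by (induction ds arbitrary: x) auto

text \<open>
  The value of \<open>demand\<close> refers to all directions of the face, so the addresses of the weights must
  be complete and free of fixed directions.
\<close>

fun entries_ok :: "int \<Rightarrow> entry list \<Rightarrow> bool" where
  "entries_ok k [] \<longleftrightarrow> True"
| "entries_ok k (E a u v w # es) \<longleftrightarrow> crossing a \<and> int (length a) = k \<and> entries_ok k es"

lemma score_fits: "fits p t \<Longrightarrow> score es t \<le> score es p"
proof (induction es)
  case (Cons e es)
  then show ?case by (cases e) (auto intro!: add_mono fits_at weight_le)
qed simp

locale array =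
  fixes S Q :: "cell \<Rightarrow> cell \<Rightarrow> int" and g :: "cell \<Rightarrow> int"
  assumes square: "a \<noteq> KX \<Longrightarrow> c \<noteq> KX \<Longrightarrow> Q a c = S a K0 * S K0 c + S a K1 * S K1 c + S a K2 * S K2 c"
    and eigen: "a \<noteq> KX \<Longrightarrow> S a K0 * g K0 + S a K1 * g K1 + S a K2 * g K2 = 5 * g a"
begin

lemma no_violation1:
  assumes "colouring S f" "distinct ds" "set ds \<subseteq> {..<13}" "c \<noteq> KX" "fits p (cube_at f ds x)"
  shows "at0 (known (col S c)) a p + at1 (w1 c) a p \<ge> 0"
proof -
  let ?t = "cube_at f ds x" let ?y = "goto a ds x"
  have "0 \<le> at0 (known (col S c)) a ?t + at1 (w1 c) a ?t"
  proof (cases "length a = length ds")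
    case True
    have nx: "f z \<noteq> KX" for z using assms(1) by (simp add: colouring_def)
    have w: "w1 c (f z) = - delta c (f z)" for z
      using nx[of z] by (cases "f z") (auto simp: delta_def)
    have "set (frees a ds) \<subseteq> {..<13}" using set_frees assms(3) by blast
    from neighbours_bound[OF assms(1,4) distinct_frees[OF assms(2)] this, where y = ?y]
    have "0 \<le> S (f ?y) c - (\<Sum>i\<leftarrow>frees a ds. delta c (f (flip i ?y)))" .
    moreover have "(\<Sum>i\<leftarrow>frees a ds. - delta c (f (flip i ?y))) = - (\<Sum>i\<leftarrow>frees a ds. delta c (f (flip i ?y)))"
      by (rule sum_list_uminus)
    ultimately show ?thesis
      using True by (simp add: at0_cube_at at1_cube_at known_eq[OF nx] col_def w)
  qed (simp add: at_length)
  also have "\<dots> \<le> at0 (known (col S c)) a p + at1 (w1 c) a p"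
  proof -
    have "w1 c b \<le> w1 c KX" for b by (cases b) auto
    then show ?thesis using assms(5) by (intro add_mono fits_at known_le)
  qed
  finally show ?thesis .
qed

lemma no_violation2:
  assumes "colouring S f" "distinct ds" "set ds \<subseteq> {..<13}" "c \<noteq> KX" "fits p (cube_at f ds x)"
  shows "at0 (known (centre Q c (margin a))) a p + at1 (known (ring S c)) a p + at2 (w2 c) a p \<ge> 0"
proof -
  let ?t = "cube_at f ds x" let ?y = "goto a ds x"
  have "0 \<le> at0 (known (centre Q c (margin a))) a ?t + at1 (known (ring S c)) a ?t + at2 (w2 c) a ?t"
  proof (cases "length a = length ds")
    case True
    have nx: "f z \<noteq> KX" for z using assms(1) by (simp add: colouring_def)
    have w: "w2 c (f z) = 2 * delta c (f z)" for z
      using nx[of z] by (cases "f z") (auto simp: delta_def)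
    have "set (frees a ds) \<subseteq> {..<13}" using set_frees assms(3) by blast
    from second_neighbours_bound[OF assms(1,4) distinct_frees[OF assms(2)] this, where y = ?y]
    have "0 \<le> Q (f ?y) c - margin a * delta c (f ?y) - 2 * (\<Sum>i\<leftarrow>frees a ds. S (f (flip i ?y)) c)
      + 2 * pair_sum (\<lambda>i j. delta c (f (flip i (flip j ?y)))) (frees a ds)"
      using square[OF nx assms(4)] margin_frees[OF True] by simp
    moreover have "(\<Sum>i\<leftarrow>frees a ds. - 2 * S (f (flip i ?y)) c) = - 2 * (\<Sum>i\<leftarrow>frees a ds. S (f (flip i ?y)) c)"
      by (rule sum_list_const_mult)
    moreover have "pair_sum (\<lambda>i j. 2 * h i j) l = 2 * pair_sum h l" for h l
      by (induction l) (auto simp: sum_list_const_mult)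
    moreover have "centre Q c (margin a) (f ?y) = Q (f ?y) c - margin a * delta c (f ?y)"
      by (simp add: centre_def delta_def)
    ultimately show ?thesis
      using True by (simp add: at0_cube_at at1_cube_at at2_cube_at known_eq[OF nx] ring_def w)
  qed (simp add: at_length)
  also have "\<dots> \<le> at0 (known (centre Q c (margin a))) a p + at1 (known (ring S c)) a p + at2 (w2 c) a p"
  proof -
    have "w2 c b \<le> w2 c KX" for b by (cases b) auto
    then show ?thesis using assms(5) by (intro add_mono fits_at known_le)
  qed
  finally show ?thesis .
qed

lemma chk_sound:
  assumes f: "colouring S f" and ds: "distinct ds" "set ds \<subseteq> {..<13}" "d < 13" "d \<notin> set ds"
    and five: "five \<Longrightarrow> length ds = 4"
    and v: "v \<le> m * score es (cube_at f ds (flip d x))" and m: "0 \<le> m"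
    and "chk S Q g five es m v (cube_at f ds x) ce q" "fits q (cube_at f ds (flip d x))"
  shows False
proof -
  let ?t = "cube_at f (d # ds) x"
  have D: "distinct (d # ds)" "set (d # ds) \<subseteq> {..<13}" using ds by auto
  show False using assms(9,10)
  proof (induction ce arbitrary: q)
    case (B a c0 c1 c2)
    obtain c where "c \<noteq> KX" "fits (put c a q) (cube_at f ds (flip d x))"
      using fits_put[OF B.prems(2) total_cube_at[OF f]] by blast
    then show ?case using B by (cases c) auto
  next
    case (V0 a)
    then show ?case
      using no_violation1[OF f D, of K0 "Nd (cube_at f ds x) q" x a] by (auto simp: fits_refl crowded_def)
  next
    case (V1 a)
    then show ?case
      using no_violation1[OF f D, of K1 "Nd (cube_at f ds x) q" x a] by (auto simp: fits_refl crowded_def)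
  next
    case (V2 a)
    then show ?case
      using no_violation1[OF f D, of K2 "Nd (cube_at f ds x) q" x a] by (auto simp: fits_refl crowded_def)
  next
    case (U0 a)
    then show ?case
      using no_violation2[OF f D, of K0 "Nd (cube_at f ds x) q" x a] by (auto simp: fits_refl crowded2_def)
  next
    case (U1 a)
    then show ?case
      using no_violation2[OF f D, of K1 "Nd (cube_at f ds x) q" x a] by (auto simp: fits_refl crowded2_def)
  next
    case (U2 a)
    then show ?case
      using no_violation2[OF f D, of K2 "Nd (cube_at f ds x) q" x a] by (auto simp: fits_refl crowded2_def)
  next
    case Y
    have "alt g ?t = 0"
      using Y five by (intro alt_five[OF f eigen] D) auto
    then show ?case
      using Y fits_alt[of "Nd (cube_at f ds x) q" ?t, where g = g] total_cube_at[OF f, of "d # ds" x]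
      by (auto simp: fits_refl)
  next
    case Z
    have "m * score es (cube_at f ds (flip d x)) \<le> m * score es q"
      using Z m by (intro mult_left_mono score_fits)
    then show ?case using Z v by simp
  next
    case (N a ss)
    obtain ds1 z where 1: "distinct ds1" "set ds1 \<subseteq> set (d # ds)"
        "face a ?t = cube_at f ds1 (z x)"
      using face_cube_at[OF D(1), of a f] by blast
    obtain ds2 where 2: "set ds2 = set ds1" "distinct ds2" "swaps ss (face a ?t) = cube_at f ds2 (z x)"
      using permutes_swaps[of ss] 1(1,3) unfolding permutes_cube_def by metis
    have "distinct ds2" "set ds2 \<subseteq> {..<13}"
      using 1(2) 2(1,2) D(2) by auto
    moreover have "fits (swaps ss (face a (Nd (cube_at f ds x) q))) (cube_at f ds2 (z x))"
    proof -
      have "fits (Nd (cube_at f ds x) q) ?t" using N by (simp add: fits_refl)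
      then show ?thesis
        using permutes_swaps[of ss] 2(3) fits_face unfolding permutes_cube_def by metis
    qed
    moreover have "dead S (swaps ss (face a (Nd (cube_at f ds x) q)))" using N(1) by simp
    ultimately show ?case using f unfolding dead_def by blast
  qed
qed

lemma demand_eq:
  assumes f: "colouring S f" and ds: "distinct ds" "set ds \<subseteq> {..<13}"
    and "entries_ok (int (length ds)) es"
  shows "(\<Sum>d\<in>{..<13} - set ds. score es (cube_at f ds (flip d x))) = demand S es (cube_at f ds x)"
  using assms(4)
proof (induction es)
  case (Cons e es)
  obtain a u v w where e: "e = E a u v w" by (cases e)
  let ?g = "weight u v w" let ?y = "goto a ds x"
  have a: "length a = length ds" "frees a ds = ds" using Cons.prems e frees_crossing by auto
  have un: "{..<13} = ({..<13} - set ds) \<union> set ds" using ds by auto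
  have "(\<Sum>i<13. ?g (f (flip i ?y)))
      = (\<Sum>d\<in>{..<13} - set ds. ?g (f (flip d ?y))) + (\<Sum>d\<in>set ds. ?g (f (flip d ?y)))"
    by (subst un) (intro sum.union_disjoint; auto)
  then have "(\<Sum>d\<in>{..<13} - set ds. ?g (f (flip d ?y)))
      = S (f ?y) K0 * u + S (f ?y) K1 * v + S (f ?y) K2 * w - (\<Sum>d\<leftarrow>ds. ?g (f (flip d ?y)))"
    using colouring_sum[OF f, of ?g ?y] ds by (simp add: sum_list_distinct)
  then show ?case
    using Cons a e by (simp add: sum.distrib at0_cube_at at1_cube_at goto_flip)
qed simp

text \<open>
  Some parallel neighbour has a score of at least the average, which is \<open>demand\<close> divided by the
  number \<open>13 - depth p\<close> of neighbours. The certificate, which begins with a neighbour of unknown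
  colours, refutes that neighbour.
\<close>

lemma dead_by_certificate:
  assumes "total p" "0 < 13 - depth p" "entries_ok (depth p) es"
    and "chk S Q g (depth p = 4) es (13 - depth p) (demand S es p) p ce (blank p)"
  shows "dead S p"
  unfolding dead_def
proof (intro allI impI notI)
  fix f ds x
  assume f: "colouring S f" and ds: "distinct ds" "set ds \<subseteq> {..<13::nat}"
    and "fits p (cube_at f ds x)"
  then have p: "p = cube_at f ds x" using fits_total assms(1) by blast
  let ?m = "13 - int (length ds)" let ?v = "demand S es p"
  have card: "int (card ({..<13} - set ds)) = ?m"
    using ds card_mono[of "{..<13}" "set ds"]
    by (simp add: card_Diff_subset distinct_card of_nat_diff)
  have "\<exists>d\<in>{..<13} - set ds. ?v \<le> ?m * score es (cube_at f ds (flip d x))"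
  proof (rule ccontr)
    assume "\<not> ?thesis"
    moreover have "{..<13} - set ds \<noteq> {}"
      using card assms(2) p by (intro notI) (simp add: depth_cube_at)
    ultimately have "(\<Sum>d\<in>{..<13} - set ds. ?m * score es (cube_at f ds (flip d x))) < (\<Sum>d\<in>{..<13} - set ds. ?v)"
      by (intro sum_strict_mono) (auto simp: not_le)
    also have "\<dots> = ?m * ?v" using card by simp
    also have "(\<Sum>d\<in>{..<13} - set ds. ?m * score es (cube_at f ds (flip d x))) = ?m * ?v"
      using demand_eq[OF f ds, of es x] assms(3) p by (simp add: depth_cube_at flip: sum_distrib_left)
    finally show False by simp
  qed
  then obtain d where d: "d < 13" "d \<notin> set ds" "?v \<le> ?m * score es (cube_at f ds (flip d x))"
    by auto
  show False
    using chk_sound[OF f ds d(1,2) _ d(3), of "depth p = 4" ce "blank p"] assms(2,4) p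
    by (simp add: depth_cube_at fits_blank)
qed

end

section \<open>The two quotient matrices\<close>

text \<open>
  Fixing one more direction of an address, at a given depth, lets the local laws speak about a facet
  of the face.
\<close>

fun hold :: "step \<Rightarrow> step" where
  "hold SL = FL" | "hold SR = FR" | "hold s = s"

fun hold0 :: "step list \<Rightarrow> step list" where "hold0 (s # ss) = hold s # ss" | "hold0 [] = []"
fun hold1 :: "step list \<Rightarrow> step list" where "hold1 (s # ss) = s # hold0 ss" | "hold1 [] = []"
fun hold2 :: "step list \<Rightarrow> step list" where "hold2 (s # ss) = s # hold1 ss" | "hold2 [] = []"
fun hold3 :: "step list \<Rightarrow> step list" where "hold3 (s # ss) = s # hold2 ss" | "hold3 [] = []"
fun hold4 :: "step list \<Rightarrow> step list" where "hold4 (s # ss) = s # hold3 ss" | "hold4 [] = []"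

lemmas [simp] = crowded_def crowded2_def centre_def ring_def col_def

text \<open>
  The matrix, its square and an eigenvector for the eigenvalue 5; likewise for the second part.
\<close>

fun s1 :: "cell \<Rightarrow> cell \<Rightarrow> int" where
  "s1 K0 K0 = 2" | "s1 K0 K1 = 11" | "s1 K0 K2 = 0" | "s1 K1 K0 = 3" | "s1 K1 K1 = 6" | "s1 K1 K2 = 4" | "s1 K2 K0 = 0" | "s1 K2 K1 = 6" | "s1 K2 K2 = 7" | "s1 _ _ = 0"

fun q1 :: "cell \<Rightarrow> cell \<Rightarrow> int" where
  "q1 K0 K0 = 37" | "q1 K0 K1 = 88" | "q1 K0 K2 = 44" | "q1 K1 K0 = 24" | "q1 K1 K1 = 93" | "q1 K1 K2 = 52" | "q1 K2 K0 = 18" | "q1 K2 K1 = 78" | "q1 K2 K2 = 73" | "q1 _ _ = 0"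

fun ev1 :: "cell \<Rightarrow> int" where
  "ev1 K0 = 11" | "ev1 K1 = 3" | "ev1 K2 = - 9" | "ev1 KX = 0"

interpretation case1: array s1 q1 ev1
proof
  show "q1 a c = s1 a K0 * s1 K0 c + s1 a K1 * s1 K1 c + s1 a K2 * s1 K2 c"
    if "a \<noteq> KX" "c \<noteq> KX" for a c
    using that by (cases a; cases c) auto
  show "s1 a K0 * ev1 K0 + s1 a K1 * ev1 K1 + s1 a K2 * ev1 K2 = 5 * ev1 a" if "a \<noteq> KX" for a
    using that by (cases a) auto
qed

fun s2 :: "cell \<Rightarrow> cell \<Rightarrow> int" where
  "s2 K0 K0 = 3" | "s2 K0 K1 = 10" | "s2 K0 K2 = 0" | "s2 K1 K0 = 4" | "s2 K1 K1 = 6" | "s2 K1 K2 = 3" | "s2 K2 K0 = 0" | "s2 K2 K1 = 7" | "s2 K2 K2 = 6" | "s2 _ _ = 0"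

fun q2 :: "cell \<Rightarrow> cell \<Rightarrow> int" where
  "q2 K0 K0 = 49" | "q2 K0 K1 = 90" | "q2 K0 K2 = 30" | "q2 K1 K0 = 36" | "q2 K1 K1 = 97" | "q2 K1 K2 = 36" | "q2 K2 K0 = 28" | "q2 K2 K1 = 84" | "q2 K2 K2 = 57" | "q2 _ _ = 0"

fun ev2 :: "cell \<Rightarrow> int" where
  "ev2 K0 = 5" | "ev2 K1 = 1" | "ev2 K2 = - 7" | "ev2 KX = 0"

interpretation case2: array s2 q2 ev2
proof
  show "q2 a c = s2 a K0 * s2 K0 c + s2 a K1 * s2 K1 c + s2 a K2 * s2 K2 c"
    if "a \<noteq> KX" "c \<noteq> KX" for a c
    using that by (cases a; cases c) auto
  show "s2 a K0 * ev2 K0 + s2 a K1 * ev2 K1 + s2 a K2 * ev2 K2 = 5 * ev2 a" if "a \<noteq> KX" for a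
    using that by (cases a) auto
qed

section \<open>From codes to colourings\<close>

definition point :: "nat \<Rightarrow> (nat \<Rightarrow> bool) \<Rightarrow> bool list" where
  "point n x = map x [0..<n]"

lemma point_flip: "i < n \<Longrightarrow> point n (flip i x) = (point n x)[i := \<not> point n x ! i]"
  by (rule nth_equalityI) (auto simp: point_def flip_def nth_list_update)

lemma point_flip_beyond: "n \<le> i \<Longrightarrow> point n (flip i x) = point n x"
  by (auto simp: point_def flip_def)

lemma point_onto: "length v = n \<Longrightarrow> point n (\<lambda>i. v ! i) = v"
  using map_nth[of v] by (auto simp: point_def)

lemma hypercube_arcs:
  "(v, w) \<in> arcs (with_proj (hypercube n)) \<longleftrightarrow> length v = n \<and> (\<exists>i<n. w = v[i := \<not> v ! i])"
proof
  assume "(v, w) \<in> arcs (with_proj (hypercube n))"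
  then have len: "length v = n" "length w = n" and "card {i. i < n \<and> v ! i \<noteq> w ! i} = 1"
    by (auto simp: hypercube_def)
  then obtain i where i: "{i. i < n \<and> v ! i \<noteq> w ! i} = {i}" by (auto simp: card_1_singleton_iff)
  have differ: "v ! j \<noteq> w ! j \<longleftrightarrow> j = i" if "j < n" for j using i that by blast
  have "w = v[i := \<not> v ! i]"
  proof (rule nth_equalityI)
    fix j assume "j < length w"
    then show "w ! j = v[i := \<not> v ! i] ! j"
      using differ[of j] len by (cases "j = i") auto
  qed (simp add: len)
  moreover have "i < n" using i by blast
  ultimately show "length v = n \<and> (\<exists>i<n. w = v[i := \<not> v ! i])" using len by blast
next
  assume "length v = n \<and> (\<exists>i<n. w = v[i := \<not> v ! i])"
  then obtain i where i: "length v = n" "i < n" "w = v[i := \<not> v ! i]" by auto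
  then have "v ! j \<noteq> w ! j \<longleftrightarrow> j = i" if "j < n" for j
    using that by (cases "j = i") auto
  then have "{j. j < n \<and> v ! j \<noteq> w ! j} = {i}" using i(2) by blast
  then show "(v, w) \<in> arcs (with_proj (hypercube n))" using i by (simp add: hypercube_def)
qed

lemma hypercube_dominates:
  "v \<rightarrow>\<^bsub>with_proj (hypercube n)\<^esub> w \<longleftrightarrow> (v, w) \<in> arcs (with_proj (hypercube n))"
  by (auto simp: arcs_ends_def arc_to_ends_def)

lemma card_neighbours:
  assumes "length v = n"
  shows "card {w \<in> A. v \<rightarrow>\<^bsub>with_proj (hypercube n)\<^esub> w} = card {i. i < n \<and> v[i := \<not> v ! i] \<in> A}"
proof -
  have "{w \<in> A. v \<rightarrow>\<^bsub>with_proj (hypercube n)\<^esub> w}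
      = (\<lambda>i. v[i := \<not> v ! i]) ` {i. i < n \<and> v[i := \<not> v ! i] \<in> A}"
    unfolding hypercube_dominates hypercube_arcs using assms by blast
  moreover have "inj_on (\<lambda>i. v[i := \<not> v ! i]) {i. i < n \<and> v[i := \<not> v ! i] \<in> A}"
  proof (rule inj_onI)
    fix i j assume "i \<in> {i. i < n \<and> v[i := \<not> v ! i] \<in> A}" "v[i := \<not> v ! i] = v[j := \<not> v ! j]"
    then show "i = j"
      using assms nth_list_update_eq[of i v "\<not> v ! i"] nth_list_update_neq[of j i v "\<not> v ! j"]
      by (cases "i = j") auto
  qed
  ultimately show ?thesis by (simp add: card_image)
qed

text \<open>
  The colour of a point is the layer of its first \<open>n\<close> coordinates. The zeros in the corners of
  \<open>S\<close> hold because adjacent vertices are in equal or consecutive layers, and the diagonal entries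
  because each row of the quotient matrix has the sum \<open>n\<close>; the \<open>13 - n\<close> ignored coordinates give
  that many more neighbours of the same colour.
\<close>

lemma colouring_of_code:
  fixes C :: "bool list set" and b0 b1 c1 c2 n :: nat
  defines "G \<equiv> with_proj (hypercube n)"
  assumes n: "n \<le> 13" and IA: "has_intersection_array G C [b0, b1] [c1, c2]"
    and s: "\<And>a. s K0 a = (case a of K0 \<Rightarrow> 13 - int b0 | K1 \<Rightarrow> int b0 | _ \<Rightarrow> 0)"
      "\<And>a. s K1 a = (case a of K0 \<Rightarrow> int c1 | K1 \<Rightarrow> 13 - int b1 - int c1 | K2 \<Rightarrow> int b1 | _ \<Rightarrow> 0)"
      "\<And>a. s K2 a = (case a of K1 \<Rightarrow> int c2 | K2 \<Rightarrow> 13 - int c2 | _ \<Rightarrow> 0)"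
  shows "\<exists>f x. colouring s f \<and> f x = K1"
proof -
  let ?P = "dist_layer G C"
  interpret pair_graph "hypercube n" by (rule pair_graph_hypercube)
  have wf: "wf_digraph G" unfolding G_def by unfold_locales
  obtain M where M: "equitable_partition G (covering_radius G C + 1) ?P M"
      and bs: "[b0, b1] = map (\<lambda>i. M $$ (i, i + 1)) [0..<covering_radius G C]"
      and cs: "[c1, c2] = map (\<lambda>i. M $$ (i + 1, i)) [0..<covering_radius G C]"
    using IA unfolding has_intersection_array_def has_quotient_matrix_def by (elim exE conjE)
  have "covering_radius G C = 2" using arg_cong[OF bs, of length] by simp
  moreover have "[0..<2] = [0, 1::nat]" by (simp add: upt_rec)
  ultimately have M3: "equitable_partition G 3 ?P M"
    and entries: "M $$ (0, 1) = b0" "M $$ (1, 2) = b1" "M $$ (1, 0) = c1" "M $$ (2, 1) = c2"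
    using M bs cs by (auto simp: numeral_2_eq_2 numeral_3_eq_3)
  have ne: "?P i \<noteq> {}" if "i < 3" for i using M3 that by (simp add: equitable_partition_def)
  have dj: "?P i \<inter> ?P j = {}" if "i < 3" "j < 3" "i \<noteq> j" for i j
    using M3 that by (auto simp: equitable_partition_def disjoint_family_on_def)
  have d01: "?P 0 \<inter> ?P 1 = {}" and d02: "?P 0 \<inter> ?P 2 = {}" and d12: "?P 1 \<inter> ?P 2 = {}"
    by (rule dj; simp)+
  have un: "?P 0 \<union> ?P 1 \<union> ?P 2 = {v. length v = n}"
  proof -
    have "(\<Union>i<3. ?P i) = verts G" using M3 by (simp add: equitable_partition_def)
    moreover have "{..<3::nat} = {0, 1, 2}" by auto
    ultimately show ?thesis by (auto simp: G_def hypercube_def)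
  qed
  have count: "card {i. i < n \<and> v[i := \<not> v ! i] \<in> ?P j} = M $$ (k, j)"
    if "v \<in> ?P k" "k < 3" "j < 3" for v j k
  proof -
    have "length v = n" using that un by (auto simp: numeral_3_eq_3 less_Suc_eq numeral_2_eq_2)
    then show ?thesis
      using card_neighbours[of v n "?P j"] M3 that by (simp add: equitable_partition_def G_def)
  qed
  have layer: "v \<in> ?P i \<longleftrightarrow> v \<in> verts G \<and> (\<exists>u\<in>C. \<exists>p. pre_digraph.awalk G u p v \<and> length p = i) \<and>
      (\<forall>u\<in>C. \<forall>p. pre_digraph.awalk G u p v \<longrightarrow> i \<le> length p)" for v i
    unfolding dist_layer_altdef[OF wf] by simp
  have no_arc: False if "v \<in> ?P 0" "w \<in> ?P 2" "(v, w) \<in> arcs G" for v w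
  proof -
    have "\<exists>u\<in>C. \<exists>p. pre_digraph.awalk G u p v \<and> length p = 0"
      using that(1) unfolding layer[of v 0] by blast
    then have "v \<in> C" by (auto simp: pre_digraph.awalk_def pre_digraph.cas.simps)
    moreover have "pre_digraph.awalk G v [(v, w)] w"
      using wf_digraph.arc_implies_awalk[OF wf that(3)] by (simp add: G_def)
    ultimately show False using that(2) unfolding layer[of w 2] by fastforce
  qed
  have sym: "(w, v) \<in> arcs G" if "(v, w) \<in> arcs G" for v w
  proof -
    have *: "{i. i < n \<and> w ! i \<noteq> v ! i} = {i. i < n \<and> v ! i \<noteq> w ! i}" for v w :: "bool list" by blast
    show ?thesis using that *[of w v] by (auto simp: G_def hypercube_def)
  qed
  have zero: "M $$ (0, 2) = 0" "M $$ (2, 0) = 0"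
  proof -
    have len: "length v = n" if "v \<in> ?P 0 \<union> ?P 2" for v using that un by blast
    have arc: "(v, v[i := \<not> v ! i]) \<in> arcs G" if "length v = n" "i < n" for v i
      unfolding G_def hypercube_arcs using that by blast
    obtain v where v: "v \<in> ?P 0" using ne[of 0] by auto
    have none: "{i. i < n \<and> v[i := \<not> v ! i] \<in> ?P 2} = {}"
      using no_arc[OF v] arc[of v] len v by blast
    have "card {i. i < n \<and> v[i := \<not> v ! i] \<in> ?P 2} = M $$ (0, 2)"
      by (rule count[OF v]) simp_all
    then show "M $$ (0, 2) = 0" unfolding none by simp
    obtain w where w: "w \<in> ?P 2" using ne[of 2] by auto
    have none: "{i. i < n \<and> w[i := \<not> w ! i] \<in> ?P 0} = {}"
      using no_arc[OF _ w] sym[OF arc[of w]] len w by blast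
    have "card {i. i < n \<and> w[i := \<not> w ! i] \<in> ?P 0} = M $$ (2, 0)"
      by (rule count[OF w]) simp_all
    then show "M $$ (2, 0) = 0" unfolding none by simp
  qed
  have row: "M $$ (k, 0) + M $$ (k, 1) + M $$ (k, 2) = n" if "k < 3" for k
  proof -
    have "?P k \<noteq> {}" by (rule ne[OF that])
    then obtain v where v: "v \<in> ?P k" by blast
    have len: "length v = n" using that v un by (auto simp: numeral_3_eq_3 less_Suc_eq numeral_2_eq_2)
    let ?A = "\<lambda>j. {i. i < n \<and> v[i := \<not> v ! i] \<in> ?P j}"
    have "{..<n} = ?A 0 \<union> ?A 1 \<union> ?A 2"
    proof (rule Set.set_eqI)
      fix i
      have "v[i := \<not> v ! i] \<in> ?P 0 \<union> ?P 1 \<union> ?P 2" unfolding un using len by simp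
      then show "i \<in> {..<n} \<longleftrightarrow> i \<in> ?A 0 \<union> ?A 1 \<union> ?A 2" by blast
    qed
    then have "n = card (?A 0 \<union> ?A 1 \<union> ?A 2)" by (metis card_lessThan)
    also have "\<dots> = card (?A 0 \<union> ?A 1) + card (?A 2)"
      using d02 d12 by (intro card_Un_disjoint) (simp, simp, blast)
    also have "card (?A 0 \<union> ?A 1) = card (?A 0) + card (?A 1)"
      using d01 by (intro card_Un_disjoint) (simp, simp, blast)
    also have "card (?A 0) = M $$ (k, 0)" by (rule count[OF v that]) simp
    also have "card (?A 1) = M $$ (k, 1)" by (rule count[OF v that]) simp
    also have "card (?A 2) = M $$ (k, 2)" by (rule count[OF v that]) simp
    finally show ?thesis by (rule HOL.sym)
  qed
  define f where "f x = (if point n x \<in> ?P 0 then K0 else if point n x \<in> ?P 1 then K1 else K2)" for x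
  have len: "length (point n x) = n" for x by (simp add: point_def)
  have in_layer: "f x = K0 \<longleftrightarrow> point n x \<in> ?P 0" "f x = K1 \<longleftrightarrow> point n x \<in> ?P 1"
      "f x = K2 \<longleftrightarrow> point n x \<in> ?P 2" "f x \<noteq> KX" for x
  proof -
    have "point n x \<in> ?P 0 \<union> ?P 1 \<union> ?P 2" unfolding un using len by simp
    then consider "point n x \<in> ?P 0" "point n x \<notin> ?P 1" "point n x \<notin> ?P 2"
      | "point n x \<notin> ?P 0" "point n x \<in> ?P 1" "point n x \<notin> ?P 2"
      | "point n x \<notin> ?P 0" "point n x \<notin> ?P 1" "point n x \<in> ?P 2"
      using d01 d02 d12 by blast
    then have "(f x = K0 \<longleftrightarrow> point n x \<in> ?P 0) \<and> (f x = K1 \<longleftrightarrow> point n x \<in> ?P 1) \<and>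
        (f x = K2 \<longleftrightarrow> point n x \<in> ?P 2) \<and> f x \<noteq> KX"
      by cases (simp_all add: f_def)
    then show "f x = K0 \<longleftrightarrow> point n x \<in> ?P 0" "f x = K1 \<longleftrightarrow> point n x \<in> ?P 1"
        "f x = K2 \<longleftrightarrow> point n x \<in> ?P 2" "f x \<noteq> KX"
      by blast+
  qed
  have total: "int (card {i. i < 13 \<and> f (flip i x) = c}) = int (M $$ (k, j)) + (if k = j then 13 - int n else 0)"
    if "point n x \<in> ?P k" "k < 3" "j < 3" "\<And>y. f y = c \<longleftrightarrow> point n y \<in> ?P j" for x c k j
  proof -
    let ?v = "point n x"
    have "{i. i < 13 \<and> f (flip i x) = c}
        = {i. i < n \<and> ?v[i := \<not> ?v ! i] \<in> ?P j} \<union> {i. n \<le> i \<and> i < 13 \<and> ?v \<in> ?P j}"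
      (is "?L = ?A \<union> ?B")
    proof (rule Set.set_eqI)
      fix i
      show "i \<in> ?L \<longleftrightarrow> i \<in> ?A \<union> ?B"
        using n that(4)[of "flip i x"] point_flip[of i n x] point_flip_beyond[of n i x]
        by (cases "i < n") simp_all
    qed
    moreover have "card ({i. i < n \<and> ?v[i := \<not> ?v ! i] \<in> ?P j} \<union> {i. n \<le> i \<and> i < 13 \<and> ?v \<in> ?P j})
        = card {i. i < n \<and> ?v[i := \<not> ?v ! i] \<in> ?P j} + card {i. n \<le> i \<and> i < 13 \<and> ?v \<in> ?P j}"
      by (rule card_Un_disjoint) auto
    moreover have "card {i. i < n \<and> ?v[i := \<not> ?v ! i] \<in> ?P j} = M $$ (k, j)"
      by (rule count[OF that(1-3)])
    moreover have "card {i. n \<le> i \<and> i < 13 \<and> ?v \<in> ?P j} = (if k = j then 13 - n else 0)"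
    proof (cases "k = j")
      case True
      then have "{i. n \<le> i \<and> i < 13 \<and> ?v \<in> ?P j} = {n..<13}" using that(1) by auto
      then show ?thesis using True by simp
    next
      case False
      then have "?v \<notin> ?P j" using dj[OF that(2,3)] that(1) by blast
      then show ?thesis using False by simp
    qed
    ultimately have "card {i. i < 13 \<and> f (flip i x) = c} = M $$ (k, j) + (if k = j then 13 - n else 0)"
      by (simp only:)
    then show ?thesis using n by (simp add: of_nat_diff)
  qed
  have "colouring s f"
    unfolding colouring_def
  proof (intro conjI allI impI)
    show "f x \<noteq> KX" for x by (rule in_layer)
    fix x c assume "(c :: cell) \<noteq> KX"
    have t: "int (card {i. i < 13 \<and> f (flip i x) = K0}) = int (M $$ (k, 0)) + (if k = 0 then 13 - int n else 0)"
        "int (card {i. i < 13 \<and> f (flip i x) = K1}) = int (M $$ (k, 1)) + (if k = 1 then 13 - int n else 0)"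
        "int (card {i. i < 13 \<and> f (flip i x) = K2}) = int (M $$ (k, 2)) + (if k = 2 then 13 - int n else 0)"
      if "point n x \<in> ?P k" "k < 3" for k
      using total[OF that _ in_layer(1)] total[OF that _ in_layer(2)] total[OF that _ in_layer(3)] by simp_all
    have r: "int (M $$ (k, 0)) + int (M $$ (k, 1)) + int (M $$ (k, 2)) = int n" if "k < 3" for k
      using row[OF that] by simp
    consider "f x = K0" | "f x = K1" | "f x = K2" using in_layer(4)[of x] by (cases "f x") auto
    then show "int (card {i. i < 13 \<and> f (flip i x) = c}) = s (f x) c"
    proof cases
      case 1
      then have "point n x \<in> ?P 0" using in_layer(1)[of x] by simp
      from t[OF this] show ?thesis
        using 1 r[of 0] \<open>c \<noteq> KX\<close> entries zero by (cases c) (simp_all add: s)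
    next
      case 2
      then have "point n x \<in> ?P 1" using in_layer(2)[of x] by simp
      from t[OF this] show ?thesis
        using 2 r[of 1] \<open>c \<noteq> KX\<close> entries zero by (cases c) (simp_all add: s)
    next
      case 3
      then have "point n x \<in> ?P 2" using in_layer(3)[of x] by simp
      from t[OF this] show ?thesis
        using 3 r[of 2] \<open>c \<noteq> KX\<close> entries zero by (cases c) (simp_all add: s)
    qed
  qed
  moreover have "\<exists>x. f x = K1"
  proof -
    obtain v where v: "v \<in> ?P 1" using ne[of 1] by auto
    then have "point n (\<lambda>i. v ! i) = v" using un by (intro point_onto) blast
    then show ?thesis using v in_layer(2) by metis
  qed
  ultimately show ?thesis by blast
qed

lemma no_colouring_if_edge_dead:
  assumes "colouring S f" "f x = K1" "0 < S K1 K2" "dead S (Nd (Lf K1) (Lf K2))"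
  shows False
proof -
  have "card {i. i < 13 \<and> f (flip i x) = K2} \<noteq> 0"
    using assms(1-3) unfolding colouring_def by (metis cell.distinct(11) int_ops(1) less_irrefl)
  then obtain i where "i < 13" "f (flip i x) = K2"
    by (metis (mono_tags, lifting) card.empty empty_Collect_eq)
  then have "fits (Nd (Lf K1) (Lf K2)) (cube_at f [i] x)" using assms(2) by simp
  then show False
    using assms(1,4) \<open>i < 13\<close> unfolding dead_def by (metis distinct_singleton empty_set
      insert_subset lessThan_iff list.simps(15) empty_subsetI)
qed

text \<open>
  The size of the matrix forces the covering radius 2.
\<close>

lemma intersection_array_of_quotient_matrix:
  assumes "has_quotient_matrix G C (mat_of_rows_list 3 [[a0, b0, z], [c1, a1, b1], [z', c2, a2]])"
  shows "has_intersection_array G C [b0, b1] [c1, c2]"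
proof -
  let ?M = "mat_of_rows_list 3 [[a0, b0, z], [c1, a1, b1], [z', c2, a2]]"
  have "?M \<in> carrier_mat (covering_radius G C + 1) (covering_radius G C + 1)"
    using assms by (simp add: has_quotient_matrix_def equitable_partition_def)
  then have "covering_radius G C = 2" by (auto simp: mat_of_rows_list_def)
  moreover have "[0..<2] = [0, 1::nat]" by (simp add: upt_rec)
  ultimately show ?thesis
    using assms unfolding has_intersection_array_def
    by (intro exI[of _ ?M]) (auto simp: mat_of_rows_list_def)
qed

section \<open>Certificates for both matrices\<close>

text \<open>
  A compact notation for certificates: \<open>!:\<close> before a case distinction, \<open>$\<close> before an address
  at which \<open>neighbours_bound\<close> fails and \<open>#\<close> before one at which \<open>second_neighbours_bound\<close>
  fails, each followed by the number of the colour. In the names of the addresses below, the letters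
  stand for the dimension and the leading binary digits, \<open>i\<close>, \<open>h\<close>, \<open>g\<close>, \<open>e\<close> with
  \<open>f\<close>, and \<open>a\<close> to \<open>d\<close> for the dimensions 1 to 5, and the digit gives the remaining
  binary digits.
\<close>

notation B ("!: _ _ _ _" [1000, 1000, 1000, 1000] 1000)
notation U0 ("#0 _" [1000] 1000) and U1 ("#1 _" [1000] 1000) and U2 ("#2 _" [1000] 1000)
notation V0 ("$0 _" [1000] 1000) and V1 ("$1 _" [1000] 1000) and V2 ("$2 _" [1000] 1000)

abbreviation "i0 \<equiv> [SL]"
abbreviation "i1 \<equiv> [SR]"
abbreviation "h0 \<equiv> [SL, SL]"
abbreviation "h1 \<equiv> [SL, SR]"
abbreviation "h2 \<equiv> [SR, SL]"
abbreviation "h3 \<equiv> [SR, SR]"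
abbreviation "g0 \<equiv> [SL, SL, SL]"
abbreviation "g1 \<equiv> [SL, SL, SR]"
abbreviation "g2 \<equiv> [SL, SR, SL]"
abbreviation "g3 \<equiv> [SL, SR, SR]"
abbreviation "g4 \<equiv> [SR, SL, SL]"
abbreviation "g5 \<equiv> [SR, SL, SR]"
abbreviation "g6 \<equiv> [SR, SR, SL]"
abbreviation "g7 \<equiv> [SR, SR, SR]"
abbreviation "e0 \<equiv> [SL, SL, SL, SL]"
abbreviation "e1 \<equiv> [SL, SL, SL, SR]"
abbreviation "e2 \<equiv> [SL, SL, SR, SL]"
abbreviation "e3 \<equiv> [SL, SL, SR, SR]"
abbreviation "e4 \<equiv> [SL, SR, SL, SL]"
abbreviation "e5 \<equiv> [SL, SR, SL, SR]"
abbreviation "e6 \<equiv> [SL, SR, SR, SL]"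
abbreviation "e7 \<equiv> [SL, SR, SR, SR]"
abbreviation "f0 \<equiv> [SR, SL, SL, SL]"
abbreviation "f1 \<equiv> [SR, SL, SL, SR]"
abbreviation "f2 \<equiv> [SR, SL, SR, SL]"
abbreviation "f3 \<equiv> [SR, SL, SR, SR]"
abbreviation "f4 \<equiv> [SR, SR, SL, SL]"
abbreviation "f5 \<equiv> [SR, SR, SL, SR]"
abbreviation "f6 \<equiv> [SR, SR, SR, SL]"
abbreviation "f7 \<equiv> [SR, SR, SR, SR]"
abbreviation "a0 \<equiv> [SL, SL, SL, SL, SL]"
abbreviation "a1 \<equiv> [SL, SL, SL, SL, SR]"
abbreviation "a2 \<equiv> [SL, SL, SL, SR, SL]"
abbreviation "a3 \<equiv> [SL, SL, SL, SR, SR]"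
abbreviation "a4 \<equiv> [SL, SL, SR, SL, SL]"
abbreviation "a5 \<equiv> [SL, SL, SR, SL, SR]"
abbreviation "a6 \<equiv> [SL, SL, SR, SR, SL]"
abbreviation "a7 \<equiv> [SL, SL, SR, SR, SR]"
abbreviation "b0 \<equiv> [SL, SR, SL, SL, SL]"
abbreviation "b1 \<equiv> [SL, SR, SL, SL, SR]"
abbreviation "b2 \<equiv> [SL, SR, SL, SR, SL]"
abbreviation "b3 \<equiv> [SL, SR, SL, SR, SR]"
abbreviation "b4 \<equiv> [SL, SR, SR, SL, SL]"
abbreviation "b5 \<equiv> [SL, SR, SR, SL, SR]"
abbreviation "b6 \<equiv> [SL, SR, SR, SR, SL]"
abbreviation "b7 \<equiv> [SL, SR, SR, SR, SR]"
abbreviation "c0 \<equiv> [SR, SL, SL, SL, SL]"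
abbreviation "c1 \<equiv> [SR, SL, SL, SL, SR]"
abbreviation "c2 \<equiv> [SR, SL, SL, SR, SL]"
abbreviation "c3 \<equiv> [SR, SL, SL, SR, SR]"
abbreviation "c4 \<equiv> [SR, SL, SR, SL, SL]"
abbreviation "c5 \<equiv> [SR, SL, SR, SL, SR]"
abbreviation "c6 \<equiv> [SR, SL, SR, SR, SL]"
abbreviation "c7 \<equiv> [SR, SL, SR, SR, SR]"
abbreviation "d0 \<equiv> [SR, SR, SL, SL, SL]"
abbreviation "d1 \<equiv> [SR, SR, SL, SL, SR]"
abbreviation "d2 \<equiv> [SR, SR, SL, SR, SL]"
abbreviation "d3 \<equiv> [SR, SR, SL, SR, SR]"
abbreviation "d4 \<equiv> [SR, SR, SR, SL, SL]"
abbreviation "d5 \<equiv> [SR, SR, SR, SL, SR]"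
abbreviation "d6 \<equiv> [SR, SR, SR, SR, SL]"
abbreviation "d7 \<equiv> [SR, SR, SR, SR, SR]"

text \<open>
  The name of each lemma lists the colours of its pattern from the leftmost to the rightmost leaf.
  A leaf \<open>N\<close> may use a pattern that has one dimension more than the pattern under proof, which is
  why the edge can come after patterns of dimension 4. The case distinctions and the weights are the
  outcome of a computer search.
\<close>

lemma dead1_0110100111112112: "dead s1 (Nd (Nd (Nd (Nd (Lf K0) (Lf K1)) (Nd (Lf K1) (Lf K0))) (Nd (Nd (Lf K1) (Lf K0)) (Nd (Lf K0) (Lf K1)))) (Nd (Nd (Nd (Lf K1) (Lf K1)) (Nd (Lf K1) (Lf K1))) (Nd (Nd (Lf K2) (Lf K1)) (Nd (Lf K1) (Lf K2)))))"
  by (rule case1.dead_by_certificate[where es = "[E f0 1 0 0]" and ce = "!:f0!:f4$0b4!:f5!:f6!:f7$0b7!:f3!:f1$0d1!:f2$0d2!:e3!:e1$0a1!:e2$0a2!:e7$0a7!:e0!:e4$0a4 Y$2c0 Y$2a0$2c3$0c2$0c1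
!:e4$0a4!:e1$0a1!:e2$0a2 Y!:e0$2c0!:e6$0c2 Y$2a6$2a0!:e0$2c0!:e5$0c1!:e2$0a2 Y!:e6$0c2 Y$2a6$2a5$2a0!:e0$2c0!:e5
$0c4!:e6$0c4!:e1$0a1 Y!:e2$0a2 Y!:e7$0a7 Y Y$2a6$2a5$2a0$2a3$2d0$2d0#0(hold1 b7)#0(hold1 b7)$2d5#0(hold1 b4)
#0(hold1 b4)#0(hold1 b4)#0(hold1 b4)$2d0 Z Z"])
    (simp_all)

lemma dead1_0110100111212112: "dead s1 (Nd (Nd (Nd (Nd (Lf K0) (Lf K1)) (Nd (Lf K1) (Lf K0))) (Nd (Nd (Lf K1) (Lf K0)) (Nd (Lf K0) (Lf K1)))) (Nd (Nd (Nd (Lf K1) (Lf K1)) (Nd (Lf K2) (Lf K1))) (Nd (Nd (Lf K2) (Lf K1)) (Nd (Lf K1) (Lf K2)))))"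
  by (rule case1.dead_by_certificate[where es = "[E f0 1 0 0]" and ce = "!:f0!:f2$0b2!:f3!:f4$0b4!:f5!:f1$0d1!:f6!:f7$0b7!:e7$0a7!:e4$0a4!:e3!:e1$0a1!:e2$0a2!:e0!:e5!:e6 Y Y$2a6 Y$2a5 Y
$2a0$0c2$0c1!:e2$0a2!:e1$0a1 Y!:e0$2c0!:e5$0c1 Y$2a5$2a0!:e0$2c0!:e6$0c2!:e1$0a1 Y!:e5$0c1 Y$2a5$2a6$2a0$2a3!:e0
$2c0!:e5$0c4!:e6$0c4!:e3!:e1$0a1!:e2$0a2 Y$0c2$0c1!:e1$0a1 Y!:e2$0a2 Y Y$2a3$2a6$2a5$2a0!:e3$2c3!:e5$2c5!:e6$2c6
!:e2$0a2!:e0!:e1$0a1!:e4$0a4 Y$2c0$2c0!:e1$0a1 Y!:e4$0a4 Y Y$2a0!:e0$2c0!:e4$0a4!:e1$0a1 Y Y!:e1$0a1 Y Y$2a0$2a6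
$2a5$2a3$2d3#0(hold1 b2)#0(hold1 b2)$2d0#0(hold1 b4)#0(hold1 b4)$2d0#0(hold1 b2)#0(hold1 b2)$2d0 Z Z"])
    (simp_all)

lemma dead1_0110100112212112: "dead s1 (Nd (Nd (Nd (Nd (Lf K0) (Lf K1)) (Nd (Lf K1) (Lf K0))) (Nd (Nd (Lf K1) (Lf K0)) (Nd (Lf K0) (Lf K1)))) (Nd (Nd (Nd (Lf K1) (Lf K2)) (Nd (Lf K2) (Lf K1))) (Nd (Nd (Lf K2) (Lf K1)) (Nd (Lf K1) (Lf K2)))))"
  by (rule case1.dead_by_certificate[where es = "[E e7 0 0 1]" and ce = "!:e7$0a7 Z!:e3$2c3!:e5$2c5!:e6$2c6!:f4$0b4!:f0!:f1$0b1!:f2$0b2!:f3!:f5!:f6!:f7$0b7!:e4$0a4!:e0!:e1$0a1!:e2$0a2 Y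
$2c0$2c0!:e1$0a1!:e2$0a2#0c0 Y!:e2$0a2 Y Y$2a0!:e0$2c0!:e1$0a1!:e2$0a2 Y Y Y$2a0$2d3#0(hold1 b2)#0(hold1 b2)
#0(hold1 b1)#0(hold1 b1)#0(hold1 b1)#0(hold1 b1)$2d0$2d0#0(hold1 b4)#0(hold1 b4)!:e4$0a4!:f2$0b2!:f0$2d0
#0(hold1 b2)#0(hold1 b2)!:e2$0a2!:f3$0d2!:f1$0b1#0(hold1 b1)!:f7$0b7#0(hold1 b7)!:f0$2d0!:f6$0d2#0(hold0 d2)!:e0
!:e1$0a1!:f5$0d1#0(hold0 d1)Y$2c0!:e1$0a1#0c0(N [SL,FL,SL,SL,SL] [S2,S1])$2a0!:e0$2c0!:e1$0a1!:f5$0d1!:f6$0d2 Y Y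
!:f6$0d2 Y Y(N [SL,FL,SL,SL,SL] [S2,S1])$2a0!:f1$0b1#0(hold1 b1)!:f7$0b7#0(hold1 b7)!:f0$2d0!:e1$0a1!:e0!:f5$0d1
!:f6$0d2#0(hold0 d4)Y Y#0c0$2a0!:e0$2c0(N [SL,FL,SL,SL,SL] [S2,S1])$2a0!:e0$2c0!:e1$0a1!:f5$0d1!:f6$0d2 Y Y Y
(N [SL,FL,SL,SL,SL] [S2,S1])$2a0!:e0$2c0!:e1$0a1(N [SL,FL,SL,SL,SL] [S1])(N [SL,FL,SL,SL,SL] [S1,S2])$2a0!:e0
$2c0!:e2$0a2!:e1$0a1(N [SL,FL,SL,SL,SL] [])(N [SL,FL,SL,SL,SL] [S2])!:e1$0a1(N [SL,FL,SL,SL,SL] [])!:f0$2d0!:f1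
$0b1#0(hold1 b1)!:f2$0b2#0(hold1 b2)!:f3$0d1!:f5$0d1 Y Y Y Y$2a0$2a6$2a5$2a3"])
    (simp_all add: dead1_0110100111112112 dead1_0110100111212112)

lemma dead1_01101001: "dead s1 (Nd (Nd (Nd (Lf K0) (Lf K1)) (Nd (Lf K1) (Lf K0))) (Nd (Nd (Lf K1) (Lf K0)) (Nd (Lf K0) (Lf K1))))"
  by (rule case1.dead_by_certificate[where es = "[E g1 0 (-4) 0, E g2 0 0 1, E g4 0 0 4, E g5 1 1 0, E g6 1 1 0, E g7 0 (-3) 1]" and ce = "!:g1$0e1!:g4$0e4 Z!:g0$2f0!:g5$0f4!:g6$0f4!:g7$0e7 Z!:g3$2f3!:g2$0e2(N [SL,SL,SL,SL] [])(N [SL,SL,SL,SL] [])$2e3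
$2e6$2e5$2e0!:g0$2f0!:g3$0f1!:g5$0f1!:g4$0e4!:g7$0e7 Z!:g6$2f6!:g2$0e2(N [SL,SL,SL,SL] [S2,S1])
(N [SL,SL,SL,SL] [S1,S2])$2e6!:g6$0f4!:g2$0e2!:g7$0e7(N [SL,SL,SR,SR] [S1])(N [SL,SL,SL,SL] [S2])!:g7$0e7
(N [SL,SL,SR,SR] [S1,S2])(N [SL,SL,SL,SL] [])$2e6$2e5$2e3$2e0"])
    (simp_all add: dead1_0110100111112112 dead1_0110100111212112 dead1_0110100112212112)

lemma dead1_11111221: "dead s1 (Nd (Nd (Nd (Lf K1) (Lf K1)) (Nd (Lf K1) (Lf K1))) (Nd (Nd (Lf K1) (Lf K2)) (Nd (Lf K2) (Lf K1))))"
  by (rule case1.dead_by_certificate[where es = "[E g1 1 0 0]" and ce = "!:g1!:g5$0e5!:g4!:g6$0e6!:g2!:g0$0f0!:g7!:g3$0f3(N [FR,SL,SL,SR] [])$2f1#0e5#0e5$0f0#0e6#0e6$2f4#0e5#0e5$2f1 Z Z"])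
    (simp_all add: dead1_01101001)

lemma dead1_0110102112012112: "dead s1 (Nd (Nd (Nd (Nd (Lf K0) (Lf K1)) (Nd (Lf K1) (Lf K0))) (Nd (Nd (Lf K1) (Lf K0)) (Nd (Lf K2) (Lf K1)))) (Nd (Nd (Nd (Lf K1) (Lf K2)) (Nd (Lf K0) (Lf K1))) (Nd (Nd (Lf K2) (Lf K1)) (Nd (Lf K1) (Lf K2)))))"
  by (rule case1.dead_by_certificate[where es = "[E f0 0 0 1]" and ce = "!:f0 Z Z!:e0$2c0!:f2$0d0!:f4$0b4!:e4!:e6$0a6!:f5!:e5$0c5!:f1$0b1!:f3!:f6!:f7$0b7!:e3!:e1$0a1!:e2$0a2!:e7$0c3 Y
$2c3$0c2$0c1!:e7$0c5!:e1$0a1!:e2$0a2#0c3 Y!:e2$0a2 Y Y!:e1$0a1!:e2$0a2 Y Y Y$2a3$2d3#0(hold1 b4)#2(hold2 b6)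
#0(hold1 b1)#0(hold1 b1)$0d1$2a5#0(hold1 b4)#0(hold1 b4)$2c4#0b4#0b4!:f1$0b1!:f5$0d4#0(hold1 b1)#0(hold1 b1)!:e6
$0a6!:e4$2c4!:f6$0d4#0(hold2 a6)#0(hold2 a6)!:f6$0d4#0(hold2 a6)#0(hold2 a6)!:e5!:e1$0a1!:e4$2c4!:e7$0c6!:f5$0d1
!:f7$0b7#0(hold2 b7)!:e2$0a2!:f6$0c6#0(hold0 c6)!:f3$0d1!:e3 Y#0c3$2a3!:e3$2c3 Y$2a3!:e3$0c2!:f3$0d1!:f6$0c6
#0(hold0 d7)Y Y$2a3$2c5$2c5$0c4$0c1!:e4$2c4!:e7$0c6!:e2$0a2!:f6$0c6#0(hold0 c6)!:f7$0b7#0(hold2 b7)!:e3!:e1$0a1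
!:f5$0d1#0c5 Y$0c1!:f3$0d1!:e1$0a1#0c3!:f5$0d1 Y Y!:e1$0a1!:f5$0d1#0c5 Y Y$2a3!:e3$0c2!:f6$0c6!:f7$0b7
#0(hold2 b7)!:f5$0d1!:e1$0a1#0c5!:f3$0d1#0(hold0 d7)Y!:e1$0a1!:f3$0d1 Y Y Y!:f7$0b7#0(hold2 b7)!:e1$0a1!:f5$0d1
#0c5 Y!:f3$0d1 Y Y$2a3!:e3$2c3!:f3$0d1!:f7$0b7#0b7!:e2$0a2!:f6$0c6!:f5$0d1!:e1$0a1 Y Y!:e1$0a1 Y Y!:e1$0a1!:f5
$0d1 Y Y Y!:f6$0c6!:e1$0a1!:f5$0d1 Y Y Y!:e1$0a1 Y Y!:f7$0b7#0b7!:f5$0d1!:e1$0a1!:e2$0a2!:f6$0c6 Y Y Y!:e2$0a2 Y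
Y!:e1$0a1!:e2$0a2 Y Y Y$2a3!:e3!:e1$0a1!:e2$0a2!:e7$0c6!:f3$0d1!:f5$0d1!:f6$0c6!:f7$0b7#0(hold4 b7)#0(hold0 d7)Y
Y$2c3$2c3$0c2$0c1!:f5$0d1!:e7$0c6!:f7$0b7#0(hold2 b7)!:f6$0c6!:f3$0d1#0(hold0 d7)!:e1$0a1!:e2$0a2 Y Y Y!:e1$0a1
!:f3$0d1(N [FR,SL,SL,SR,FR] [])Y!:e2$0a2 Y Y!:f7$0b7#0(hold2 b7)!:e2$0a2!:f6$0c6!:e1$0a1!:f3$0d1 Y Y Y!:e1$0a1 Y
Y!:e1$0a1!:f3$0d1 Y Y Y!:f3$0d1!:f7$0b7#0(hold1 b7)!:e2$0a2!:e7$0c6!:e1$0a1#0c3 Y!:e1$0a1 Y Y!:e1$0a1!:e7$0c6 Y Y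
Y!:e1$0a1!:e2$0a2!:e7$0c6 Y Y Y Y$2a3$2a5$2b2$2a0"])
    (simp_all add: dead1_11111221)

lemma dead1_0001100111121001: "dead s1 (Nd (Nd (Nd (Nd (Lf K0) (Lf K0)) (Nd (Lf K0) (Lf K1))) (Nd (Nd (Lf K1) (Lf K0)) (Nd (Lf K0) (Lf K1)))) (Nd (Nd (Nd (Lf K1) (Lf K1)) (Nd (Lf K1) (Lf K2))) (Nd (Nd (Lf K1) (Lf K0)) (Nd (Lf K0) (Lf K1)))))"
  by (rule case1.dead_by_certificate[where es = "[E f2 (-1) 0 0, E f3 0 (-3) 0, E f7 0 (-3) 0]" and ce = "!:e0$0a0!:e1$0a1!:e2$0a2!:e5$0a5!:e6$0a6!:f3$0b3 Z!:f7$0d3 Z!:f5$2d5!:f6$2d6!:e4$0a4!:e3$2c3!:e7$2c7!:f4!:f0!:f1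
$2d1!:f2$2d2 Y$2d0$2d0!:f1$2d1!:f2$2d2#0d0 Y!:f2$2d2 Y Y$0d0#0(hold2 d7)#0(hold2 d4)#0(hold1 c7)!:e7$0c3
#0(hold1 c3)!:f1$2d1!:f2$2d2!:f0 Y!:f4#0d0#0d0#0(hold4 d4)#0(hold2 d0)!:f0$2d0 Y!:f4$0d0#0(hold3 d0)#0(hold2 d4)
!:f2$2d2!:f0$2d0 Y!:f4$0d0#0(hold4 d0)#0(hold2 d4)Y!:f4$0c4#0(hold0 c4)!:e7$2c7#0(hold2 d7)!:e3$2c3#0(hold1 c7)
!:f1$2d1!:f2$2d2!:f0$2d0#0(hold1 d4)#0(hold2 d0)Y!:f2$2d2 Y Y$2b6$2b5$2a6$2a5$2a2$2a1$2a0"])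
    (simp_all)

lemma dead1_0110101112010112: "dead s1 (Nd (Nd (Nd (Nd (Lf K0) (Lf K1)) (Nd (Lf K1) (Lf K0))) (Nd (Nd (Lf K1) (Lf K0)) (Nd (Lf K1) (Lf K1)))) (Nd (Nd (Nd (Lf K1) (Lf K2)) (Nd (Lf K0) (Lf K1))) (Nd (Nd (Lf K0) (Lf K1)) (Nd (Lf K1) (Lf K2)))))"
  by (rule case1.dead_by_certificate[where es = "[E f6 0 0 1]" and ce = "!:f6 Z Z!:f2$2d2!:f4$2d4!:e4$0a4!:e2$0a2!:f0$0b0!:e6$2c6#0(hold4 d6)!:e7$0c6!:e0!:e1$0a1!:e3!:e5!:f5!:f1$0b1!:f7
$0b7!:f3 Y#0(hold3 b7)$2c3$2d5$0d1!:f7$0b7#0(hold2 b7)!:f1$0b1!:f3$2d3#0(hold4 b1)$2c3 Y$2c5#0(hold1 c6)$2a5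
#0(hold1 c6)$2a3$2c0#0(hold1 c6)$2a0!:e3$2c3!:e5$2c5!:f7$0b7!:f3!:f1$0b1!:f5!:e0!:e1$0a1 Y$2c0 Y$2a0#0(hold2 b7)
#0(hold2 b7)$0d1#0(hold3 b7)#0(hold3 b7)!:e0!:e1$0a1!:f1$0b1!:f3$2d3!:f5$2d5#0(hold4 b1)#0(hold4 b1)#0(hold2 d3)
!:f3$0d1 Y!:f5$0d1 Y Y$2c0!:e1$0a1#0c0!:f1$0b1#0(hold0 c1)!:f3$0d1 Y!:f5$0d1 Y Y$2a0$2a5$2a3!:e0$2c0!:e6$2c6
#0(hold4 d6)!:e7$0c6#0(hold1 c6)!:e3$2c3!:e5$2c5!:f7$0b7!:f3!:f1$0b1!:e1$0a1#0(hold0 d0)#0(hold0 c1)$0d1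
#0(hold3 b7)#0(hold3 b7)!:f3$2d3!:f1$0b1#0(hold0 d0)!:e1$0a1 Y!:f5$0d1 Y Y!:f1$0b1#0(hold0 d0)!:e1$0a1!:f5$0d1 Y
Y!:f5$0d1 Y Y$2a5$2a3$2a0!:e0$2c0!:e3$0c2!:e6$0c2!:f0$0b0#0(hold4 c2)#0(hold4 c2)!:e1$0a1!:f1$0b1!:f0$0b0!:f3
!:f7$0b7!:e7$0c6!:f5 Y#0(hold2 b7)#0(hold2 b7)!:e5$2c5!:f5 Y#0(hold2 b7)#0(hold4 d5)$2a5$2d3!:f5!:f7$0b7!:e7$0c6
#0(hold3 b7)#0(hold3 b7)$2d5#0(hold4 b1)#0(hold4 b1)#0(hold2 d3)#0(hold0 d0)!:e5!:e7$0c6!:f5$0d1!:f7$0b7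
#0(hold2 b7)!:f0$0b0 Y!:f3$0d1 Y Y$2c5$2c5!:f3$0d1!:f7$0b7!:e7$0c6#0(hold3 b7)#0(hold3 b7)!:e7$0c6 Y!:f0$0b0 Y
!:f5$0d1 Y Y!:f5$0d1!:e7$0c6#0c5!:f0$0b0!:f7$0b7#0(hold4 b7)Y Y!:f7$0b7#0(hold1 b7)!:e7$0c6!:f0$0b0 Y Y!:f0$0b0 Y
Y$2a5!:e5$0c1!:e7$0c6!:f7$0b7!:f3!:f1$0b1!:f0$0b0#0(hold0 c1)#0(hold0 c1)$0d1#0(hold3 b7)#0(hold3 b7)!:f3$2d3
!:f1$0b1#0(hold0 c1)!:f0$0b0 Y!:f5$0d1 Y Y!:f1$0b1#0(hold0 c1)!:f5$0d1!:f0$0b0 Y Y!:f0$0b0 Y Y!:f1$0b1!:f0$0b0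
#0(hold0 c1)#0(hold0 c1)!:f5$0d1!:f7$0b7#0(hold2 b7)!:f0$0b0!:f3$0d1 Y Y!:f3$0d1 Y Y!:f0$0b0!:f3$0d1 Y Y Y$2a5
$2a3$2a0!:e0$2c0!:e5$0c4!:e6$0c4!:e2$0a2!:f0$0b0#0(hold4 c4)#0(hold4 c4)!:f0$0b0#0(hold4 c2)#0(hold4 c2)!:e7$0c6
!:f7$0b7!:f3!:f1$0b1!:f5!:e1$0a1!:f0$0b0!:e2$0a2 Y!:e3$0c2 Y$2a3!:e2$0a2#0(hold0 d0)#0(hold0 d0)!:e3$0c1!:f0$0b0
!:e2$0a2#0(hold0 c1)#0(hold0 c1)(N [SL,SL,SR,FL,SR] [S1])$2a3#0(hold2 b7)#0(hold2 b7)$0d1#0(hold3 b7)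
#0(hold3 b7)!:e2$0a2!:f3$2d3!:e1$0a1!:e3!:f5$2d5!:f1$0b1#0(hold4 b1)Y!:f0$0b0!:f1$0b1#0(hold4 b1)Y Y#0c3$2a3!:e3
$0c1!:f1$0b1#0(hold0 c1)!:f0$0b0 Y!:f5$0d1 Y Y$2a3!:e3$2c3!:f1$0b1!:e1$0a1!:f0$0b0#0(hold2 d3)#0(hold2 d0)
#0(hold0 c1)!:f5$0d1!:e1$0a1 Y!:f0$0b0 Y Y!:e1$0a1!:f0$0b0 Y Y!:f0$0b0 Y Y$2a3!:e3$0c2!:f0$0b0!:f1$0b1!:e1$0a1
!:f3$2d3!:f5$2d5#0(hold4 b1)#0(hold4 b1)#0(hold2 d3)#0(hold0 c1)!:f3$0d1!:e1$0a1 Y!:f5$0d1 Y Y!:e1$0a1!:f5$0d1 Y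
Y!:f5$0d1 Y Y!:f3$2d3!:f1$0b1#0(hold0 d0)!:e1$0a1!:f5$0d1 Y Y!:f5$0d1 Y Y!:e1$0a1!:f5$2d5 Y Y Y$2a3!:e3$2c3!:f7
$0b7!:f3!:f1$0b1!:f5!:f0$0b0!:e2$0a2!:e1$0a1 Y#0(hold0 c1)!:e1$0a1 Y#0(hold0 c1)!:e1$0a1!:e2$0a2#0(hold0 d0)
#0(hold0 d0)Y#0(hold2 b7)#0(hold2 b7)$0d1#0(hold3 b7)#0(hold3 b7)!:f0$0b0!:f1$0b1!:f3$2d3!:f5$2d5#0(hold1 b1)
#0(hold1 b1)!:f5$2d5#0(hold1 b1)#0(hold1 b1)!:f3$0d1!:e1$0a1!:e2$0a2 Y!:f5$0d1#0(hold0 d1)Y!:f5$0d1!:e2$0a2 Y Y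
!:e2$0a2 Y Y!:e2$0a2!:f5$0d1!:e1$0a1 Y Y!:e1$0a1 Y Y!:e1$0a1!:f5$0d1 Y Y Y!:f1$0b1!:e2$0a2!:e1$0a1#0(hold0 d0)
#0(hold0 c1)!:e1$0a1#0(hold0 d0)#2(hold0 c0)!:e1$0a1!:f3$0d1!:e2$0a2!:f5$0d1 Y Y!:f5$0d1 Y Y!:e2$0a2!:f5$0d1 Y Y
Y!:e2$0a2!:f3$0d1!:f5$0d1 Y Y Y Y$2a3$2a5$2a0$2b4$2b2"])
    (simp_all add: dead1_0110102112012112)

lemma dead1_0110102112011112: "dead s1 (Nd (Nd (Nd (Nd (Lf K0) (Lf K1)) (Nd (Lf K1) (Lf K0))) (Nd (Nd (Lf K1) (Lf K0)) (Nd (Lf K2) (Lf K1)))) (Nd (Nd (Nd (Lf K1) (Lf K2)) (Nd (Lf K0) (Lf K1))) (Nd (Nd (Lf K1) (Lf K1)) (Nd (Lf K1) (Lf K2)))))"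
  by (rule case1.dead_by_certificate[where es = "[E e7 1 0 0]" and ce = "!:e7!:e6$0a6!:f7$0b7!:f1$0b1!:e3!:e1$0a1!:e2$0a2!:f3$0c3!:f0!:f5!:e5$0c5!:f6!:f2$0d2!:e4$0c5 Y!:e0$2c0!:f4$0c4 Y
$2d0$2a0$2b2#0(hold1 b7)#0(hold1 b7)$2a5#0(hold4 b1)#0(hold4 b1)#0(hold1 b1)#0(hold1 b1)$2c3$0c2$0c1!:f2!:e2$0a2
!:f6!:f0$0d2!:f3$0d2#0(hold1 b1)$2d2$0d0!:e4!:f5$0c5#0(hold2 b7)#0(hold2 b7)#0(hold4 a6)#0(hold4 a6)$2d2$0c2!:e1
$0a1!:e5!:e4$0c5!:f5$0c5!:f0!:f3!:f6$0d2#0(hold2 a6)#0(hold2 a6)#0(hold4 b1)#0(hold4 b1)#0(hold3 b1)#0(hold3 b1)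
$2c5$0c4!:e2$0a2!:e0!:e4!:f0$0c0!:f5$0c5#0(hold3 b1)#0(hold3 b1)$2c0!:f6!:f3(N [SR,SR,SL,FR,SR] [S2])!:f0!:f5 Y
#0(hold4 b1)#0(hold4 b1)#0(hold1 b1)$2c0!:f0!:f5!:f4$0d4 Y$2d0#0(hold4 b1)#0(hold4 b1)#0(hold2 d3)$2c0
#0(hold4 a6)#0(hold4 a6)$2c0!:f3!:f6(N [SR,SR,SL,FR,SR] [S2])!:f5(N [SR,SL,SR,SR,FR] [S1,S2])#0(hold2 b7)
#0(hold2 b7)!:f5(N [SR,SL,SR,SR,FR] [S1,S2])#0(hold2 b7)#0(hold2 b7)#0c3!:f0!:f5!:f6!:f4$0d4 Y$2d0#0(hold1 b7)
#0(hold3 d6)#0(hold4 b1)#0(hold4 b1)#0(hold2 d3)#0(hold2 d0)$2a0!:e0$2c0!:e4(N [SL,FL,SR,SL,SR] [S1,S0])!:f6!:f4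
!:f3!:f0$0d2!:f5$0d7#0(hold3 b1)$2d4$0d0!:f0!:f5$0d4#0(hold4 b1)$2d4#0(hold1 b1)$0d0 Y!:f5!:f0 Y#0d4#0(hold3 d0)
#0c5#0(hold3 d5)$0d4#0(hold4 a6)#0(hold4 a6)!:f6!:f4$0c4!:f0!:f3$0d2!:f5 Y#0(hold4 b1)#0(hold4 b1)Y#0(hold4 c4)
#0(hold4 c4)$0d4#0(hold4 a6)#0(hold4 a6)$2a0$2a5!:e0$2c0!:e5$0c1!:e2$0a2!:f3!:f5!:f6$0d7!:e4$0c5#0(hold4 a6)
#0(hold4 a6)!:e4$0c5#0(hold4 a6)#0(hold4 a6)!:f0(N [SL,SR,FL,SR,SL] [S1,S0])#0(hold3 b1)#0(hold3 b1)
(N [SL,SL,SL,SR,FR] [S0,S2,S1])!:f0!:f5!:f6!:f4$0d4 Y$2d0#0(hold1 b7)#0(hold3 d6)#0(hold4 b1)#0(hold4 b1)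
#0(hold2 c1)#0(hold2 c1)!:f5(N [SL,SL,SR,SL,FR] [S0,S1])#0(hold4 b1)#0(hold4 b1)!:e4!:f5$0c5!:f0!:f3!:f6$0d2
#0(hold2 b7)#0(hold2 b7)#0(hold4 b1)#0(hold4 b1)#0(hold3 b1)#0(hold3 b1)!:f3(N [SL,SL,SL,SR,FR] [S0,S2,S1])
#0(hold4 b1)#0(hold4 b1)!:f6!:f4!:f0!:f3$0d2 Y Y Y$0d0!:f3!:f0$0d2!:f5$0d7#0(hold3 b1)#0(hold3 b1)#0(hold3 d0)
!:f0!:f5 Y#0(hold4 b1)#0(hold4 b1)#0(hold2 c1)#0(hold3 d0)Y$0d4#0(hold4 a6)#0(hold4 a6)
(N [SL,FL,SL,SR,SR] [S2,S1])$2a5$2a0$2b2$2a3!:f5$0d1!:f3$0d1#0(hold1 b7)#0(hold1 b7)!:f3$0d1#0(hold1 b7)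
#0(hold1 b7)$2c7$0c6 Z Z"])
    (simp_all add: dead1_0110101112010112 dead1_0110102112012112)

lemma dead1_0110101112012112: "dead s1 (Nd (Nd (Nd (Nd (Lf K0) (Lf K1)) (Nd (Lf K1) (Lf K0))) (Nd (Nd (Lf K1) (Lf K0)) (Nd (Lf K1) (Lf K1)))) (Nd (Nd (Nd (Lf K1) (Lf K2)) (Nd (Lf K0) (Lf K1))) (Nd (Nd (Lf K2) (Lf K1)) (Nd (Lf K1) (Lf K2)))))"
  by (rule case1.dead_by_certificate[where es = "[E e7 1 0 0]" and ce = "!:e7!:f7$0b7!:f1$0b1!:f5!:e5$0c5!:f4$0b4!:e4$0c5!:f0!:f6!:f2$0d2!:f3$0d2!:e1$0a1!:e2$0a2 Y!:e0$2c0!:e3$0c2 Y$2a3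
$2a0!:e3$0c1(N [SR,SL,SR,SR,FR] [S0,S1,S0])$2a3(N [SR,FR,SL,SL,SL] [S1,S2,S1])$2b2#0(hold2 b4)#0(hold2 b4)#0b4
#0b4!:e0$2c0!:e6$0c4!:f6(N [SR,SL,FR,SR,SR] [S1,S2,S1])#0(hold2 b4)#0(hold2 b4)$0c6$2a0$0d4$2a5!:f0!:f3!:f6$0d2
#0(hold2 b7)#0(hold2 b7)#0(hold1 b1)#0(hold1 b1)#0(hold1 b1)#0(hold1 b1)#2(hold1 b5)!:f3$0d1!:f5$0d1#0(hold1 b7)
#0(hold1 b7)!:f5$0d1#0(hold1 b7)#0(hold1 b7)$2c7 Z Z"])
    (simp_all add: dead1_0110102112011112 dead1_0110102112012112)

lemma dead1_0110102112010112: "dead s1 (Nd (Nd (Nd (Nd (Lf K0) (Lf K1)) (Nd (Lf K1) (Lf K0))) (Nd (Nd (Lf K1) (Lf K0)) (Nd (Lf K2) (Lf K1)))) (Nd (Nd (Nd (Lf K1) (Lf K2)) (Nd (Lf K0) (Lf K1))) (Nd (Nd (Lf K0) (Lf K1)) (Nd (Lf K1) (Lf K2)))))"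
  by (rule case1.dead_by_certificate[where es = "[E e0 4 1 0, E e1 0 (-3) 0, E e2 0 (-3) 1, E e4 0 (-2) 1, E e5 0 1 0, E e6 0 1 0, E e7 0 1 1, E f4 0 1 0, E f5 0 1 0]" and ce = "!:e0!:e1$0a1!:e2$0a2!:e4$0a4!:e5 Z!:e6$0a6!:f0$0b0!:f4 Z!:f5 Z!:e7 Z!:f6!:f7$0b7!:f3!:f1$0b1!:f2$0d2 Y$2b2$0d1
#0(hold4 b7)#0(hold4 b7)$2d6#0(hold3 a6)#0(hold3 a6)!:e3$2c3#0(hold1 c7)$2a3 Z$2b4$2c0 Z$2a5$2c0$2c0$2c0!:e1$0a1
!:e2$0a2!:e4$0a4 Z!:e5$0c4!:e6$0a6!:e7 Z#0(hold1 c4)#0(hold1 c4)Z$2a5!:e3$0c2!:f2$0c2!:e4$0a4!:e6$0a6!:e7!:e5 Z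
!:f4 Z!:f5 Z!:f7$0b7!:f1$0b1#0c5#0c5$2c7 Z$2b4$2a5#0(hold1 c2)#0(hold1 c2)!:e5 Z!:f4 Z!:f5 Z!:f1$0b1!:e7$0c6#0c5
!:f0$0b0!:f3!:f6$0c6#0d4!:f7$0b7#0(hold2 b7)$2d3#0(hold4 b1)#0(hold4 b1)#0(hold3 d0)!:e7$0c6#0c5!:f3$0d1!:f0$0b0
#0(hold0 d1)!:f6$0c6!:f7$0b7#0(hold4 b7)Y Y!:f7$0b7#0(hold4 b7)!:f0$0b0!:f6$0c6#0d4 Y!:f6$0c6 Y Y Z$2b4$2a5!:e5
$0c4!:f4$0c4!:e6$0a6!:e7(N [SL,FL,SL,SR,SR] [S1,S2,S1,S0])#0(hold1 c2)#0(hold1 c2)!:e7$0c6!:f0$0b0!:f1$0b1!:f3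
!:f7$0b7!:f6$0c6!:f5 Y#0(hold2 b7)#0(hold4 d5)Y$2d3!:f5!:f7$0b7!:f6$0c6#0(hold3 b7)#0(hold3 b7)$2d5#0(hold4 b1)
#0(hold4 b1)#0(hold2 d3)!:f3$0d1!:f5$0d1#0(hold0 d1)!:f6$0c6!:f7$0b7#0(hold4 b7)Y Y!:f5$0d1!:f6$0c6!:f7$0b7
#0(hold4 b7)Y Y!:f6$0c6 Y Y!:f1$0b1!:f3(N [SL,SL,FL,SR,SR] [S1])#0(hold2 d0)#0(hold2 d0)!:f3$0d1!:f5$0d1!:f7$0b7
#0(hold4 b7)(N [FR,SL,SL,SR,FR] [])!:f6$0c6 Y Y!:f5$0d1!:f6$0c6 Y Y Y!:f0$0b0!:f1$0b1!:f6$0c6!:f7$0b7 Y!:f3$2d3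
!:f5$2d5#0(hold4 b1)#0(hold4 b1)#0(hold2 d3)Y!:f3$0d1!:f5$0d1#0(hold0 d1)!:f6$0c6 Y Y!:f5$0d1!:f6$0c6 Y Y Y!:f6
$0c6!:f1$0b1#0(hold0 d0)!:f3$0d1!:f5$0d1 Y Y Y Y$2b4$2a5$2b2$2a3!:e3$0c1!:e5$0c1!:e2$0a2!:e4$0a4!:e6$0a6!:e7 Z
!:f4 Z!:f5 Z!:f1$0b1#0(hold0 c1)!:f6!:f7$0b7!:f3$0d1#0(hold4 b7)#0(hold4 b7)$2d6#0(hold3 a6)#0(hold3 a6)Z$2b4
#0(hold1 c7)Z!:f4$0c4!:e6$0a6!:e7(N [SL,FL,SL,SR,SR] [S2,S1])#0(hold1 c4)#0(hold1 c4)!:e7$0c6!:f1$0b1!:f0$0b0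
#0(hold0 c1)#0(hold0 c1)!:f0$0b0!:f2!:f3$0d1!:f6$0c6!:f5$0d1!:f7$0b7#0(hold4 b7)#0(hold0 d7)Y$2d2$2d2!:f3$0d1
!:f6$0c6#0d2!:f5$0d1!:f7$0b7#0(hold4 b7)Y Y!:f5$0d1!:f6$0c6!:f7$0b7#0(hold4 b7)Y Y!:f6$0c6 Y Y$2b2!:f2$0d0!:f3
$0d1!:f6$0c6!:f7$0b7#0(hold3 b7)(N [FR,SL,SL,FR,SR] [S0])!:f5$0d1 Y Y!:f5$0d1!:f6$0c6 Y Y Y$2b2!:f1$0b1!:f0$0b0
#0(hold0 c1)#0(hold0 c1)!:f0$0b0!:f2!:f3$0d1!:f5$0d1!:f6$0c6 Y$2d2 Y$2d2!:f3$0d1!:f6$0c6#0d2!:f5$0d1 Y Y!:f5$0d1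
!:f6$0c6 Y Y Y$2b2!:f2$0d0!:f3$0d1!:f5$0d1!:f6$0c6 Y Y Y Y$2b2$2b4!:f2$0c2!:e4$0a4!:e6$0a6!:e7
(N [SL,FL,SR,SL,SR] [S1,S2,S1])#0(hold1 c2)#0(hold1 c2)!:e7$0c6!:f1$0b1!:f0$0b0#0(hold0 c1)#0(hold0 c1)!:f0$0b0
!:f3$0d1!:f5$0d1!:f7$0b7#0(hold4 b7)!:f4!:f6$0c6#0(hold0 d7)$2d4 Y$2b4!:f4$2d4!:f6$0c6!:f7$0b7#0(hold4 b7)Y Y
$2b4!:f5$0d1!:f7$0b7#0(hold4 b7)!:f4!:f6$0c6 Y$2d4!:f6$0c6#0d4 Y$2b4!:f4$2d4!:f6$0c6 Y Y$2b4!:f4$0d0!:f3$0d1!:f5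
$0d1!:f6$0c6!:f7$0b7#0(hold4 b7)#0(hold0 d7)Y!:f6$0c6 Y Y!:f5$0d1!:f6$0c6 Y Y Y$2b4!:f1$0b1!:f0$0b0#0(hold0 c1)
#0(hold0 c1)!:f0$0b0!:f3$0d1!:f5$0d1!:f7$0b7#0(hold4 b7)!:f4!:f6$0c6 Y$2d4!:f6$0c6#0d4 Y$2b4!:f4$2d4!:f6$0c6 Y Y
$2b4!:f4!:f5$0d1 Y$2d4!:f5$0d1!:f6$0c6#0d4 Y Y$2b4!:f4$0d0!:f3$0d1!:f5$0d1!:f6$0c6 Y Y Y Y$2b4!:f4$0c4!:e6$0a6
!:e7(N [SL,FL,SL,SR,SR] [S2,S1])#0(hold1 c2)#0(hold1 c2)!:f1$0b1!:f0$0b0!:e7$0c6#0(hold0 c1)#0(hold0 c1)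
#2(hold0 c0)!:e7$0c6!:f0$0b0!:f3$0d1!:f5$0d1!:f6$0c6!:f7$0b7#0(hold4 b7)#0(hold0 d7)Y!:f6$0c6 Y Y!:f5$0d1!:f6
$0c6 Y Y Y!:f3$0d1!:f5$0d1!:f6$0c6 Y Y Y Y!:f0$0b0!:f3$0d1!:f5$0d1!:f6$0c6 Y Y Y Y!:f3$0d1 Y Y$2b4$2b2$2a5$2a3
$2a0"])
    (simp_all add: dead1_0110101112012112 dead1_0110102112011112 dead1_0110102112012112 dead1_11111221)

lemma dead1_0110101111012112: "dead s1 (Nd (Nd (Nd (Nd (Lf K0) (Lf K1)) (Nd (Lf K1) (Lf K0))) (Nd (Nd (Lf K1) (Lf K0)) (Nd (Lf K1) (Lf K1)))) (Nd (Nd (Nd (Lf K1) (Lf K1)) (Nd (Lf K0) (Lf K1))) (Nd (Nd (Lf K2) (Lf K1)) (Nd (Lf K1) (Lf K2)))))"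
  by (rule case1.dead_by_certificate[where es = "[E e1 0 0 1, E e2 0 0 1, E e3 1 0 0]" and ce = "!:e3!:e1$0a1!:e2$0a2 Z$0c2$0c1!:e1$0a1 Z!:e0$2c0!:e2$0a2 Z!:e5$0c1!:f2$0c2!:f4$0b4!:e6$0c2!:f7$0b7!:f1$0c1!:f0
!:f3(N [SL,SR,FL,SR,SL] [S1,S2])!:e7!:e4(N [SL,FL,SR,SL,SR] [S1,S2])!:f5!:f6 Y#0(hold2 b4)#0(hold4 d6)
#0(hold2 b4)#0(hold4 d5)(N [SL,FL,SL,SR,SR] [S2,S1])#0b7#0(hold3 c7)(N [SL,SL,FL,SL,SL] [S2,S1])!:e4!:e7
(N [SL,FL,SR,SL,SR] [S1,S2])!:f3!:f5!:f6 Y#0(hold2 b7)#0(hold4 d6)#0(hold2 b7)#0(hold4 d5)#0(hold2 c1)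
#0(hold4 d3)(N [SL,FL,SL,SL,SL] [S1])#0b4#0(hold4 c4)!:f3(N [SL,SL,FL,SR,SR] [S1])#0(hold2 c1)#0(hold2 c1)!:f5
$0d1!:f0$2d0#0(hold1 b4)#0(hold1 b4)!:f0$2d0#0(hold1 b4)#0(hold1 b4)!:f5$2d5!:f6$2d6#0(hold2 b4)#0(hold2 b4)!:f6
$2d6#0(hold2 b4)#0(hold2 b4)!:e4$2c4!:f6$0c6#0(hold2 b4)#0(hold2 b4)!:f6$0c6#0(hold2 b4)#0(hold2 b4)!:f7$0b7!:f5
$0d4!:f6$0d4#0(hold2 b7)#0(hold2 b7)!:f6$0d4#0(hold2 b7)#0(hold2 b7)!:e4$2c4!:e7$2c7!:e6$0c2#0(hold1 c2)!:f6$0c6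
#0(hold2 c6)!:f5$0d4!:f1$0c1#0(hold0 c1)!:f0$2d0 Y!:f3$0d1 Y Y!:f1$0c1#0(hold0 c1)!:f0$2d0!:f3$0d1 Y Y!:f3$0d1 Y
Y!:e6$0c2#0(hold1 c2)!:f3$2d3!:f1$0c1#0(hold0 c1)!:f6$0c6!:f0$2d0 Y!:f5$0d1 Y Y!:f5$0d1!:f0$2d0#0(hold1 d1)Y!:f0
$2d0 Y Y!:f1$0c1#0(hold0 c1)!:f0$2d0!:f5$0d1!:f6$0c6#0(hold0 d4)Y!:f6$0c6 Y Y!:f5$0d1!:f6$0c6 Y Y Y!:e7$2c7!:e6
$0c2#0(hold1 c2)!:f0$2d0!:f1$0c1#0(hold0 c1)!:f5$0d1!:f3$0d1#0(hold1 d1)!:f6$0c6 Y Y!:f3$0d1!:f6$0c6 Y Y!:f6$0c6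
Y Y!:f1$0c1#0(hold0 c1)!:f5$0d1!:f6$0c6!:f3$0d1#0(hold0 d7)Y!:f3$0d1 Y Y!:f3$0d1!:f6$0c6 Y Y Y!:e6$0c2
#0(hold1 c2)!:f3$2d3!:f1$0c1#0(hold0 c1)!:f5$0d1!:f0$2d0#0(hold1 d1)!:f6$0c6 Y Y!:f0$2d0!:f6$0c6 Y Y Y!:f1$0c1
#0(hold0 c1)!:f0$2d0!:f5$0d1!:f6$0c6 Y Y Y!:f5$0d1 Y Y$2b2$2a5$2a0$2a3"])
    (simp_all add: dead1_0110101112010112 dead1_0110101112012112)

lemma dead1_0001101111100100: "dead s1 (Nd (Nd (Nd (Nd (Lf K0) (Lf K0)) (Nd (Lf K0) (Lf K1))) (Nd (Nd (Lf K1) (Lf K0)) (Nd (Lf K1) (Lf K1)))) (Nd (Nd (Nd (Lf K1) (Lf K1)) (Nd (Lf K1) (Lf K0))) (Nd (Nd (Lf K0) (Lf K1)) (Nd (Lf K0) (Lf K0)))))"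
  by (rule case1.dead_by_certificate[where es = "[E e0 0 1 0, E e1 0 (-6) 0, E e2 0 1 0, E e3 0 1 1, E e4 0 1 1, E e5 1 1 0, E e7 0 1 1, E f0 0 1 1, E f1 1 1 1, E f2 0 1 0, E f3 (-1) 0 0, E f6 0 1 0, E f7 0 1 0]" and ce = "!:e0$0a0!:e1$0a1!:e2 Z!:f2$0b2!:f3 Z!:f6$0b6!:f7$0b7!:f0 Z!:f5$0b5!:e4$0a4!:e7 Z!:e3$0a3!:e6!:f1!:e5 Y Y$2a5#0d3
#0(hold2 d1)#0c2#0(hold3 c6)!:e5!:e6!:f1!:f4 Y Y$2b4#0(hold0 c3)#0(hold2 d1)#0(hold3 c3)#0(hold3 c3)#0(hold0 c3)
$2a5!:e5$2c5!:e3$0a3#0(hold4 c7)!:e6$2c6#0(hold2 c7)!:f1!:f4 Y#0(hold4 c6)$2b4 Y#0(hold4 d1)$2a5!:e5$0c4!:f4$0c4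
!:e6$0c4#0(hold4 c4)!:f1!:e7$0c6!:e3$0a3#0(hold3 c6)#0(hold3 c3)Y#0d0#0(hold3 d1)$2b4$2a5!:e5$2c5!:f4$2d4!:f1
$2d1#0(hold1 d5)!:e3$0a3#0(hold2 d1)#0(hold2 d1)$2b4$2a5!:f1$0d0#0(hold2 d0)!:f4$0d0!:e4$0a4#0(hold4 d0)
#0(hold4 d0)$2b4$2b7$2b6$2b3 Z$2a2$2a1$2a0"])
    (simp_all)

lemma dead1_01111221: "dead s1 (Nd (Nd (Nd (Lf K0) (Lf K1)) (Nd (Lf K1) (Lf K1))) (Nd (Nd (Lf K1) (Lf K2)) (Nd (Lf K2) (Lf K1))))"
  by (rule case1.dead_by_certificate[where es = "[E g4 (-3) 0 0, E g6 0 0 (-3)]" and ce = "!:g6$0e6!:g4 Z!:g2!:g7!:g5$0e5!:g1!:g0$0f0!:g3$0f3(N [SR,SL,SL,SR] [S0])$2f1$2e0#0e5#0e5$0f5#0e6#0e6#0e6#0e6!:g0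
$2f0!:g2!:g7!:g5$0e5!:g1!:g3$0f3(N [SR,SL,SL,SR] [S0])$2f1#0e5#0e5$0f5#0e6#0e6#0e6#0e6$2e0 Z"])
    (simp_all add: dead1_0110101111012112 dead1_0110101112012112)

lemma dead1_0001101111102110: "dead s1 (Nd (Nd (Nd (Nd (Lf K0) (Lf K0)) (Nd (Lf K0) (Lf K1))) (Nd (Nd (Lf K1) (Lf K0)) (Nd (Lf K1) (Lf K1)))) (Nd (Nd (Nd (Lf K1) (Lf K1)) (Nd (Lf K1) (Lf K0))) (Nd (Nd (Lf K2) (Lf K1)) (Nd (Lf K1) (Lf K0)))))"
  by (rule case1.dead_by_certificate[where es = "[E e4 (-2) (-2) 0, E e7 (-3) 0 0]" and ce = "!:e0$0a0!:e1$0a1!:e4 Z Z!:e5$0c4!:f4$0b4!:f0!:f5!:f6!:e6$0c4(N [SR,SR,FR,SR,FL] [S1,S0])$0c6#0(hold4 b4)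
#0(hold4 b4)#0b4#0b4#0(hold4 b4)#0(hold4 b4)!:e6$0c4!:e7 Z!:e2!:e3$0a3!:f2!:f0$2d0!:f6$0d4!:f7!:f1$0d3 Y!:f5$0d1
#0(hold3 d1)$0d5!:f5$0d4!:f1 Y Y#0(hold3 d1)Y$2b7$2d2$0d0!:f7!:f5$0d4!:f6$0d4!:f0$2d0!:f1 Y Y#0(hold3 d1)Y$0d6
$0d5!:f5$0d4!:f0$2d0!:f1!:f6$0d4 Y Y!:f3!:f6$0d4 Y Y#0d1$2b3#0(hold3 d1)!:f6$0d4!:f1$0d0 Y!:f3$0d1#0(hold4 d1)
$2b3 Y!:f0$2d0!:f6$0d4!:f1$2d1 Y!:f3$0d1#0(hold2 d1)$2b3 Y!:f6$0d4 Y Y$2b7$2c2$2c2#0(hold1 c4)$2a2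
(N [SL,FL,FR,SL,SR] [])!:e2$2c2!:e7$0c6!:e3$0a3!:f6$0c6!:f2!:f0$2d0!:f7!:f3$0d3!:f5$0d4 Y$0d5$2b3#0(hold3 c6)
$2b7$0d0#0(hold3 c6)#0(hold3 c6)!:f7$0d6!:f2$2d2!:f5$0d4!:f0$2d0!:f1 Y Y#0(hold3 d1)Y!:f0$2d0 Y Y!:f3$0d2!:f0
$2d0!:f1!:f5$0d4 Y$2d1#0(hold2 d2)#0(hold2 d1)!:f1$0d0 Y!:f5$0d1#0(hold4 d1)Y$2b3$2b7#0(hold1 c3)!:f7$0c7!:e3
$0a3!:f3!:f1!:f0$2d0!:f2$0d3!:f5$0d4 Y$2d1$0d2$0d0!:f5$0d4!:f6$0c6!:f0$2d0!:f2 Y Y$0d2 Y!:f0$2d0 Y Y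
(N [FR,SR,SL,SR,FR] [S0])$0d1!:f5$0d4#0(hold4 c7)#0(hold4 c7)$2b3!:f3$0c3!:f5$0d4!:f6$0c6!:f0$2d0!:f2!:f1 Y Y
#0(hold4 d1)!:f1 Y#0d1#0(hold4 d1)#0(hold4 d2)!:f1$0d0!:f2$0d0#0(hold2 d0)#0(hold3 d2)#0(hold4 d1)!:f1!:f0$2d0 Y
$0d0!:f0$2d0!:f2$2d2#0d1#0(hold2 d2)Y#0(hold4 d1)!:f1$2d1#0(hold4 d5)!:f0$2d0!:f2(N [FR,SR,FL,SR,SL] [S1,S0])
#0(hold2 d1)#0(hold2 d1)!:f2$0d0 Y!:f6$0c6#0(hold3 d2)Y$2b3$2b7$2a2$2a5$2a1$2a0"])
    (simp_all add: dead1_01111221)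

lemma dead1_0110102112212122: "dead s1 (Nd (Nd (Nd (Nd (Lf K0) (Lf K1)) (Nd (Lf K1) (Lf K0))) (Nd (Nd (Lf K1) (Lf K0)) (Nd (Lf K2) (Lf K1)))) (Nd (Nd (Nd (Lf K1) (Lf K2)) (Nd (Lf K2) (Lf K1))) (Nd (Nd (Lf K2) (Lf K1)) (Nd (Lf K2) (Lf K2)))))"
  by (rule case1.dead_by_certificate[where es = "[E f0 1 0 0]" and ce = "!:f0!:f1$0b1!:f2$0b2!:f3!:f4$0b4!:f5!:f7$0b7!:e0!:e1$0a1!:e2$0c0!:e4$0c0!:e3!:e7$0c3!:e5 Y!:f6$0b6 Y Y$2a5$2c3
!:e5!:e7$0c5!:f6$0b6 Y Y$2c5!:e7(N [SR,SL,SR,SR,FR] [S1,S2])!:f6$0b6!:e6$0a6 Y#0(hold0 c6)Y!:f6$0b6 Y Y$2a5$2a3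
$2c0$2c0$2c0!:e1$0a1!:e3!:e2$0c3!:e7$0c3!:e5!:e4$0c5!:f6$0b6 Y Y$0c4!:e4(N [SR,SL,SR,FL,SL] [S1,S2])!:f6$0b6!:e6
$0a6 Y#0(hold0 c6)Y!:f6$0b6 Y Y$2a5$2c3$0c2!:e5!:e4$0c5!:e7$0c5!:e2(N [SR,SL,FL,SR,SL] [S1,S2])!:f6$0b6!:e6$0a6 Y
#0(hold0 c6)Y!:f6$0b6 Y Y$2c5$0c4!:e2(N [SR,SL,FL,SR,SL] [S1,S2])!:e4(N [SR,SL,SR,FL,SL] [S1,S2])!:e6$0a6#0c0
#0c0!:e6$0a6(N [SL,FL,SL,SL,FL] [S0])!:e7$0c6#0c3 Y!:e4(N [SR,SL,SR,FL,SL] [S1,S2])!:e6$0a6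
(N [SL,FL,SL,SL,FL] [S1,S0])!:e7$0c6#0c5 Y!:e7(N [SR,SL,SR,SR,FR] [S1,S2])Y Y$2a5$2a3!:e3$0c1!:e5$0c1!:e2
(N [SR,SL,FL,SR,SL] [S1,S0])!:e4(N [SR,SL,SR,FL,SL] [S1,S0])!:e7(N [SR,SL,SR,SR,FR] [S1,S0])!:e6$0a6 Y!:f6$0b6
#0(hold0 c6)Y Y!:e7(N [SR,SL,SR,SR,FR] [S1,S0])Y Y!:e4(N [SR,SL,SR,FL,SL] [S1,S0])!:e7
(N [SR,SL,SR,SR,FR] [S1,S0])Y Y Y$2a5$2a3$2a0$2d3#0(hold1 b1)#0(hold1 b1)$2d0#0(hold1 b1)#0(hold1 b1)$2d0$2d0 Z Z"])
    (simp_all add: dead1_0110101112010112 dead1_0110102112010112 dead1_01111221)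

lemma dead1_0001100111122112: "dead s1 (Nd (Nd (Nd (Nd (Lf K0) (Lf K0)) (Nd (Lf K0) (Lf K1))) (Nd (Nd (Lf K1) (Lf K0)) (Nd (Lf K0) (Lf K1)))) (Nd (Nd (Nd (Lf K1) (Lf K1)) (Nd (Lf K1) (Lf K2))) (Nd (Nd (Lf K2) (Lf K1)) (Nd (Lf K1) (Lf K2)))))"
  by (rule case1.dead_by_certificate[where es = "[E e7 0 0 1]" and ce = "!:e0$0a0!:e1$0a1!:e2$0a2!:e7 Z Z!:e5$2c5!:e6$2c6!:e3$2c3!:e4$0a4#0(hold1 c7)#0(hold1 c7)!:f3$0b3!:f1!:f4$0b4!:f0
!:f2!:f5!:f6!:f7$0b7!:e4$0a4 Y Y$2d5#0(hold1 b4)$2d2#0(hold1 b4)$2d1(N [SL,SL,FL,FR,SL] [S1,S0])$2d0#0(hold1 b4)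
$0d0!:f0$2d0!:f2!:f5$0d4!:f6$0d4!:e4$0a4!:f7$0b7#0(hold2 b7)#0(hold0 d4)Y$2d2$2d1(N [SL,SL,FL,FR,SL] [S1,S0])
#0(hold2 d2)$0d0(N [SL,SL,FL,SL,FR] [S1,S0])!:f0$2d0#0(hold2 d1)!:f2$0d0#0(hold2 b3)#0(hold2 b3)!:f4$0b4!:f0!:f1
$2d1!:f2$2d2!:f5!:f6!:f7$0b7!:e4$0a4 Y Y$2d5#0(hold1 b4)#0(hold1 b4)#0(hold1 b4)#0(hold1 b4)$2d0$2d0#0(hold1 b4)
#0(hold1 b4)!:f5$0d4!:f7$0b7(N [SL,SL,FR,SL,FR] [S1,S0])!:f1$2d1!:f0$2d0!:f6$0d4!:e4$0a4#0(hold0 d4)!:f2$2d2 Y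
#0(hold4 d2)!:e4$0a4!:f2$2d2 Y Y Y!:f2$0d0#0(hold2 d0)!:f6$0d2!:e4$0a4 Y Y!:e4$0a4 Y Y!:f0$2d0#0(hold3 d1)!:f6
$0d4!:f2$0d0!:e4$0a4 Y Y Y!:e4$0a4!:f2$0d0 Y Y Y!:f2$2d2!:f6$0d4!:f7$0b7#0(hold2 b7)!:e4$0a4!:f0$2d0!:f1$2d1 Y Y
Y!:f0$2d0 Y Y!:e4$0a4!:f0$2d0 Y Y Y!:f6$0d2!:f0$2d0#0(hold4 d2)!:e4$0a4!:f1$0d0 Y!:f7$0b7#0(hold2 b7)Y Y!:f7$0b7
$2d7!:f0$2d0!:e4$0a4!:f1$2d1 Y Y Y!:e4$0a4 Y Y$2a6$2a5$2a2$2a1$2a0"])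
    (simp_all add: dead1_01111221)

lemma dead1_0110102112112122: "dead s1 (Nd (Nd (Nd (Nd (Lf K0) (Lf K1)) (Nd (Lf K1) (Lf K0))) (Nd (Nd (Lf K1) (Lf K0)) (Nd (Lf K2) (Lf K1)))) (Nd (Nd (Nd (Lf K1) (Lf K2)) (Nd (Lf K1) (Lf K1))) (Nd (Nd (Lf K2) (Lf K1)) (Nd (Lf K2) (Lf K2)))))"
  by (rule case1.dead_by_certificate[where es = "[E f2 0 (-3) (-3), E f5 0 0 (-3)]" and ce = "!:f2!:f6$0b6!:f1$0b1!:f0!:f3!:e2$0d2!:f4$0b4!:f5!:f7$0b7!:e1$0a1!:e0!:e3(N [SR,SR,FL,SR,SL] [])!:e4$0c0!:e5!:e6
$0a6 Y!:e7$0c5(N [FR,SR,SL,SR,SL] [S0,S2])$2c5!:e7(N [SR,SL,SR,SR,FR] [S1,S2])!:e6$0a6 Y#0(hold0 c6)Y$2a5$2c0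
$2a3!:e5!:e4$0c5!:e7$0c5!:e3!:e6$0a6 Y(N [FR,SR,SL,SR,SL] [S0])!:e6$0a6 Y#0(hold0 c6)$2a3$2c5$0c4!:e3!:e7$0c3
!:e4(N [SR,SL,SR,FL,SL] [S1,S2])!:e6$0a6 Y#0(hold0 c6)Y$2c3!:e6$0a6!:e4(N [SR,SL,SR,FL,SL] [S1,S2])!:e7 Y#0c5
#0(hold3 c7)#0(hold4 c4)!:e4$2c4 Y!:e7$0c6 Y Y$2a3$2a5$2a0!:e0$2c0!:e3$0c1!:e5$0c1!:e7
(N [SR,SL,SR,SR,FR] [S1,S0])!:e4(N [SR,SL,SR,FL,SL] [S1,S0])!:e6$0a6 Y#0(hold0 c6)Y!:e4
(N [SR,SL,SR,FL,SL] [S1,S0])Y Y$2a5$2a3$2a0$2d3#0(hold1 b1)Z$2d0$0c2#0(hold1 b1)$2d2#0(hold1 b1)$0d0!:f0$2d0!:f3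
$0d1!:f5$0d1!:f4$0b4!:e4!:e6$0a6!:f7$0b7!:e7!:e5$0c5!:e1$0a1!:e0!:e2$0c0!:e3 Y#0(hold0 d1)$2a3$2c0#0(hold0 d1)
$2a0!:e0$2c0!:e3$0c1!:e2 Y Y$0c2$2a3$2a0$2a5#0(hold4 b7)#0(hold4 b7)(N [FR,FR,SL,SR,SL] [S1,S0])$2c4#0(hold3 b4)
#0(hold3 b4)!:f7$0b7(N [FR,FR,SL,SR,SL] [S0])!:e4$2c4!:e5!:e1$0a1!:e0!:e7$2c7!:e3!:e2$0c2!:e6$0a6 Y Y$2c0
(N [FR,SL,SR,SL,FR] [])$2a3$2c5(N [FR,SL,SR,FL,SR] [])$2a0$0c1!:e6$0a6#0(hold0 d4)#0(hold0 d4)$2a5!:e0$2c0!:e5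
$0c4!:e1$0a1#0(hold0 d1)!:e3$0c1!:e7$2c7#0(hold0 d7)!:e2!:e6$0a6 Y$2c2 Y$0c2$2a3$2a5$2a0 Z$2d2$0d0$2d2 Z Z"])
    (simp_all add: dead1_0001100111121001 dead1_0001101111102110 dead1_0110101112010112 dead1_0110102112010112 dead1_01111221)

lemma dead1_0001100111112111: "dead s1 (Nd (Nd (Nd (Nd (Lf K0) (Lf K0)) (Nd (Lf K0) (Lf K1))) (Nd (Nd (Lf K1) (Lf K0)) (Nd (Lf K0) (Lf K1)))) (Nd (Nd (Nd (Lf K1) (Lf K1)) (Nd (Lf K1) (Lf K1))) (Nd (Nd (Lf K2) (Lf K1)) (Nd (Lf K1) (Lf K1)))))"
  by (rule case1.dead_by_certificate[where es = "[E e7 (-3) (-3) 0, E f3 0 (-3) 0, E f6 3 0 0]" and ce = "!:e0$0a0!:e1$0a1!:e2$0a2!:f4$0b4!:f0!:f5!:f6!:f7!:e7$0d7!:f3$0d7 Z$0d3$0c7!:e4$0a4!:f2!:e6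
(N [SR,SL,SR,SR,FL] [S1,S0,S2,S1,S0])!:f3$0d2!:e7 Z Z!:e3$2c3#0(hold3 c7)!:e5$2c5 Y$2a5$2d2$2a6!:f1!:e5
(N [SR,SL,SR,FL,SR] [S1,S0,S2,S1,S0])!:f3$0d1!:e7 Z Z!:e3$2c3#0(hold4 c7)Y$2d1$2a5!:f3(N [FR,FR,SL,SL,SL] [])
!:e3!:e7 Z Z$2c3#0b3#0(hold2 c3)!:e3$2c3#0(hold4 d3)!:e7$0c3 Y!:e5$2c5!:e6$2c6 Y$2a6$2a5$2d0$2d0!:e5$0c4!:e6$0c4
!:e7(N [SR,SL,FR,SR,SR] [S1,S0])!:f3!:f1$0d1!:f2$0d2 Y$2d0$2d0 Z!:e3$2c3!:f1$2d1#0(hold4 d3)$2d0#0(hold1 c3)!:e3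
$2c3#0(hold1 c7)(N [SL,FL,SL,SL,SL] [])$2a6$2a5$2d5#0(hold1 b4)#0(hold1 b4)#0(hold1 b4)#0(hold1 b4)#0(hold1 b4)
#0(hold1 b4)!:f6$0d4!:e7 Z Z!:e5$2c5!:e6$2c6!:e3$2c3!:e4$0a4#0(hold1 c7)#0(hold1 c7)!:e4$0a4!:f3$0c3 Z!:f5$0d4
!:f7$0c7#0(hold2 c7)!:f0$2d0#0(hold0 d4)!:f1$0d0!:f2$0d0#0(hold2 d0)Y!:f2$0d0 Y Y!:f7$0c7#0(hold2 c7)!:f2$2d2
!:f0$2d0!:f1$2d1 Y Y Y!:f0$2d0#0(hold4 d2)!:f1$0d0 Y Y(N [SL,FL,SL,SL,SL] [])$2a6$2a5!:e6$2c6!:e7 Z Z!:e5$2c5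
!:f7$0c7(N [SL,SL,FR,FR,SL] [])!:f3$2d3 Z!:e4$0a4!:e3$2c3#0(hold1 c7)!:f5$0d4!:f1$2d1!:f0$2d0!:f2$2d2 Y Y Y!:f0
$2d0#0(hold3 d1)!:f2$0d0 Y Y!:f0$2d0!:f1$2d1 Y!:f2$2d2 Y Y Y!:e3$2c3#0(hold1 c7)(N [SL,FL,SL,SL,SL] [])$2a5$2a6
$2a2$2a1$2a0"])
    (simp_all add: dead1_0001100111121001 dead1_0001100111122112 dead1_01101001 dead1_0110101112010112 dead1_01111221)

lemma dead1_0001111011120111: "dead s1 (Nd (Nd (Nd (Nd (Lf K0) (Lf K0)) (Nd (Lf K0) (Lf K1))) (Nd (Nd (Lf K1) (Lf K1)) (Nd (Lf K1) (Lf K0)))) (Nd (Nd (Nd (Lf K1) (Lf K1)) (Nd (Lf K1) (Lf K2))) (Nd (Nd (Lf K0) (Lf K1)) (Nd (Lf K1) (Lf K1)))))"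
  by (rule case1.dead_by_certificate[where es = "[E e4 0 0 3, E e5 (-1) 0 0, E f0 (-3) (-3) 0, E f4 0 (-3) 0]" and ce = "!:e0$0a0!:f4!:f0!:e4$0d4 Z$0c4!:e4 Z Z$0c4$0d0!:e4 Z Z!:f0 Z Z!:f1$0d0!:f3$0b3#0(hold1 b3)!:f5!:e5$0c4!:e1!:e3
$0a3!:f7$0d3!:f2$0d0!:e2(N [SL,SL,FL,SL,SL] [S0])#0(hold2 d0)$2a2!:e2$2c2!:e7!:e6$0c4(N [SL,FL,SL,SL,SL] [S0])
$0c6!:e6$0c4#0(hold1 c4)!:f6$0c6#0(hold3 c6)Y$2a7$2a2$2d5$2c1(N [FR,SR,SR,FL,SR] [S1,S0])$2a1$0c5!:e1!:e5$0c4
(N [FR,SL,SL,FL,SR] [S1,S0])$2c1#0(hold3 d0)$2a1(N [SL,FR,SR,FL,SL] [])!:e1$2c1!:f3$0b3#0(hold1 b3)!:e5$0c4!:f5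
$0d1#0(hold3 c4)#0(hold3 c4)!:e7$0c5!:f5$0c5(N [SL,SL,SL,FL,FR] [])!:f2$0d0!:e2!:e3$0a3!:e6$0c4!:f6!:f7$0d3 Y
$2d6(N [FR,SL,SL,SR,FL] [S1,S0])#0(hold4 d6)$2c2$2c2!:f6!:e6$0c4(N [FR,SR,SR,SR,FL] [S1,S0])$0c6#0(hold4 d0)
#0(hold4 d0)$2a2!:e2$2c2!:f6$0d2!:e6$0c4#0(hold4 c4)(N [SL,SL,SL,FR,FL] [])!:e6$0c4#0(hold4 c4)!:f7$0d3
(N [SL,FR,FR,SL,SL] [])!:e3$0a3 Y Y$2a2$2a7$2a1$2b4$2a0"])
    (simp_all add: dead1_0001100111122112 dead1_0001101111102110 dead1_01111221)

lemma dead1_0110112112211221: "dead s1 (Nd (Nd (Nd (Nd (Lf K0) (Lf K1)) (Nd (Lf K1) (Lf K0))) (Nd (Nd (Lf K1) (Lf K1)) (Nd (Lf K2) (Lf K1)))) (Nd (Nd (Nd (Lf K1) (Lf K2)) (Nd (Lf K2) (Lf K1))) (Nd (Nd (Lf K1) (Lf K2)) (Nd (Lf K2) (Lf K1)))))"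
  by (rule case1.dead_by_certificate[where es = "[E e2 (-3) 0 0, E e7 (-3) (-3) 0, E f1 0 (-3) 0, E f5 0 3 0]" and ce = "!:f5$0b5!:e5!:f4!:f6$0b6!:f7!:f1$0b1!:e7 Z Z$2c5!:e1$2c1!:f0$2d0!:f3$0d1!:f2$0b2!:e2!:e7 Z Z$2c5#0(hold2 b2)
#0(hold2 b2)!:e0!:e2$2c2!:e3!:e4$0c4!:e6$0a6 Y!:e7$0c6(N [FR,SL,SR,SL,SR] [S1,S0])$2c3$2c0
(N [FR,SL,FL,SL,SL] [])$2a3$2c0!:e3!:e2$2c2(N [FR,SL,FL,SR,SR] [])$0c2!:e2$2c2(N [FR,SL,FL,SL,SL] [])!:e6$0a6
!:e4!:e7 Y(N [SL,FL,SL,FR,SR] [S1,S0])$2c5(N [SL,FL,SL,SL,FL] [S1,S0])$0c4!:e4$2c4!:e7$0c6 Y$2c5$0c4$2a3$2a0$0d3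
$0d0$0c1#0(hold2 b5)#0(hold2 b5)$2d4#0(hold2 b5)#0(hold2 b5)#0(hold2 b5)#0(hold2 b5)!:e7 Z Z!:e3$2c3!:f1$0b1 Z
!:f2$0b2!:e2 Z!:e6$0a6(N [SL,FL,SL,FR,SR] [S0])!:f3$0d1!:f0$2d0#0(hold2 b2)#0(hold2 b2)(N [SL,SL,FL,FR,SR] [S0])
!:e0$2c0!:f0$2d0(N [SL,SL,FL,SL,FL] [S1,S0])!:f3$0d1#0(hold2 b2)#0(hold2 b2)$2a0!:e2$2c2!:e6$0a6
(N [SL,FL,SL,FR,SR] [S0])!:f7$0c7!:f3$0d1!:e5$2c5#0(hold4 c7)!:e0!:e1$2c1!:f0$2d0(N [FR,SL,FL,SL,SL] [])$2c0$2c0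
!:f6$0b6!:f0$2d0#0(hold0 d2)!:f4$0d0!:e4$2c4 Y(N [SL,SL,SL,FL,FL] [])Y!:f0$2d0!:e1$2c1(N [FR,SL,FL,SL,SL] [])
!:f4$2d4!:e4$2c4 Y Y Y!:f4$0d0!:e4$2c4!:e1$2c1 Y Y(N [SL,SL,SL,FL,FL] [])!:e1$2c1 Y!:e4$2c4 Y Y$2a0
(N [SL,SL,SL,FR,FR] [])!:e0!:e1$2c1!:e4$2c4!:f0$2d0!:f3$0d1(N [FR,SL,FL,SL,SL] [])!:f4$2d4!:e5$2c5!:f6$0b6#2d6 Y
Y!:e5$2c5 Y Y$2c0$2c0$2c0!:e1$2c1!:f3$0d1!:f0$2d0(N [FR,SL,FL,SL,SL] [])!:f4$0d0!:e4$2c4!:e5$2c5 Y Y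
(N [SL,SL,SL,FL,FL] [])!:e5$2c5 Y Y!:e4$2c4!:e5$2c5!:f0$2d0#0c0!:f4$0d0!:f6$0b6 Y Y Y!:f4$2d4 Y Y!:f4$0c4!:e5
$0c4#0(hold3 c4)!:f0$2d0 Y(N [SL,SL,SL,FL,FL] [])!:e5$0c4!:f0$2d0 Y!:f6$0b6$2d6 Y Y!:e5$0c1
(N [SL,FL,SL,SR,FR] [])!:f6$0b6!:f4$2d4!:e4$2c4 Y!:f0$2d0 Y(N [SL,SL,SL,FL,FL] [])$2d6!:f4$2d4!:f0$2d0!:e4$2c4 Y
!:f3$0d1 Y Y!:e4$2c4!:f3$0d1 Y Y(N [SL,SL,SL,FL,FL] [])!:e4$2c4 Y!:f0$2d0 Y!:f3$0d1 Y Y$2a0!:e0$2c0!:e6$0a6!:e4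
!:e5$2c5(N [SR,FL,FR,SL,SL] [S0])$2c4#0(hold1 a6)#0(hold1 a6)!:e1$2c1!:e4$2c4!:f6$0b6!:f7$0c7!:e5$2c5
#0(hold4 c7)!:f3$0d1!:f4$2d4 Y Y(N [SL,SL,SL,FR,FR] [])!:f4$2d4!:e5$2c5!:f0$2d0 Y!:f3$0d1 Y Y Y$2d6!:f4$2d4!:f3
$0d1!:e5$2c5!:f0$2d0!:f7$0c7#0(hold4 c7)Y Y!:f7$0c7!:f0$2d0 Y Y Y!:f0$2d0!:e5$2c5 Y!:f7$0c7 Y Y Y!:f7$0c7!:e5
$2c5#0(hold4 c7)!:f3$0d1 Y(N [SL,SL,SL,FR,FR] [])!:e5$2c5!:f0$2d0 Y!:f3$0d1 Y Y Y!:e5$0c4!:f4$0c4#0(hold3 c4)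
!:f7$0c7#0(hold4 c7)!:f6$0b6$2d6!:f3$0d1!:f0$2d0 Y Y!:f0$2d0 Y Y!:f7$0c7!:f3$0d1!:f6$0b6!:f4$0c4!:f0$2d0 Y Y Y
!:f0$2d0!:f4$0c4 Y Y Y(N [SL,SL,SL,FR,FR] [])!:f4$0c4!:f0$2d0!:f3$0d1 Y!:f6$0b6 Y Y(N [SL,SL,SL,FL,FL] [])!:f0
$2d0 Y!:f3$0d1 Y!:f6$0b6$2d6 Y!:e5$0c1(N [SL,FL,SL,SR,FR] [])!:f6$0b6!:f4$2d4!:f3$0d1!:f0$2d0!:f7$0c7!:e4$2c4 Y Y
Y!:e4$2c4!:f7$0c7 Y Y Y!:f7$0c7(N [SL,SL,SL,FR,FR] [])!:e4$2c4!:f0$2d0 Y Y!:f0$2d0 Y Y!:f7$0c7!:f3$0d1!:e4$2c4 Y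
!:f0$2d0 Y Y(N [SL,SL,SL,FR,FR] [])$2d6!:f3$0d1!:f4$2d4!:e4$2c4!:f0$2d0!:f7$0c7 Y Y Y!:f0$2d0 Y Y!:e4$2c4!:f7
$0c7!:f0$2d0 Y Y Y!:f0$2d0!:f7$0c7 Y Y Y!:f7$0c7(N [SL,SL,SL,FR,FR] [])!:e4$2c4!:f0$2d0!:f4$2d4 Y Y Y!:f0$2d0 Y Y
$2a0$2a3"])
    (simp_all add: dead1_0110102112010112 dead1_01111221 dead1_11111221)

lemma dead1_00011001: "dead s1 (Nd (Nd (Nd (Lf K0) (Lf K0)) (Nd (Lf K0) (Lf K1))) (Nd (Nd (Lf K1) (Lf K0)) (Nd (Lf K0) (Lf K1))))"
  by (rule case1.dead_by_certificate[where es = "[E g3 (-1) 0 0, E g4 0 0 1, E g7 (-1) 0 0]" and ce = "!:g0$0e0!:g1$0e1!:g2$0e2!:g4$0e4 Z!:g5$0f4!:g6$0f4!:g3 Z!:g7 Z(N [SL,SL,SL,SL] [])#0f7!:g7$0f3#0f3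
(N [SL,SL,SL,SL] [])$2e6$2e5$2e2$2e1$2e0"])
    (simp_all add: dead1_0001100111112111 dead1_0001100111122112)

lemma dead1_11122112: "dead s1 (Nd (Nd (Nd (Lf K1) (Lf K1)) (Nd (Lf K1) (Lf K2))) (Nd (Nd (Lf K2) (Lf K1)) (Nd (Lf K1) (Lf K2))))"
  by (rule case1.dead_by_certificate[where es = "[E g0 1 1 1, E g1 10 1 1, E g2 1 (-8) (-8), E g3 0 (-8) 1, E g4 0 10 1, E g5 1 1 1, E g6 1 1 1, E g7 0 (-8) 1]" and ce = "!:g4$0e4!:g0!:g5!:g6!:g7$0e7!:g3$0e3!:g1!:g2(N [FR,SL,SL,SL] [])Z$2f0 Z$2f0!:g1$2f1!:g2$2f2 Z$2f0$2f0$2f5#0e4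
#0e4#0e4#0e4#0e4#0e4!:g3$0e3!:g1!:g0$2f0!:g2!:g5$0f4!:g6$0f4!:g7$0e7 Z(N [SR,SL,SL,SR] [S0])$2f2$2f1 Z Z$0f0 Z Z
!:g1$2f1!:g2$2f2 Z Z!:g2$2f2 Z Z"])
    (simp_all add: dead1_00011001 dead1_0110112112211221)

lemma dead1_0110102111212122: "dead s1 (Nd (Nd (Nd (Nd (Lf K0) (Lf K1)) (Nd (Lf K1) (Lf K0))) (Nd (Nd (Lf K1) (Lf K0)) (Nd (Lf K2) (Lf K1)))) (Nd (Nd (Nd (Lf K1) (Lf K1)) (Nd (Lf K2) (Lf K1))) (Nd (Nd (Lf K2) (Lf K1)) (Nd (Lf K2) (Lf K2)))))"
  by (rule case1.dead_by_certificate[where es = "[E f0 1 0 (-1), E f1 0 0 1, E f2 0 0 1, E f4 0 0 1, E f5 0 0 (-1), E f6 0 0 (-1)]" and ce = "!:f2$0b2!:f0!:f4$0b4!:f1 Z Z$2d0$2d0!:f1 Z Z!:f3$0d1!:f5$0d1#0(hold1 d1)Z(N [SL,FR,FL,SL,SL] [S0])Z!:f4$0b4!:f0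
$2d0!:f1 Z Z!:f3$0d1(N [SL,FR,FL,SL,SR] [])!:e3$2c3!:f5$0d1!:e1$0a1#0(hold3 d1)!:e0$2c0!:e4!:e5$0c1!:e6$0a6!:f6
$0b6!:f7$0b7(N [SL,FR,SR,SL,FR] [S1,S0])!:e7$2c7!:e2$2c2 Y Y!:e2$2c2 Y Y Z$2c4$2a5#0(hold3 b4)#0(hold3 b4)$2a0 Z
$2a3 Z!:f6$0b6!:e3!:e1$0a1!:e2$2c2!:f3$0d2!:f0$2d0!:f1!:f5$0d4!:f7$0b7(N [FR,FR,SL,SL,SR] [S1,S0])!:e6$0a6!:e7
$2c7#2d6$2c3$2d6$2d1!:f5$0d4!:f7$0b7(N [FR,FR,SL,SL,SR] [S1,S0])!:e6$0a6#0(hold0 d2)$2d6 Z#0(hold2 d1)!:e0$2c0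
!:f1$0d0 Z!:f5$0d1!:f7$0b7#0(hold4 d1)#0(hold4 d1)Z$2a0$2c3$0c2$0c1!:f3$0d2!:f0$2d0!:f7$0b7!:f5$0d4!:f1
(N [FR,FR,SL,SL,SR] [S1,S0])(N [FR,FR,SL,SL,SR] [S1,S0])#0(hold1 d1)!:f1$2d1 Z(N [SL,FR,FL,SL,SR] [])!:e6$0a6
!:e2$2c2#0(hold0 d2)!:e0$2c0!:e4$2c4(N [FR,SL,SR,SL,FL] [])!:e7$2c7(N [FR,SL,SR,FR,SR] [])#2(hold1 c6)$2a0$2d6
!:e0$2c0!:f1$0d0 Z!:f5$0d1!:e1$0a1#0(hold4 d1)!:e5$0c1!:f7$0b7!:e7!:e6$0a6!:e4$2c4!:e2$2c2 Y Y!:e2$2c2 Y Y$0c6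
#0(hold4 b7)#0(hold4 b7)(N [SL,FR,SL,SL,FR] [])$2a5 Z$2a0!:f7$0b7!:f5$0d4!:f1$2d1(N [SL,FR,SL,SL,FR] [S1,S0])
(N [SL,FR,SR,SL,FR] [S1,S0])!:e5$2c5!:e7!:e6$0a6!:f0$2d0!:f1$2d1 Z!:e1$0a1!:e0!:e2$2c2!:e4$2c4
(N [FR,SL,SL,SL,FL] [])$2c0$2c0!:e4$2c4!:e2$2c2#0c0 Y!:e2$2c2 Y Y$2a0(N [SL,SL,SL,SR,FR] [S0,S2])Z$0c6
#0(hold4 b7)#0(hold4 b7)$2a5!:e6$0a6!:e2$2c2!:e7$2c7!:e0!:e1$0a1!:e4$2c4!:f0$2d0(N [FR,SL,SL,SL,FL] [])$2c0$2c0
$2c0!:e4$2c4!:f0$2d0(N [FR,SL,SL,SL,FL] [])!:f1$0d0 Z!:f5$0d1!:e5(N [FR,SL,FR,SL,SR] [])(N [FR,SL,FR,SL,SR] [])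
$2a5 Z(N [SL,FL,SL,SL,FL] [S0])$2a0(N [SL,FL,SL,FR,SR] [S0])!:e0$2c0!:e4$2c4(N [SL,FL,SL,SL,FL] [S1,S0])!:e7$2c7
(N [SL,FL,SL,FR,SR] [S1,S0])#2(hold1 c6)$2a0$2d6$2a3!:f0$2d0!:f1 Z Z!:f5$0d1(N [SL,FR,SL,FL,SR] [])Z Z"])
    (simp_all add: dead1_0110102112112122 dead1_01111221 dead1_11111221 dead1_11122112)

lemma dead1_0001111011122221: "dead s1 (Nd (Nd (Nd (Nd (Lf K0) (Lf K0)) (Nd (Lf K0) (Lf K1))) (Nd (Nd (Lf K1) (Lf K1)) (Nd (Lf K1) (Lf K0)))) (Nd (Nd (Nd (Lf K1) (Lf K1)) (Nd (Lf K1) (Lf K2))) (Nd (Nd (Lf K2) (Lf K2)) (Nd (Lf K2) (Lf K1)))))"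
  by (rule case1.dead_by_certificate[where es = "[E e4 0 0 2, E e5 2 0 2, E e6 2 0 2, E e7 (-5) 0 0, E f0 0 0 2, E f1 2 0 (-5), E f2 (-6) 0 (-5), E f3 0 0 2, E f5 0 0 2, E f6 0 0 2, E f7 2 0 (-12)]" and ce = "!:e0$0a0!:f3$0b3!:f1!:f2!:f5$0b5!:f6$0b6!:e7 Z!:f7!:f0!:e1(N [SR,SL,FL,FL,SR] [S1,S0])!:e2
(N [SR,SL,FL,SR,FL] [S1,S0])!:e4 Z Z!:e5$0c4 Z!:e6$0c4 Z!:e3$0a3!:f4$0b4 Y$2d0 Y$2a2$2a1!:e4 Z Z!:f4$0b4
(N [SL,SL,SL,FL,FL] [S1,S0])(N [SR,FR,SL,SL,SR] [S2])$0d0#0(hold1 b3)Z$2a7$2d2$2d1#0(hold1 b3)#0(hold1 b3)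
#0(hold1 b3)#0(hold1 b3)!:f1$2d1!:f7$0d3!:f5$0b5(N [SR,FR,SR,SL,FR] [])!:f2$2d2!:f6$0b6(N [SR,FR,SR,FR,SL] [])
!:e1!:e3$0a3!:e2(N [SL,FL,FL,SL,SL] [])!:e5$2c5!:e7!:e6$2c6(N [FR,SL,SR,FR,SR] [])$0c6#0(hold0 d3)$2a7$2c1$2a2
$2c1!:e3$0a3!:e2!:e6$2c6!:e7!:e5$2c5(N [FR,SL,SR,SR,FR] [])$0c5#0(hold0 d3)$2a7$2c2#0(hold0 d3)$2a2!:e2$2c2!:e7
$0c3!:e5$2c5(N [FR,SL,SR,SL,FR] [])!:e6$2c6(N [FR,SL,SR,FR,SL] [])!:e4$2c4#0(hold1 c5)!:f0!:f4$0b4 Y$2d0!:f4$0b4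
#0d0 Y#0(hold2 d0)$2a7$2a2$2a1!:e2$2c2!:e5$2c5!:e7 Z!:e1!:e3$0a3(N [FR,SL,SL,SL,FR] [])$2c1!:e3$0a3
(N [FR,SL,SL,SL,FR] [])(N [FR,SL,SR,SL,FR] [])$2a1$2a7!:e1$2c1!:e7$0c5!:e3$0a3(N [FR,SL,SL,SR,FR] [])!:e4$2c4
!:e6(N [FR,FL,SR,SR,SL] [S1,S0])#0(hold1 c5)#0(hold1 c5)!:e6$0c4(N [FR,FL,SL,SR,SL] [S1,S0])!:f4$0b4!:f0$2d0 Y
#0(hold3 d0)Y$2a7$2a1$2a2 Z!:e1$2c1!:f7$0d3!:f2$2d2!:f6$0b6(N [SR,FR,SR,FR,SL] [])!:e6$2c6!:e7 Z!:e2!:e3$0a3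
(N [FR,SL,SL,FR,SL] [])$2c2!:e3$0a3(N [FR,SL,SL,FR,SL] [])(N [FR,SL,SR,FR,SL] [])$2a2$2a7!:e2$2c2!:e7$0c6!:e3
$0a3(N [FR,SL,SL,FR,SR] [])!:e4$2c4!:e5(N [FR,FL,SR,SL,SR] [S0])#0(hold1 c6)#0(hold1 c5)!:e5$0c4
(N [FR,FL,SL,SL,SR] [S0])!:f4$0b4!:f0$2d0 Y#0(hold4 d0)Y$2a7$2a2!:e2$2c2!:e4 Z Z!:e5$0c4 Z!:e6$0c4 Z!:e7$0c5!:f0
$2d0 Z!:f5$0b5 Z!:f6$0b6 Z!:f4$0b4$2d4!:e3$0a3 Y Y$2a7$2a2 Z$2a1$2a0"])
    (simp_all add: dead1_00011001 dead1_0110102112112122 dead1_01111221 dead1_11111221 dead1_11122112)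

lemma dead1_01101021: "dead s1 (Nd (Nd (Nd (Lf K0) (Lf K1)) (Nd (Lf K1) (Lf K0))) (Nd (Nd (Lf K1) (Lf K0)) (Nd (Lf K2) (Lf K1))))"
  by (rule case1.dead_by_certificate[where es = "[E g0 4 1 0, E g1 0 (-5) 1, E g2 (-2) (-2) 1, E g3 4 1 0, E g4 (-2) (-2) 1, E g5 1 1 0, E g6 0 1 1, E g7 (-2) (-2) 1]" and ce = "!:g0!:g1$0e1!:g2!:g3(N [SR,FL,SR,SL] [])!:g4$0f0 Z$2f0$2e3!:g4!:g3!:g7 Z Z$2f3 Z$2e3!:g3!:g7 Z Z$2f3 Z$2e3$2f0
$2f0$2f0!:g1$0e1!:g3!:g2!:g7$0f3 Z$2f3!:g7 Z Z$2f3$0f2!:g2 Z Z!:g4 Z Z!:g5$0f4!:g7 Z Z!:g6$0e6#0f2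
(N [SL,SL,SL,SL] [])$2e5$2e3!:g3$0f1!:g5$0f1!:g6$0e6!:g2!:g4!:g7 Z Z(N [SL,SL,SL,SL] [])!:g7 Z Z
(N [FR,SL,SR,SL] [S1,S0])!:g7(N [SL,SL,SR,SR] [S0])(N [FR,SL,SR,SL] [S0])(N [SL,SL,SL,SL] [])!:g4!:g7 Z Z
(N [FR,SR,SL,SL] [S1,S0])!:g7 Z Z#0f7(N [SL,SL,SL,FL] [S0])!:g4!:g7(N [SL,SR,SL,SR] [S1,S0])(N [FR,SR,SL,SL] [])
(N [SL,SL,SL,SL] [S1])(N [SL,SL,SL,FL] [S1,S0])!:g7(N [SL,SL,SR,SR] [S2,S1])#0f2#0f2!:g2$2f2!:g4$2f4!:g7$0f6 Z
(N [FR,SL,SL,SL] [S1,S0])!:g7$0f6(N [FR,SL,SR,SR] [S0])(N [SL,SL,SL,SL] [])!:g4$2f4!:g7$0f6(N [FR,SR,SL,SR] [])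
(N [SL,SL,SL,SL] [S1])!:g7$0f6(N [SL,SL,SR,SR] [S2,S1])(N [SL,SL,SL,SL] [])$2e5$2e3$2e0"])
    (simp_all add: dead1_00011001 dead1_0110102111212122 dead1_0110102112010112 dead1_0110102112012112 dead1_0110102112112122 dead1_0110102112212122 dead1_01111221 dead1_11122112)

lemma dead1_11122221: "dead s1 (Nd (Nd (Nd (Lf K1) (Lf K1)) (Nd (Lf K1) (Lf K2))) (Nd (Nd (Lf K2) (Lf K2)) (Nd (Lf K2) (Lf K1))))"
  by (rule case1.dead_by_certificate[where es = "[E g0 0 (-1) (-1), E g1 0 1 1, E g2 0 1 1, E g3 0 0 (-3), E g4 0 (-1) 0, E g5 0 1 1]" and ce = "!:g3$0e3!:g1!:g2!:g5$0e5!:g6$0e6!:g7!:g0!:g4$0e4(N [SR,SL,SL,SL] [])$2f0!:g4$0e4 Z(N [FR,SL,SL,SR] [S1])$0f0#0e3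
#0e3$2f2$2f1#0e3#0e3#0e3#0e3!:g0!:g4$0e4 Z$2f0 Z Z"])
    (simp_all add: dead1_0001111011122221 dead1_01101021)

lemma dead1_00011110: "dead s1 (Nd (Nd (Nd (Lf K0) (Lf K0)) (Nd (Lf K0) (Lf K1))) (Nd (Nd (Lf K1) (Lf K1)) (Nd (Lf K1) (Lf K0))))"
  by (rule case1.dead_by_certificate[where es = "[E g1 4 3 0, E g2 4 3 0, E g3 0 0 3, E g4 3 2 3, E g5 0 (-1) 0, E g6 0 0 1, E g7 0 (-1) 0]" and ce = "!:g0$0e0!:g1!:g3$0e3!:g2(N [SL,FL,SL,SL] [])!:g5!:g4(N [SR,SL,FL,SR] [S1,S0])!:g7(N [SR,SR,SL,FR] [])Z$2e7$0f4
!:g6 Z Z!:g7$0f6 Z$2e7$2f1$2e2$2f1!:g2!:g3$0e3!:g6!:g4(N [SR,SL,SR,FL] [S1,S0])Z$0f4!:g7!:g5!:g4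
(N [SL,SL,SL,SL] [S0,S2])Z$0f4 Z$0f5 Z$2e7$2f2$2f2!:g3$0e3!:g6 Z Z!:g7$0f6 Z$2e7!:g7$0f3!:g5
(N [SL,SL,SL,FR] [S1])!:g6(N [SL,SL,FR,SL] [S1])!:g4(N [SL,SL,SL,SL] [])Z#0f4!:g4$2f4#0f6(N [FR,SL,SL,SR] [S0])
!:g4$2f4!:g6(N [FR,SR,SR,SL] [S1,S0])#0f5#0f5!:g6$0f4(N [FR,SL,SR,SL] [S1,S0])(N [FR,SL,SL,SL] [])$2e7$2e2$2e1
$2e0"])
    (simp_all add: dead1_00011001 dead1_0001101111100100 dead1_0001111011120111 dead1_01101021 dead1_01111221 dead1_11122112 dead1_11122221)

lemma dead1_01101221: "dead s1 (Nd (Nd (Nd (Lf K0) (Lf K1)) (Nd (Lf K1) (Lf K0))) (Nd (Nd (Lf K1) (Lf K2)) (Nd (Lf K2) (Lf K1))))"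
  by (rule case1.dead_by_certificate[where es = "[E g0 0 1 0, E g2 1 (-2) (-3), E g3 (-1) (-1) 0, E g4 0 0 (-1), E g5 0 0 (-1), E g6 0 0 2, E g7 1 1 0]" and ce = "!:g6$0e6!:g0!:g2!:g1$0f0!:g3(N [SR,FL,SR,SL] [])(N [SR,FL,SL,SL] [S1,S0])$2e3$2f0 Z$2f0!:g2!:g3!:g1$0f3
(N [SR,FL,SR,SR] [S0])$0f1!:g1(N [SL,FL,SL,SL] [])!:g4(N [SL,SL,SL,FL] [S0,S1])!:g7(N [SL,SL,FR,SR] [S0,S1])!:g5
$0e5#0e5(N [SR,FR,SR,SL] [])!:g5$0e5#0e5(N [SR,FR,SL,SL] [S1,S0])!:g5$0e5(N [SL,SL,FL,SL] [S0])!:g7$0f5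
(N [SR,FR,SR,SR] [S0])Z(N [SL,FL,SL,SL] [S1])$2e3!:g3 Z Z$2e3 Z$2e0!:g7$0f6!:g5$0e5!:g4$2f4(N [SR,FR,SL,SR] [])
(N [SR,FR,SR,SR] [S1,S0])!:g3!:g1$2f1!:g2$2f2!:g0 Z!:g4$2f4(N [FR,SL,SR,SR] [])Z$2e0$0f2$0f1!:g2$2f2!:g0 Z!:g4
$2f4!:g1$2f1(N [FR,SL,SL,SL] [])(N [FR,SL,SR,SL] [])Z$2e0 Z$2e3!:g3$2f3!:g2$2f2!:g0 Z!:g4$2f4!:g5$0e5
(N [SR,FR,SL,SL] [S0])Z Z$2e0 Z$2e3"])
    (simp_all add: dead1_00011001 dead1_00011110 dead1_01101001 dead1_01101021 dead1_01111221 dead1_11111221 dead1_11122112 dead1_11122221)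

lemma dead1_0110: "dead s1 (Nd (Nd (Lf K0) (Lf K1)) (Nd (Lf K1) (Lf K0)))"
  by (rule case1.dead_by_certificate[where es = "[E h1 1 0 1, E h2 1 0 1, E h3 1 0 0]" and ce = "!:h3!:h1!:h2$0g7!:h0(N [SR,SL,SR] [])(N [SR,SR,SR] [S1,S0])$2g0$0g6!:h2!:h0(N [SR,SR,SL] [])(N [SR,SR,SR] [S0])
$2g0 Z$0g6$0g5!:h0!:h1!:h2$0g4 Z$2g4 Z$2g4!:h1!:h2(N [SL,SL,SL] [])Z(N [SL,SL,SL] [])Z!:h2(N [SL,SL,SL] [S1])Z
(N [SL,SL,SL] [])$2g0$2g3"])
    (simp_all add: dead1_00011001 dead1_00011110 dead1_01101001 dead1_01101021 dead1_01101221)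

lemma dead1_0112: "dead s1 (Nd (Nd (Lf K0) (Lf K1)) (Nd (Lf K1) (Lf K2)))"
  by (rule case1.dead_by_certificate[where es = "[E h0 (-1) 0 0, E h1 1 0 0, E h2 1 0 0]" and ce = "!:h0!:h1!:h2$0g4 Z$2g4 Z$2g4!:h1(N [SL,FL,SL] [])!:h2(N [SL,SL,FL] [])Z Z!:h2(N [SL,SL,FL] [])Z Z$2g0"])
    (simp_all add: dead1_0110)

lemma dead1_12: "dead s1 (Nd (Lf K1) (Lf K2))"
  by (rule case1.dead_by_certificate[where es = "[E i0 1 0 0]" and ce = "!:i0!:i1$0h1(N [SR,SL] [])$2h2 Z Z"])
    (simp_all add: dead1_0112)

lemma dead2_0110100112212112: "dead s2 (Nd (Nd (Nd (Nd (Lf K0) (Lf K1)) (Nd (Lf K1) (Lf K0))) (Nd (Nd (Lf K1) (Lf K0)) (Nd (Lf K0) (Lf K1)))) (Nd (Nd (Nd (Lf K1) (Lf K2)) (Nd (Lf K2) (Lf K1))) (Nd (Nd (Lf K2) (Lf K1)) (Nd (Lf K1) (Lf K2)))))"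
  by (rule case2.dead_by_certificate[where es = "[E e0 (-3) 0 0, E f3 (-3) 0 0]" and ce = "!:e0 Z!:f3 Z!:f1$0b1#2(hold1 b3)!:f0$2d0!:f2$0b2#2(hold1 b0)!:f4$0b4#2(hold1 b0)!:f5$0d1!:f6$0d2!:e1$2c1
#2(hold0 d0)!:e2$2c2#2(hold0 d0)!:e3$0c1!:e4$2c4#2(hold0 d0)!:e5$0c1!:e6$0c2 Y$2a6$2a5$2a3$2b6$2b5$2b0$2b3$2a0"])
    (simp_all)

lemma dead2_12212112: "dead s2 (Nd (Nd (Nd (Lf K1) (Lf K2)) (Nd (Lf K2) (Lf K1))) (Nd (Nd (Lf K2) (Lf K1)) (Nd (Lf K1) (Lf K2))))"
  by (rule case2.dead_by_certificate[where es = "[E g0 1 0 0]" and ce = "!:g0!:g1$0e1!:g2$0e2!:g3!:g4$0e4!:g5!:g6!:g7$0e7(N [SR,SL,SL,SL] [])$2f3#2e6$2e6#2e5$2e5$2f0#2e3$2e3$2f0$2f0 Z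
$2e0"])
    (simp_all add: dead2_0110100112212112)

lemma dead2_0110101112212122: "dead s2 (Nd (Nd (Nd (Nd (Lf K0) (Lf K1)) (Nd (Lf K1) (Lf K0))) (Nd (Nd (Lf K1) (Lf K0)) (Nd (Lf K1) (Lf K1)))) (Nd (Nd (Nd (Lf K1) (Lf K2)) (Nd (Lf K2) (Lf K1))) (Nd (Nd (Lf K2) (Lf K1)) (Nd (Lf K2) (Lf K2)))))"
  by (rule case2.dead_by_certificate[where es = "[E e0 (-1) 0 0, E f1 0 0 1, E f2 0 0 1, E f3 2 0 0, E f4 0 0 1]" and ce = "!:f4$0b4!:f3!:f1$0b1!:f2$0b2 Z$0d2$0d1 Z$2b3!:f0$2d0!:f5$0d4!:f1$0b1#0(hold1 b1)!:f3$0d1!:e0 Z!:f2$0b2 Z!:e3!:e1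
$2c1!:e2$2c2#2(hold0 d0)$0c2$0c1!:e5!:e1$2c1!:e4$2c4#2(hold0 d0)$0c4$0c1!:e1$2c1#0(hold0 d1)!:e4$2c4!:e2$2c2
#2(hold0 d0)!:f6$0b6#2(hold0 d0)!:e7!:e6$0c2!:f7$0b7 Y$2c7$0c6!:f7$0b7 Y#2(hold0 d5)Y!:f6$0b6!:e2$2c2
#2(hold0 d0)!:e6$0c2!:f7$0b7 Y$2d6$2d6!:e2$2c2!:e7!:e6$0c4!:f7$0b7 Y$2c7$0c6!:f7$0b7 Y#2(hold0 d3)Y!:e6$0c2 Y
!:e7$0c6 Y Y$2a5$2a3$2a0$2b3$2b5$2b0"])
    (simp_all)

lemma dead2_12212122: "dead s2 (Nd (Nd (Nd (Lf K1) (Lf K2)) (Nd (Lf K2) (Lf K1))) (Nd (Nd (Lf K2) (Lf K1)) (Nd (Lf K2) (Lf K2))))"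
  by (rule case2.dead_by_certificate[where es = "[E g0 1 0 0, E g6 0 0 (-1)]" and ce = "!:g0!:g1$0e1!:g2$0e2!:g3!:g4$0e4!:g5!:g6$0e6!:g7$0e7(N [SR,SL,SL,SL] [])$2f3 Z#2e5$2e5$2f0#2e3$2e3$2f0$2f0 Z$2e0"])
    (simp_all add: dead2_0110101112212122)

lemma dead2_11121221: "dead s2 (Nd (Nd (Nd (Lf K1) (Lf K1)) (Nd (Lf K1) (Lf K2))) (Nd (Nd (Lf K1) (Lf K2)) (Nd (Lf K2) (Lf K1))))"
  by (rule case2.dead_by_certificate[where es = "[E g0 (-3) (-3) 0, E g1 0 0 (-3), E g3 0 1 1, E g4 0 0 (-3), E g5 0 1 1, E g7 1 1 0]" and ce = "!:g0 Z Z!:g1$0f0!:g4$0f0!:g5$0e5#0e5!:g7$0f5!:g3$0e3#0e3!:g2$0f0#0f0!:g6$0e6#2e2(N [FR,SL,SL,SR] [S0,S1])$2e7 Z Z"])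
    (simp_all add: dead2_12212122)

lemma dead2_0111112212222211: "dead s2 (Nd (Nd (Nd (Nd (Lf K0) (Lf K1)) (Nd (Lf K1) (Lf K1))) (Nd (Nd (Lf K1) (Lf K1)) (Nd (Lf K2) (Lf K2)))) (Nd (Nd (Nd (Lf K1) (Lf K2)) (Nd (Lf K2) (Lf K2))) (Nd (Nd (Lf K2) (Lf K2)) (Nd (Lf K1) (Lf K1)))))"
  by (rule case2.dead_by_certificate[where es = "[E e3 0 (-3) 0, E f6 (-3) 0 0]" and ce = "!:f6 Z!:e6$0a6#2(hold4 b6)!:f2$0b2#2(hold4 b6)!:f0$2d0!:f4$0b4#2(hold4 b6)!:e3!:e2$2c2!:e7$0a7!:f3$0b3!:f7!:f5
$0b5!:e4$2c4!:e0!:e1 Y!:f1$0b1 Y Y$2c0(N [FR,SL,SL,SL,FL] [])$2a0!:e0$2c0!:e5$0c4!:e1 Y!:f1$0b1 Y#2(hold0 d0)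
$0c1#2(hold4 a5)$2a0$0d5#2(hold4 b7)$2b7$2c3$2c3$0c2 Z!:e1$2c1!:e2$2c2#2a3!:e0$2c0!:e7$0a7#2(hold4 a3)!:f3$0b3
#2(hold4 a3)!:f7$0c7!:e4$2c4!:e5$2c5!:f1$0b1!:f5$0b5#0(hold0 d4)#2d1 Y#2a5!:f5$0b5!:e5$0c4!:f1$0b1 Y#2d5
#2(hold4 a5)!:e5$0c4 Y!:f1$0b1 Y Y$2b7$2a0!:e0$2c0!:e7$0a7!:e5$0c1#0(hold4 a7)$2c7!:f7$0c7!:f1$0b1!:f5$0b5!:e4
$2c4#0(hold0 d4)!:e5$0c1#0(hold3 c1)!:e2$2c2 Y!:f3$0b3#2(hold4 b7)Y!:e5$0c1#2(hold3 d1)!:f3$0b3!:e2$2c2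
#2(hold3 d3)!:e4$2c4 Y Y$2d1!:f3$0b3$2d3!:e5$0c1!:e4$2c4!:e2$2c2#2c2!:f5$0b5#0(hold0 d4)Y!:f5$0b5!:e2$2c2 Y Y
$2c5!:e2$2c2 Y!:e4$2c4 Y!:f5$0b5$2d5 Y$2b7$2a0$2b0$2b6"])
    (simp_all add: dead2_11121221)

lemma dead2_01121221: "dead s2 (Nd (Nd (Nd (Lf K0) (Lf K1)) (Nd (Lf K1) (Lf K2))) (Nd (Nd (Lf K1) (Lf K2)) (Nd (Lf K2) (Lf K1))))"
  by (rule case2.dead_by_certificate[where es = "[E g0 (-1) 0 0, E g2 0 0 (-1), E g3 0 1 1, E g4 1 1 0, E g7 0 1 0]" and ce = "!:g0 Z!:g7 Z!:g3$0e3#2e7!:g2$2f2!:g5$0e5#2e7!:g4$2f4!:g6$0e6#0e6!:g1$2f1(N [FR,SL,SL,SL] [])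
(N [SL,SL,SL,SL] [S0,S1,S2,S1,S0])Z Z$2e7$2e0"])
    (simp_all add: dead2_0111112212222211 dead2_11121221)

lemma dead2_0000011011111221: "dead s2 (Nd (Nd (Nd (Nd (Lf K0) (Lf K0)) (Nd (Lf K0) (Lf K0))) (Nd (Nd (Lf K0) (Lf K1)) (Nd (Lf K1) (Lf K0)))) (Nd (Nd (Nd (Lf K1) (Lf K1)) (Nd (Lf K1) (Lf K1))) (Nd (Nd (Lf K1) (Lf K2)) (Nd (Lf K2) (Lf K1)))))"
  by (rule case2.dead_by_certificate[where es = "[E e5 0 0 3, E e6 (-3) (-3) 0, E f6 0 (-3) 0]" and ce = "!:e0$0a0!:e3$0a3!:f6$0b6!:e5 Z Z!:e1$2c1!:e4$2c4!:e6 Z Z!:e2$2c2!:e7$0c5!:f2!:f4!:f5$0b5!:f0 Y!:f3 Y Y$2d2$0d0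
$2d4#0b6#2(hold1 b4)#0b6#0b6$2a7$2a2$2a4$2a1!:f5$0b5!:f4$2d4!:f7$0d6#0(hold1 b5)#0(hold1 b5)#2(hold1 b4)!:e6$2c6
!:e5$2c5 Z!:e1$2c1!:e4$2c4!:e7$0c5!:f4$2d4!:e2!:f2$2d2!:f1$2d1!:f0!:f3 Y Y!:f7$0d3#0(hold4 d3)Y!:f7$0d5!:f3 Y
#0(hold0 d6)#0(hold4 d3)Y#0(hold3 d0)!:f0$2d0!:f7$0d5 Y Y#2d4$2c2!:f2$2d2!:f0!:f1$2d1!:f7$0d5!:f3 Y#0(hold0 d6)
#0(hold4 d3)Y$2d0!:f7$0d5#0(hold0 d6)!:f1$2d1!:f3$2d3#2(hold1 b7)#0(hold2 d3)Y#0(hold4 d0)!:f3$0d2!:f1$2d1!:f0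
$2d0#0(hold2 d2)#0(hold3 d0)Y!:f7$0d3#2d7!:f0$2d0 Y!:f1$0d0#0(hold3 d0)Y$2a2!:f0$2d0#2(hold1 b4)!:f7$0d5!:f2$0d0
!:f1$0d0!:f3!:e2 Y Y$2a2!:e2 Y#0(hold2 d0)$2a2#0(hold4 d3)!:e2 Y!:f3$0d1 Y#0(hold3 d3)$2a2!:e2$2c2!:f1$0d0!:f3
$0d2 Y#0(hold4 d3)Y$2a2!:f3$2d3#2(hold1 b7)!:f1$0d0#2d1!:e2 Y Y$2a2$2a7$2a4$2a1!:e2$2c2!:e4$2c4!:e7$0c6!:f7$0d5
!:e5$2c5!:f1$2d1!:f4$2d4!:e1!:f3!:f0 Y Y#2(hold0 d4)!:f0 Y#0(hold0 d5)#2(hold0 d4)#2(hold0 d7)!:f0!:f3 Y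
#0(hold0 d5)#0(hold4 d3)#0(hold0 d5)#0(hold3 d0)$2a1!:f0$2d0#2(hold1 b4)!:f2$0d0!:e1!:f3 Y Y#0(hold3 d3)!:f3 Y
#0(hold2 d0)#0(hold4 d3)$2a1!:e1 Y!:f3$0d2 Y#0(hold4 d3)$2a1!:e1$2c1!:f3$0d1!:f2$2d2!:f0$2d0#0(hold2 d1)!:f4$0d0
#0(hold4 d0)Y Y!:f2$2d2#0(hold3 d3)!:f4$2d4#2d7 Y$2a1!:e1$2c1!:f1$2d1!:f4$2d4!:f0!:f2$2d2 Y$2d0!:f3 Y Y
#0(hold4 d3)#0(hold3 d0)!:f3 Y Y#0(hold4 d3)!:f2$2d2!:f3$0d1 Y#0(hold3 d3)Y$2a1!:f3$2d3#2(hold1 b7)!:e1!:e5$2c5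
!:f1$2d1!:f2$2d2!:f0 Y!:f4$2d4 Y#2(hold1 b4)#2d2!:f4$2d4 Y Y$2c1$2c1!:f2$2d2!:f0!:e5$2c5!:f1$2d1!:f4$2d4 Y$2d0
$2d0 Y!:f1$2d1#0(hold2 d3)!:e5$2c5 Y Y#2d2!:f1$2d1!:e5$2c5!:f0$2d0 Y#2d1 Y!:e5$2c5 Y Y$2a1$2a7$2a4$2a2$2a3$2a0"])
    (simp_all)

lemma dead2_0001011011111221: "dead s2 (Nd (Nd (Nd (Nd (Lf K0) (Lf K0)) (Nd (Lf K0) (Lf K1))) (Nd (Nd (Lf K0) (Lf K1)) (Nd (Lf K1) (Lf K0)))) (Nd (Nd (Nd (Lf K1) (Lf K1)) (Nd (Lf K1) (Lf K1))) (Nd (Nd (Lf K1) (Lf K2)) (Nd (Lf K2) (Lf K1)))))"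
  by (rule case2.dead_by_certificate[where es = "[E e3 (-3) (-3) 0, E f0 (-3) (-3) 0, E f3 0 (-3) 0, E f4 0 0 (-3), E f7 0 0 (-3)]" and ce = "!:e0$0a0!:f5$0b5!:f7!:f6$0b6!:f3!:e3!:f0 Z Z!:f1$0d0!:f4$0d0#0(hold1 b5)Z$0d1!:f0 Z Z!:f1$0d0!:f4$0d0
#0(hold1 b5)Z$0d1$0c3!:e3 Z Z!:e1$2c1!:e2$2c2!:e7$0c3!:f0 Z Z!:f4$0d0!:f1$0d0#0(hold1 b5)#0(hold1 b5)Z$2a7$2a2
$2a1$0d3$0d6!:e5!:f1!:f4!:f6$0b6!:e6!:e4$0c4!:f2!:f0!:e3 Z Z!:f3$0c3 Z$2d1!:e3 Z Z!:f3$0c3 Z$2d1$0d0#0(hold1 b6)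
#0(hold1 b6)$2a4#0b6#0b6$2d4#0(hold1 b5)#2(hold1 b4)#0(hold1 b5)#0(hold1 b5)#0b5#0b5#2(hold1 b7)!:f6$0b6!:f4$2d4
!:f7$0d5#0(hold1 b6)#0(hold1 b6)#2(hold1 b4)!:f4$2d4!:e6$2c6!:e2!:f2$2d2!:e3!:f0 Z Z!:e4!:e5$2c5!:f1$0d0
#0(hold1 d0)!:f3$0d1 Z$2c3$2c4#2d4$2a4!:f0 Z Z!:e4!:e5$2c5!:f1$0d0#0(hold1 d0)!:e1$2c1!:f3$0d1 Z!:f7$0d3
#2(hold1 d2)Z$2a1$2c4#2d4$2a4$2c2$2c2!:f2$2d2!:f1$2d1!:f0!:e3 Z Z!:e1$2c1!:e7$0c3!:f3$0c3 Z!:f7$0d3#0(hold1 d3)Z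
$2a7$2a1!:e3 Z Z!:e1$2c1!:e7$0c3!:f3$0c3 Z!:f7$0d3#0(hold1 d3)Z$2a7$2a1#0(hold1 d0)!:e1$2c1!:f3$0d1!:e3 Z Z!:e7
$0c3#0c3$2a7!:f0$2d0!:e3$2c3 Z!:e7$0c3!:f7$0d3#0(hold0 d6)Z$2a7#2d2$2a1!:f3$0d2!:e3 Z Z!:e1$2c1!:e7$0c3!:e5$2c5
#0c3#0c3$2a7$2a1!:e3$2c3!:f0$2d0 Z!:f7$0d3!:e4!:e5$2c5!:e1!:f1$0d0#2(hold1 d1)$2c1 Y$2a1$2c4#2d4$2a4 Z!:e1$2c1
!:e7$0c3!:f0$2d0!:f7$0d3!:e5$2c5#2d7!:f1$2d1#2d7 Y Z!:f1$0d0#2d1!:e5$2c5!:e4!:f7$0d3#2d7 Y#2d4$2a4!:e4$2c4!:f7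
$0d3#2d4 Y$2a4$2a7$2a1$2a2!:e2$2c2!:e4$2c4!:e7$0c6!:f2$2d2!:f0!:e3 Z Z!:e1$2c1!:e5$2c5!:f1$2d1!:f3$0c3 Z!:f7$0d3
#0(hold1 d3)Z$2d0(N [FR,FL,SL,SL,SL] [])$2a1!:e3 Z Z!:e1$2c1!:e5$2c5!:f3$0c3 Z!:f7$0d3#2d7 Z
(N [FR,FL,SL,SL,SL] [])$2a1#0(hold4 d0)!:f7$0d5!:f0$2d0!:e3 Z Z!:e1$2c1#2(hold0 c2)$2a1!:e5$2c5#2d4!:e1$2c1!:f1
$0d0#0(hold3 d0)!:e3!:f3$0d1 Z$2c3 Y Y$2a1!:e3 Z Z!:e1$2c1!:e5$2c5!:f1$2d1 Y Y$2c7$2a1$2a7$2a4$2a2!:e3 Z Z!:e1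
$2c1!:e2$2c2!:e4$2c4!:e7$0c3!:f0$2d0 Z!:f3$0c3 Z!:f7$0d3!:f1$0d0#2d1!:f2$0d0#2d2!:e5$2c5!:e6$2c6 Y Y Y Z$2a7$2a4
$2a2$2a1$2a0"])
    (simp_all add: dead2_11121221)

lemma dead2_11111221: "dead s2 (Nd (Nd (Nd (Lf K1) (Lf K1)) (Nd (Lf K1) (Lf K1))) (Nd (Nd (Lf K1) (Lf K2)) (Nd (Lf K2) (Lf K1))))"
  by (rule case2.dead_by_certificate[where es = "[E g0 0 (-1) 0, E g1 1 0 0, E g2 0 (-1) (-1), E g4 1 0 0, E g5 0 (-3) 0, E g7 1 0 0]" and ce = "!:g5$0e5!:g1!:g0!:g2!:g4!:g6$0e6!:g7!:g3(N [SR,SL,SL,SL] [])(N [SR,SL,SL,SL] [])$2f1 Z Z$2f2 Z$2f0 Z$2f0 Z$0f0 Z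
Z!:g4$2f4!:g6$0e6!:g7$0f5#0e6#0e6!:g2$2f2!:g1$2f1!:g7$0f5 Z Z!:g7$0f5 Z Z!:g7$0f5!:g1$2f1 Z Z!:g1$2f1 Z Z!:g0
$2f0#2e4!:g6$0e6#2e4!:g2$0f0!:g7$0f5!:g1$0f0 Z Z!:g1$0f0 Z Z!:g1$0f0!:g7$0f5 Z Z!:g7$0f5 Z Z"])
    (simp_all add: dead2_0000011011111221 dead2_0001011011111221)

lemma dead2_1111112211222222: "dead s2 (Nd (Nd (Nd (Nd (Lf K1) (Lf K1)) (Nd (Lf K1) (Lf K1))) (Nd (Nd (Lf K1) (Lf K1)) (Nd (Lf K2) (Lf K2)))) (Nd (Nd (Nd (Lf K1) (Lf K1)) (Nd (Lf K2) (Lf K2))) (Nd (Nd (Lf K2) (Lf K2)) (Nd (Lf K2) (Lf K2)))))"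
  by (rule case2.dead_by_certificate[where es = "[E e1 1 0 1, E e2 1 0 0, E e4 1 0 0, E e5 1 1 1, E e6 0 0 1, E f0 0 (-1) (-1), E f2 0 0 1, E f3 0 1 1, E f4 0 0 1, E f5 0 1 1, E f6 0 0 (-1), E f7 0 1 1]" and ce = "!:f2$0b2!:e6$0a6!:f4$0b4!:e2!:e4!:f0!:f6$0b6!:e1!:e0$0c0!:f7$0b7!:f1!:f3$0b3!:f5$0b5!:e7$0a7 Y!:e3$2c3!:e5$2c5 Y
$2c1$2c1$2d1$2d1!:e3!:e7$0a7!:f3$0b3!:e5!:f5$0b5 Y$2c5 Y$2c1$2c3$2c3!:e5!:e7$0a7!:f5$0b5 Y$2c5$2c5#0a1$2c1$2c1
$2c1!:e7$0a7!:f3$0b3 Y!:e3$2c3!:f1$2d1 Y$2c1$2c1!:e3$2c3!:e5$2c5!:f1!:f3$0b3 Y$2d1#0a1$2c1$2c1$2c1$0c0 Z!:e0$2c0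
!:e3$0c1!:e5$0c1!:f1$0c1!:e7$0a7#0c1#0c1$2d0$2c4$2c2$0c0 Z Z Z Z Z Z Z!:e4$2c4!:f0$2d0 Z Z!:f0$2d0 Z Z!:f3$0b3
!:f4$0b4!:e2$2c2!:e4$2c4 Z Z!:e4$2c4 Z Z!:f0$2d0!:e2$2c2!:e4$2c4 Z Z!:e4$2c4 Z Z!:e0$2c0#2(hold4 b0)!:f1$0d0#2b0
!:e1$0c0#2(hold4 b1)!:f5$0b5#2(hold4 b1)!:e4$0c0!:e2$0c0 Z Z!:e2$0c0 Z Z!:e3$2c3!:e2$2c2!:e4$2c4!:f0!:f4$0b4 Z
$2d0 Z Z!:f0!:f4$0b4 Z$2d0 Z Z#2a2!:e2$2c2!:e1$2c1#2a3!:e7$0a7#2a3!:e4$2c4!:e0$2c0#0a0!:f0$0c0 Z Z!:e0$2c0#0a0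
!:f0$0c0 Z Z!:e0$2c0#2(hold4 a2)!:f0$0c0!:e4$0c0 Z Z$2d2!:f0$2d0!:f3$0b3!:e2$2c2!:f4$0b4!:e4!:e6$0a6 Z$2c4 Z Z
!:e4$2c4!:e0!:e1!:e6$0a6 Z!:f6$0b6$2d6 Z Z$2c0#0a0#0(hold4 c0)!:e0$2c0#0a0!:e1$0c0 Z!:e3$0c1!:e6$0a6 Z!:f6$0b6
$2d6 Z#2(hold2 c2)!:e0$2c0!:e1!:e3$0c2#2a2$2c1#0a0#0a0!:e4$0c0!:e1$0c0 Z!:e6$0a6 Z!:f1$0c1!:f4$0b4 Z!:f6$0b6$2d6
Z#2b1!:e1$0c0 Z!:e6$0a6 Z!:f1$0c1!:f4$0b4 Z!:f6$0b6$2d6 Z#2b1!:f4$0b4!:e2$2c2!:e4!:e6$0a6 Z$2c4 Z Z!:e4!:e6$0a6 Z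
$2c4 Z Z!:f5$0b5!:f1$2d1!:e4$2c4!:e2$2c2!:e0!:e1!:e3$2c3!:e6$0a6 Z!:f6$0b6$2d6 Z$2c1 Z$2c0#0a0#0(hold4 c0)!:e0
$2c0#0a0!:f6$0b6#2d0 Z!:e2$2c2!:e0$2c0#0a0!:f6$0b6#2d0 Z!:e0$2c0#0a0!:e1$0c0 Z!:e6$0a6 Z!:f6$0b6$2d6 Z#2b1!:e3
$2c3!:f6$0b6!:e6$0a6!:e2$2c2!:e4$2c4 Z Z#2a2$2d6!:f7$0b7$2d7!:e2$2c2!:e4$2c4 Z Z!:e4$2c4 Z Z!:f7$0b7!:e7$0a7!:e1
$2c1#2(hold4 a3)!:e2$2c2#2a3!:e0$2c0#0a0!:f1$0c1!:f6$0b6!:e6$0a6!:e4$0c0 Z Z$2d6$2d7$2d0$2d7!:f6$0b6$2d6!:e2$2c2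
!:e4$2c4 Z Z!:e4$2c4 Z Z!:e0$2c0!:f1$0d0#2b0!:f4$0b4#2(hold4 b0)!:e1$2c1!:e2$2c2#0a0#0a0!:e2$2c2#0a0#0a0!:f7$0b7
!:e1$0c0!:e4$0c0!:e2$0c0 Z Z!:e2$0c0 Z Z!:f1$0c1!:f4$0b4#2b0!:e6$0a6!:e4$0c0!:e2$0c0 Z Z!:e2$0c0 Z Z!:f6$0b6$2d6
!:e4$0c0!:e2$0c0 Z Z!:e2$0c0 Z Z!:e2$0c0!:e4$0c0!:e6$0a6 Z!:e3$0c1!:f4$0b4 Z!:f6$0b6$2d6 Z$2c2!:e6$0a6 Z!:e3$0c1
!:f4$0b4 Z!:f6$0b6$2d6 Z$2c2!:e4$0c0!:e6$0a6 Z!:f4$0b4 Z!:f6$0b6$2d6 Z!:e6$0a6 Z!:f4$0b4 Z!:f6$0b6$2d6 Z!:f3$0b3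
!:f1$0d0!:f4$0b4#2b0!:f6$0b6$2d6!:e2$0c0!:e4$0c0 Z Z!:e4$0c0 Z Z$2d3!:f4$0b4!:f1$0d0#2b0!:e2$0c0!:e4$0c0 Z Z!:e4
$0c0 Z Z!:f6$0b6$2d6!:e4$0c0!:e2$0c0 Z Z!:e2$0c0 Z Z"])
    (simp_all)

lemma dead2_0110101111212122: "dead s2 (Nd (Nd (Nd (Nd (Lf K0) (Lf K1)) (Nd (Lf K1) (Lf K0))) (Nd (Nd (Lf K1) (Lf K0)) (Nd (Lf K1) (Lf K1)))) (Nd (Nd (Nd (Lf K1) (Lf K1)) (Nd (Lf K2) (Lf K1))) (Nd (Nd (Lf K2) (Lf K1)) (Nd (Lf K2) (Lf K2)))))"
  by (rule case2.dead_by_certificate[where es = "[E e0 13 2 0, E e1 (-20) (-20) 2, E e2 (-9) (-9) 2, E e3 13 2 0, E e4 (-9) (-9) 2, E e5 13 2 0, E e6 2 2 2, E e7 (-9) (-9) 2, E f0 2 2 2, E f1 2 (-9) 2, E f2 0 2 2, E f3 2 2 2, E f4 0 2 2, E f5 2 2 2, E f6 0 2 2, E f7 0 2 2]" and ce = "!:e0!:e1!:e2!:e4$0c0!:f0$0c0!:f2$0b2!:e3!:e7$0c3!:e5!:f1$0c1 Z$2c1 Z$2a5$2c3!:e5!:e7 Z Z$2c5 Z$2a5$2a3$2c2$2c0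
$2c0!:e3!:e4!:f0$0c0!:f4$0b4!:e5!:e7$0c5!:f1$0c1 Z$2c1$2c3!:e7 Z Z$2c3$2a5$2c4$2c0!:e5!:f1$0c1!:e7 Z Z$2c3$2c1
!:e7 Z Z$2c3$2a5$2c0!:e4!:e5!:e7$0c5 Z$2c5 Z$2a5!:e5!:e7 Z Z$2c5 Z$2a5$2c0$2a3$2c0!:e2!:f2$0b2!:f7$0b7!:f4$0b4
!:e3!:e4!:f0$0c0!:e7!:e5!:f3$0c3!:f5$0c5!:f1!:e6 Y Y$2c2 Z#0(hold1 d1)$2c5$2c3 Z$2a5!:e5!:f1!:e6 Y!:f6$0b6 Y Y
$2c2 Z!:f3$0d1!:f5$0d1#0(hold1 d1)$2c5$2c3 Z$2a5$2c3$2c0!:e7!:e5!:f3$0c3!:f1!:e6 Y!:f6$0b6 Y Y$2c2 Z!:f0$2d0!:f5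
$0d1#0(hold1 d1)$2c5$2c0$2c3 Z$2a5!:e5!:f1!:e6 Y!:f6$0b6 Y Y$2c2 Z!:f0$2d0!:f3$0d1!:f5$0d1#0(hold1 d1)$2c5$2c3
$2c0 Z$2a5$2c3$2c0!:e4!:e5!:e7 Z Z$2c5 Z$2a5!:e5!:e7 Z Z$2c5 Z$2a5$2c0$2a3!:e4$2c4!:f0$2d0!:e5!:f5$0d4!:e7!:e3
!:f3$0c3!:f1!:e6 Y!:f6$0b6 Y Y$2c2 Z#0(hold1 d1)$2c3 Z$2a3!:e3!:f1!:e6 Y!:f6$0b6 Y Y$2c2 Z!:f3$0d1#0(hold1 d1)
$2c3 Z$2a3$2c5$2c5!:e3!:e7 Z Z$2c3 Z$2a3$2a5$2c0$2c0!:e3!:e7$2c7!:f3$2d3!:e4!:e5!:f0$0c0!:f4$0b4!:f5$2d5!:f1!:e6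
Y!:f6$0b6 Y Y$2c2 Z#0(hold1 d1)$2c5$2c4$2c0 Z$2a5!:e5!:f5$2d5!:f0!:f1!:f4$0b4!:e6 Y!:f6$0b6 Y Y$2c2$2d0 Z$2d0
!:f1!:e6!:f6$0b6 Y$2c6!:f4$0b4 Y!:f6$0b6#2(hold2 d6)Y$2c2 Z#0(hold1 d1)$2c0$2c5 Z$2a5$2c0$2c3$2c3!:e4!:e5!:e7
$2c7 Z$2c5 Z$2a5!:e5!:e7$2c7 Z$2c5 Z$2a5$2c0$2a3$2c2!:e3!:e4!:f4$0b4!:e7!:e5!:f5$0c5!:f7$0b7!:e6!:f6$0b6!:f1!:f0
!:f2$0b2 Y$2d0 Y$2c0 Z!:f0$2d0!:f3$0d1#0(hold1 d1)$2c3$2c0$2c6!:f1!:f6$0b6!:f2$0b2 Y!:f0$2d0!:f3$0d2 Y$2c3$2c0 Y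
Z!:f0$2d0!:f3$0d1#0(hold1 d1)$2c3$2c0$2c4$2c7$2c5 Z$2a5!:e5!:e6!:f6$0b6!:f0!:f1!:f2$0b2!:f3!:f7$0b7 Y$2d3 Y$2c3
$2d0 Z$2d0!:f1!:f2$0b2 Y!:f3$0d2!:f5!:f7$0b7 Y$2d5 Y$2c5$2c3 Z!:f3$0d1!:f5$0d1#0d1$2c5$2c3$2c0$2c6!:f0!:f1!:f2
$0b2!:f6$0b6!:f7$0b7 Y!:f3$2d3!:f5$2d5 Y$2c5$2c3 Y$2d0 Z$2d0!:f1!:f7$0b7!:f2$0b2 Y!:f3$0d2!:f6$0b6 Y Y$2c3!:f3
$2d3!:f5$2d5!:f2$0b2 Y!:f6$0b6#2(hold3 d6)Y$2c5$2c3 Z!:f3$0d1!:f5$0d1#0d1$2c5$2c3$2c0$2c4 Z$2a5$2c3$2c4!:e7!:e5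
!:f7$0b7!:e6!:f6$0b6!:f0!:f1!:f2$0b2!:f4$0b4 Y$2d0$2d0 Z$2d0!:f1!:f2$0b2 Y!:f3$0d2!:f4$0b4 Y!:f5$0d4 Y$2c5$2c3 Z
!:f3$0d1!:f5$0d1#0d1$2c5$2c3$2c0$2c6!:f0!:f1!:f2$0b2!:f4$0b4!:f6$0b6 Y Y$2d0$2d0 Z$2d0!:f1!:f2$0b2!:f4$0b4 Y!:f5
$0d4!:f6$0b6 Y Y$2c5!:f3$0d2!:f6$0b6!:f4$0b4 Y#2(hold4 d6)Y$2c3 Z!:f3$0d1!:f5$0d1#0d1$2c5$2c3$2c0$0c6$2c7 Z$2a5
!:e5!:f0!:f1!:f2$0b2!:f4$0b4!:f6$0b6!:e6 Y!:f3!:f7$0b7 Y$2d3 Y$2c3#0(hold4 c6)!:e6$2c6 Y!:f3!:f7$0b7 Y$2d3 Y$2c3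
$2d0$2d0 Z$2d0!:f1!:f2$0b2!:f7$0b7!:f6$0b6!:e6 Y Y#0(hold3 c6)Y!:f3$2d3!:f5$2d5!:f6$0b6!:e6 Y Y#0(hold3 c6)Y$2c5
$2c3!:f3$0d2!:f6$0b6!:e6!:f4$0b4 Y!:f7$0b7 Y$2d6!:f4$0b4!:f7$0b7 Y#2(hold3 d6)#2(hold4 d6)#0c6!:f5!:f4$0b4!:f7
$0b7 Y$2d5$0d4!:e6$2c6 Y!:f4$0b4 Y!:f7$0b7 Y Y$2c5$2c3 Z!:f3$0d1!:f5$0d1!:f2$0b2#0d1#0d1$2c5$2c3$2c0 Z$2a5$2c3
$2c0!:e4!:e5!:e7 Z Z$2c5 Z$2a5!:e5!:e7 Z Z$2c5 Z$2a5$2c0$2a3$2c0$2c0!:e3!:e1!:e2!:e7$0c3!:e4 Z Z!:e5$0c4 Z$2a5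
$2c3!:e7!:e4 Z Z!:e5$0c4 Z$2a5!:e4 Z Z!:e5$0c4 Z$2a5$2c3$0c2!:e2!:f2$0b2!:e7!:e4 Z Z!:e5$0c4 Z$2a5!:e4 Z Z!:e5
$0c4 Z$2a5$2c3$2c2!:e7!:e4 Z Z!:e5$0c4 Z$2a5!:e4 Z Z!:e5$0c4 Z$2a5$2c3$0c2$0c1!:e5!:e1!:e4!:e7$0c5 Z$2c5!:e7 Z Z
$2c5$0c4!:e4!:e7 Z Z$2c5!:e7 Z Z$2c5$0c4$0c1!:f2$0b2!:f4$0b4!:f7$0b7!:f0!:f1!:e1!:e2 Z Z!:e4 Z Z!:e7 Z Z Y!:e2 Z
Z!:e4 Z Z!:e7 Z Z Y$0c1!:e1 Z Z!:f3!:f5!:f6$0b6!:e2!:e4 Z Z!:e7 Z Z Y!:e4 Z Z!:e7 Z Z Y!:e4!:e7 Z Z Y!:e7 Z Z Y Y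
!:e6$2c6!:e2!:e4 Z Z Y!:e4 Z Z#0c4 Y!:e2$2c2!:e4$2c4 Z Y!:e4$2c4 Y Y!:f6$0b6!:e2!:e4 Z Z!:e6$0c4#0c4$2c2!:e4 Z Z
!:e7 Z Z#2(hold0 c5)!:e6$0c2 Y!:e4$2c4!:e7$0c6 Z#0c1 Y!:e2!:e4 Z Z#2(hold2 d4)!:e4 Z Z#2(hold2 d4)Y#2(hold1 b5)
!:f5!:f6$0b6!:e2!:e4 Z Z!:e6$0c4 Y$2c2!:e4 Z Z!:e7 Z Z#0c1!:e6$0c2#0c2!:e4$2c4!:e7$0c6 Z#2(hold0 c3)Y!:e2!:e4 Z Z
Y!:e4 Z Z Y#2(hold3 d2)!:e7!:e2 Z Z!:e4 Z Z#0c1!:e2 Z Z#0c1(N [FR,SR,SL,SR,FR] [])#2(hold1 b5)#2(hold1 b3)$2d0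
!:f3!:f1!:e1!:e2 Z Z!:e4 Z Z!:e7 Z Z Y!:e2 Z Z!:e4 Z Z!:e7 Z Z Y$0c1!:e1 Z Z!:f5!:f6$0b6!:e2!:e4 Z Z!:e6$0c4#0c4
$2c2!:e4 Z Z!:e7 Z Z#0c1!:e6$0c2#0c2!:e4$2c4!:e7$0c6 Z#0c1#2(hold0 c0)!:e2!:e4 Z Z#2(hold4 d4)!:e4 Z Z
#2(hold4 d4)#2(hold4 d2)!:e4!:e2 Z Z!:e6$0c2 Y$2c4!:e2 Z Z#0c1(N [FR,SR,SL,FL,SL] [])#2(hold1 b5)$0d1!:f5!:f1
!:e1!:e2 Z Z!:f6$0b6#2d2#2(hold4 d2)!:e2 Z Z!:e4 Z Z Y$0c1!:e1 Z Z!:e2!:e4 Z Z!:e6$0c4 Y$2c2!:e4 Z Z#0c1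
(N [FR,SR,FL,SL,SL] [])$0d1!:f1!:e1!:e2 Z Z!:e4 Z Z Y!:e2 Z Z!:e4 Z Z Y$0c1!:e1 Z Z!:e2!:e4 Z Z#0c1#0c1#0c1
#0(hold1 d1)#2(hold1 b5)#2(hold1 b3)#2(hold1 b0)!:e7$2c7!:e1 Z Z!:f1$0c1!:e2 Z Z!:e4 Z Z!:f3$2d3#0c1#2(hold1 b3)
!:f0$2d0!:f3$0d1!:f5$0d1#0(hold1 d1)!:e4!:e2 Z Z!:e6$0c2#0c2$2c4!:e2 Z Z!:f6$0b6 Y#2(hold4 d2)#2(hold3 d4)!:e2
!:e4 Z Z!:e6$0c4#0c4$2c2!:e4 Z Z!:e6$0c4#0c4!:f6$0b6#0(hold3 c6)#2(hold4 d4)#2(hold2 d2)#2(hold1 b0)!:e6$2c6!:f0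
!:f1!:f3$2d3!:f5$2d5!:e1!:e2 Z Z!:e4 Z Z#2(hold1 c6)!:e2 Z Z#0c2$0c1$2d1$2d1!:e1 Z Z!:f3$2d3!:f5$2d5!:e2!:e4 Z Z
#2(hold0 c5)#0c1#2(hold0 c3)#2(hold1 b5)#2(hold1 b3)$2d0!:f6$0b6!:e2!:e1 Z Z!:e4!:f1$0c1 Z!:f3$0d1!:f5$0d1
#0(hold1 d1)Y!:f5$0d1 Y Y!:f1$0c1 Z!:f3$0d1!:f5$0d1#0(hold1 d1)#2(hold0 c5)Y#0c4!:e1 Z Z!:e4!:f1$0c1 Z!:f3$0d1
!:f5$0d1#0(hold1 d1)Y#2(hold0 c3)(N [FR,FL,SL,SR,SL] [S1,S0])#0(hold4 c4)#0c2!:e2!:e1 Z Z!:f1$0c1 Y!:f3$0d1!:f5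
$0d1#0(hold1 d1)Y Y!:e1 Z Z!:f3$2d3 Y#2(hold3 d2)#2(hold4 d2)#2(hold1 b0)!:e2$2c2!:e1 Z Z!:e4$2c4!:f1$0c1 Z!:f0
$2d0!:f6$0b6#0(hold4 c6)!:f3$0d1!:f5$0d1#0(hold1 d1)#2d4#2d2#2(hold1 b0)!:f5$2d5!:f1$0c1#2(hold0 c5)!:f0$2d0!:f3
$0d1#0(hold1 d1)Y#2(hold3 d4)$2c5!:f3$2d3!:e4$2c4!:e1 Z Z!:f1$0c1#2(hold0 c3)!:f0$2d0!:f5$0d1#0(hold1 d1)Y
#2(hold2 d2)!:f5$2d5!:f6$0b6!:f1 Y Y!:e1$2c1#0(hold4 d1)Y Y(N [SL,SL,FR,FL,SR] [])(N [SL,SL,FL,FR,SR] [])!:e4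
$2c4!:e1 Z Z!:f1$0c1!:e2 Z Z!:e7 Z Z!:f0$2d0#0c1#2(hold1 b0)!:f7$0b7!:f3$0d1!:f0$2d0!:f5$0d1#0(hold1 d1)!:e7!:e2
Z Z!:e6$0c2#0c2$0c6!:e2 Z Z!:f6$0b6 Y#2(hold3 d2)#2(hold4 d7)!:e2!:e7 Z Z!:e6$2c6#0c7$2c2!:e7 Z Z!:e6$2c6#0c7
!:f6$0b6#0(hold4 c6)#2(hold3 d7)#2(hold2 d2)#2(hold1 b3)!:e7$2c7!:e2 Z Z!:e6$0c2#0c2!:f0$2d0!:f3$0d1!:f6$0b6$2d6
#2d2#2(hold2 d2)(N [SL,SL,FL,SL,FL] [])!:e6$2c6!:e2!:f0$2d0!:f3$0d1!:f5$0d1#0(hold1 d1)!:f6$0b6#2d6 Y!:f5$0d1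
!:f6$0b6#0(hold0 d4)Y Y!:f3$0d1!:f5$0d1!:f6$0b6#2d5 Y Y!:f5$0d1 Y Y(N [FR,FL,SL,SR,SL] [S1,S0])#0c2!:f6$0b6$2d6
!:e2$2c2!:f0$2d0!:f3$0d1!:f5$0d1#0(hold1 d1)Y#2d2!:f3$0d1#2d2$2d2!:f0$2d0!:f3$0d1#2d2$2c3$2d2!:f7$0b7!:e6$0c4
!:f0$2d0!:f3!:f1!:f5$0d4!:e1!:e2 Z Z!:e7 Z Z#2(hold1 c6)!:e2 Z Z#0c2$0c1$2d1!:e1 Z Z!:f5$0d4!:e2!:e7 Z Z
#2(hold0 c5)#0c1#2(hold0 c0)#2(hold1 b5)$0d1!:e2!:e1 Z Z!:f5$0d4!:f1$0c1#0c1#0(hold1 d1)!:f6$0b6 Y Y!:e1 Z Z!:e7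
!:f1$0c1 Z!:f5$0d1#0(hold1 d1)Y(N [FR,FL,SL,SR,SL] [S0])#0c7#0c2#2(hold1 b3)!:f1$0d0#2(hold1 b0)!:f3$0d1!:e1$2c1
!:e2 Z Z#2(hold2 d2)!:e2!:f5$0d1!:f6$0b6 Y Y Y#2(hold0 c0)$2c0#2(hold1 b3)!:e2$2c2!:e1 Z Z!:e7$0c6!:f1$0c1 Z!:f3
$0d1!:f6$0b6#0(hold3 c6)!:f0$2d0!:f5$0d1#0(hold1 d1)#2d7#2d2#2(hold1 b3)!:f5$0d4!:f0$2d0!:f1$0c1#0(hold0 c1)!:f3
$0d1#0(hold1 d1)#2(hold4 d7)Y$2c5!:f0$2d0!:e7$0c6!:e1 Z Z!:f1$0c1#2(hold0 c0)!:f3$0d1!:f5$0d1#0(hold1 d1)Y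
#2(hold2 d2)!:f5$0d4!:f6$0b6!:f1 Y Y!:e1$2c1#0(hold3 d1)Y Y(N [SL,SL,FR,SL,FR] [])(N [SL,SL,FL,SL,FL] [])!:e6
$0c4!:e7$2c7!:e1 Z Z!:e2!:f1$0c1 Z!:f0$2d0!:f3$0d1!:f5$0d1#0(hold1 d1)!:f6$0b6#2d6 Y!:f5$0d1!:f6$0b6#2d5 Y Y!:f3
$0d1!:f5$0d1!:f6$0b6#0(hold0 d7)Y Y!:f5$0d1 Y Y(N [FR,FL,SL,SR,SL] [S0])#0c2!:e2!:e1 Z Z(N [FR,FL,SL,SR,SL] [])
!:e1 Z Z(N [FR,FL,SL,SR,SL] [])#2(hold1 c6)!:f6$0b6$2d6!:e2$2c2!:e1 Z Z!:e7$0c6!:f1$0c1 Z!:f0$2d0!:f3$0d1!:f5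
$0d1#0(hold1 d1)Y#2d2!:f3$0d1#2d2$2d2!:f0$2d0!:f1$0c1#0c1!:f3$0d1!:f5$0d1#0(hold1 d1)$2c5#2d2 Y!:f0$2d0!:f3$2d3
#2d2$2d2$2d2!:e2$2c2!:e1 Z Z!:f1$0c1!:e4 Z Z!:e7 Z Z!:f0$2d0#0c1#0c1!:f0$2d0!:f3$0d1!:f4$0b4!:f5$0d1#0(hold1 d1)
!:f7$0b7#2(hold1 b5)!:e7$2c7#2d3!:f6$0b6#0(hold0 d2)!:e4!:e6$2c6 Y$2c4#2d4$2c5!:e4$2c4#2d0!:f5$0d1#0(hold1 d1)
!:f6$0b6#2d0!:e7!:e6$0c4!:f7$0b7 Y$2c7$0c6!:f7$0b7#2d7#2d3$2c5!:f7$0b7!:e7!:e4 Z Z!:e6$0c4!:f4$0b4#0c4!:f5$0d1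
!:f6$0b6#2d0 Y Y$0c6!:e4 Z Z!:e6$0c4(N [FR,FL,SL,SR,SL] [S0])!:f5$0d1!:f6$0b6#0(hold3 c6)#2d7#2(hold4 d7)
(N [SL,SL,SL,FR,FR] [])!:e7$2c7!:e4 Z Z!:e6$0c4(N [FR,FL,SL,SR,SL] [S0])!:f6$0b6$2d6!:f5$0d1!:f4$0b4#2d4 Y Y!:e6
$2c6!:e4!:f4$0b4!:f5$0d1!:f6$0b6#2d6 Y Y$2c4(N [FR,FL,SL,SR,SL] [S1,S0])(N [FR,FL,SL,SR,SL] [])!:f6$0b6$2d6!:e4
$2c4!:f5$0d1!:f4$0b4 Y#2d0 Y!:f5$0d1 Y$2c5!:f4$0b4!:e4!:e7 Z Z!:e6$2c6!:f3$0d1!:f5$0d1!:f6$0b6!:f7$0b7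
#0(hold3 c7)#2d3 Y Y!:f5$0d1 Y Y$2c4!:e7 Z Z!:e6$2c6(N [FR,FL,SL,SR,SL] [S1,S0])!:f5$0d1!:f6$0b6#0(hold4 c6)#2d4
#2(hold3 d4)(N [SL,SL,SL,FL,FL] [])!:e4$2c4!:e7 Z Z!:e6$2c6(N [FR,FL,SL,SR,SL] [S1,S0])!:f6$0b6$2d6!:f3$0d1!:f5
$0d1!:f7$0b7#2d7 Y Y!:f5$0d1 Y Y!:e6$0c4!:e7!:f7$0b7!:f3$0d1!:f5$0d1!:f6$0b6#2d6 Y Y!:f5$0d1 Y Y$2c7
(N [FR,FL,SL,SR,SL] [S0])(N [FR,FL,SL,SR,SL] [])!:f6$0b6$2d6!:e7$0c6!:f3$0d1!:f5$0d1!:f7$0b7 Y#2d3 Y!:f5$0d1 Y Y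
!:f3$0d1!:f5$0d1 Y$2c5 Y!:e6$0c2!:f0$2d0!:f3$0d2!:f4$0b4!:f6$0b6!:e4!:e1 Z Z!:e7!:f1$0c1 Z!:f5$0d1#0(hold1 d1)
!:f7$0b7#2(hold1 b5)$2c7!:f1$0c1 Z!:f5$0d1#0(hold1 d1)!:f7$0b7#2(hold1 b5)#2d3(N [FR,FL,SR,SL,SL] [])!:e1 Z Z
!:e7!:f1$0c1 Z!:f5$0d1#0(hold1 d1)!:f7$0b7#2(hold1 b5)$2c7(N [FR,FL,SR,SL,SL] [])(N [FR,FL,SR,SL,SL] [])
#0(hold4 c4)!:e4!:e1 Z Z!:f1$0c1!:e7 Z Z#2(hold0 c3)!:f5$0d1#0(hold1 d1)Y!:e1 Z Z!:e7!:f7$0b7 Y$2c7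
(N [FR,FL,SR,SL,SL] [])#2(hold0 c6)#0(hold4 c4)!:e4$2c4!:e1 Z Z!:e7!:f1$0c1 Z!:f5$0d1#0(hold1 d1)!:f6$0b6#2d0
!:f7$0b7 Y$2c7(N [FR,FL,SR,SL,SL] [])(N [FR,FL,SR,SL,SL] [])!:e7!:e1 Z Z(N [FR,FL,SR,SR,SR] [])!:e1 Z Z
(N [FR,FL,SR,SR,SR] [])#2(hold1 c6)!:f1$2d1!:e1 Z Z!:e4!:e7 Z Z$2c3#0c1#2(hold0 c0)!:e1$2c1!:e4 Z Z!:e7 Z Z
#2(hold1 c6)!:e7!:f7$0b7!:e4!:f4$0b4!:f5$0d1!:f6$0b6 Y Y#2(hold1 b5)$2c4!:f5$0d1!:f4$0b4 Y!:f6$0b6#0(hold0 d4)Y Y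
(N [FR,FL,SR,SR,SR] [])$2c7!:e4!:f4$0b4!:f5$0d1!:f6$0b6!:f7$0b7#2(hold0 c3)#2d6 Y Y$2c4(N [FR,FL,SR,SL,SL] [])
(N [FR,FL,SR,SR,SR] [])$2c3!:f1$0d0!:e1 Z Z!:e4!:e7 Z Z(N [FR,FL,SR,SL,SL] [])#2(hold0 c0)$2c0!:e1$2c1!:e4 Z Z
!:e7 Z Z#2(hold1 c6)!:e4!:f4$0b4!:f7$0b7!:f3$0d1!:f5$0d1!:f6$0b6 Y Y#2(hold1 b5)Y!:e7$2c7!:f3$0d1!:f5$0d1!:f6
$0b6#0(hold0 d7)Y Y!:f5$0d1 Y Y(N [FR,FL,SR,SL,SL] [])$2c4!:e7!:f4$0b4#2(hold0 c0)!:f7$0b7!:f3$0d1!:f5$0d1!:f6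
$0b6#2d6 Y Y!:f5$0d1 Y Y$2c7(N [FR,FL,SR,SL,SL] [])(N [FR,FL,SR,SL,SL] [])$2c0!:e4$2c4!:e1 Z Z!:e7$0c6!:f1$0c1 Z
!:f4$0b4!:f6$0b6#0(hold2 c6)!:f0$2d0!:f5$0d1!:f3$0d1#0(hold1 d1)Y#2d4!:f5$0d1#2d4$2d4!:f6$0b6$2d6!:f0$2d0!:f3
$0d1!:f5$0d1#0(hold1 d1)!:f7$0b7#2d7 Y!:f5$0d1!:f7$0b7#2d7#2d5 Y!:f3$0d1!:f5$0d1!:f7$0b7 Y#2d5 Y!:f5$0d1 Y Y!:f3
$0d2!:f1$0c1#0c1!:f7$0b7!:f5$0d1!:f0$2d0#0(hold1 d1)!:f6$0b6 Y#2d7#2(hold4 d7)!:f6$0b6$2d6!:f0$2d0!:f5$0d1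
#0(hold1 d1)Y!:f5$0d1 Y Y$2c3!:f4$0b4!:f0$2d0!:e7$0c6!:e1 Z Z!:f1$0c1#2(hold0 c0)!:f5$0d1!:f3$0d1#0(hold1 d1)
!:f6$0b6 Y#2d4#2(hold3 d4)!:e1!:f1!:f3$0d2!:f6$0b6!:f7$0b7 Y$2d6 Y$2d1 Z$2c1!:f1!:f3$0d2!:f6$0b6 Y Y$2d1 Z!:f5
$0d1#0(hold3 d1)#2(hold3 d4)(N [FR,FL,SL,SL,SL] [])(N [SL,SL,SL,FL,FL] [])!:f6$0b6$2d6!:e7$0c6!:e1 Z Z!:f0$2d0
!:f1$0c1#0c1!:f3$0d1!:f5$0d1#0(hold1 d1)Y!:f5$0d1 Y Y$2c0!:e1!:f1!:f0$2d0!:f3$0d2!:f5$0d4 Y$2d1$2d1$0d0 Z$2c1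
!:f0$2d0!:f3$0d2!:f1 Y Z#0(hold2 d1)!:f5$0d4 Y Y!:f1$0d0 Z!:f3$0d1!:f5$0d1#0(hold4 d1)Y Y(N [FR,FL,SL,SL,SL] [])
$2a5$2a3$2a0"])
    (simp_all add: dead2_01121221 dead2_11111221 dead2_11121221 dead2_12212122)

lemma dead2_11121222: "dead s2 (Nd (Nd (Nd (Lf K1) (Lf K1)) (Nd (Lf K1) (Lf K2))) (Nd (Nd (Lf K1) (Lf K2)) (Nd (Lf K2) (Lf K2))))"
  by (rule case2.dead_by_certificate[where es = "[E g0 0 1 1, E g1 3 1 0, E g2 2 1 0, E g3 0 (-1) 1, E g4 0 (-1) (-2), E g5 0 (-1) 1, E g6 0 0 1, E g7 0 1 0]" and ce = "!:g3$0e3!:g5$0e5!:g1!:g6$0e6!:g0 Z!:g2!:g4!:g7$0e7(N [SR,SL,SL,SR] [])Z Z Z Z Z$0f0!:g2$2f2!:g4$2f4 Z Z Z Z Z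
!:g1$2f1!:g4$2f4!:g2!:g6$0e6 Z$2f2 Z Z Z!:g4$2f4 Z Z!:g1$2f1!:g5$0e5!:g2$2f2!:g4!:g6$0e6 Z$2f4 Z Z Z!:g6$0e6!:g2
$2f2!:g4$2f4!:g0 Z!:g7$0e7(N [FR,SL,SL,SL] [S1,S0])Z#0f0 Z!:g4$2f4 Z Z!:g7$0e7$2f7!:g2$2f2!:g4$2f4!:g0 Z
(N [SL,SL,SL,SL] [S0,S1,S2])#0f0 Z!:g4$2f4 Z Z!:g2$2f2!:g5$0e5 Z!:g4$2f4!:g6$0e6 Z!:g7$0e7$2f7 Z Z!:g4!:g5$0e5 Z
$2f4 Z Z"])
    (simp_all add: dead2_0110101111212122 dead2_1111112211222222 dead2_11111221)

lemma dead2_0111112112122221: "dead s2 (Nd (Nd (Nd (Nd (Lf K0) (Lf K1)) (Nd (Lf K1) (Lf K1))) (Nd (Nd (Lf K1) (Lf K1)) (Nd (Lf K2) (Lf K1)))) (Nd (Nd (Nd (Lf K1) (Lf K2)) (Nd (Lf K1) (Lf K2))) (Nd (Nd (Lf K2) (Lf K2)) (Nd (Lf K2) (Lf K1)))))"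
  by (rule case2.dead_by_certificate[where es = "[E e0 2 2 0, E e1 0 0 5, E e3 2 0 0, E e4 (-3) (-3) 2, E e5 2 (-7) (-12), E e7 2 2 2, E f1 0 2 2, E f3 0 (-11) 2, E f7 2 0 0]" and ce = "!:f3$0b3!:e5!:f5$0b5!:f7!:f6$0b6!:e1!:e4 Z Z$0c4!:e4 Z Z$0c4$0c1$0d6#2b7$2b7$2c5!:e1 Z Z!:e3$0c1 Z Z Z!:f7$0d3
!:f5$0b5!:e7#2b7#2b7!:f6$0b6#2b7!:e3$2c3!:e5$2c5#0(hold4 c7)!:e1$2c1 Z!:e0$2c0!:e2!:e6$0a6#0(hold3 c7)$2c2#2c3
$2c3$2a0!:e6$0a6!:e2$2c2!:f2$2d2#2(hold3 c6)(N [SL,SL,FL,FR,SL] [])$2c6!:e1$2c1!:e5$2c5!:e4$2c4 Z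
(N [SL,FL,FR,SL,SR] [])Z!:e0$2c0!:e4$2c4!:e5$0c1!:f1$0b1(N [FR,SR,SR,SL,FR] [])!:f4$0b4!:f0$2d0!:e2$2c2!:f2$2d2 Y
#2b2 Y#2d4!:f2$2d2!:e2$2c2!:f0$2d0 Y Y!:f0$2d0 Y$2d2!:e2$2c2 Y!:f0$2d0 Y Y Z!:e5$0c1#2(hold1 c5)!:e2$2c2!:f2$2d2
!:f4$0b4!:f0!:f1$0b1 Y$2d0#2(hold4 d4)$2d4!:f0$2d0!:f1$0b1#2(hold2 d1)$2d5 Y(N [SL,SL,FL,FR,SL] [])!:f0!:f1$0b1
!:f2$0c2 Y$2d0$2d0!:f1$0b1 Y!:f4$0b4 Y$2d5$2c0$2a0!:f6$0b6!:e7#2b7#2b7!:e3$2c3!:e5$2c5#0(hold4 c7)!:e1$2c1 Z!:e0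
$2c0!:e2!:e6$0a6#0(hold3 c7)$2c2#2c3$2c3$2a0!:e1$2c1!:e5$2c5!:e4 Z Z!:e0$2c0#2c5$2a0 Z!:e0$2c0!:f1$0b1$2d1!:e5
$0c1!:e4!:e6$0a6#0(hold2 c7)$2c4#2c5$2c5!:e4$2c4 Z!:e2$2c2!:e6$0a6#0(hold1 a6)!:f2$2d2!:f0$2d0!:f4$0b4#2d4 Y Y
#2(hold3 b2)!:e6$0a6$2c6!:f0$2d0!:f2$0c2 Y#2b2$2c0$2a0!:f1$0b1!:f4$0b4!:f0!:f2$2d2(N [FR,FR,SL,SL,SL] [])$2d0
(N [SR,FR,SL,FL,SL] [])$2d1!:f0$2d0!:f2$2d2!:e1!:e3$2c3!:e5$2c5!:e4$2c4 Z!:e0$2c0!:e2!:e6$0a6 Y$2c2 Y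
#2(hold0 d2)$2a0$2c1$2c1!:e0#2d1#2d1$2a0$2d1!:e2$2c2#2b2!:e0$2c0!:e1!:e3$0c2!:e5$2c5!:e4$2c4 Z Y$2c1$2c1!:e3$0c2
#2d1!:e5$2c5#2d1 Z$2d1$2a0$2d1!:f4$0b4!:f0$2d0!:e4!:e5$2c5!:e6$0a6!:f2$2d2!:e7!:e3$2c3!:e1$2c1 Z!:e0$2c0 Y$2a0
$0c3#2(hold0 d7)$2d7!:e2$2c2#2b2!:e0$2c0!:e1$2c1!:e3$0c2 Z Z Y$2a0$2c4$2c4!:e6$0a6(N [SR,SL,FR,SL,FL] [])!:e7
$0c6!:e5$2c5!:e0#2d4#2d4$2a0!:e3$2c3 Z Z$2d7$2d4$2d4!:e1$2c1!:e4$2c4!:e5$2c5!:e3$2c3 Z Z Z!:e0$2c0!:e3$2c3!:e5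
$0c4!:e7!:e6$0a6!:f0$2d0!:f2$2d2 Y!:e2$2c2#2b2$2c6 Y$0c6!:e6$0a6#2(hold2 c6)!:f0$2d0!:e2$2c2!:f2$2d2 Y#2b2 Y!:e2
$2c2 Y Y$2d7 Z!:e5$0c4!:e7$0c3!:e2$2c2#0(hold1 c3)!:e6$0a6$2c6!:f0$2d0!:f2$0c2 Y Y Y$2d7 Z$2a0!:e0$2c0!:e3$0c1
!:e7!:e5$0c1!:e6$0a6!:e4$2c4!:f0$2d0!:f2$2d2 Y!:e2$2c2#2b2 Y Y!:f0$2d0 Y Y$0c6$0c5!:e5$0c1
(N [FR,SL,SR,SR,FR] [])!:e4$2c4 Z!:e2!:e6$0a6!:f2$2d2 Y$2c2$2c2!:e6$0a6#0(hold1 a6)!:f0$2d0!:f2$2d2 Y#2b2 Y#2c3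
$2d7!:e7$0c3!:e4$2c4!:e5$0c1!:e2$2c2!:e6$0a6#0(hold1 a6)!:f2$2d2!:f0$2d0 Y Y#2c2!:e6$0a6#0(hold1 a6)!:f0$2d0!:f2
$0c2 Y Y Y Z!:e5$0c1#2c5!:e2$2c2!:e6$0a6#0(hold1 a6)!:f2$2d2!:f0$2d0 Y Y Y!:e6$0a6$2c6!:f0$2d0!:f2$0c2 Y Y$2c0
$2d7$2a0$2b7"])
    (simp_all add: dead2_01121221 dead2_11121222)

lemma dead2_1112222222222121: "dead s2 (Nd (Nd (Nd (Nd (Lf K1) (Lf K1)) (Nd (Lf K1) (Lf K2))) (Nd (Nd (Lf K2) (Lf K2)) (Nd (Lf K2) (Lf K2)))) (Nd (Nd (Nd (Lf K2) (Lf K2)) (Nd (Lf K2) (Lf K2))) (Nd (Nd (Lf K2) (Lf K1)) (Nd (Lf K2) (Lf K1)))))"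
  by (rule case2.dead_by_certificate[where es = "[E e0 1 0 0, E e1 (-1) 0 0, E e2 1 0 0, E f3 0 0 1, E f5 1 0 0]" and ce = "!:e1!:e3$0a3!:e5$0a5!:f1$0b1!:e0!:e4$0a4!:f0$0b0!:e2!:e6$0a6!:f2$0b2!:f3$0b3!:f5!:f4$0b4!:f7!:e7$0a7!:f6$0b6 Y
$0d6$0c7!:e7$0a7!:f6$0b6#0d7 Y Y$2b7$0d4 Z$2b5!:f7$0d3!:e7$0a7!:f4$0b4 Y!:f5$0d4!:f6$0b6#0(hold0 d4)Y$2b5 Y$2b7
$2c2$2c2!:f3$0b3 Z!:f2$0b2(N [SR,SL,FL,FR,SL] [])!:f5!:f4$0b4!:f7$0d3!:f6$0b6!:e6$0a6!:e7$0a7 Y Y#2d6!:e7$0a7 Y Y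
$2b7$0d4 Z$2b5$2a2$2c0$2c0!:e2!:e6$0a6!:f2$0b2!:f3$0b3 Z!:f5!:f4$0b4!:f7$0d3!:e4$0a4!:e7$0a7!:f0$0b0!:f6$0b6 Y Y
Y Y!:e7$0a7 Y Y$2b7$0d4 Z$2b5$2c2$2c2 Z$2a2$0c0$2c1$2c1$2c1!:e2!:e3$0a3!:e6$0a6!:f2$0b2!:e0!:e4$0a4!:e5$0a5#2a1
!:f0$0b0!:f1$0b1#2a1!:f5$0c5!:f4$0b4!:f7!:e7$0a7!:f3$0b3!:f6$0b6 Y$0d6$0d3$0c7!:e7$0a7#0(hold0 c5)!:f3$0b3
#0(hold0 d1)Y$2b7(N [FR,SL,SL,FL,SL] [])$2b5$2c0$2c0!:e5$0a5#2a1!:f1$0b1#2a1!:f5$0c5!:f3$0b3 Z!:f7$0d3!:e7$0a7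
!:e4$0a4#0(hold0 c5)!:f0$0b0!:f6$0b6!:f4$0b4 Y#2(hold0 d5)Y!:f6$0b6 Y$2d2!:f6$0b6!:e4$0a4!:f0$0b0!:f4$0b4#0c0
#2(hold3 c4)Y!:f0$0b0 Y Y(N [FR,SL,SL,FR,SL] [])$2b7$2b5$0c0$2c2$2c2$2c2!:f5!:e5$0a5!:f1$0b1!:e0#2a1#2a1!:e3$0a3
#2(hold4 a1)!:e4$0a4#0(hold1 c0)!:f0$0b0#0(hold2 c0)!:f3$0b3 Z!:f4$0b4!:f6$0b6!:f7$0d3!:e7$0a7!:e6$0a6 Y#2c7 Y
$2b7$2d4$0d4$0d1$0c5!:e0!:e4$0a4!:f0$0b0!:f3$0b3 Z!:f7$0d3!:e3$0a3!:e5$0a5#2a1!:f1$0b1#2a1!:f2$0b2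
(N [SR,SL,FL,FR,SL] [])!:f4$0b4!:e6$0a6!:e7$0a7#0(hold0 c5)#2c3!:e7$0a7#0(hold0 c5)!:f6$0b6#2d6 Y$2d0!:e5$0a5
!:f1$0b1#2a1!:f4$0b4(N [SR,SL,SL,FL,SL] [S2])!:f2$0b2!:e6$0a6!:f6$0b6#0(hold0 d4)(N [SR,SL,SL,FR,FL] [])!:e7$0a7
#2c7!:f6$0b6#0(hold0 d4)Y$2d0!:e6$0a6!:e7$0a7#2c7!:f1$0b1!:f4$0b4(N [SR,SL,SL,FL,SL] [S1,S2])!:f6$0b6!:f2$0b2
#0(hold0 d4)#0(hold0 d4)Y!:f4$0b4!:f6$0b6!:f2$0b2 Y Y Y(N [FR,SL,SL,FL,SL] [])!:e7$0a7$2c7!:f4$0b4!:f1$0b1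
(N [SR,SL,SL,FL,SL] [S1,S2])!:f2$0b2!:f6$0b6 Y Y Y$2c4$2b7$2c0$2c0 Z Z$2b5$2a2$2a1"])
    (simp_all add: dead2_0111112112122221 dead2_01121221 dead2_11121222)

lemma dead2_0111112212122121: "dead s2 (Nd (Nd (Nd (Nd (Lf K0) (Lf K1)) (Nd (Lf K1) (Lf K1))) (Nd (Nd (Lf K1) (Lf K1)) (Nd (Lf K2) (Lf K2)))) (Nd (Nd (Nd (Lf K1) (Lf K2)) (Nd (Lf K1) (Lf K2))) (Nd (Nd (Lf K2) (Lf K1)) (Nd (Lf K2) (Lf K1)))))"
  by (rule case2.dead_by_certificate[where es = "[E e3 0 0 1]" and ce = "!:e3 Z Z!:e1$2c1#2a3!:e0$2c0!:e2$2c2#2a3!:e7$0a7#2a3!:f3$0b3#2a3!:f7$0c7!:f6$0b6!:f5#2b7#2b7!:e5$0c1#2(hold3 b5)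
!:f1$0b1$2d1!:f4$0b4#2(hold3 b5)!:f0$2d0!:f2$0c2!:e4$2c4!:e6$0a6#0(hold4 c2)Y Y#2b2!:e4$2c4!:e6$0a6 Y!:f2$0c2 Y
$2d6$2c0!:e6$0a6$2c6!:f1$0b1!:f0!:f2$0c2!:e4$2c4!:f4$0b4 Y$2d0 Y$2d0!:f2$0c2#2(hold2 d1)!:f5!:e5$0c1!:f4$0b4 Y
$0d4$0c5#0(hold3 b1)$2d1$2d1!:f5$0d1!:e5$0c1!:e4$2c4!:f0$2d0!:f2$0c2 Y!:f4$0b4#0(hold3 b4)Y Y#2c5!:e4$2c4!:f4
$0b4!:f0$2d0#0(hold3 b4)#0(hold3 b4)!:f2$0c2!:f0$2d0 Y$2d2 Y!:f0$2d0!:f2$0c2 Y!:f4$0b4#0(hold3 b4)Y$2c0$2d7$2b7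
$2a0"])
    (simp_all)

lemma dead2_0011111211222222: "dead s2 (Nd (Nd (Nd (Nd (Lf K0) (Lf K0)) (Nd (Lf K1) (Lf K1))) (Nd (Nd (Lf K1) (Lf K1)) (Nd (Lf K1) (Lf K2)))) (Nd (Nd (Nd (Lf K1) (Lf K1)) (Nd (Lf K2) (Lf K2))) (Nd (Nd (Lf K2) (Lf K2)) (Nd (Lf K2) (Lf K2)))))"
  by (rule case2.dead_by_certificate[where es = "[E e0 1 1 0, E e1 1 1 0, E e2 1 1 1, E e3 12 1 1, E e4 1 1 1, E e5 12 1 1, E e6 1 1 1, E e7 0 (-20) 1, E f0 1 1 (-9), E f1 1 1 1, E f2 0 1 1, E f3 0 (-9) 1, E f4 0 1 1, E f5 0 (-9) 1, E f6 0 1 1, E f7 0 1 (-20)]" and ce = "!:e7$0a7!:f7$0b7!:f5$0b5!:e3!:f3$0b3 Z$2c3 Z Z!:e5$2c5!:e3!:f3$0b3 Z$2c3 Z Z!:e1$2c1!:e3!:f3$0b3 Z$2c3 Z Z$2a1 Z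
!:e3$2c3!:f5$0b5!:f7$0b7!:f3$0b3!:e5$2c5 Z Z!:f6$0b6!:e5$2c5!:e1!:f1$2d1!:f2$0b2!:e6$2c6#2d7!:e2$2c2#2a6!:e0$2c0
!:e4$2c4#2a6!:f0!:f4$0b4#2d7$2d0#2(hold2 d2)$2d2$2a0!:f0$2d0!:e2$2c2!:e6$2c6!:e4!:f4$0b4#2d7$2c4#0(hold0 c7)
#0(hold0 c7)#2a6!:e0$2c0!:e6$0c2!:e4!:f4$0b4#2d7$2c4#0(hold0 c7)#2(hold1 c6)!:e4$2c4#2a6!:f4$0b4 Y$2d6$2a0 Z$2c1
!:f1$2d1(N [FR,SL,SL,SL,FR] [S1,S0])!:f0$2d0!:f4$0b4!:e0!:e6$2c6!:e2!:f2$0b2#2d7$2c2#0(hold0 c7)$2c0!:e2$2c2#2a6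
$2c0#0(hold3 d1)$2a0#2(hold3 d5)Z$2a1!:e1$2c1!:f1$2d1!:f2$0b2!:e2!:e6$2c6!:f0!:f4$0b4#2d7$2d0#0(hold0 d3)Z$2c2
#0(hold0 d3)#0(hold0 d3)!:f0$2d0!:f4$0b4!:e0!:e2$2c2!:e4$2c4!:e6$2c6 Y#0(hold4 c6)$2c0$2c0!:e2$2c2!:e4$2c4
#0(hold3 c5)!:e6$0c4#0(hold4 c4)#2a6#2c3$2a0#2(hold3 d5)Z(N [SL,SL,SL,FL,FR] [])$2a1$2d7 Z!:f7$0b7!:f3$0b3!:f6
$0b6!:e1!:e5$2c5!:f1$2d1!:f4$0b4!:e6$2c6#2d7!:e2$2c2#2a6!:e0$2c0!:e4$2c4#2a6!:f0!:f2$0b2#2d7$2d0#2(hold3 d4)$2d4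
$2a0!:f0$2d0!:e4$2c4!:e6$2c6!:e2!:f2$0b2#2d7$2c2#0(hold0 c7)#0(hold0 c7)#2a6!:e0$2c0!:e6$0c4!:e2!:f2$0b2#2d7$2c2
#0(hold0 c7)#2(hold1 c6)!:e2$2c2#2a6!:f2$0b2 Y$2d6$2a0 Z$2c1$2c1!:e5$2c5!:f1$2d1(N [FR,SL,SL,SL,FR] [S0])!:f0
$2d0!:f2$0b2!:e0!:e6$2c6!:e2!:e4!:f4$0b4#2d7$2c4#0(hold0 c7)$2c0#0(hold0 c7)$2c0!:e2$2c2#2a6$2c0#0(hold2 d1)$2a0
#2(hold2 d3)Z!:e4$2c4!:e6$2c6!:f2$0b2!:f4$0b4!:f1$2d1#2d7!:f0$2d0!:e2 Y Y#0(hold3 c2)Z!:f0$2d0!:e2 Y!:f1$2d1 Y Y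
#0(hold3 c2)Z!:f0$2d0!:f1$2d1!:f4$0b4!:e2$2c2#0(hold0 d2)!:e0$2c0#0(hold1 c2)$2a0 Y#2(hold2 d3)Z#2a6!:e0$2c0!:e6
$0c4!:f4$0b4(N [FR,SR,FR,SR,SL] [])!:f0$2d0!:f2$0b2!:e2!:f1$2d1 Y#0(hold2 d1)#0c2#0(hold4 c2)!:e2$2c2
#0(hold0 d2)#0(hold1 c2)Z!:e2$2c2#2a6!:f4$0b4!:f2$0b2!:f0!:f1$2d1 Y$2d0#0(hold2 c2)$2d4!:f0$2d0!:f1$2d1
#2(hold3 d4)#0(hold2 d1)$2d4(N [SL,SL,FR,SL,SL] [S2])$2a0$2a1$2d7$2d7!:e5$2c5 Z Z!:e1$2c1!:f5$0b5!:f7$0b7!:e2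
$2c2!:e6$2c6!:f3$0b3!:e5$2c5 Z Z!:f6$0b6!:e5$2c5!:f4$0b4!:f1$2d1!:f2$0b2#2d7!:f0$2d0!:e4 Y Y#0(hold2 c4)Z!:f0
$2d0!:e0!:e4 Y!:f2$0b2 Y Y$2c0#0(hold3 d1)$2a0 Z!:f0$2d0!:f1$2d1!:f2$0b2!:e4$2c4#0(hold0 d4)!:e0$2c0#0(hold1 c4)
$2a0 Y#2(hold3 d5)Z!:f1$2d1!:f0!:f2$0b2!:e4$2c4 Y!:e0$2c0!:f4$0b4 Y$2d0$2a0$2d0!:f4$0b4!:f2$0b2!:e4$2c4 Y!:e0
$2c0#0(hold4 c4)$2a0 Y#2(hold3 d5)Z(N [SL,SL,SL,FL,FR] [])$2d7(N [SL,FL,SL,FR,SL] [])!:e0$2c0!:f3$0b3!:e5$2c5 Z Z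
!:f6$0b6!:f2$0b2!:e6$0c2(N [FR,SR,SR,FR,SL] [])!:e4$2c4#2a6!:f0!:f1$2d1!:f4$0b4!:e5$0c4 Y Y$2d0$2d0!:f1$2d1
#2(hold2 d2)!:f4$0b4#2d2 Y$2d2!:e6$0c2!:e5$2c5!:f0$2d0!:f4$0b4!:e4!:f1$2d1 Y#0(hold3 d1)#0c4#0(hold4 c4)!:e4$2c4
#0(hold0 d4)#0(hold1 c4)Z!:f0$2d0!:f1$2d1!:e4$2c4 Y!:f4$0b4#0(hold4 c4)#2(hold3 d5)Y Z(N [SL,SL,SL,FR,SL] [S2])
$2d7$2a0 Z!:f3$0b3!:f1$2d1!:f7$0b7!:f6$0b6!:e5$2c5!:f4$0b4!:e4!:e6$2c6!:f0!:f2$0b2#2d7$2d0#0(hold0 d5)Z$2c4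
#0(hold0 d5)#0(hold0 d5)!:f0$2d0!:f2$0b2!:e0!:e2$2c2!:e4$2c4!:e6$2c6 Y#0(hold4 c6)$2c0$2c0!:e2$2c2#0(hold2 c3)
!:e4$2c4!:e6$0c2#0(hold4 c2)#2a6#2c5$2a0#2(hold2 d3)Z!:e4$2c4!:e6$2c6!:f0!:f2$0b2!:e2$2c2 Y!:e0$2c0!:f4$0b4 Y
$2d0$2a0$2d0!:f2$0b2!:f4$0b4!:e2$2c2 Y!:e0$2c0#0(hold4 c2)$2a0 Y#2(hold2 d3)Z#2a6!:e0$2c0!:f0!:f2$0b2!:e2$2c2
#0(hold2 c3)!:e6$0c2#2c6!:f4$0b4 Y$2d0$2d0!:f2$0b2!:e2$2c2#0(hold2 c3)!:e6$0c2#0(hold4 c2)!:f4$0b4#2(hold3 d4)Y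
#2(hold2 d3)Z$2a0$2d7 Z(N [SL,SL,FL,SL,FR] [])!:f7$0b7$2d7!:e5$2c5 Z Z$2a1"])
    (simp_all add: dead2_01121221 dead2_11111221 dead2_11121222 dead2_1112222222222121)

lemma dead2_0111112212122122: "dead s2 (Nd (Nd (Nd (Nd (Lf K0) (Lf K1)) (Nd (Lf K1) (Lf K1))) (Nd (Nd (Lf K1) (Lf K1)) (Nd (Lf K2) (Lf K2)))) (Nd (Nd (Nd (Lf K1) (Lf K2)) (Nd (Lf K1) (Lf K2))) (Nd (Nd (Lf K2) (Lf K1)) (Nd (Lf K2) (Lf K2)))))"
  by (rule case2.dead_by_certificate[where es = "[E e4 0 0 (-3), E f4 0 (-3) 0, E f7 0 0 (-3)]" and ce = "!:f4$0b4 Z!:e4$2c4!:f5$0d4!:f7$0b7!:e5#2b5#2b5!:e7$0a7#0(hold2 c5)!:f1$0b1#2b5!:e1$2c1#0(hold3 c5)!:e0$2c0!:f0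
$2d0(N [SL,SL,SL,FL,SL] [S0,S2,S1])!:f6$0b6!:f2$0d0!:e6$0a6!:e2!:e3$0c1!:f3$0b3
(N [FR,SL,SL,SR,SL] [S0,S1,S0,S2,S1])Y$2c2!:f3$0b3!:e3$0c1#0c2#2a3 Y#0(hold4 c2)!:e2$2c2#2c4!:f3$0b3!:e3$0c1
#0(hold2 c2)Y Y!:e6$0a6!:e2$2c2(N [SL,SL,SL,SL,FL] [S0,S1,S2])!:f3$0b3(N [FR,FR,SR,SR,SR] [])Y$2d6!:f3$0b3!:f2
$0d0!:e3$0c1!:e2!:e6$0a6 Y$2c2 Y#0(hold2 c2)!:e2$2c2#2a3 Y!:e3$0c1!:e2$2c2(N [SL,SL,FL,FR,SL] [S0])Y$2d3$2d7$2a0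
Z$2b5 Z"])
    (simp_all add: dead2_0111112112122221 dead2_0111112212122121 dead2_11111221 dead2_11121222)

lemma dead2_0111122112221221: "dead s2 (Nd (Nd (Nd (Nd (Lf K0) (Lf K1)) (Nd (Lf K1) (Lf K1))) (Nd (Nd (Lf K1) (Lf K2)) (Nd (Lf K2) (Lf K1)))) (Nd (Nd (Nd (Lf K1) (Lf K2)) (Nd (Lf K2) (Lf K2))) (Nd (Nd (Lf K1) (Lf K2)) (Nd (Lf K2) (Lf K1)))))"
  by (rule case2.dead_by_certificate[where es = "[E e0 (-1) 0 0, E e1 0 (-1) 0, E e2 5 4 0, E e3 (-4) (-6) 0, E e5 0 0 4, E e6 0 (-51) (-47), E e7 7 0 (-5), E f0 6 6 7, E f1 0 6 7, E f2 0 6 7, E f3 0 3 7, E f4 0 (-1) 1, E f5 0 7 7, E f7 8 7 0]" and ce = "!:e6$0a6!:e7!:e5$0a5!:f1$0b1!:e3!:f3$0b3!:f6$0b6!:f7!:f5$0b5!:e2!:f2$0b2!:f4!:f0 Z Z$0d0 Z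
(N [SR,FR,FR,SR,SR] [])$2c2!:f4!:f0 Z Z$0d0 Z(N [SR,FR,FR,SR,SR] [])$0c2$0d5#2b7$2b7!:f7$0d6!:f4$2d4 Z!:e4$2c4
!:f5$0b5#2b7!:e1!:f0$2d0!:e0 Z!:e2!:f2$0b2 Z$2c2 Z$0c2$2a0!:e0$2c0 Y$2a0(N [SR,SL,SL,FL,FR] [])$0c1
(N [SR,FL,FR,SR,SR] [])$2b7$2c3!:f7!:f3$0b3!:e0 Z!:e1!:e2!:f2$0b2 Z$2c2 Z Z Z#2(hold4 a1)$2a0$0d3!:f3$0b3 Z!:f2
$0b2!:f0!:f4!:e0 Z!:e1!:e2!:e4$0c0!:f5$0b5!:f6$0b6#2b7$2d4$2d4$0c4 Z Z Z#2(hold4 a1)$2a0 Z$2d0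
(N [SR,FR,FL,SL,SL] [])(N [SL,FR,FL,SL,SL] [S0,S1])!:e2$2c2!:f0$2d0!:f5$0b5!:f6$0b6#2b7!:f4$2d4 Z!:e4$2c4
#0(hold3 d4)(N [SR,FL,FR,SR,SR] [])!:e1!:f4$2d4 Z!:e4$2c4!:f6$0b6#0(hold4 d4)!:e0 Y Y$2a0(N [SR,FL,FR,SR,SR] [])
#2(hold4 d1)$2d1!:e0$2c0!:e1!:f5$0b5!:f6$0b6#2b7!:e4!:f4$0d0 Y$2c4 Y Y$2d1#2(hold2 d1)$2d1$2a0 Z$2b7$0c3!:f5$0b5
!:f7!:f3$0b3!:f6$0b6!:e3!:e1$2c1!:f0$2d0!:f4!:e0 Z!:e2!:f2$0b2 Z$2c2 Z$0c2$2a0 Z#2(hold1 b4)!:e0$2c0!:f4$0d0!:e2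
!:f2$0b2 Z$2c2 Z$0c2(N [SR,FR,FR,SR,SR] [])$2a0$0c1!:f4!:f0$2d0 Z$0d0 Z(N [SR,FR,FR,SR,SR] [])$0c3$0d6$0d3!:f3
$0b3#2b7!:e3$2c3!:e1$2c1!:f6$0b6#2b7!:f0$2d0!:f4$2d4!:e0 Z!:e2!:f2$0b2 Z$2c2 Z Z$2a0#2d5!:e0$2c0!:f2$0b2$2d2!:e2
$2c2!:f4$0d0 Y!:e4$2c4#2d5 Y Z$2a0(N [SR,SL,SR,SR,FR] [S0,S1,S0,S2,S1,S0])$0c3$2b7!:f7$0d5!:e3!:e1$2c1!:f3$0b3
!:f4$2d4 Z!:e4$2c4!:f6$0b6#2b7!:f0$2d0!:e0 Z!:f2$0b2 Z#2d0$2a0!:e0$2c0!:f2$0b2 Y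
(N [SR,FR,SR,SR,SR] [S0,S1,S0,S2,S1])$2a0(N [SR,FL,FR,SR,SR] [])$2c3$0c1!:f2$0b2!:f3$0b3 Z!:e2!:f4$2d4!:f0$2d0
!:e0 Z!:e1$2c1 Z Y$2a0!:f6$0b6(N [FR,FR,SR,SR,SL] [])$2d2!:e4$2c4!:f6$0b6(N [SR,SL,FR,SR,SR] [S1])!:f0$2d0!:e0 Y
!:e1$2c1 Y Y$2a0$2d2(N [SR,FL,FR,SR,SR] [])!:f6$0b6!:f0$2d0!:f4$2d4 Z!:e4$2c4#0(hold4 d4)(N [SR,FL,FR,SR,SR] [])
#2d2#2(hold3 d2)Z!:e2$2c2!:f3$0b3 Z!:f4$2d4!:f0$2d0!:e0 Z!:e1$2c1 Z!:f6$0b6 Y Y$2a0!:e0$2c0!:e1$2c1!:f6$0b6 Y Y Y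
$2a0!:e4$2c4!:f6$0b6#2d6!:f0$2d0(N [SL,FR,SL,SL,SL] [S1,S0,S2,S1])!:e0$2c0 Y$2a0(N [SR,FL,FR,SR,SR] [])Z$0c3$2b7
$0c5!:f3$0b3!:e3!:e0 Z!:e1!:e5$0a5 Z$2c1 Z$0c1$2a0 Z!:e2$2c2!:f2$0b2#0(hold3 c3)#0(hold3 c3)Z!:f7$0d3!:e3$2c3
!:e5$0a5 Z!:f5$0b5!:f6$0b6#2b7!:f4$2d4 Z!:e4$2c4#2(hold2 d5)!:e0$2c0!:e2!:f1$0b1!:e1$2c1 Z Y$2d5#0(hold1 a6)$2c6
$2a0!:f4$2d4 Z!:f0$2d0!:e0 Z!:e1$2c1 Z!:e2!:f2$0b2 Z$2c2 Z Z$2a0!:e0$2c0!:f1$0b1$2d1!:e1$2c1!:e2!:f2$0b2 Z$2c2 Z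
Z!:e4$2c4!:e2!:f2$0b2 Y$2c2#0(hold1 a6)Z Y$2a0!:e2$2c2!:e4!:e5$0a5!:e1$2c1#0(hold1 c3)!:e0$2c0!:f4!:f5$0b5!:f6
$0b6#2b7$2d4$2d4!:f0 Z Z!:f1$0b1$2d1!:f2$0b2 Z!:f5$0b5!:f6$0b6#2b7 Y Y$2c4$2a0$2c4#0(hold1 a6)#0(hold1 a6)!:e0
$2c0!:e4!:e5$0a5 Z$2c4#0(hold1 a6)#0(hold1 a6)$2a0$2b7#2(hold1 a7)!:e2$2c2!:e5$0a5!:e7$0c6!:f3$0b3!:e3 Z Z!:f2
$0b2#0(hold3 c3)#0(hold3 c3)!:f7$0d3!:e3$2c3!:e0 Z!:e1!:f1$0b1 Z$2c1 Z(N [SL,FL,SL,SR,FR] [S1,S0])$2a0!:e1$2c1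
#0(hold1 c3)!:e4$2c4#0(hold1 a5)#0(hold1 a5)$2b7#2(hold1 a7)!:f7!:e7$0c5!:f3$0b3!:f5$0b5!:f6$0b6!:f2$0b2!:e3!:e1
$2c1!:f4!:f0 Z Z$0d0 Z(N [SR,FR,FR,SR,SR] [])$0c1!:f4 Z Z(N [SR,FR,FR,SR,SR] [])#0(hold3 c3)!:e3!:e1$2c1!:f0$2d0
!:f1$0b1!:f4 Z Z$2d6 Y!:e0$2c0!:f4$0d0!:f1$0b1 Z Y$2d6$2a0$0c1!:f4!:f0$2d0 Z$0d0 Z$2d6#2(hold3 c2)$0d6$0d5$0d3
$0c7!:e1$2c1!:f3$0b3!:e7$0c5!:e3!:f5$0b5#2b7!:f4$2d4 Z!:f6$0b6#2b7!:e4$2c4!:e0!:f0$2d0 Z$2c0#2c4$2a0!:e0$2c0!:f0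
$2d0!:f1$0b1 Z!:f2$0b2 Z#2d0!:f1$0b1#2d1!:f2$0b2#2d2(N [SR,FR,SR,SR,SR] [S0,S1,S0,S2,S1])$2a0 Z#0(hold4 c3)!:e0 Z
!:e3$2c3 Z!:f1$0b1 Z#0(hold2 c3)$2a0!:e3$2c3!:e7$0c5!:e0!:e4$2c4!:f0!:f1$0b1!:f2$0b2 Z$2d0$2d0!:f5$0b5!:f4!:f6
$0b6#2b7$2d4 Z#2(hold2 d5)!:f1$0b1#2d1!:f4$2d4 Z(N [SL,SL,SL,FL,SL] [S0,S1,S2,S1,S0])$2c0$2c0!:e4$2c4
(N [FR,FL,SL,SL,SL] [])!:f1$0b1!:f0!:f4$0c4 Z$2d0!:f2$0b2(N [SR,FR,FL,SL,SL] [])!:f4$0c4 Z!:f5$0b5#2d5#2d1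
#2(hold2 d1)!:f5$0b5!:f4$0c4!:f0$2d0#2d5!:f6$0b6#2b7 Y$2d5!:f0$2d0!:f4$0c4!:f2$0b2 Z!:f6$0b6#2d6 Y!:f2$0b2!:f6
$0b6#2d6#2d2 Y!:f2$0b2#2(hold2 d2)!:f6$0b6!:f4$0c4 Y$2d6 Y$2a0 Z!:e7$0c3#0(hold1 c3)!:e4$2c4!:e0!:f5$0b5!:f0!:f1
$0b1!:f2$0b2!:f4 Z Z$2d0$2d0$2d0!:f1$0b1!:f2$0b2(N [SR,FR,FL,SL,SL] [])!:f4!:f6$0b6 Y$2d4 Z#0(hold3 d4)!:f2$0b2
!:f4!:f6$0b6 Y$2d4 Z$2d5 Y$2c0!:f6$0b6!:f0!:f1$0b1!:f4$2d4 Z$2d0$2d0!:f4$2d4!:f2$0b2 Z#2(hold4 d6)#2b4$2c0$2d7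
(N [FR,FL,SL,SL,SL] [])$2a0!:e0$2c0!:f2$0b2!:f1$0b1!:f0!:f4$0c4 Z$2d0(N [SR,FR,FL,SL,SL] [])#0(hold2 d0)!:f5$0b5
!:f0$2d0#2c1!:f4$0c4!:f6$0b6#0(hold4 d0)$2d2$2d5!:f6$0b6!:f0$2d0!:f4$0c4 Y Y Y$2d7!:f6$0b6!:f0$2d0#2c2!:f4$0c4
!:f5$0b5(N [SR,FR,FR,SL,SL] [])Y$2d6!:f5$0b5!:f4$0c4!:f0$2d0!:f1$0b1 Y#2c1 Y!:f1$0b1!:f0$2d0 Y Y$2d5$2d7$2a0!:e0
$2c0!:f1$0b1!:e4$2c4!:e7$0c5!:e3$0c1!:f3$0b3 Z!:f0!:f2$0b2!:f4!:f6$0b6#0(hold0 c6)$2d4 Z$2d0$2d0#0(hold2 c1)$2d1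
(N [SL,FL,SL,SL,SL] [S0,S2,S1])!:e3$0c1 Z(N [SL,FL,SL,SL,SL] [S0,S2,S1])!:f6$0b6!:f4$0c4!:f5$0b5
(N [SR,FR,FR,SL,SL] [])!:f0!:f2$0b2!:f3$0b3(N [SR,FR,SL,SL,SL] [S2,S1])$2d1$2d0#2(hold3 d1)$2d1!:f0$2d0!:f2$0b2
(N [SL,SL,SL,SL,FL] [S0,S1,S0,S2,S1])$2d6(N [SL,SL,FL,FL,SL] [])!:f0!:f2$0b2!:f4$0c4!:f3$0b3!:f5$0b5
(N [SR,FR,SL,SL,SL] [S1])Y!:e7$0c5 Y Y$2d0$2d0!:f3$0b3!:e3$0c1#0(hold2 c1)!:e7$0c3#0(hold3 c3)Z!:e3$0c1
#0(hold2 c1)!:f2$0b2#2(hold2 d1)(N [SL,SL,FL,SL,SL] [S0,S1,S2,S1,S0])(N [SL,SL,FL,FL,SL] [])!:f5$0b5!:f3$0b3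
(N [SR,FR,SR,SR,FR] [])!:e7$0c5!:f6$0b6#2b7!:f4$2d4!:f0$2d0!:e4$2c4#2d5!:e3$0c1 Y!:f2$0b2#2d2 Y!:e4$2c4!:e3$0c1 Y
#2c7 Y$2d5!:e3$0c1 Z!:e4$2c4(N [SL,FL,SL,SL,SL] [S0,S2,S1])!:f4$0c4!:f6$0b6(N [SR,FR,FR,SL,SL] [])!:f0$2d0 Y Y
$2d5!:e3$0c1!:e7$0c5!:f3$0b3!:f0$2d0 Z!:f2$0b2 Z!:f4$0d0 Z!:f6$0b6$2d6(N [SR,FR,SR,SR,SR] [S0,S1,S0,S2,S1])!:e4
$2c4!:f4$2d4!:f6$0b6#0(hold0 c6)!:f0$2d0 Y Y!:f0$2d0#2c4!:f6$0b6#2(hold2 d6)Y!:f0$2d0!:f6$0b6!:f2$0b2 Y!:f4$0c4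
#2d6$2d6 Y!:f6$0b6 Y Y Z!:e7$0c3!:e4$2c4(N [SL,FL,SL,SL,SL] [S0,S2,S1])!:f3$0b3#0(hold3 c3)!:f4$0c4!:f0$2d0!:f6
$0b6!:f2$0b2 Y#2c2 Y!:f6$0b6 Y$2d4!:f6$0b6!:f2$0b2!:f0$2d0#2d6 Y$2d6!:f0$2d0!:f2$0b2 Y Y Y!:e4$2c4
(N [SL,FL,SL,SL,SL] [S0,S2,S1])!:f3$0b3!:f2$0b2!:f0$2d0 Z!:f6$0b6 Y Y$2d3!:f6$0b6!:f0$2d0!:f2$0b2 Y!:f4$0c4 Y
$2d6 Y$2d7$2a0$2b7!:e0$2c0!:e3$0c2!:e7$0c6!:e5$0a5 Z!:f3$0b3 Z!:f7$0d3!:e1$2c1 Z#2c3$2b7 Z!:f3$0b3!:e7$0c3!:e5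
$0a5 Z!:f7!:f5$0b5!:f6$0b6!:f2$0b2!:f1$0b1!:e1$2c1#0(hold4 c3)!:f4!:f0 Z Z$0d0 Z(N [SR,FR,FR,SR,SR] [])!:e1$2c1
#2(hold4 c1)!:f0$2d0!:e4$2c4 Y!:f4$0c4 Z$2d5(N [SL,SL,FL,SL,FL] [])!:f1$0b1!:e1$2c1#0(hold4 c3)!:f0$2d0!:e4$2c4 Y
!:f4$0c4 Z$2d6(N [SL,SL,FL,FL,SL] [])$2d3$0d6$0d5(N [SL,SL,SR,FR,FR] [S1,S0])$2b7 Z!:f7$0d3!:f2$0b2!:f6$0b6!:f0
!:e7$0c3!:f1$0b1!:e5$0a5 Z!:f5$0b5#2b7!:e1$2c1!:e4$2c4#2c7!:f4$0c4 Y$2d0$2d1$2d0 Z!:e7$0c3!:f1$0b1#2(hold2 d2)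
!:e1$2c1(N [SL,SL,FL,SL,SL] [S0,S1,S0,S2])!:f4#2d2#2d2!:e4$2c4#0(hold4 d4)!:f5$0b5#2(hold2 d6)Y Z$2d2$2d2!:e5
$0a5!:e7$0c3!:e1$2c1!:e4$2c4#0(hold1 a5)#0(hold1 a5)!:e4$2c4#0(hold1 a5)#0(hold1 a5)Z!:f6$0b6!:f4!:e4$2c4!:f0
$2d0!:e7$0c3!:f5$0b5#2b7$2d4 Z$0d0$0c4!:e7$0c3!:f5$0b5#2b7!:e1$2c1!:e4$2c4#2c7!:f0$2d0!:f1$0b1#2d1 Y Y!:f1$0b1
$2d1!:e4$2c4!:f0$2d0#2d6 Y!:f0$2d0 Y$2c0 Z$2d6!:e7$0c3!:e4$2c4!:e1$2c1(N [SL,FL,SL,SL,SL] [S0,S1])!:f5$0b5!:f4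
$2d4!:f0$2d0!:f1$0b1#2d1#2d5 Y#2(hold2 d5)!:f0$2d0!:f1$0b1$2d1!:f4$2d4 Y Y Y!:f1$0b1!:e1$2c1!:f0$2d0!:f5$0b5!:f4
$0c4 Y#2d5 Y!:f5$0b5 Y$2d1!:f0$2d0!:f5$0b5 Y$2d1$2c0!:f0$2d0!:f5$0b5!:e1$2c1#2c1!:f4$0c4 Y$2d5!:e1$2c1!:f4$0c4 Y
Y Y!:e1$2c1!:f5$0b5!:f4$0c4 Y$2d5 Y$2c0!:f4$2d4 Z!:f5$0b5!:f1$0b1!:e1$2c1 Z!:f0$2d0 Z$2d1$2d5$2d7$2b7$2a0"])
    (simp_all add: dead2_0011111211222222 dead2_0111112112122221 dead2_0111112212122121 dead2_0111112212122122 dead2_01121221 dead2_11111221 dead2_11121222 dead2_1112222222222121 dead2_12212122)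

lemma dead2_0110101112112122: "dead s2 (Nd (Nd (Nd (Nd (Lf K0) (Lf K1)) (Nd (Lf K1) (Lf K0))) (Nd (Nd (Lf K1) (Lf K0)) (Nd (Lf K1) (Lf K1)))) (Nd (Nd (Nd (Lf K1) (Lf K2)) (Nd (Lf K1) (Lf K1))) (Nd (Nd (Lf K2) (Lf K1)) (Nd (Lf K2) (Lf K2)))))"
  by (rule case2.dead_by_certificate[where es = "[E f1 0 0 1, E f2 1 0 0]" and ce = "!:f1$0b1 Z!:f2!:f0$2d0!:f3$0d1!:f5$0d1!:f6$0b6!:f4$0b4!:f7$0b7#2(hold1 b5)(N [SR,FR,SL,SR,SL] [S0,S2,S1,S0])!:f7
$0b7(N [SR,FR,SL,SR,SL] [S0,S1,S0])(N [FR,FR,SL,SR,SL] [])$2d2$2b5$2d2$0d0 Z Z"])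
    (simp_all add: dead2_0111112212122121 dead2_01121221)

lemma dead2_01111221: "dead s2 (Nd (Nd (Nd (Lf K0) (Lf K1)) (Nd (Lf K1) (Lf K1))) (Nd (Nd (Lf K1) (Lf K2)) (Nd (Lf K2) (Lf K1))))"
  by (rule case2.dead_by_certificate[where es = "[E g3 0 0 1, E g4 0 0 (-1), E g5 0 0 1, E g6 0 0 1, E g7 2 0 (-1)]" and ce = "!:g7!:g5$0e5!:g6$0e6!:g3 Z Z$0f3$0f6$0f5!:g3 Z Z!:g5$0e5 Z!:g4$2f4!:g6$0e6 Z!:g1$2f1!:g2$2f2#0f3!:g0$2f0
(N [SL,SL,SL,SL] [S0,S1])$2e0!:g0$2f0!:g2$2f2(N [SL,SL,SL,SL] [S0,S2,S1])(N [SL,SL,SL,SL] [])$2e0 Z Z"])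
    (simp_all add: dead2_0111112212122121 dead2_0111122112221221)

lemma dead2_0110112112210110: "dead s2 (Nd (Nd (Nd (Nd (Lf K0) (Lf K1)) (Nd (Lf K1) (Lf K0))) (Nd (Nd (Lf K1) (Lf K1)) (Nd (Lf K2) (Lf K1)))) (Nd (Nd (Nd (Lf K1) (Lf K2)) (Nd (Lf K2) (Lf K1))) (Nd (Nd (Lf K0) (Lf K1)) (Nd (Lf K1) (Lf K0)))))"
  by (rule case2.dead_by_certificate[where es = "[E e0 4 10 0, E e2 0 10 (-15), E e3 0 6 0, E e4 6 0 0, E e5 10 (-9) (-9), E e6 0 (-15) 10, E e7 6 0 0, E f0 0 (-29) (-54), E f1 0 (-9) 10, E f2 0 (-27) 10, E f3 0 10 (-15), E f4 4 10 0, E f5 6 0 0, E f6 0 (-35) (-60), E f7 4 10 0]" and ce = "!:f1$0b1!:e6$0a6!:f2$0b2!:f0!:f3!:f6!:e2!:f7!:e5!:e7$0d7!:f5$0d7!:e0 Z!:e3 Z!:e4!:e1$0c0!:f4$0d4 Y$2b4$0c1 Z$0c4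
$2a3$2a0$2c5$2c5 Z Z!:e0!:e1$0c0!:e4$0c0!:e5!:e7!:e3$0c3!:f5$0d7!:f4 Z Y$2b4$2c5$2a3!:e3 Z!:f4 Z!:f5 Y Z$2c5$2b4
$2a3$2c5 Z Z$2c0$2c0!:f4!:e4$0d4!:e5!:f5$0d4!:e3 Z!:e7!:e1$0c3 Y$0c1 Z$2c5$2a3$2c5 Z Z$0c4!:e3!:e1$0c3!:e5!:e7
$0c3!:f5!:e4$0d4 Y$0c4!:e4 Y Z$0c4$2c5$2c3 Z Z$0c1!:e5!:e1!:e4$0c0!:e7$0c3!:f5 Y Y$2c5$2c5$0c4!:e4!:e7 Y!:f5$0d4
Y$2c5$2c5!:e7!:f5$0d7 Y$2c5!:f5 Y Y$2c5$2c5$0c4$0c1!:e4!:f5$0d4 Z Z Z Z!:e4$2c4 Z Z$2a3$2b4$2a0$2b7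
(N [SR,SR,SR,FR,FL] [])(N [SR,SR,SR,FR,FL] [])Z Z(N [SR,FR,FL,SL,SL] [])(N [SR,FR,FL,SL,SL] [])!:f3
(N [SR,FR,FL,SR,SR] [])(N [SR,FR,FL,SL,SL] [])Z Z!:f6$0d2!:f0$2d0!:e2$2c2!:e4!:e5!:e7!:f3$0d2!:e1!:f5$0c5#0b1
$2c5#0b1$0c1 Z#0a6$2c5 Z$2c4#0a6#0a6 Z Z!:f0$2d0 Z Z!:f7!:e7$0c6!:f6$0c6!:f2$0b2!:e2$2c2!:f0!:f3!:e5!:e4$2c4!:e0
Z!:e3 Z!:f4 Z!:f5!:e1 Y Y$0c1 Z$2c5$2b4$2a3$2a0$0c4 Z Z#0b2$0d3 Z Z Z!:f3$0d2!:f0$2d0!:e1!:f5!:e4$2c4!:e2$2c2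
!:e3!:e5!:e0!:f4 Y(N [FR,SL,SL,SL,FL] [S1,S0])$2b4!:f4(N [FR,SR,SR,SL,FL] [S1,S0])Y$2b4$2a0 Z$2c1
(N [FR,SR,SR,FR,SR] [S1,S0])$2a3 Z!:e0$2c0!:e2$2c2!:e3!:e5$0c4 Z$2c1(N [FR,SR,SR,FR,SR] [S1,S0])$2a3 Z$2a0#0b1
$0d5#0b1#0b1!:e4$2c4 Z Z$0d3$0d6$0c7!:f4!:e4$2c4!:f6$0c6!:f2$0b2!:e2$2c2!:f0!:f3!:e5!:e7$0c6!:e0 Z!:e3 Z!:f5!:e1
Y Y$0c1 Z$2c5$2a3$2a0$2c5 Z Z#0b2 Z Z$0d0 Z!:f0$2d0!:e0!:e2$2c2!:f3$0d2!:e1!:f5!:e7$0c6!:e3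
(N [FR,SL,SL,FR,SR] [S1,S0])Y$2a3!:e5$2c5 Z$2c1#0b1$2d4#0b1$2c0 Z$2c0!:e2$2c2(N [FR,SR,SR,SL,FL] [S1,S0])!:e7
$0c6 Z Z$2a0$0d0$2d4$0c4!:e3!:e2$2c2!:e7$0c6!:f2$0b2!:f6$0c6!:f0!:f3!:e5!:e4$2c4!:e0 Z!:f5!:e1 Y Y$0c1 Z$2c5$2a0
$0c4 Z Z#0b2$2c3 Z Z Z!:f3$0d2!:f6$0c6(N [FR,SL,SL,FR,SR] [S1,S0])!:f0$2d0!:e4$2c4 Z Z Z$2c3$2c3$0c2!:f2$0b2!:f6
$0c6!:f3!:e2$2c2!:f0!:e7$0c6!:e5!:e4$2c4!:e0!:f5!:e1 Y Y$2c0 Z$2c5#0(hold0 c6)$2a0$0c4 Z Z!:e5$2c5 Z Z Z Z Z!:e2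
$2c2#0b2#0b2(N [SL,FR,SR,FR,SR] [S0])!:f3 Z(N [SL,FR,SR,FR,SR] [S1,S0])Z!:f3$0d2!:f0$2d0!:e1!:f5!:e5!:e4$2c4!:e7
$0c6!:f6$0c6!:e0!:e2$2c2#0(hold0 d2)$2c0 Y$2a0!:e0 Z!:e2$2c2 Y Z$2a0$2c5$0c4!:f6$0c6!:e2$2c2#0(hold0 d2)Z Z$2c1
#0b1#0b1#0b1#0b1!:e0$2c0!:e1!:e2$2c2(N [SL,SL,FL,SR,SR] [S0,S2,S1])!:f6$0c6 Z Z#0b1#2(hold2 d1)$2a0!:e1!:f0$2d0
!:f5!:f6$0c6(N [SL,FR,SR,SL,SL] [S0,S1])Z#0b1#2(hold1 d1)(N [SL,FR,FL,SL,SL] [])(N [SL,SL,FL,SR,FR] [S0])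
(N [SL,SL,FL,SR,FR] [])$2a3$2b4$2b7!:e3!:e1$2c1!:f3$0d1!:f2$0b2!:f0$2d0!:e2!:e6$0a6!:e5!:f5$0d1!:f6!:f4!:e0 Z
!:e4!:e7!:f7 Z Y$2b7 Z$2c3 Z$0c4$2a0!:e4!:f7!:e0 Z!:e7 Y Z$2c3$2a0!:e7 Y!:e0 Z Y$2a0$2c3$2b7!:e0 Z!:e7!:f7 Z Y
$2b7 Z$2c3$2a0$0c4$2b4 Z Z$2c5 Z Z$2c2#0b2$0c2!:e0$2c0!:e2!:e6$0a6 Z$2c2#0b2$0c2$2a0!:e2$2c2!:e0!:f0$2d0!:e6$0a6
!:f6$0d2!:e4!:e7!:f5$0d1!:e5!:f7!:f4 Y(N [FR,FR,SR,SR,SR] [])$2b4!:f4(N [FR,FR,SR,SL,SL] [])Y$2b4$2b7 Z$2c4!:e5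
$2c5 Z$2c4#0a6$2c3#0a6$2c0 Z!:e4$2c4!:e7$0c6!:f6$0c6!:f4!:f5$0d1!:f7!:e5 Y Z Z(N [FR,FR,SR,SL,SL] [])$2b7$2d4
(N [FR,SL,SL,SL,FL] [S1,S0])$2b4!:e5!:f4$2d4!:f5$0d1!:f7$0d6 Y$2b7$2c5$2b4 Z Z$2c3$2c0$2c0!:f0$2d0
(N [FR,SL,FL,SR,SR] [])!:f4$0d0!:f5$0d1!:f6$0d2!:e6$0a6 Z!:e7$0c6!:e5!:e4$2c4!:f7 Y(N [FR,SL,SL,FR,SR] [S1,S0])
$2b7$0c4 Z Z$2c3 Z!:f6$0d2!:e6$0a6 Z!:e7$0c6!:e5$2c5 Z Z$2c3 Z$2b4$2a0$0c2$2c3$0c1!:f0$2d0!:f2$0b2!:f3$0d1!:e2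
!:e6$0a6!:f6!:f5$0d1!:e5!:e1$2c1!:f7!:f4!:e0 Z!:e4!:e7 Y Z$2c5 Z$0c4$2a0!:e4!:e7 Y!:e0 Z Y$2a0$2c5!:e0 Z!:e7 Y Z
$2c5$2a0$0c4$2b4!:e7!:e4 Y!:e0!:f4 Z Y$2b4 Y$2a0$0c4!:e4!:e0!:f4 Z Y$2b4 Y$2a0!:e0 Z!:f4 Z#0(hold0 d1)$2b4$2a0
$0c4$2c5$2b7$0c1 Z Z!:e5$2c5 Z Z Z Z$2c2#0b2#0b2!:e2!:e6$0a6 Z$2c2#0b2#2(hold2 d2)!:e0!:e1$2c1!:e2$2c2!:f3$0d1
(N [FR,SL,FL,SL,SL] [])!:f7$0d3!:e6$0a6!:f6$0d2!:f5$0d1 Z Z Z!:e4$2c4!:f6$0c6!:f4!:e5!:e7$0c6!:f5$0d1 Y$2c5$2c5 Z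
Z(N [FR,SL,SL,SL,FL] [S1,S0])$2b4 Z$2c0$2b7$2c0$2c0!:e2$2c2!:e6$0a6!:e1$2c1!:f3$0d1(N [FR,SL,FL,SL,SL] [])!:f6
$0d2!:e4!:e5!:e7!:f5$0d1!:f4 Z!:f7$0d3 Y$2b7$2b4$2c5#0a6$2c5 Z$2c4#0a6#0a6 Z!:e5$0c1!:f5$0d1!:f6$0d2!:e4!:e7!:f3
$0d1!:f4!:f7 Z#0(hold0 d2)$2b7#0(hold0 d2)$2b4 Z#0a6#0a6#0a6#0a6 Z(N [SL,SL,SR,FL,FR] [])!:e4$2c4!:e7$0c5#0a6
#0a6(N [SL,FL,SL,SL,FL] [S0])!:e1$2c1!:f3$0d1(N [FR,SL,FL,SL,SL] [])!:f7$0d3!:f6$0c6!:e4$2c4!:f4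
(N [FR,SR,SR,SL,FL] [S1,S0])(N [FR,SL,SL,SL,FL] [S1,S0])$2b4!:f4$0c4!:e7$0c6!:f5$0d1!:e5$0c4 Z Z!:e5$0c4 Z Z!:e5
$0c4 Y!:f5$0c5 Z Z$2b4!:e5!:e4$2c4!:e7$0c6 Z$2c5$0c4 Z Z$2b7!:e4$2c4!:f6$0c6!:f4(N [FR,SR,SR,SL,FL] [S1,S0])
(N [FR,SL,SL,SL,FL] [S1,S0])$2b4!:f4$2d4!:f7$0d6!:f5$0d1!:f3$0d1!:e5$0c1!:e7$0c6 Z Z!:e7$0c5 Z Z Z!:e5$0c1
(N [SL,SL,SR,FL,FR] [])!:e7$0c5 Z Z$2b7$2b4!:e5$0c1(N [SL,FL,SL,FL,SL] [])!:f4$0c4!:f3$0d1!:f6$0c6#0(hold0 d2)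
!:f7$0d6!:e7$0c5!:f5$0c5 Z Z Y$2b7!:f6$0c6!:f7$0d3!:e7$0c5!:f5$0c5 Z Z Y$2b7 Z$2b4!:e6$0a6!:e4!:e7!:f6$0d2!:e5
!:e1$2c1!:f3$0d1!:f4!:f5$0d1 Z$2c5(N [SL,SR,SR,SL,FL] [S1,S0,S2,S1,S0])$2b4 Z$0c1 Z$2c4 Z
(N [SL,FL,SL,FR,SR] [S1,S0])(N [SL,FL,SL,FR,SR] [])(N [SL,FL,SL,SL,FL] [S1,S0])(N [SL,FL,SL,SL,FL] [])!:f4!:e4
$2c4!:f5$0d1!:f6$0c6!:e5!:e1$2c1!:e7$0c6!:f3$0d1!:f7 Y(N [FR,FR,SR,SL,SL] [])$2b7 Z$2c5$0c1 Z Z$2d4$2d4$0c4!:e7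
$0c6!:f5$0d1!:f6$0c6!:f3$0d1!:f7(N [FR,FR,SR,SR,SR] [])(N [FR,FR,SR,SL,SL] [])$2b7 Z Z!:f6$0c6!:f3$0d1!:f7$0d5
!:e4$2c4!:e5$2c5 Z Z!:e5$0c4 Z Z$2b7 Z Z!:f7$0c7!:f5$0d1!:f6$0c6!:f3$0d1(N [FR,FR,SR,SL,SL] [])Z Z!:e5$2c5
(N [SL,SR,FR,SR,FR] [])!:f6$0c6!:e4$2c4 Z Z Z$2b7$2b4$2a0!:e0$2c0!:f4$0d0!:f2$0b2!:e2!:e6$0a6 Z$2c2
(N [SL,SL,FL,SL,FL] [S0])(N [SL,SL,FL,SL,FL] [])!:e1$2c1!:e6$0a6!:f6$0d2!:e2$2c2!:e4!:e5!:e7!:f3$0d1!:f5$0d1!:f7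
Z Y$2b7$2c5 Z#0a6$2c5 Z$2c4#0a6#0a6 Z Z!:e4$2c4!:e7$0c6!:f6$0c6!:e2$2c2!:e5!:f3$0d1!:f7
(N [FR,SR,SR,FR,SR] [S1,S0])#0(hold0 c6)$2b7 Z#0(hold0 c6)#0(hold1 c5)Z Z!:f6$0c6!:e2$2c2!:f3$0d1!:f7$0c7!:f5
$0d1!:e5$2c5 Z Z!:e5$2c5 Z Z$2b7 Z Z Z!:e5$0c4!:e7$0c6!:f5$0d1!:f6$0c6 Z Z(N [SL,SR,FR,FL,SL] [])
(N [SL,FL,FR,SL,SR] [])!:f6$0c6!:e2$2c2!:f3$0d1!:f5$0c5!:e7$0c5 Z Z!:e7$0c5 Z Z Z Z Z!:e5$0c1!:f5$0d1!:f6$0d2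
!:e2$2c2!:e6$0a6 Z!:e4$2c4!:e7$0c6 Z Z(N [SL,FL,SL,FL,SL] [])Z Z(N [SL,SL,SR,FL,FR] [])!:f6$0d2!:e2$2c2!:e6$0a6 Z
!:f3$0d1!:e4$2c4!:e7$0c5#0(hold0 c6)!:f5$0c5 Z Z!:e7$0c5!:f5$0c5 Z Z!:f5$0c5 Z Z Z Z Z$2b4$2a0$2a3"])
    (simp_all add: dead2_0110101112112122 dead2_01111221 dead2_01121221 dead2_11111221 dead2_11121222 dead2_12212122)

lemma dead2_0011110111222212: "dead s2 (Nd (Nd (Nd (Nd (Lf K0) (Lf K0)) (Nd (Lf K1) (Lf K1))) (Nd (Nd (Lf K1) (Lf K1)) (Nd (Lf K0) (Lf K1)))) (Nd (Nd (Nd (Lf K1) (Lf K1)) (Nd (Lf K2) (Lf K2))) (Nd (Nd (Lf K2) (Lf K2)) (Nd (Lf K1) (Lf K2)))))"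
  by (rule case2.dead_by_certificate[where es = "[E e0 0 4 0, E e2 1 2 4, E e3 0 (-3) 2, E e4 (-1) 0 2, E e5 3 0 5, E e6 2 0 0, E e7 4 0 4, E f0 22 4 (-3), E f1 0 (-3) 0, E f2 0 (-8) 4, E f4 0 (-8) 4, E f5 0 4 4, E f7 0 (-8) 0]" and ce = "!:f2$0b2!:f7$0b7!:f4$0b4!:f0!:f6!:f3$0b3!:f5$0b5!:e6!:e7!:e2$0c6!:e4$0c6!:e0!:e3!:e5 Z Z$0c5 Z$0c3!:e3!:e5!:f1 Y
Z$2d0 Z$0c5!:e5 Z Z$0c5$0c3$2a0$0c4$0c2!:e2!:e0 Z!:e3!:e4$0c6 Z$0c4 Z$2c2$2a0!:e3!:e0 Z!:e4 Z!:e5 Z Z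
#0(hold2 c5)$0c4$2a0 Z#0(hold3 c3)$0c2$2c6!:e0!:e5!:e2 Z!:e4 Z Z$2c0$2c0 Z!:e1$2c1!:e4$2c4!:e2 Z!:e3 Z Z Y$2c0
$2c0$2a1!:e1!:e5!:e4!:e3!:e2$0c0 Z$0c2 Z$2c1!:e3!:f1$0c1 Z$2c1 Z$2c1$0c4!:e3!:e2 Z Z$0c2 Z$2c1$2c1!:f1!:e3!:e2
!:e7!:e5!:e4$0c6 Z$0c4 Z$0c5 Z$2c3!:e4!:e5 Z Z$2c4!:e5 Y Z!:e7$0c5 Z$2c3(N [SL,SL,SL,SL,FL] [S0])$0c2!:e5!:e2 Z Z
Y Z!:e7$0c5 Z!:e4$2c4!:e2 Z Z#0c2 Y!:e7$0c3!:e2$2c2#0(hold3 c3)!:e5!:e4 Z Y$0c4 Z(N [FR,SR,SL,SL,FR] [])!:e5$2c5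
!:e2$2c2!:e4 Z Z#0c4 Y!:e4$2c4!:e2$2c2 Y(N [SL,SL,SL,SL,FL] [S0,S2])!:e2$2c2(N [SL,SL,SL,SL,FL] [S0])Y!:e3!:e5
!:e2 Z Z$0c2 Z(N [SL,SL,SL,FL,FR] [S1,S0])!:e5 Z Z(N [SL,SL,SL,FL,FR] [S1,S0])(N [SL,SL,FL,SL,FR] [S1,S0])$2d0
$2a1$2a0$2a6!:f1$2d1!:e5$2c5!:e0 Z!:e3!:e2 Z Z$0c2 Z!:e1$2c1(N [SL,SL,FL,SL,FR] [S1,S0])$2a1$2a0!:e1$2c1!:e3!:e7
$0c5!:e2 Z Z$0c2$2c3!:e7$0c5 Z(N [SL,SL,SL,SL,FR] [S0,S1,S0,S2])(N [SL,SL,FL,SL,FR] [S1,S0])$2a1$2d0!:f1$2d1!:e3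
$2c3!:e0 Z!:e2 Z!:e4 Z Z!:e6$0c4 Z$2a6!:e1!:e5!:e4 Z Z$0c4 Z$2c1(N [FR,SR,FL,SL,SL] [S0])$2a1$2a0!:e1$2c1!:e7
$0c3!:e0 Z!:e5!:e4 Z Z$0c4 Z(N [SL,FL,SL,SL,FR] [])$2a0!:e6$2c6!:f5$0b5!:e5$2c5
(N [SL,SL,SL,SL,FR] [S0,S1,S2,S1,S0])(N [SL,SL,SL,FL,FR] [S1,S0])$2d7$2a6$2a1$2d0#2(hold1 b6)$2b6 Z Z!:f0$2d0
!:f6$0d4!:f3$0b3!:e3!:e0 Z!:e2 Z!:e4$2c4 Z!:e6$0c4 Z$2a6$0c2$2a0 Z!:e1$2c1!:f1!:f5$0b5(N [SR,FR,SL,SL,SR] [S2])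
$2d1(N [SL,SL,FL,SL,FR] [S1,S0])#2(hold2 d3)$2a1(N [SR,FR,SR,FR,SL] [])$2b6 Z!:f6$2d6!:f4$0b4!:f0
(N [SR,FR,SL,SL,FL] [])(N [SR,FR,SL,SL,FL] [])Z!:f5$0b5!:f1!:f0$2d0!:f3$0b3(N [FR,FR,SL,SL,SR] [])$2d1$0d0!:f3
$0b3(N [SR,FR,SL,SL,FR] [])!:e5!:e4$2c4!:e7$2c7!:e6!:f0$2d0!:e2 Z Z$0c2 Z(N [FR,SL,FR,SL,SR] [])$2a6$2c5$0c4!:f0
$2d0!:e1#2d5#2d5$2a1 Z$2d5$2d5!:e6!:e4$2c4!:e7$2c7!:e5$2c5!:f0$2d0!:e2 Z Z$0c2 Z(N [SL,SL,FR,SR,SL] [S0,S1,S2])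
$2c6$0c4!:e2!:e3!:e7$2c7!:f0$2d0!:e0 Z!:e4$2c4 Z!:e5$0c4 Z!:e1$2c1!:f1$2d1 Z Y$2a1$2a0 Z$2c3!:f0$2d0!:e0 Z!:e5
$2c5 Z!:e1$2c1!:e7$0c5 Z!:f1$2d1 Z!:e4$2c4 Y(N [SL,SL,SL,FL,SL] [S1,S0])$2a1$2a0 Z$2c2!:e7$2c7!:f0$2d0!:e5$2c5 Z
!:e1$2c1!:e3!:e0 Z!:e4$2c4#2c4!:f1$2d1 Z(N [SL,SL,SL,FL,SL] [S1,S0])$2a0 Z#2c7$2a1 Z!:e0!:e4$2c4!:f0$2d0!:e3$2c3
Z!:e1$2c1!:e5$2c5 Z!:f1$2d1 Z Y$2a1$2c0$2c0!:f0$2d0!:e3$2c3!:e5$2c5 Z!:e1$2c1!:e4$2c4!:f1$2d1 Z Y!:f1$2d1!:f3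
$0b3 Y Y(N [SL,SL,SL,FL,SL] [S1,S0])$2a1!:e1$2c1!:f3$0b3(N [SL,SL,SR,FR,SL] [S0,S1,S2,S1,S0])!:f1$2d1!:e4$2c4
!:e5$2c5 Z Y Y!:e5$2c5!:e4$2c4 Y#2c5 Y$2a1(N [SL,SL,FL,SL,FL] [S0])$2a0(N [SL,SL,SR,FR,FL] [S1,S0])$2a6$2b6!:f6
$0d2!:e0!:e2$2c2!:f0$2d0!:e4!:f4$0b4!:e5!:e3 Z Z!:e7$0c3 Z$2c5 Z$2c4$2c4!:f4$0b4!:f7$0b7 Z!:e7$2c7!:e3 Z Z!:e1
$2c1!:e5 Z Z(N [SL,FL,SL,SL,FR] [])$2a1!:e3$2c3 Z!:e1$2c1!:e5$2c5 Z!:e6$2c6!:f1!:f3$0b3$2d3$2d1 Z Y$2a6$2a1!:e6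
!:f7$0b7!:e7!:e3!:f3$0b3!:f5$0b5!:f1(N [FR,FR,SL,SL,SR] [S1,S0])(N [FR,FR,SL,SL,SR] [S1,S0])#2(hold1 d0)!:e5$2c5
!:f1$2d1 Z!:e1$2c1 Y$2a1$0c5$2c3!:e5!:f5$0b5!:f1!:f3$0b3(N [FR,FR,SL,SL,SR] [S1,S0])$2d1 Z!:e1$2c1 Y$2a1$2c5 Z
$0c5$0c3!:e5!:f5$0b5!:f3$0b3!:f1(N [FR,FR,SL,SL,SR] [S1,S0])Z#2(hold1 d0)!:e3$2c3 Z!:e1$2c1!:f1$2d1 Z Y$2a1$2c5 Z
!:e1$2c1!:e3!:f3$0b3!:f1!:f5$0b5#0(hold2 c5)$2d1 Z Y$2c3 Z(N [SL,FL,SL,SL,FR] [])$2a1$2c6!:e7$2c7!:f3$0b3!:e3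
!:f5$0b5!:f1(N [FR,FR,SL,SL,SR] [])#2(hold1 d3)$2d3!:e5$2c5!:f1$2d1!:e1 Y(N [FR,SL,SL,SL,SL] [S2])$2a1$2d3
(N [SL,SL,FR,SR,SL] [S0,S1,S2])#2(hold3 d3)$2d3!:e3$2c3!:f5$0b5!:e5!:f1$2d1!:e1 Y(N [FR,SL,SL,SL,SL] [S1,S2])
$2a1$2d5#2(hold2 d5)$2d5!:e5$2c5!:f1$2d1 Z!:e1$2c1 Y$2a1(N [SL,SL,FR,SR,SL] [S0,S1,S2])
(N [SL,SL,SR,FR,SL] [S0,S1,S2])$2c6(N [FR,SL,SL,SL,FL] [])$2a6$2c0$2c0$2c0!:f7$0b7!:e6!:e2$2c2!:f4$0b4!:f0$2d0
!:e4 Z!:e3 Z Z!:e7$0c3 Z$2c6$0c4 Z!:e4$2c4!:f0$2d0(N [FR,SL,SR,SR,FL] [])!:e7!:e3!:e5!:f1$0d0 Z!:e1$2c1!:f3$0b3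
!:f5$0b5 Y$2c5$2c3$2a1 Z$0c5!:e5 Z Z$0c5$0c3!:e3 Z Z!:e1$2c1!:e5 Z Z(N [FR,FL,SR,SR,SL] [S1,S0])$2a1$2c6$0c4$0c2
!:f0$2d0!:f4$0b4!:e4 Z!:e2$2c2 Z!:e3$0c2 Z!:e7$0c3 Z(N [SL,SL,FR,FR,SL] [S1,S0])(N [SL,SL,FR,SR,FL] [S1,S0])!:e2
$2c2!:e4$2c4(N [FR,SL,SL,SL,FL] [])!:f3$0b3!:e3!:f1!:f5$0b5(N [FR,FR,SL,SL,SR] [S1,S0])$2d1#0(hold0 d2)
#0(hold0 d2)#0(hold0 d2)#0(hold0 d2)!:f5$0b5!:f1$2d1!:e1!:e3$2c3!:e5$0c4 Z$2c1$2c1!:e5$0c4!:e3$2c3 Z!:e7$0c3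
#0(hold1 c3)#0(hold2 c7)#2(hold3 d5)$2a1#2d0!:e1!:e3$2c3!:e5$0c4!:f1$2d1 Z$2c1$2c1$2c1!:f1$2d1!:e7!:e3$2c3!:e5
$0c4 Z$0c5$0c3!:e3$2c3#2d7!:e5$0c4#0(hold1 c3)#0(hold1 c3)$2d7#2d0$2a1!:e4$2c4!:f5$0b5!:e5!:f1!:f3$0b3
(N [FR,FR,SL,SL,SR] [S1,S0])$2d1#0(hold0 d4)#0(hold0 d4)#0(hold0 d4)#0(hold0 d4)!:e1!:e3$0c2!:e5$2c5!:f1$2d1 Z
$2c1$2c1$2c1!:f1$2d1!:e3$0c2!:e5$2c5 Z!:e7$0c5#0(hold1 c5)(N [SL,FL,SR,FR,SL] [])!:e7$0c3!:e5$2c5!:f3$0b3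
#0(hold4 c3)#2d7#0(hold1 c5)(N [SL,SL,FR,FR,SL] [S1,S0])#2d0$2a1!:e5$0c4!:e3$0c2!:e1!:e7!:f3$0b3!:f1!:f5$0b5
(N [FR,FR,SL,SL,SR] [S1,S0])$2d1!:f5$0b5 Y Y$2c1!:f1$2d1!:f5$0b5 Y Y$2c1(N [FR,FL,SL,SL,SR] [S1,S0])#2(hold0 c6)
!:e7(N [FR,FL,SR,SR,SR] [S1,S0])(N [FR,FL,SL,SL,SR] [S1,S0])#0(hold1 c7)$2a1!:e1$2c1!:e7$0c3!:f3$0b3
(N [SL,SL,SR,FR,SL] [S0,S1,S0,S2])!:f1$2d1!:f5$0b5 Y#2d7(N [SL,SL,FL,SL,SL] [S1,S0])(N [SL,FL,FR,SR,SL] [])$2a1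
!:e1$2c1!:e7$0c5!:e3$0c2!:f5$0b5(N [SL,SL,FR,SR,SL] [S0,S1,S0,S2])!:f1$2d1!:f3$0b3 Y#2d7
(N [SL,SL,SL,FL,SL] [S1,S0])(N [SL,FL,SL,SL,FR] [])(N [SL,SL,FR,FR,SL] [S1,S0])$2a1!:f4$0b4 Z!:e7!:e3!:e2$2c2
!:e5!:e4$2c4 Z$0c4 Z$0c5$0c2!:e5!:e4$2c4 Z$0c4 Z$0c5$0c3!:e2$2c2!:e3 Z Z!:e1$2c1!:e5 Z Z#0(hold1 c3)$2a1!:e3$0c2
Z!:e1$2c1!:e5!:e4$2c4 Z$0c4 Z(N [SL,FL,SL,SL,FR] [])$2a1(N [SL,SL,FR,FR,SL] [S1,S0])$2a6!:f3$0b3!:e6!:e2$2c2!:e7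
$2c7!:e3!:f1!:f0$2d0!:f5$0b5!:f4$0b4(N [FR,FR,SL,SL,SR] [S0])(N [FR,FR,SL,SL,SR] [])$2d1$0d0!:f5$0b5
(N [SR,FR,SL,SL,FR] [])!:f4$0b4!:f0$2d0!:e4 Z Z$0c4 Z!:e4$2c4!:e5$2c5!:f0$2d0(N [FR,SL,SR,SR,FL] [])Z
(N [SL,SL,FR,SR,SL] [S0,S1,S2])$0c4$2d3#2(hold3 d3)$2d3$2c6$0c2!:f1!:f0$2d0!:f5$0b5!:f4$0b4
(N [FR,FR,SL,SL,SR] [S0])(N [FR,FR,SL,SL,SR] [])$2d1$0d0!:f5$0b5(N [SR,FR,SL,SL,FR] [])!:f4$0b4!:e4!:e5$2c5!:f0
$2d0 Z Z$2c4!:f0$2d0!:e2$2c2#0(hold0 d2)!:e3$0c2!:e1#2d3#2d3$2a1$2d3 Z(N [SL,SL,FR,SR,FL] [S1,S0])!:e1!:e5$2c5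
!:e7$2c7!:e3!:e2$2c2(N [FR,SL,SL,FR,SR] [])$0c2#2d3$2c1!:e3$2c3!:e2$2c2#2d3(N [SL,FL,SR,FR,SL] [])$2c1$2c1!:e3
!:e2$2c2!:e7$2c7(N [FR,SL,SL,FR,SR] [])$2c3$0c2!:e2$2c2#2d3!:e7$2c7#2d3(N [SL,FL,SR,FR,SL] [])$2d3$2a1$2d3$2a6
!:e2$2c2!:e1!:e3$2c3!:f1$2d1!:f4$0b4!:f0$2d0!:e4 Z!:e5 Z Z$2c1(N [SL,SL,SL,FL,FL] [S1,S0])Z!:e4$2c4!:f0$2d0!:e6
(N [FR,SL,SR,SR,FL] [])(N [FR,SL,SL,SL,FL] [])$2a6!:f5$0b5!:e5!:e7$2c7 Z$2c5#2d5$2c1(N [SL,FR,SL,SL,SR] [S0,S1])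
!:e5$0c4!:e6$0c4!:e7$2c7!:f0$2d0!:f5$0b5#2(hold0 d6)(N [FR,SL,SL,SL,SR] [S2])Z(N [FR,FL,SL,SL,SR] [])$2a6$2c1
$2c1$2c1!:e6!:e7$2c7!:e3$2c3!:f4$0b4!:f0$2d0!:e4 Z Z$0c4 Z!:e4$2c4!:f0$2d0(N [FR,SL,SR,SR,FL] [])!:e5!:f1$0d0 Z
!:f5$0b5$2d5$2c5 Z!:f5$0b5$2d5(N [SL,SL,FR,SR,SL] [S0,S1,S2])$0c4(N [SL,SL,SR,FR,SL] [S0,S1,S2])$2c6!:e7$2c7!:e3
$2c3!:f4$0b4!:f0$2d0 Z Z!:e4$2c4!:e5!:f5$0b5#2(hold0 d6)$2c5#0c6#0(hold1 c5)!:e5$0c4!:f0$2d0!:f1$2d1!:f5$0b5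
#2(hold0 d6)Y#2d0 Z!:f1$2d1!:f0$2d0 Y!:f5$0b5$2d5 Y Y(N [FR,SL,SR,FR,SL] [])!:f4$0b4!:e4!:e5$2c5!:f0$2d0!:e3$2c3
Z!:f1$2d1 Z Y Z$2c4!:f0$2d0!:e5$2c5!:e3$2c3 Z!:f1$2d1 Z Y!:f5$0b5(N [SL,SL,FR,SR,SL] [S0,S1,S2,S1,S0])!:f1$2d1
!:e3$2c3 Z Y!:e3$2c3 Y Y Z(N [SL,SL,FR,SR,FL] [S1,S0])!:e4$2c4!:f0$2d0(N [FR,SL,SL,SL,FL] [])!:e3$2c3!:e5$2c5
#0(hold1 c7)!:f1$0d0!:f5$0b5$2d5 Y Y!:f1$0d0!:e5$2c5!:f5$0b5#2d5 Y Y(N [SL,SL,FL,SL,SL] [S0])!:e5$0c4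
(N [SL,FL,FR,SR,SL] [])!:f5$0b5$2d5!:f0$2d0!:f1$2d1!:e3$2c3 Y Y#2d0!:e3$2c3 Y!:f1$0d0 Y Y$2a6$2a1!:e6$0c2!:e3
$0c2!:e7$2c7!:f4$0b4!:f0$2d0!:e4 Z Z(N [SL,SL,FR,SR,FL] [S1,S0])Z!:f5$0b5!:f1$2d1!:e4$2c4!:e5
(N [FR,SL,FR,SL,SR] [])#2(hold2 d5)$2d5!:e5$0c4(N [SL,SL,FR,SR,SL] [S0,S1])$2d5$2d5!:f1$2d1!:f0$2d0!:e5$2c5!:e4
$2c4!:e1(N [FR,SL,SL,SL,SR] [S1,S2])Y$2a1 Y!:e1$2c1!:e4$2c4#0(hold1 c5)Y$2a1(N [SL,FR,SL,SL,SR] [S0,S1])!:e1$2c1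
!:f0$2d0!:e4$2c4#2d0!:e5$0c4 Y Y(N [SL,SL,FL,SL,SR] [S0])$2a1(N [SL,FL,SR,FR,SL] [])!:e1$2c1!:e7$0c3!:f0$2d0!:f1
$2d1!:f4$0b4!:e5!:e4 Z Z$0c4 Z#2c7!:e5!:e4$2c4!:f5$0b5#0(hold0 d4)$2c5$0c4!:e4$2c4 Y!:f5$0b5#2d5 Y#2c7
(N [SL,SL,FL,SL,SL] [S1,S0])!:f1$0d0(N [SL,SL,FL,SL,SR] [S1,S0])!:f4$0b4 Z!:f5$0b5$2d5!:e5$2c5!:e4$2c4 Y Y#2c7
!:f4$0b4!:e4!:e5$2c5!:f0$2d0!:f1$2d1 Z(N [SL,SL,FL,SL,SL] [S1,S0])Z$2c4!:f0$2d0!:f1$2d1!:f5$0b5!:e5$2c5 Y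
#0(hold3 c5)Y(N [SL,SL,FL,SL,SL] [S1,S0])(N [SL,SL,SL,FL,FL] [S0])(N [SL,SL,FR,SR,FL] [S1,S0])!:f1$2d1!:f0$2d0
!:e4$2c4!:e5$2c5!:f5$0b5#0(hold0 d4)Y Y!:e5$0c4(N [SL,FL,FR,SR,SL] [])!:f5$0b5$2d5 Y(N [SL,SL,FL,SL,SR] [S1,S0])
!:f0$2d0(N [SL,SL,FL,SL,SL] [S1,S0])!:f5$0b5$2d5!:e4$2c4!:e5$2c5 Y Y Y$2a1$2a6$2a0$2b6"])
    (simp_all add: dead2_0011111211222222 dead2_0110101112112122 dead2_0110112112210110 dead2_0111112112122221 dead2_01111221 dead2_01121221 dead2_11111221 dead2_11121222 dead2_1112222222222121)

lemma dead2_11222212: "dead s2 (Nd (Nd (Nd (Lf K1) (Lf K1)) (Nd (Lf K2) (Lf K2))) (Nd (Nd (Lf K2) (Lf K2)) (Nd (Lf K1) (Lf K2))))"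
  by (rule case2.dead_by_certificate[where es = "[E g1 1 0 0]" and ce = "!:g1!:g3$0e3!:g5$0e5!:g0!:g2$0e2!:g4$0e4!:g6!:g7$0e7(N [SR,SL,SL,SL] [])$2f6(N [SR,SL,SL,FL] [])$2e6$2f0$2f0!:g2
$0e2!:g4$0e4!:g6(N [SR,SR,SR,FL] [])(N [SR,SL,SL,FL] [])$2e6!:g6$0f4!:g7$0e7(N [SR,SL,SL,SR] [S2])
(N [FR,SL,SL,SR] [])$2e6!:g6$0f2!:g4$0e4!:g7$0e7(N [SR,SL,SL,SR] [S1,S2])(N [FR,SL,SL,SR] [S0])!:g7$0e7
(N [FR,SL,SL,SR] [S1,S0])(N [FR,SL,SL,SR] [])$2e6$0f0$2f1$2f1 Z Z"])
    (simp_all add: dead2_0011110111222212 dead2_0111112112122221 dead2_01111221 dead2_01121221 dead2_11111221)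

lemma dead2_00010110: "dead s2 (Nd (Nd (Nd (Lf K0) (Lf K0)) (Nd (Lf K0) (Lf K1))) (Nd (Nd (Lf K0) (Lf K1)) (Nd (Lf K1) (Lf K0))))"
  by (rule case2.dead_by_certificate[where es = "[E g3 0 0 1, E g5 0 0 1, E g6 0 0 1, E g7 1 0 0]" and ce = "!:g0$0e0!:g7!:g5!:g3!:g6$0f7 Z$0f6!:g6 Z Z$0f6$0f3!:g3!:g6 Z Z$0f6!:g6 Z Z$0f6$0f3$0f5!:g1!:g5!:g3 Z Z$2f1!:g3 Z
Z$2f1$2f1!:g4!:g6!:g5 Z Z$2f4!:g5 Z Z$2f4$2f4!:g2!:g3!:g6 Z Z$2f2!:g6 Z Z$2f2$2f2!:g5!:g3 Z Z!:g6 Z Z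
(N [FR,SR,SL,SR] [S0])!:g3 Z Z!:g6 Z Z(N [FR,SL,SL,SL] [S0])!:g6!:g3 Z Z(N [FR,SR,SR,SL] [S1,S0])!:g3 Z Z
(N [FR,SL,SL,SL] [S1,S0])!:g3(N [FR,SL,SR,SR] [])(N [FR,SL,SL,SL] [])(N [FR,SL,SL,SL] [])$2e2$2e4$2e1$2e7$2e0"])
    (simp_all add: dead2_01111221 dead2_11111221 dead2_11121221)

lemma dead2_01101001: "dead s2 (Nd (Nd (Nd (Lf K0) (Lf K1)) (Nd (Lf K1) (Lf K0))) (Nd (Nd (Lf K1) (Lf K0)) (Nd (Lf K0) (Lf K1))))"
  by (rule case2.dead_by_certificate[where es = "[E g0 1 (-2) 0, E g1 0 0 3, E g2 (-2) (-2) 1, E g4 0 0 3, E g5 1 1 0, E g7 (-3) 0 0]" and ce = "!:g0!:g1!:g2!:g4$0f0 Z$2f0!:g4 Z Z$2f0$2f0!:g2!:g4 Z Z$2f0!:g4 Z Z$2f0$2f0$2f0!:g3!:g1!:g2 Z Z$0f2!:g2 Z Z$0f2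
$0f1!:g5!:g1!:g4 Z Z$0f4!:g4 Z Z$0f4$0f1!:g6!:g2!:g4 Z Z$0f4!:g4 Z Z$0f4$0f2!:g1!:g2 Z Z!:g4 Z Z!:g7 Z
(N [FR,SL,SL,SR] [S1,S0])(N [FR,SL,SL,SR] [])!:g2 Z Z!:g4 Z Z!:g7 Z(N [FR,SL,SL,SR] [S1,S0])(N [FR,SL,SL,SR] [])
!:g2!:g4 Z Z!:g7 Z(N [FR,SL,SR,SL] [S0])(N [FR,SL,SR,SL] [])!:g4 Z Z!:g7 Z(N [FR,SL,SR,SL] [S0])
(N [FR,SL,SR,SL] [])!:g4!:g7 Z(N [FR,SR,SL,SL] [])(N [FR,SR,SL,SL] [])!:g7 Z(N [FR,SR,SL,SL] [])
(N [FR,SR,SL,SL] [])!:g7(N [FR,SR,SR,SR] [])(N [FR,SR,SR,SR] [])(N [FR,SL,SL,SL] [])$2e6$2e5$2e3$2e0"])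
    (simp_all add: dead2_01111221 dead2_01121221 dead2_11111221 dead2_11121221 dead2_12212112)

lemma dead2_1111112222122211: "dead s2 (Nd (Nd (Nd (Nd (Lf K1) (Lf K1)) (Nd (Lf K1) (Lf K1))) (Nd (Nd (Lf K1) (Lf K1)) (Nd (Lf K2) (Lf K2)))) (Nd (Nd (Nd (Lf K2) (Lf K2)) (Nd (Lf K1) (Lf K2))) (Nd (Nd (Lf K2) (Lf K2)) (Nd (Lf K1) (Lf K1)))))"
  by (rule case2.dead_by_certificate[where es = "[E e3 0 0 1]" and ce = "!:e3 Z Z!:e1$2c1#2a3!:e2$2c2#2a3!:e7$0a7#2a3!:e6$0a6(N [SL,FL,SL,FR,SL] [])!:f3$0b3#2a3!:f7$0c7
(N [SL,SR,SR,FR,FR] [S0,S1])$2b7"])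
    (simp_all add: dead2_11222212)

lemma dead2_1112211222222222: "dead s2 (Nd (Nd (Nd (Nd (Lf K1) (Lf K1)) (Nd (Lf K1) (Lf K2))) (Nd (Nd (Lf K2) (Lf K1)) (Nd (Lf K1) (Lf K2)))) (Nd (Nd (Nd (Lf K2) (Lf K2)) (Nd (Lf K2) (Lf K2))) (Nd (Nd (Lf K2) (Lf K2)) (Nd (Lf K2) (Lf K2)))))"
  by (rule case2.dead_by_certificate[where es = "[E f4 0 0 (-3), E f5 0 (-3) 0]" and ce = "!:f4$0b4!:f5$0b5 Z!:e5$2c5!:e4$0a4!:e0!:e6!:e7$0a7(N [SR,FL,FR,SR,SL] [])$2c6#0(hold1 a4)$2a6#0(hold1 a4)
#0(hold1 a4)(N [SR,SL,FR,FL,SR] [S0,S1])$2a5 Z"])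
    (simp_all add: dead2_01111221 dead2_11222212)

lemma dead2_1112211222222112: "dead s2 (Nd (Nd (Nd (Nd (Lf K1) (Lf K1)) (Nd (Lf K1) (Lf K2))) (Nd (Nd (Lf K2) (Lf K1)) (Nd (Lf K1) (Lf K2)))) (Nd (Nd (Nd (Lf K2) (Lf K2)) (Nd (Lf K2) (Lf K2))) (Nd (Nd (Lf K2) (Lf K1)) (Nd (Lf K1) (Lf K2)))))"
  by (rule case2.dead_by_certificate[where es = "[E e1 1 1 1, E e2 1 0 0, E e3 0 1 1, E e5 1 1 1, E e6 0 0 (-6), E f0 0 1 (-5), E f1 0 0 1, E f2 0 (-5) 1, E f3 0 1 (-5), E f5 0 1 0, E f6 1 1 0, E f7 0 0 5]" and ce = "!:f2$0b2!:f0$0b0!:f3$0b3!:f7$0b7!:e2!:e3$0a3!:f1$0b1 Z!:e1$2c1!:f5$0d1!:f4$0b4!:e5#2b5#0(hold0 d1)#0(hold0 d1)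
(N [SR,FR,SR,FL,SR] [S0,S1])$2b5(N [SR,SL,FL,SR,FR] [S1])$2c2 Z Z!:f5$2d5!:f1$0b1!:f6$2d6!:f4$0b4!:e6#2b6#2b6 Z
(N [FR,FR,SL,SL,SR] [])$2b6(N [SR,FR,SR,SL,FR] [S0,S1])$2b5 Z Z!:f6$0d2!:f0$0b0!:f4$0b4!:f7$0b7!:f5
(N [SR,FR,FR,SL,SR] [])(N [SR,FR,FR,SL,SR] [])$2b5!:f3$0b3(N [SR,FR,SR,FR,SL] [S0,S1])!:f5$2d5!:f1$0b1!:e5#2b5
#2b5!:e4$0a4!:e0!:e1$2c1#0(hold3 c5)$2c0#0(hold1 a4)#2(hold3 c4)!:e0$2c0!:e6$0c4!:e7$0a7#2(hold2 c7)
(N [SL,FL,FR,SR,SL] [S0,S1])Z(N [SR,SR,SL,FL,FL] [])(N [FR,FR,SR,SL,SL] [])$2b5(N [SR,FR,SR,SR,FL] [S0,S1])!:f3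
$0b3!:f7$0b7!:e2$2c2 Z Z(N [SR,FR,SR,FR,SL] [S0,S1])Z$2b6"])
    (simp_all add: dead2_01111221 dead2_11111221 dead2_11121222 dead2_11222212)

lemma dead2_11122112: "dead s2 (Nd (Nd (Nd (Lf K1) (Lf K1)) (Nd (Lf K1) (Lf K2))) (Nd (Nd (Lf K2) (Lf K1)) (Nd (Lf K1) (Lf K2))))"
  by (rule case2.dead_by_certificate[where es = "[E g0 2 2 2, E g1 1 1 2, E g2 1 1 2, E g3 0 2 2, E g4 0 2 2, E g5 2 0 (-1), E g7 0 0 2]" and ce = "!:g7$0e7!:g5!:g4$0e4!:g6!:g2!:g1 Z Z$0f1!:g1 Z Z$0f1$0f2(N [SR,FR,SL,SR] [])#2e6$0f4 Z Z!:g5$2f5!:g4$0e4!:g6$2f6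
#0e4#0e4!:g6$0f4!:g3$0e3!:g0$2f0!:g2!:g1 Z Z#0f1!:g1 Z Z#0f1#0f2!:g1$0f0!:g2$0f0 Z#2f3!:g2$0f0#2f3$2f3!:g1$2f1
!:g2$2f2 Z!:g0$2f0(N [SL,SL,SL,SR] [S0,S1,S0,S2])(N [FR,SR,SL,SR] [S0,S1])!:g0$2f0!:g2$2f2
(N [SL,SL,SR,SL] [S0,S1,S2,S1,S0])#2f0!:g2$0f0(N [FR,SR,SR,SL] [S0,S1])(N [SL,SL,SL,SL] [])
(N [SL,FR,SL,SR] [S0,S1])!:g1$2f1 Z!:g2 Z Z!:g3$0e3$2f3!:g0$2f0(N [SL,FL,SL,SL] [])!:g4$0e4#0e4!:g6$0f2
(N [SL,FR,SR,SL] [S0,S1])(N [SL,SL,SL,SL] [])"])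
    (simp_all add: dead2_01111221 dead2_1111112222122211 dead2_11121222 dead2_1112211222222112 dead2_1112211222222222 dead2_11222212)

lemma dead2_0110122112211221: "dead s2 (Nd (Nd (Nd (Nd (Lf K0) (Lf K1)) (Nd (Lf K1) (Lf K0))) (Nd (Nd (Lf K1) (Lf K2)) (Nd (Lf K2) (Lf K1)))) (Nd (Nd (Nd (Lf K1) (Lf K2)) (Nd (Lf K2) (Lf K1))) (Nd (Nd (Lf K1) (Lf K2)) (Nd (Lf K2) (Lf K1)))))"
  by (rule case2.dead_by_certificate[where es = "[E e4 0 0 1]" and ce = "!:e4 Z Z!:e0$2c0!:e6$0a6!:e2!:f2$0b2!:e5$0a5!:e7(N [SR,FL,FR,SR,SR] [])(N [SR,FL,FR,SR,SR] [])
(N [SL,FL,FR,SL,SL] [])!:e7$0c5!:f4$0c4!:f6$0b6(N [SR,SR,FR,SL,FL] [S0])!:f0!:f1$0b1!:f3!:f7$0d6#2(hold2 c6)$2d3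
(N [SR,FR,FL,SL,SL] [])(N [SR,FR,FL,SL,SL] [])$2d0(N [FR,SL,SL,SR,FL] [S0])#2(hold4 d4)!:f5$0b5
(N [SL,SR,FR,FL,SL] [S1])!:f6$0b6!:f0$2d0(N [SR,FR,SL,SL,FL] [S0])!:f1$0b1(N [SL,FR,SL,FL,SL] [S1])!:f3$0d1!:f7
$0d5!:e1$2c1!:e3 Y Y$2a3 Y#0(hold3 d7)(N [SL,FR,FL,SL,SL] [S1])(N [SL,SL,FR,SL,FL] [S1])
(N [SL,FL,FR,SL,SL] [S1])$2c2(N [SL,FL,SL,SL,FL] [S0])(N [SL,FL,SL,SL,FL] [])!:e5$0a5!:e1!:e7$0c6!:f1$0b1!:f4
$0c4!:f5$0b5(N [SR,SR,FR,FL,SL] [S0])!:f0!:f2$0b2!:f3!:f7$0d5#2(hold2 c5)$2d3(N [SR,FR,FL,SL,SL] [])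
(N [SR,FR,FL,SL,SL] [])$2d0(N [FR,SL,SL,FL,SR] [S0])#2(hold3 d4)!:f5$0b5!:f0$2d0(N [SR,FR,SL,FL,SL] [S0])!:f6
$0b6(N [SL,SR,FR,SL,FL] [S1])!:f2$0b2(N [SL,FR,SL,SL,FL] [S1])!:f3$0d2!:f7$0d6!:e2$2c2!:e3 Y Y$2a3 Y#0(hold4 d7)
(N [SL,FR,FL,SL,SL] [])(N [SL,SL,FR,FL,SL] [S1])$2c1(N [SL,FL,FR,SL,SL] [])(N [SL,FL,SL,FL,SL] [S0])
(N [SL,FL,SL,FL,SL] [])!:e7$0c5(N [SL,FL,FR,SR,SR] [S0,S1])!:e3$2c3!:f7$0c7!:f6$0b6!:f4$0c4!:f5$0b5
(N [SR,FR,FR,SL,SL] [])(N [SR,FR,FR,SR,SL] [])(N [SL,SR,FR,SL,FL] [S1])!:f4$0c4!:f5$0b5(N [SR,FR,FR,SL,SR] [])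
!:e1$2c1!:e2$2c2!:f0!:f1$0b1 Y$2d0 Y$2d4 Y Y!:f5$0b5(N [SL,SR,FR,FL,SL] [S1])(N [SL,FR,FR,SR,SR] [S0,S1])!:f5
$0b5(N [SL,SR,FR,SR,FR] [S1])!:f6$0b6(N [SL,SR,FR,FR,SR] [S1])!:f4$0c4(N [SL,FR,FR,SL,SL] [S0,S1])!:f2$0b2!:f0
$2d0!:e2$2c2!:e1$2c1!:f1$0b1 Y!:f3$0d1(N [SR,FR,FL,SR,SL] [])#2d2 Y(N [SL,SL,FL,SL,FL] [S1,S0])
(N [SL,FR,SL,SL,FL] [S1])!:f1$0b1!:f0$2d0!:f3$0d2(N [SR,FR,FL,SL,SR] [])(N [SL,FR,SL,SR,FR] [S1])
(N [SL,FR,SL,FL,SL] [S1])!:f3$0d1!:f0$2d0!:e2$2c2!:e1$2c1#2d0(N [FR,SL,FL,SR,SL] [])!:e1$2c1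
(N [FR,SL,FL,SL,SR] [])Y(N [SL,FR,FL,SR,SR] [S0,S1])!:f0$2d0(N [SL,FR,FL,SL,SL] [S0,S1])!:e1$2c1 Y Y$2a3$2a0"])
    (simp_all add: dead2_01111221 dead2_01121221 dead2_11111221 dead2_11121221 dead2_11122112 dead2_11222212 dead2_12212112 dead2_12212122)

lemma dead2_01101221: "dead s2 (Nd (Nd (Nd (Lf K0) (Lf K1)) (Nd (Lf K1) (Lf K0))) (Nd (Nd (Lf K1) (Lf K2)) (Nd (Lf K2) (Lf K1))))"
  by (rule case2.dead_by_certificate[where es = "[E g0 (-1) 0 0, E g5 0 0 1, E g6 0 0 1, E g7 1 0 (-1)]" and ce = "!:g7!:g5$0e5!:g6$0e6 Z$0f6$0f5!:g0 Z!:g5$0e5 Z!:g6$0e6 Z!:g4$2f4!:g2$2f2!:g3!:g1$2f1(N [FR,SL,SR,SR] [])$0f1!:g1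
$2f1(N [FR,SL,SL,SL] [])(N [FR,SL,SR,SL] [])$2e3!:g3$0f2!:g1$2f1(N [FR,SL,SL,SR] [])(N [SL,SL,SL,SL] [])$2e3
(N [SL,FR,SR,SR] [S0,S1])$2e0 Z"])
    (simp_all add: dead2_0110122112211221 dead2_01111221 dead2_11111221 dead2_11122112 dead2_11222212)

lemma dead2_01101011: "dead s2 (Nd (Nd (Nd (Lf K0) (Lf K1)) (Nd (Lf K1) (Lf K0))) (Nd (Nd (Lf K1) (Lf K0)) (Nd (Lf K1) (Lf K1))))"
  by (rule case2.dead_by_certificate[where es = "[E g0 1 0 0, E g1 (-2) 0 3, E g2 0 0 2, E g3 1 0 0, E g4 0 0 2, E g5 1 0 0, E g6 0 0 (-1), E g7 0 0 2]" and ce = "!:g0!:g1!:g2!:g4$0f0 Z$2f0!:g4 Z Z$2f0$2f0!:g2!:g4!:g7 Z Z!:g3$2f3!:g5$2f5 Z$2e5$2e3!:g7 Z Z!:g3$2f3!:g5$2f5 Z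
$2e5$2e3$2f0!:g4!:g7 Z Z!:g3$2f3!:g5$2f5 Z$2e5$2e3!:g7 Z Z!:g3$2f3!:g5$2f5 Z$2e5$2e3$2f0$2f0$2f0!:g3!:g1!:g2
(N [SR,FL,SR,SR] [])!:g7 Z Z$2f3$0f2!:g2!:g7!:g4 Z Z!:g5$0f4 Z$2e5!:g4 Z Z!:g5$0f4 Z$2e5$2f3!:g7!:g4 Z Z!:g5$0f4
Z$2e5!:g4 Z Z!:g5$0f4 Z$2e5$2f3$0f2$0f1!:g5!:g4!:g1 Z!:g7 Z Z$2f5$0f1!:g1 Z!:g7 Z Z$2f5$0f1$0f4!:g2!:g1 Z!:g4 Z Z
!:g6$0f4!:g7 Z Z(N [FR,SL,SR,SL] [])$2f2!:g4!:g7 Z Z(N [SL,SL,SR,FR] [])!:g7 Z Z(N [SL,SL,SR,FR] [])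
(N [SL,SL,FL,SL] [])!:g1 Z!:g4 Z Z!:g6$0f4!:g7 Z Z(N [FR,SL,SL,SR] [])Z!:g4!:g7 Z Z(N [SL,SL,SR,FR] [])!:g7 Z Z
(N [SL,SL,SR,FR] [])(N [SL,SL,FL,SL] [])!:g6$0f2!:g4!:g1 Z!:g7 Z Z(N [FR,SR,SL,SL] [S0])(N [SL,FL,SL,SL] [])!:g1
Z!:g7 Z Z(N [FR,SL,SL,SR] [S0])(N [SL,FL,SL,SL] [])(N [SL,SL,SL,FL] [])!:g1 Z!:g4$2f4 Z!:g7$0f6 Z
(N [FR,SL,SL,SR] [])(N [SL,FL,SL,SL] [])$2e5$2e3$2e0"])
    (simp_all add: dead2_00010110 dead2_01101221 dead2_01111221 dead2_11111221 dead2_11121222)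

lemma dead2_01121222: "dead s2 (Nd (Nd (Nd (Lf K0) (Lf K1)) (Nd (Lf K1) (Lf K2))) (Nd (Nd (Lf K1) (Lf K2)) (Nd (Lf K2) (Lf K2))))"
  by (rule case2.dead_by_certificate[where es = "[E g1 1 0 0, E g2 1 0 0, E g3 0 0 1, E g4 1 0 0, E g5 0 0 1, E g6 0 0 1, E g7 0 0 (-1)]" and ce = "!:g6$0e6!:g3$0e3!:g5$0e5!:g1!:g2!:g4!:g0$0f0!:g7$0e7(N [FR,SL,SL,SR] [])Z$2e0 Z Z Z Z Z Z!:g4$2f4!:g1$2f1 Z Z
!:g1$2f1 Z Z!:g5$0e5!:g2$2f2!:g1$2f1 Z Z!:g1$2f1 Z Z!:g1$2f1!:g7$0e7(N [SR,SL,SL,FR] [S0,S1])!:g2$2f2 Z Z!:g0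
$2f0!:g2$2f2!:g4$2f4 Z Z!:g4$2f4 Z Z$2e0!:g3$0e3!:g2$2f2!:g4$2f4!:g1!:g5$0e5 Z$2f1 Z Z!:g0$2f0!:g1!:g5$0e5 Z$2f1
Z Z$2e0!:g0$2f0!:g1(N [SL,FL,SL,SL] [S0])(N [SL,FL,SL,SL] [S0])(N [SL,FL,SL,SL] [])$2e0!:g2$2f2!:g7$0e7
(N [SR,SL,FR,SL] [S0,S1])!:g4$2f4!:g1$2f1 Z Z!:g1$2f1 Z Z!:g0$2f0!:g7$0e7!:g5$0e5!:g1$2f1!:g4$2f4 Z Z
(N [SR,SR,SL,FR] [])$2f7!:g4$2f4!:g1$2f1 Z Z!:g1$2f1 Z Z$2e0"])
    (simp_all add: dead2_01101011 dead2_01101221 dead2_01111221 dead2_01121221 dead2_11222212)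

lemma dead2_01111112: "dead s2 (Nd (Nd (Nd (Lf K0) (Lf K1)) (Nd (Lf K1) (Lf K1))) (Nd (Nd (Lf K1) (Lf K1)) (Nd (Lf K1) (Lf K2))))"
  by (rule case2.dead_by_certificate[where es = "[E g0 1 1 0, E g1 (-2) (-2) 1, E g2 (-2) (-2) 1, E g3 1 1 (-2), E g4 (-2) (-2) 1, E g5 1 1 (-2), E g6 1 1 (-2), E g7 0 1 1]" and ce = "!:g0!:g1!:g2!:g4$0f0 Z$2f0!:g4 Z Z$2f0$2f0!:g2!:g4 Z Z$2f0!:g4 Z Z$2f0$2f0$2f0!:g7$0e7!:g3!:g1!:g2!:g4 Z Z!:g5
$0f4!:g6$0f4#0e7$2f2$2f1!:g4 Z Z!:g5$0f4!:g6$0f4#0e7 Z$2f1$0f2!:g2!:g4 Z Z!:g5$0f4!:g6$0f4#0e7$2f2 Z!:g4 Z Z!:g5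
$0f4!:g6$0f4#0e7 Z Z$0f2$0f1!:g5!:g6!:g1!:g2(N [SL,FL,SL,SL] [S0,S1])!:g4 Z Z$0f4$0f2!:g2!:g4 Z Z$0f4!:g4 Z Z
$0f4$0f2$0f1#0e7#0e7#0e7#0e7!:g5!:g1$2f1(N [SR,SR,SL,FR] [S1,S0])$0f1#0e7#0e7!:g3$2f3!:g5$2f5!:g6$2f6!:g1!:g2
(N [SL,FL,SL,SL] [S0,S1])!:g4 Z Z(N [FR,SL,SL,SR] [])(N [SL,SL,FR,SL] [])!:g2!:g4 Z Z(N [FR,SL,SR,SL] [])!:g4 Z Z
#0f4(N [SL,SL,FR,SL] [])(N [SL,SL,SL,FR] [])!:g1!:g2$2f2 Z!:g4$2f4 Z(N [FR,SL,SL,SR] [])!:g2$2f2 Z!:g4$2f4 Z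
(N [FR,SL,SL,SR] [])(N [SL,SL,SL,FR] [])!:g1$2f1!:g2 Z Z!:g6$0f2(N [SL,SL,FR,SL] [])Z!:g2!:g4$2f4 Z!:g6$0f4
(N [FR,SL,SR,SL] [])$2f2!:g4$2f4 Z!:g6$0f4(N [FR,SL,SR,SL] [])Z(N [SL,FL,SL,SL] [])!:g1$2f1!:g2$2f2 Z!:g4 Z Z
!:g6$0f2(N [SL,SL,SL,FL] [])Z!:g5$0f1!:g4!:g2$2f2 Z!:g6$0f2(N [FR,SR,SL,SL] [])$2f4!:g2$2f2 Z!:g6$0f2
(N [FR,SR,SL,SL] [])Z(N [SL,SL,FL,SL] [])!:g2$2f2 Z!:g4$2f4 Z!:g6$0f2(N [SL,SL,SL,FL] [])Z$2e0"])
    (simp_all add: dead2_01101011 dead2_01111221 dead2_01121222 dead2_11121222 dead2_11122112)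

lemma dead2_1111111212222222: "dead s2 (Nd (Nd (Nd (Nd (Lf K1) (Lf K1)) (Nd (Lf K1) (Lf K1))) (Nd (Nd (Lf K1) (Lf K1)) (Nd (Lf K1) (Lf K2)))) (Nd (Nd (Nd (Lf K1) (Lf K2)) (Nd (Lf K2) (Lf K2))) (Nd (Nd (Lf K2) (Lf K2)) (Nd (Lf K2) (Lf K2)))))"
  by (rule case2.dead_by_certificate[where es = "[E e1 0 0 (-3), E f1 0 (-3) 0]" and ce = "!:f1$0b1 Z!:e1$2c1!:f0$2d0!:e0!:f2$0b2#2b0!:e2$2c2!:e4!:f4$0b4#2b0$2c4#0a0$2c0$2c0!:e2!:f2$0b2#2b0$2c2#0a0#0a0
(N [SL,SL,FL,FL,SL] [])$2b0 Z"])
    (simp_all add: dead2_11122112)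

lemma dead2_1111122212221222: "dead s2 (Nd (Nd (Nd (Nd (Lf K1) (Lf K1)) (Nd (Lf K1) (Lf K1))) (Nd (Nd (Lf K1) (Lf K2)) (Nd (Lf K2) (Lf K2)))) (Nd (Nd (Nd (Lf K1) (Lf K2)) (Nd (Lf K2) (Lf K2))) (Nd (Nd (Lf K1) (Lf K2)) (Nd (Lf K2) (Lf K2)))))"
  by (rule case2.dead_by_certificate[where es = "[E e0 0 0 1, E e1 1 0 (-1), E e2 0 0 (-1), E e5 0 0 1, E f0 1 0 (-2), E f1 0 0 1, E f2 0 0 1]" and ce = "!:f1$0b1!:f2$0b2!:e1!:e5$0a5!:e0 Z Z$0c0$2c1!:e0 Z Z!:f0$0c0 Z Z Z!:f0$2d0!:e1!:e5$0a5!:e0 Z Z$0c0$2c1!:e0 Z Z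
!:e2$0c0#0(hold2 c0)Z Z Z!:e1$2c1!:f0$2d0!:e0!:e5$0a5 Z!:e4$2c4!:e2!:f2$0b2 Z$2c2#0a0$2c0$2c0!:e2!:f2$0b2 Z$2c2
#0a0 Z(N [SL,SL,FL,FL,SL] [])Z!:f0$2d0!:e0$2c0 Z!:e2$0c0!:f2$0b2 Z(N [SL,SL,FL,SL,FL] [])Z Z"])
    (simp_all add: dead2_11122112)

lemma dead2_1111112212122222: "dead s2 (Nd (Nd (Nd (Nd (Lf K1) (Lf K1)) (Nd (Lf K1) (Lf K1))) (Nd (Nd (Lf K1) (Lf K1)) (Nd (Lf K2) (Lf K2)))) (Nd (Nd (Nd (Lf K1) (Lf K2)) (Nd (Lf K1) (Lf K2))) (Nd (Nd (Lf K2) (Lf K2)) (Nd (Lf K2) (Lf K2)))))"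
  by (rule case2.dead_by_certificate[where es = "[E e1 1 0 0, E e2 1 0 0, E e4 1 0 0, E e6 0 0 1, E f0 1 0 0, E f1 0 0 1, E f4 0 0 1]" and ce = "!:e6$0a6!:f4$0b4!:e4!:f6$0b6!:e0!:e1!:f1$0b1!:e2!:f0$0c0 Z$2c0 Z$2c0$2c1!:e2!:f0!:f1$0b1 Z$2d0 Z$2c0 Z$2c0$2c0
!:e2!:f0!:f1$0b1!:e1!:f2!:f3$0b3!:f5$0b5!:e5!:e7$0a7!:f7$0b7 Y Y$2c5(N [FR,SL,SL,FL,SR] [])$2c1
(N [SR,FR,SL,FL,SL] [])$2d2(N [FR,SL,SL,SR,FL] [])$2c2 Z Z$2d0!:e1!:f1$0b1 Z$2c1 Z Z#2(hold3 b0)!:e1!:f1$0b1 Z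
$2c1 Z Z(N [SR,FL,SR,SL,FL] [S1,S0])$0c0(N [SR,SL,FR,SL,FL] [])!:e1!:f1$0b1 Z$2c1 Z Z#2(hold4 a4)!:f6$0b6!:e4
$2c4!:f0$2d0!:e1!:f1$0b1 Z$2c1 Z Z!:e1!:f1$0b1 Z$2c1 Z Z(N [SR,SL,FR,SR,FL] [S1])!:e4$2c4!:f0$2d0!:e1!:f1$0b1 Z
$2c1 Z Z!:e1!:f1$0b1 Z$2c1 Z Z!:e0$2c0#2(hold4 a4)!:e2$0c0(N [SL,FL,SL,SR,FL] [S0])$2c6!:e2$2c2!:e4$2c4!:e0!:e1
!:f1$0b1!:f0!:f4$0b4 Z$2d0 Z$2c0$2c1!:f0!:f1$0b1 Z$2d0 Z$2c0$2c0!:e1!:f0!:f1$0b1!:f4$0b4 Z$2d0$2c1#0a0#0a0#0a0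
#0a0(N [SL,FL,SL,SL,FL] [])!:e0$2c0!:e1!:e5$0c4#2a4$2c1#0a0#0a0!:e1$0c0!:f0$0c0 Z Z!:f0$0c0 Z Z!:e0$2c0!:e4$2c4
!:e1!:e3$0c2!:f0!:f1$0b1!:f4$0b4 Z$2d0$2c1#0a0#0a0$2c1#0a0#0a0(N [SL,FL,SL,SL,FL] [])!:e7$0a7!:e3$0c2!:e1$0c0
!:e4$0c0!:f0$0c0 Z Z!:f0$0c0 Z Z!:e5$0c1!:e4$0c0!:f0$0c0 Z Z!:f0$0c0 Z Z(N [SL,FL,SL,SR,FR] [S0])
(N [SL,FL,SL,FR,SR] [])!:e1$0c0!:e4$0c0!:f0$0c0 Z Z!:f0$0c0 Z Z!:e4$0c0!:f0$0c0 Z Z!:f0$0c0 Z Z"])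
    (simp_all add: dead2_01101011 dead2_01111221 dead2_01121222 dead2_11121222 dead2_11122112 dead2_11222212)

lemma dead2_0000011010111021: "dead s2 (Nd (Nd (Nd (Nd (Lf K0) (Lf K0)) (Nd (Lf K0) (Lf K0))) (Nd (Nd (Lf K0) (Lf K1)) (Nd (Lf K1) (Lf K0)))) (Nd (Nd (Nd (Lf K1) (Lf K0)) (Nd (Lf K1) (Lf K1))) (Nd (Nd (Lf K1) (Lf K0)) (Nd (Lf K2) (Lf K1)))))"
  by (rule case2.dead_by_certificate[where es = "[E e0 0 (-3) 0, E e2 1 1 0, E e5 0 0 1, E e6 0 0 1, E e7 1 1 0, E f3 0 0 1, E f4 0 0 1]" and ce = "!:e0$0a0!:e1$0a1!:e3$0a3!:e4!:e5$0a5!:f4!:e6 Z Z$2c4!:e6 Z Z$2c4$2c4$2c4!:f6$0b6!:e5$0a5!:e6!:f4 Z Z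
(N [SL,SL,FR,SL,FL] [S0])!:f4 Z Z(N [SL,SL,FR,SL,FL] [S0])!:f4(N [SL,SL,FR,SL,FL] [S1,S0])
(N [SL,SL,FR,SL,FL] [S1,S0])(N [SL,SL,FR,SL,FL] [])!:e7$0c5!:f5$0c5!:f4!:e6!:f3 Z Z!:f1$2d1!:f7$0d3!:f2$2d2#0d3
(N [SL,FR,SR,FR,SR] [S1,S0])(N [FR,SL,FR,SR,SL] [S1,S0])$2b1!:e2(N [FR,FL,SL,SR,SL] [])!:f3 Z Z!:f1$2d1!:f7$0d3
#0(hold0 c5)#0(hold0 c5)$2b1$2a2(N [SL,FL,FR,SL,SL] [])!:e6!:f3 Z Z!:f1$2d1!:f7$0d3#0(hold0 c5)#0(hold0 c5)$2b1
!:e2(N [FR,FL,SL,SR,SL] [])!:f1!:f3 Z Z$2d1#0(hold0 c5)$2b1$2a2(N [SL,FL,FR,SL,SL] [])(N [SL,SL,FR,FL,SL] [])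
$2b5$2a7!:e5$0a5!:e6$2c6!:f3 Z Z!:f1$2d1!:f4$2d4 Z!:f5$0d4!:f7$0d3!:f2$2d2#0d3!:e2$2c2!:f0$2d0#2d0 Y$2a2
(N [SL,FR,FR,SL,SR] [])$2b5$2b1!:e2$2c2!:e7$0c6!:f2$2d2!:f4$2d4!:f3 Z Z!:f7$0d3#0(hold3 d3)
(N [SL,SL,FR,FR,SR] [])(N [SL,SL,FR,SL,FL] [])(N [SL,SL,SL,FR,FL] [])$2a7$2a2!:e7$0c5!:e6$2c6!:e2
(N [FR,FL,SL,SR,SL] [])!:f5$0c5!:f4$2d4!:f7$0d6#0(hold0 c5)#0(hold0 c5)(N [SL,SL,FR,FL,SL] [])$2b5$2a2
(N [SL,FL,FR,SL,SL] [])$2a7$2a4$2a3$2a1$2a0"])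
    (simp_all add: dead2_01101221 dead2_01111112 dead2_01111221 dead2_01121221 dead2_01121222 dead2_11122112)

lemma dead2_0111111112222222: "dead s2 (Nd (Nd (Nd (Nd (Lf K0) (Lf K1)) (Nd (Lf K1) (Lf K1))) (Nd (Nd (Lf K1) (Lf K1)) (Nd (Lf K1) (Lf K1)))) (Nd (Nd (Nd (Lf K1) (Lf K2)) (Nd (Lf K2) (Lf K2))) (Nd (Nd (Lf K2) (Lf K2)) (Nd (Lf K2) (Lf K2)))))"
  by (rule case2.dead_by_certificate[where es = "[E e0 6 2 0, E e1 (-12) (-7) 2, E e2 (-12) (-7) 2, E e3 6 2 2, E e4 (-12) (-7) 2, E e5 6 2 2, E e6 6 2 2, E e7 (-3) (-7) 2, E f0 2 (-3) 0, E f1 0 2 2, E f2 0 2 2, E f3 0 2 2, E f4 0 2 2, E f5 0 2 2, E f6 0 2 2, E f7 0 2 2]" and ce = "!:e0!:e1!:f1$0b1!:e2!:e4$0c0!:f0$0c0!:e3!:e7 Z Z$2c3 Z$2c1$2b0$2c0!:e3!:f3$0b3!:e7!:f7$0b7!:e5!:f5$0b5!:e6!:f6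
$0b6!:f0!:e4$0c0!:f2$0b2!:f4$0b4 Y$2d0$2d0$2c0!:e4 Z!:f2$0b2 Y!:f4$0b4 Y Y$2c0$2b0$2c6!:e4 Z!:f0!:f2$0b2!:f4$0b4
!:f6$0b6 Y Y$2d0$2d0 Z$2b0$2c0$0c6$2c5!:e4 Z!:e6!:f0!:f2$0b2!:f4$0b4!:f5$0b5!:f6$0b6 Y$2c6 Y$2d0$2d0 Z$2b0 Z$0c6
$2c0$2c1$2c7!:e4 Z!:e5!:e6(N [FR,FL,SL,SL,SR] [])Z Z Z$2c1$2c0$2c3$2c3!:e4!:f0$0c0 Z$2b0!:e5!:e7!:e6!:f0!:f2$0b2
!:f3$0b3!:f4$0b4!:f5$0b5!:f6$0b6!:f7$0b7 Y$2c7$2c6$2c5$2d0(N [SR,FR,FL,SL,SL] [])$2d0 Z$2b0 Z$0c6 Z$2c5!:e6!:e7 Z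
Z$2c6 Z Z$2c1$2c0$2c1$2c0$2c1!:e2!:f2$0b2!:e3!:f3$0b3!:e7!:f7$0b7!:e5!:f5$0b5!:e6!:f6$0b6!:f0!:e4$0c0!:f1$0b1
!:f4$0b4 Y$2d0$2d0$2c0!:e4 Z!:f1$0b1 Y!:f4$0b4 Y Y$2c0$2b0$2c6!:e4 Z!:f0!:f1$0b1!:f4$0b4!:f6$0b6 Y Y$2d0$2d0 Z
$2b0$2c0$2c2$2c5!:e4 Z!:e6!:f0!:f1$0b1!:f4$0b4!:f5$0b5!:f6$0b6 Y$2c6 Y$2d0$2d0 Z$2b0 Z$2c2$2c0$0c5$2c7!:e4 Z!:e5
!:e6(N [FR,FL,SL,SR,SL] [])Z$2c2 Z Z$2c0$2c3$2c3!:e4!:f0$0c0 Z$2b0!:e6!:e7!:e5!:f0!:f1$0b1!:f3$0b3!:f4$0b4!:f5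
$0b5!:f6$0b6!:f7$0b7 Y$2c7$2c6$2c5$2d0(N [SR,FR,FL,SL,SL] [])$2d0 Z$2b0 Z$0c5 Z$2c6!:e5!:e7 Z Z$2c5 Z Z$2c2$2c0
$2c2$2c2!:e4!:f4$0b4!:e5!:f5$0b5!:e7!:f7$0b7!:f0!:f1$0b1!:f2$0b2!:f3$0b3!:f6$0b6!:e3!:e6 Y Y$2c4!:e6 Y Z$2c4$0c3
(N [SR,FR,SL,SL,FL] [])(N [SR,FR,FL,SL,SL] [])$2d0$2d0!:e3!:e6!:f3$0b3!:f6$0b6!:f1$0b1 Y!:f2$0b2 Y Y$2c6$2c3 Z
$2c4 Z$0c3$2b0$2c7!:e3!:e6(N [FR,FL,SR,SL,SL] [])Z$2c4 Z Z$2c5$2c5!:e6!:e7!:e3!:f0!:f1$0b1!:f2$0b2!:f3$0b3!:f5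
$0b5!:f6$0b6!:f7$0b7 Y$2c7$2c6(N [SR,FR,SL,FL,SL] [])$2c3$2d0$2d0 Z$2b0 Z$0c3 Z$2c6!:e3!:e7 Z Z$2c3 Z Z$2c4$2c4
$2c4!:f0!:f1$0b1!:f2$0b2!:f3$0b3!:f4$0b4!:f5$0b5!:f6$0b6!:f7$0b7!:e3!:e5!:e6 Y Y#0(hold4 c6)!:e6 Y Y#0(hold4 c6)
#0(hold3 c5)!:e5!:e6 Y Y#0(hold4 c6)!:e6 Y!:e7 Z Z#0(hold4 c7)#0(hold4 c6)#0(hold3 c5)#0(hold2 c3)
(N [FR,FR,SL,SL,SL] [])(N [SR,FR,SL,SL,FL] [])(N [SR,FR,SL,FL,SL] [])$2d0(N [SR,FR,FL,SL,SL] [])$2d0$2d0!:f1$0b1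
!:f3$0b3!:e3!:e7!:f7$0b7!:e5!:e6(N [FR,FL,SR,SR,SR] [])!:f5$0b5!:f6$0b6!:f2$0b2 Y!:f4$0b4 Y#2(hold4 d6)Y$2c5$0c6
!:e6!:f6$0b6!:f5$0b5!:f2$0b2 Y!:f4$0b4 Y Y Y$2c6 Z$0c6$0c5$2c7!:e5!:e6(N [FR,FL,SL,SL,SL] [])Z Z Z Z$2c3!:e7!:e5
!:e6!:f5$0b5!:f6$0b6!:f7$0b7!:f2$0b2 Y!:f4$0b4 Y Y$2c7$2c6$2c5 Z$0c6 Z$0c5 Z!:f7$0b7(N [SR,SL,SL,FR,FR] [S1,S0])
!:e5$2c5!:e6$2c6 Z Z!:e6$2c6 Z Z(N [SR,SL,FL,SL,FR] [S1,S0])!:f2$0b2(N [SR,FR,FL,SL,SL] [])!:e3$2c3!:e7!:e5!:e6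
!:f5$0b5!:f6$0b6!:f4$0b4 Y(N [FR,SL,SL,SL,FL] [])$2c6$2c5 Z$0c6 Z$0c5 Z!:e5$2c5!:e6$2c6 Z Z!:e6$2c6 Z Z!:e7$0c3 Z
!:f7$0b7(N [SL,SL,SR,FR,FR] [])!:e5$2c5!:e6$2c6 Z Z!:e6$2c6 Z Z!:f3$0b3!:f2$0b2!:e3!:e7!:f7$0b7!:e5!:e6
(N [FR,FL,SR,SR,SR] [])!:f5$0b5!:f4$0b4!:f6$0b6 Y#0(hold0 d6)(N [FR,SL,SL,FL,SL] [])$2c5$0c6!:e6!:f6$0b6!:f5$0b5
!:f4$0b4 Y#2(hold3 d5)Y$2c6 Z$0c6$0c5$2c7!:e5!:e6(N [FR,FL,SL,SL,SL] [])Z Z Z Z$2c3!:e7!:e5!:e6!:f5$0b5!:f4$0b4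
!:f6$0b6!:f7$0b7 Y$2c7$2c6(N [FR,SL,SL,FL,SL] [])$2c5 Z$0c6 Z$0c5 Z!:f7$0b7(N [SR,SL,SL,FR,FR] [S1,S0])!:f5$0b5
#2d3!:f6$0b6#2d3!:f4$0b4(N [SR,FR,SL,SL,FL] [])!:e5$2c5!:e6$2c6 Z Z(N [FR,SL,SL,FL,SL] [])#0(hold2 c3)
(N [SR,FR,FL,SL,SL] [S0,S1])!:e3$2c3!:e7!:e5!:e6!:f5$0b5!:f4$0b4!:f6$0b6!:f7$0b7 Y$2c7$2c6
(N [FR,SL,SL,FL,SL] [])$2c5 Z$0c6 Z$0c5 Z!:e5$2c5!:e6$2c6 Z Z!:e6$2c6 Z Z!:e7$0c3 Z!:f2$0b2!:f7$0b7
(N [SL,SL,SR,FR,FR] [])!:e5$2c5!:e6$2c6 Z Z!:e6$2c6 Z Z(N [FR,SL,FL,SL,SL] [])$2b0$2c0$2c0$2c0!:f0!:f1$0b1!:f2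
$0b2!:f3$0b3!:f4$0b4!:f5$0b5!:f6$0b6!:f7$0b7!:e1!:e2!:e3!:e4$0c0!:e7 Z Z$2c3(N [SL,SL,SL,FL,FL] [S1,S0])
(N [FR,SL,FL,SL,SR] [])$2c1!:e3!:e4!:e7 Z Z$2c3!:e7!:e5!:e6 Y Z$0c6 Z$2c1 Z$2c3(N [SL,SL,SL,FL,FL] [S1,S0])!:e4 Z
!:e7 Z Z(N [SR,SL,SL,FR,FR] [S1,S0])(N [SL,SL,SL,FL,FL] [S1,S0])$2c1(N [SL,SL,FL,SL,FL] [S1,S0])!:e2!:e3!:e4!:e7
Z Z$2c3!:e7!:e5!:e6 Y Z$2c2 Z$0c5 Z$2c3(N [SL,SL,SL,FL,FL] [S1,S0])!:e4 Z!:e7 Z Z(N [SR,SL,SL,FR,FR] [S1,S0])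
(N [SL,SL,SL,FL,FL] [S1,S0])$2c2!:e3!:e4!:e7!:e5!:e6 Y Z$2c4 Z$2c4 Z$2c3!:e5!:e6 Y Y#0(hold4 c6)!:e6 Y!:e7 Z Z
$2c3#0(hold4 c6)#0(hold3 c5)(N [SL,SL,SL,FL,FL] [S1,S0])!:e4!:e7 Z Z(N [SR,SL,SL,FR,FR] [S1,S0])!:e7!:e5!:e6 Y Z
$0c6 Z$0c5 Z(N [SR,SL,SL,FR,FR] [S1,S0])(N [SL,SL,SL,FL,FL] [S1,S0])#0(hold2 c3)(N [SL,SL,FL,SL,FL] [S1,S0])
(N [SL,SL,FL,FL,SL] [S1,S0])(N [FR,FR,SL,SL,SL] [])(N [SR,FR,SL,SL,FL] [])(N [SR,FR,SL,FL,SL] [])$2d0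
(N [SR,FR,FL,SL,SL] [])$2d0$2d0!:f1$0b1!:f2$0b2!:f3$0b3!:e1!:e2!:e3!:e4 Z Z!:e5$0c4!:e6$0c4 Z$2c2$2c1
(N [SL,FL,FL,SL,SL] [S0,S1])$2c1!:e4 Z!:e3!:e7 Z Z$2c3 Z$2c1!:e5$0c4!:f4$0b4(N [SL,SL,SL,FL,FL] [S1,S0])!:e6$0c4
!:e7 Z Z(N [SL,FL,FR,SL,SR] [])!:e3!:e7$0c6 Z$2c3 Z$2c1$2c1(N [SL,SL,FL,SL,FL] [S1,S0])!:f4$0b4!:f5$0b5!:f6$0b6
!:f7$0b7!:e2!:e4 Z!:e3!:e7 Z Z$2c3 Z$2c2(N [SL,SL,SL,FL,FL] [S1,S0])!:e4!:e3!:e7 Z Z$2c3 Z Z#0d0#0d0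
(N [SL,SL,FL,SL,FL] [S1,S0])(N [SR,FR,SL,SL,SL] [])(N [SR,FR,SL,SL,FL] [])(N [SR,FR,SL,FL,SL] [])!:e4$2c4!:e2
!:e3!:e7 Z Z$2c3 Z$2c2!:e7!:e3!:e5!:e6!:f5$0b5!:f6$0b6!:f7$0b7 Y$2c7$2c6$2c5 Z$0c6 Z$0c5 Z$0c3 Z!:e3$2c3!:e5$2c5
Z Z#0(hold2 c3)(N [SL,SL,FL,SL,FL] [S1,S0])!:e2!:e6$0c4!:e5$0c4!:e7 Z Z(N [SL,FL,FR,SL,SR] [])!:e3!:e7$0c5 Z$2c3
Z$2c2$2c2!:e3!:e5$0c4!:e7!:e6$0c4!:f7$0b7!:f5$0b5!:f6$0b6 Y Y Y$2c7$0c6!:e6$0c4 Z Z$2c3!:e7$0c5!:e6$0c4 Z Z$2c3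
!:e5$0c4!:e7!:e6$0c4 Z$0c6 Z!:f5$0b5#0c1#0c1!:e7$0c5 Z!:f5$0b5(N [SL,SL,FR,FL,SR] [])!:f6$0b6!:e6$0c4#0c2
(N [SL,SL,FR,SR,FL] [])Y#0(hold2 c3)(N [SL,SL,FL,SL,FL] [S1,S0])(N [SL,SL,FL,FL,SL] [S1,S0])
(N [SR,FR,FL,SL,SL] [])!:f4$0b4!:f5$0b5!:e1!:e2$2c2!:e4 Z!:e3!:e7 Z Z$2c3 Z$2c1(N [SL,SL,SL,FL,FL] [S1,S0])!:e3
$0c2!:e6$0c2!:e4 Z!:e7 Z Z(N [SL,FL,SL,FR,SR] [])(N [SL,FL,SL,SL,FL] [])!:e4$2c4!:e5!:e7$0c6 Z$2c5 Z$2c1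
(N [SL,SL,SL,FL,FL] [S1,S0])$2c1!:e2$2c2!:e4!:e3!:e7 Z Z$2c3 Z Z!:e7!:e3!:e5!:e6!:f3$0b3!:f6$0b6!:f7$0b7 Y$2c7
$2c6$2c3 Z$0c6 Z$0c5 Z$0c3 Z!:e3$2c3!:e5$2c5 Z Z(N [SL,FL,FL,SL,SL] [])(N [SL,SL,SL,FL,FL] [S1,S0])!:e3$0c2!:e6
$0c2!:e7!:e4 Z!:e5!:f7$0b7!:f3$0b3!:f6$0b6 Y Y Y$2c7 Z$0c5(N [SL,FL,SL,SL,FL] [])!:e4 Z Z#0(hold1 c2)
(N [SL,FL,SL,FR,SR] [])!:e4$2c4!:e7$0c6 Z!:e5$2c5!:f3$0b3#0c1#0c1#0(hold3 c5)(N [SL,SL,SL,FL,FL] [S1,S0])!:f3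
$0b3(N [SL,SL,FL,FR,SR] [])!:e7$0c3!:e4 Z!:e6$0c2 Z Z(N [SL,SL,SL,FL,FL] [S1,S0])!:e5$2c5!:f7$0b7
(N [SR,SL,FR,SL,FR] [S1,S0])!:e6$0c2!:e4 Z!:f6$0b6#0c4#0c4#0(hold3 c4)!:e4$2c4!:f6$0b6$2d6 Y#0(hold3 c4)
(N [SR,SL,SL,FL,FR] [S1,S0])(N [SL,SL,FL,FL,SL] [S1,S0])(N [SR,FR,SL,FL,SL] [])!:f6$0b6
(N [SR,FR,SL,SL,FL] [S0,S1])!:e1!:e2$2c2!:e3!:f3$0b3!:e7!:e4$2c4 Z!:e5$0c4!:e6$0c4 Z$0c6$2c1!:e6$2c6 Z Z$2c3$2c3
!:e4$2c4 Z!:e5$0c4!:e6$0c4 Z Z$2c1$2c1!:e3$0c2!:e4$2c4!:e5!:e7!:e6$0c2 Z$0c6 Z$2c5!:e6$0c2 Z Z$2c1!:e5$0c4!:e6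
$0c2(N [FR,SL,SL,SL,FL] [S0,S1])!:e7$0c6 Z(N [FR,FL,SL,SL,SR] [])$2c1$2c1!:e2$2c2!:e4$2c4!:e6$2c6!:e3!:e7 Z Z
$2c3 Z Z(N [FR,SL,SL,SL,FL] [])!:e3!:f3$0b3!:e5$0c4!:e6$0c4!:e7!:f5$0b5!:f7$0b7 Y$2c7 Y Z$2c3!:e7$0c6 Z$2c3!:e7
$0c5!:e6$0c4 Z Z$2c3$2c3!:e6$0c4!:e7!:e5$0c4 Z$0c5 Z#2c6!:e7$0c6 Z!:f7$0b7(N [SL,SL,FR,FR,SR] [])!:f5$0b5!:e5
$0c4!:f3$0b3#0c1#0c1$2d5!:e5$0c4#2c5!:f3$0b3 Y Y(N [SL,FL,FL,SL,SL] [])!:e4$2c4!:e3$0c2!:e6$0c2!:e7!:e5!:f5$0b5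
!:f3$0b3!:f7$0b7 Y$2c7 Y$2c5 Z$0c5 Z#0(hold1 c2)!:e7$0c6 Z!:e5$2c5!:f3$0b3!:f5$0b5#0c1#0c1#2c3#2c4!:f3$0b3
(N [SL,SL,FL,FR,SR] [])!:e7$0c3!:e6$0c2 Z Z!:e5$2c5!:e6$0c2#2c6!:f5$0b5!:f7$0b7$2d7 Y Y(N [SL,FL,SL,FL,SL] [])
!:e6$0c2(N [FR,SL,SL,SL,FL] [S0,S1])!:e3$0c2!:e5$0c4!:e7$0c6!:f3$0b3!:f5$0b5#0c1#0c1!:f5$0b5#0c1#0c1
(N [FR,FL,SL,SL,SR] [])!:f5$0b5(N [SL,SL,FR,FL,SR] [])!:e7$0c5!:f3$0b3!:f7$0b7 Y#2c7 Y!:f3$0b3 Y#2c3!:f3$0b3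
(N [SL,SL,FL,FR,SR] [])!:e7$0c3!:e5$0c4!:f5$0b5!:f7$0b7 Y#2c7 Y#2(hold1 c7)!:f5$0b5!:e5$0c4 Y
(N [SL,SL,FR,FL,SR] [])Y(N [SL,SL,FL,FL,SL] [S1,S0])!:f2$0b2!:f4$0b4!:f6$0b6!:e2!:e1$2c1!:e4 Z!:e3!:e7 Z Z$2c3 Z
$2c2(N [SL,SL,SL,FL,FL] [S1,S0])!:e3$0c1!:e5$0c1!:e4 Z!:e7 Z Z(N [SL,FL,SL,SR,FR] [])(N [SL,FL,SL,FL,SL] [])!:e4
$2c4!:e6!:e7$0c5 Z$2c6 Z$2c2(N [SL,SL,SL,FL,FL] [S1,S0])$2c2!:e1$2c1!:e4!:e3!:e7 Z Z$2c3 Z Z!:e7!:e3!:e5!:e6!:f3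
$0b3!:f5$0b5!:f7$0b7 Y$2c7$2c5$2c3 Z$0c6 Z$0c5 Z$0c3 Z!:e3$2c3!:e5$2c5 Z Z(N [SL,FL,FL,SL,SL] [])
(N [SL,SL,SL,FL,FL] [S1,S0])!:e3$0c1!:e5$0c1!:e7!:e4 Z!:e6!:f7$0b7!:f3$0b3!:f5$0b5 Y Y Y$2c7 Z$0c6
(N [SL,FL,SL,FL,SL] [])!:e4 Z Z#0(hold1 c1)(N [SL,FL,SL,SR,FR] [])!:e4$2c4!:e7$0c5 Z!:e6$2c6!:f3$0b3#0c2#0c2
#0(hold4 c6)(N [SL,SL,SL,FL,FL] [S1,S0])!:f3$0b3(N [SR,SL,FL,FR,SL] [S1,S0])!:e7$0c3!:e4 Z!:e5$0c1 Z Z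
(N [SL,SL,SL,FL,FL] [S1,S0])!:e6$2c6!:f7$0b7(N [SR,SL,FR,FR,SL] [S1,S0])!:e5$0c1!:e4 Z!:f5$0b5#0c4#0c4
#0(hold4 c4)!:e4$2c4!:f5$0b5$2d5 Y#0(hold4 c4)(N [SR,SL,SL,FR,FL] [S1,S0])(N [SL,SL,FL,SL,FL] [S1,S0])
(N [SR,FR,SL,SL,FL] [])!:f5$0b5(N [SR,FR,SL,FL,SL] [S0,S1])!:e1$2c1!:e2!:e3!:f3$0b3!:e7!:e4$2c4 Z!:e5$0c4!:e6
$0c4 Z$2c2$0c5!:e5$2c5 Z Z$2c3$2c3!:e4$2c4 Z!:e6$0c4!:e5$0c4 Z Z$2c2$2c2!:e4$2c4!:e5$2c5!:e3!:e7 Z Z$2c3 Z Z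
(N [FR,SL,SL,FL,SL] [])!:e3!:f3$0b3!:e5$0c4!:e6$0c4!:e7!:f6$0b6!:f7$0b7 Y$2c7 Y Z$2c3!:e7$0c6 Z$2c3!:e7$0c5!:e6
$0c4 Z Z$2c3$2c3!:e5$0c4!:e7!:e6$0c4 Z$0c6 Z#2c5!:e7$0c5 Z!:f7$0b7(N [SL,SL,FR,SR,FR] [])!:f6$0b6!:e6$0c4!:f3
$0b3#0c2#0c2$2d6!:e6$0c4#2c6!:f3$0b3 Y Y(N [SL,FL,FL,SL,SL] [])(N [SL,SL,FL,SL,FL] [S1,S0])!:e5$0c1!:e4$2c4!:e2
!:e3$0c1!:e7 Z Z#2c5$2c2!:e3$0c1!:e7!:e6!:f6$0b6!:f3$0b3!:f7$0b7 Y$2c7 Y$2c6 Z$0c6 Z#0(hold1 c1)!:e7$0c3 Z!:e6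
$2c6#2c5(N [SL,FL,SL,SL,FL] [])(N [SL,SL,FL,SL,FL] [S1,S0])(N [FR,SL,SL,FL,SL] [S0,S1])!:e2!:e3$0c1!:e6!:e4$2c4
!:e7$0c5 Z$2c6$0c4!:e4$2c4 Z!:e7$0c5 Z(N [FR,FL,SL,SR,SL] [])$2c2$2c2!:e4$2c4!:e7$0c5!:e3$0c1 Z Z!:e6$2c6!:f7
$0b7(N [SL,SL,FR,SR,FR] [])!:f3$0b3!:e3$0c1!:f6$0b6#0c2#0c2$2d3!:e3$0c1#2c3!:f6$0b6 Y Y#2c4!:e3$0c1!:e6$0c4!:e7
$0c5!:f3$0b3!:f6$0b6#0c2#0c2!:f6$0b6#0c2#0c2(N [FR,FL,SL,SR,SL] [])!:f6$0b6(N [SL,SL,FR,SR,FL] [])!:e7$0c5!:f3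
$0b3!:f7$0b7 Y#2c7 Y!:f3$0b3 Y#2c3!:f3$0b3(N [SR,SL,FL,FR,SL] [S1,S0])!:e7$0c3!:e6$0c4!:f6$0b6!:f7$0b7 Y#2c7 Y
#2(hold1 c7)!:f6$0b6!:e6$0c4 Y(N [SL,SL,FR,SR,FL] [])Y(N [SL,SL,FL,SL,FL] [S1,S0])!:f3$0b3
(N [SR,FR,FL,SL,SL] [S0,S1])!:f4$0b4!:e1$2c1!:e2$2c2!:e3$2c3!:e4 Z!:e5!:e7 Z Z$2c5 Z Z
(N [SL,SL,SL,FL,FL] [S1,S0])(N [FR,SL,FL,SL,SL] [])!:e4!:e6$0c2!:e3$0c2!:e7 Z Z#2c3!:e5!:e7$0c3 Z$2c5 Z$2c4$2c4
!:e3$0c2!:e5!:f5$0b5!:e6$0c2!:e7!:f6$0b6!:f7$0b7 Y$2c7 Y Z$2c5!:e7$0c6 Z$2c5$2c5!:e7!:e6$0c2 Z$0c6 Z#2c3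
(N [SL,FL,SL,FL,SL] [])!:e7$0c3!:e6$0c2 Z Z!:e5$2c5!:f7$0b7(N [SL,SL,SR,FR,FR] [])!:f6$0b6!:e6$0c2!:f5$0b5#0c4
#0c4$2d6!:e6$0c2#2c6!:f5$0b5 Y Y#2c1(N [SL,SL,SL,FL,FL] [S1,S0])!:e3$0c1!:e2$2c2!:e4!:e5$0c1!:e7 Z Z#2c3$2c4!:e5
$0c1!:e7!:e6!:f6$0b6!:f5$0b5!:f7$0b7 Y$2c7 Y$2c6 Z$0c6 Z#0(hold1 c1)!:e7$0c5 Z!:e6$2c6#2c3
(N [SL,FL,SL,SL,FL] [])(N [SL,SL,SL,FL,FL] [S1,S0])(N [FR,SL,FL,SL,SL] [S0,S1])!:e2$2c2!:e7$0c3!:e4 Z!:e5$0c1 Z Z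
(N [SL,SL,SL,FL,FL] [S1,S0])!:f7$0b7(N [SL,SL,SR,FR,FR] [])!:e4!:e5$0c1!:e6$2c6 Z$2c4$2c4!:e6$2c6!:f5$0b5!:e5
$0c1!:f6$0b6#0c4#0c4$2d5!:e5$0c1#2c5!:f6$0b6 Y Y#2c2(N [SL,SL,SL,FL,FL] [S1,S0])!:e4!:e5$0c1!:e6$0c2!:e7$0c3 Z
(N [FR,FL,SR,SL,SL] [])$2c4$2c4!:e5$0c1!:e6$0c2!:e7$0c3!:f5$0b5!:f6$0b6#0c4#0c4!:f6$0b6#0c4#0c4
(N [FR,FL,SR,SL,SL] [])!:f6$0b6(N [SR,SL,FR,SL,FL] [S1,S0])!:e7$0c3!:f5$0b5!:f7$0b7 Y#2c7 Y!:f5$0b5 Y#2c5!:f5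
$0b5(N [SR,SL,FR,FL,SL] [S1,S0])!:e7$0c3!:e6$0c2!:f6$0b6!:f7$0b7 Y#2c7 Y#2(hold1 c7)!:f6$0b6!:e6$0c2 Y
(N [SR,SL,FR,SL,FL] [S1,S0])Y(N [SL,SL,SL,FL,FL] [S1,S0])!:f5$0b5(N [SR,FR,SL,FL,SL] [S0,S1])!:f6$0b6
(N [SR,FR,SL,SL,FL] [S0,S1])!:f7$0b7$2d7!:e1$2c1!:e2$2c2!:e3$2c3!:e5$2c5!:e4$2c4 Z!:e7$2c7 Z#2c5!:e4$2c4 Z!:e6
$0c4!:e7$0c5 Z#2c6 Y(N [FR,SL,FL,SL,SL] [])!:e4$2c4!:e5$2c5!:e3$0c2!:e7$2c7 Z#2c3!:e6$0c2!:e7$0c3 Z#2c6 Y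
(N [FR,SL,SL,FL,SL] [])!:e6$0c2(N [FR,SL,SL,SL,FL] [S0,S1])!:e3$0c2!:e7$0c6!:e5$0c4 Y Y Y!:e5$0c4!:e7$0c3 Y Y Y
!:e2$2c2!:e4$2c4!:e6$2c6!:e3$0c1!:e7$2c7 Z#2c3!:e5$0c1!:e7$0c3 Z#2c5 Y(N [FR,SL,SL,SL,FL] [])!:e5$0c1
(N [FR,SL,SL,FL,SL] [S0,S1])!:e3$0c1!:e7$0c5!:e6$0c4 Y Y Y!:e6$0c4!:e7$0c3 Y Y Y!:e3$0c1
(N [FR,SL,FL,SL,SL] [S0,S1])!:e4$2c4!:e5$0c1!:e7$0c3!:e6$0c2 Y Y Y!:e6$0c2!:e7$0c3 Y Y Y!:e5$0c1
(N [FR,SL,SL,FL,SL] [S0,S1])!:e6$0c2(N [FR,SL,SL,SL,FL] [S0,S1])!:e7$0c3$2c7 Y$2b0$2a0"])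
    (simp_all add: dead2_00010110 dead2_01101001 dead2_01101011 dead2_01101221 dead2_01111112 dead2_01111221 dead2_01121222 dead2_1111111212222222 dead2_11111221 dead2_11121222 dead2_11122112 dead2_11222212)

lemma dead2_12222222: "dead s2 (Nd (Nd (Nd (Lf K1) (Lf K2)) (Nd (Lf K2) (Lf K2))) (Nd (Nd (Lf K2) (Lf K2)) (Nd (Lf K2) (Lf K2))))"
  by (rule case2.dead_by_certificate[where es = "[E g0 1 0 0]" and ce = "!:g0!:g1$0e1!:g2$0e2!:g3$0e3!:g4$0e4!:g5$0e5!:g6$0e6!:g7$0e7(N [SR,SL,SL,SL] [])(N [FR,SL,SL,SL] [])
(N [SR,SL,SL,FL] [])(N [SR,SL,FL,SL] [])$2f0(N [SR,FL,SL,SL] [])$2f0$2f0 Z$2e0"])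
    (simp_all add: dead2_0111111112222222 dead2_01111112 dead2_01121222)

lemma dead2_11111222: "dead s2 (Nd (Nd (Nd (Lf K1) (Lf K1)) (Nd (Lf K1) (Lf K1))) (Nd (Nd (Lf K1) (Lf K2)) (Nd (Lf K2) (Lf K2))))"
  by (rule case2.dead_by_certificate[where es = "[E g3 0 0 1, E g4 1 0 (-1), E g5 0 0 1, E g6 0 0 1, E g7 0 0 (-1)]" and ce = "!:g7$0e7!:g6$0e6!:g4!:g5$0e5!:g3 Z Z!:g1$2f1(N [SR,SL,SL,FR] [S1,S0])!:g0$2f0(N [SR,SR,FL,SL] [S1,S0])$0f0$2f4
!:g3 Z Z!:g2$2f2(N [SR,SL,FR,SL] [S1,S0])!:g0$2f0(N [SL,SL,SL,FL] [S1,S0])(N [SL,SR,SL,FL] [S1,S0])Z!:g5$0e5!:g4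
$2f4!:g3 Z Z!:g1$2f1(N [SR,SL,SL,FR] [S1,S0])!:g0$2f0(N [SL,SL,FL,SL] [S1,S0])(N [SL,SR,FL,SL] [S1,S0])Z!:g4$2f4
(N [SR,FR,SL,SL] [S0,S1])!:g3 Z Z$2f7!:g4!:g5$0e5!:g6$0e6 Z$2f4$2f4!:g3$2f3 Z!:g5$0e5 Z!:g6$0e6 Z!:g2$2f2!:g0
!:g1$2f1(N [FR,SL,SL,SL] [])$2f0!:g1$2f1(N [FR,SL,SL,SL] [])(N [SL,SL,SL,SL] [S0,S2,S1])(N [SL,SL,SL,FL] [])!:g1
$2f1!:g0$2f0(N [SL,SL,SL,SL] [S0,S1])(N [SL,SL,FL,SL] [])!:g0$2f0(N [SL,SL,SL,SL] [])(N [FR,SR,SL,SL] [])Z"])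
    (simp_all add: dead2_01111221 dead2_01121222 dead2_1111112212122222 dead2_11111221 dead2_1111122212221222 dead2_11121222 dead2_11122112 dead2_11222212 dead2_12222222)

lemma dead2_00010111: "dead s2 (Nd (Nd (Nd (Lf K0) (Lf K0)) (Nd (Lf K0) (Lf K1))) (Nd (Nd (Lf K0) (Lf K1)) (Nd (Lf K1) (Lf K1))))"
  by (rule case2.dead_by_certificate[where es = "[E g3 0 0 1, E g5 0 0 1, E g6 0 0 1, E g7 1 0 0]" and ce = "!:g0$0e0!:g1!:g5!:g3!:g6 Z Z!:g7$0f6 Z$2f3!:g6 Z Z!:g7$0f6 Z$2f5$2f1!:g3!:g6 Z Z!:g7$0f6 Z$2f3!:g6 Z Z!:g7$0f6 Z
Z$2f1$2f1!:g2!:g3!:g6!:g5 Z Z!:g7$0f5 Z$2f3!:g5 Z Z!:g7$0f5 Z$2f3$2f2!:g6!:g5 Z Z!:g7$0f5 Z$2f6!:g5 Z Z!:g7$0f5 Z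
Z$2f2$2f2!:g4!:g6!:g5!:g3 Z Z!:g7$0f3 Z$2f5!:g3 Z Z!:g7$0f3 Z$2f6$2f4!:g5!:g3 Z Z!:g7$0f3 Z$2f5!:g3 Z Z!:g7$0f3 Z
Z$2f4$2f4!:g7!:g3!:g5!:g6 Z Z$0f6!:g6 Z Z$0f6$0f5!:g5!:g6 Z Z$0f6!:g6 Z Z$0f6$0f5$0f3!:g3!:g5 Z Z!:g6 Z Z
(N [FR,SL,SR,SR] [])!:g5 Z Z!:g6 Z Z(N [FR,SL,SL,SL] [])!:g5!:g6 Z Z(N [FR,SR,SL,SR] [S0])!:g6 Z Z
(N [FR,SL,SL,SL] [S0])(N [SL,SL,SL,FR] [])!:g6$2f6!:g3$2f3 Z!:g5$2f5 Z(N [FR,SL,SL,SL] [S1,S0])!:g5$2f5!:g3$2f3 Z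
(N [FR,SL,SL,SL] [S0])!:g3$2f3(N [FR,SL,SL,SL] [])(N [FR,SL,SL,SL] [])$2e4$2e2$2e1$2e0"])
    (simp_all add: dead2_01111221 dead2_11111221 dead2_11111222 dead2_11121222)

lemma dead2_00011110: "dead s2 (Nd (Nd (Nd (Lf K0) (Lf K0)) (Nd (Lf K0) (Lf K1))) (Nd (Nd (Lf K1) (Lf K1)) (Nd (Lf K1) (Lf K0))))"
  by (rule case2.dead_by_certificate[where es = "[E g3 (-1) 0 1, E g5 0 0 1, E g6 0 0 1, E g7 1 0 0]" and ce = "!:g7!:g5!:g3 Z!:g6 Z Z$0f6$0f3!:g3 Z!:g6 Z Z$0f6$0f3$0f5!:g3 Z!:g5 Z Z!:g1$2f1!:g6 Z Z!:g2$2f2!:g0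
(N [SL,FL,SL,SL] [])!:g4$2f4(N [FR,SL,SL,SL] [])(N [FR,SL,SR,SR] [])$2e0$2e2$2e1!:g1$2f1!:g2$2f2!:g5!:g6 Z Z
(N [SL,SL,FR,SL] [])!:g6 Z Z(N [SL,SL,FR,SL] [])(N [SL,SL,SL,FR] [])$2e2$2e1$2e7"])
    (simp_all add: dead2_00010111 dead2_01101221 dead2_11111221 dead2_11111222)

lemma dead2_11111112: "dead s2 (Nd (Nd (Nd (Lf K1) (Lf K1)) (Nd (Lf K1) (Lf K1))) (Nd (Nd (Lf K1) (Lf K1)) (Nd (Lf K1) (Lf K2))))"
  by (rule case2.dead_by_certificate[where es = "[E g0 1 1 0, E g2 (-1) (-1) 1, E g3 0 0 (-1), E g4 1 1 1, E g5 1 0 1, E g6 1 1 0, E g7 0 0 1]" and ce = "!:g7$0e7!:g2 Z Z!:g6$0f2!:g3$0f2#0e7#0e7!:g3$0f2#0e7 Z!:g5$2f5!:g2 Z Z!:g3$0f2!:g6$0f2(N [SL,SL,FR,SL] [])!:g0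
$2f0!:g4$2f4(N [SL,FR,SL,SL] [S0])(N [SL,SL,SL,FL] [])Z!:g0$2f0!:g1$2f1(N [SL,SL,SL,FR] [S1,S0])
(N [SL,FL,SL,SL] [])Z!:g1$2f1!:g3$2f3(N [SL,SL,SL,FR] [S0])(N [SL,SL,SL,FR] [])!:g4$2f4!:g6$2f6
(N [SL,FR,SL,SL] [S1,S0])(N [SL,FR,SL,SL] [])!:g0$2f0(N [SL,SL,FL,SL] [])!:g2$0f0 Z!:g3$0f1(N [SL,FL,SR,SR] [])
!:g6$0f2(N [FR,SR,SR,SL] [])Z"])
    (simp_all add: dead2_11111222 dead2_11121222 dead2_11122112 dead2_12222222)

lemma dead2_00000110: "dead s2 (Nd (Nd (Nd (Lf K0) (Lf K0)) (Nd (Lf K0) (Lf K0))) (Nd (Nd (Lf K0) (Lf K1)) (Nd (Lf K1) (Lf K0))))"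
  by (rule case2.dead_by_certificate[where es = "[E g5 0 0 1]" and ce = "!:g0$0e0!:g3$0e3!:g5 Z Z!:g1$2f1!:g4$2f4!:g7$0f5!:g2!:g6(N [SL,SL,SL,SL] [S2])(N [FR,SL,SR,SL] [])$2f2!:g6
(N [SL,SL,FR,SR] [])(N [FR,SL,SR,SL] [])(N [FR,SL,SL,SL] [])$2e2$2e7$2e4$2e1$2e3$2e0"])
    (simp_all add: dead2_0000011010111021 dead2_00011110 dead2_01111112 dead2_11111112 dead2_11111221)

lemma dead2_01101021: "dead s2 (Nd (Nd (Nd (Lf K0) (Lf K1)) (Nd (Lf K1) (Lf K0))) (Nd (Nd (Lf K1) (Lf K0)) (Nd (Lf K2) (Lf K1))))"
  by (rule case2.dead_by_certificate[where es = "[E g1 1 0 0, E g2 0 0 1, E g4 0 0 1, E g6 0 0 (-1), E g7 0 0 1]" and ce = "!:g3!:g1!:g2!:g0(N [SR,FL,SL,SL] [])(N [SR,FL,SR,SR] [])$2e0!:g0!:g7!:g5(N [SR,SL,SR,FR] [])(N [SR,SL,SR,FR] [])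
$2e5!:g5!:g4(N [SR,SL,FL,SL] [])!:g6$0e6(N [FR,SL,SL,SR] [])Z$2f0(N [SR,SL,SR,FR] [S0])$2e5$2f3
(N [SR,FL,SR,SR] [S1,S0])$2e0$0f2!:g7!:g5!:g6$0e6!:g4!:g2 Z Z$0f2!:g2 Z Z$0f2$0f4$0f6(N [SR,SL,SR,FR] [S1,S0])
$2e5!:g6$0e6!:g4!:g2 Z Z$0f2!:g2 Z Z$0f2!:g5$0f4(N [SL,FR,SL,SR] [S1,S0])$2e5!:g2$2f2 Z$0f2$2f3$0f1!:g0!:g2!:g1
(N [SR,FL,SL,SL] [])(N [SR,FL,SL,SL] [S1,S0])$2f0!:g1(N [SR,FL,SL,SL] [S0])!:g4!:g5!:g7 Z Z$2f5
(N [SR,SL,FL,SL] [S1,S0])$2e5!:g6$0e6!:g7 Z Z(N [SL,SL,FR,SR] [S0])Z$2f0$2f0$2f0!:g6$0e6!:g5!:g1!:g4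
(N [SR,SR,FL,SR] [])(N [SR,SR,FL,SR] [S1,S0])$0f4!:g4(N [SR,SR,FL,SR] [S0])!:g2(N [SL,FL,SL,SL] [S1])!:g7 Z Z
$2f5(N [SL,SL,SL,FL] [S1,S0])$0f4$0f1!:g4!:g1(N [SL,SL,FL,SL] [])(N [SL,SL,FL,SL] [S1])!:g2!:g7 Z Z
(N [FR,SL,SR,SL] [S1,S0])!:g7 Z Z(N [FR,SR,SL,SL] [S1,S0])(N [SL,FL,SL,SL] [])!:g7!:g1(N [SL,SL,FL,SL] [])
(N [SL,SL,SR,FR] [S1])!:g2 Z Z(N [FR,SR,SR,SR] [])!:g1(N [SL,SL,FL,SL] [])!:g2 Z Z(N [FR,SR,SL,SR] [])!:g2 Z Z
(N [FR,SR,SL,SL] [])(N [SL,FR,SL,SR] [S0])!:g2(N [SL,SL,SL,FL] [S0])(N [SL,SL,SL,FL] [S0])(N [SL,SL,SL,FL] [])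
$2e5!:g5!:g4$2f4!:g1(N [SR,SR,FL,SR] [S1,S0])!:g7$0f6 Z$2f5$0f1$0f4!:g2$2f2!:g7$0f6!:g1(N [SL,FL,SL,SL] [])Z Z
!:g1(N [SL,FL,SL,SL] [])!:g4$2f4 Z(N [FR,SL,SL,SR] [])(N [SL,SL,SR,FR] [])!:g4$2f4!:g1(N [SL,SL,FL,SL] [])!:g7
$0f6 Z(N [FR,SL,SL,SR] [S0])(N [SL,FL,SL,SL] [])(N [SL,SL,SL,FL] [])$2e5$2e0$2e3"])
    (simp_all add: dead2_00000110 dead2_00010110 dead2_00010111 dead2_00011110 dead2_01101001 dead2_01101011 dead2_01101221 dead2_01111221 dead2_01121221 dead2_01121222 dead2_11111112 dead2_11111221 dead2_11111222)

lemma dead2_0110: "dead s2 (Nd (Nd (Lf K0) (Lf K1)) (Nd (Lf K1) (Lf K0)))"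
  by (rule case2.dead_by_certificate[where es = "[E h0 (-2) 1 0, E h1 3 1 1, E h2 1 (-2) (-2), E h3 1 1 0]" and ce = "!:h0!:h1!:h2!:h3(N [SR,SL,SL] [])(N [SR,SL,SL] [])$2g3 Z$2g4 Z$2g4!:h3!:h1!:h2(N [SR,SR,SR] [])
(N [SR,SR,SR] [S1,S0])$0g6!:h2(N [SR,SR,SR] [S0])Z$0g6$0g5!:h1!:h2(N [SL,SL,SL] [])(N [SL,SL,SL] [])
(N [SL,SL,SL] [])!:h2(N [SL,SL,SL] [S1])Z Z!:h2(N [SL,SL,SL] [S1])Z Z$2g3$2g0"])
    (simp_all add: dead2_00000110 dead2_00010110 dead2_00011110 dead2_01101001 dead2_01101011 dead2_01101021)

lemma dead2_00111122: "dead s2 (Nd (Nd (Nd (Lf K0) (Lf K0)) (Nd (Lf K1) (Lf K1))) (Nd (Nd (Lf K1) (Lf K1)) (Nd (Lf K2) (Lf K2))))"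
  by (rule case2.dead_by_certificate[where es = "[E g1 (-3) 0 0, E g3 0 (-3) (-3)]" and ce = "!:g1 Z!:g3(N [SL,FL,SL,FR] [])Z Z$2e1"])
    (simp_all add: dead2_0110)

lemma dead2_01111222: "dead s2 (Nd (Nd (Nd (Lf K0) (Lf K1)) (Nd (Lf K1) (Lf K1))) (Nd (Nd (Lf K1) (Lf K2)) (Nd (Lf K2) (Lf K2))))"
  by (rule case2.dead_by_certificate[where es = "[E g0 (-1) 0 0, E g1 1 0 0, E g2 1 0 0]" and ce = "!:g0!:g1!:g2!:g3!:g4$0f0!:g5$0e5!:g7$0e7(N [SR,SL,SL,FR] [])$2f3$2f1$2f0(N [SR,FL,SL,SL] [])$2f1 Z$2f0 Z$2f0!:g1
(N [SL,FL,FL,SL] [])!:g2(N [SL,FL,SL,FL] [])Z Z!:g2(N [SL,FL,SL,FL] [])Z Z$2e0"])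
    (simp_all add: dead2_00010111 dead2_00111122 dead2_0110)

lemma dead2_1122: "dead s2 (Nd (Nd (Lf K1) (Lf K1)) (Nd (Lf K2) (Lf K2)))"
  by (rule case2.dead_by_certificate[where es = "[E h0 1 0 0, E h1 1 0 0, E h3 0 0 1]" and ce = "!:h3$0g3!:h0!:h1!:h2$0g2(N [SR,SL,SL] [])$2g4 Z$2g4 Z Z!:h1$2g5!:h0!:h2$0g2(N [SR,SL,SL] [S0])$2g4 Z Z!:h0$2g4 Z
Z"])
    (simp_all add: dead2_00111122 dead2_01111222)

lemma dead2_12: "dead s2 (Nd (Lf K1) (Lf K2))"
  by (rule case2.dead_by_certificate[where es = "[E i0 0 0 (-1), E i1 0 0 1]" and ce = "!:i1$0h1 Z!:i0$2h2(N [SL,SL] [S0])Z"])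
    (simp_all add: dead2_1122)

section \<open>Nonexistence\<close>

lemma no_code_11_4_3_6: "n \<le> 13 \<Longrightarrow> \<not> has_intersection_array (with_proj (hypercube n)) C [11, 4] [3, 6]"
proof
  assume "n \<le> 13" and "has_intersection_array (with_proj (hypercube n)) C [11, 4] [3, 6]"
  then have "\<exists>f x. colouring s1 f \<and> f x = K1"
  proof (rule colouring_of_code)
    fix a
    show "s1 K0 a = (case a of K0 \<Rightarrow> 13 - int 11 | K1 \<Rightarrow> int 11 | _ \<Rightarrow> 0)"
      "s1 K1 a = (case a of K0 \<Rightarrow> int 3 | K1 \<Rightarrow> 13 - int 4 - int 3 | K2 \<Rightarrow> int 4 | _ \<Rightarrow> 0)"
      "s1 K2 a = (case a of K1 \<Rightarrow> int 6 | K2 \<Rightarrow> 13 - int 6 | _ \<Rightarrow> 0)"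
      by (cases a; simp)+
  qed
  then show False using no_colouring_if_edge_dead[OF _ _ _ dead1_12] by auto
qed

lemma no_code_10_3_4_7: "n \<le> 13 \<Longrightarrow> \<not> has_intersection_array (with_proj (hypercube n)) C [10, 3] [4, 7]"
proof
  assume "n \<le> 13" and "has_intersection_array (with_proj (hypercube n)) C [10, 3] [4, 7]"
  then have "\<exists>f x. colouring s2 f \<and> f x = K1"
  proof (rule colouring_of_code)
    fix a
    show "s2 K0 a = (case a of K0 \<Rightarrow> 13 - int 10 | K1 \<Rightarrow> int 10 | _ \<Rightarrow> 0)"
      "s2 K1 a = (case a of K0 \<Rightarrow> int 4 | K1 \<Rightarrow> 13 - int 3 - int 4 | K2 \<Rightarrow> int 3 | _ \<Rightarrow> 0)"
      "s2 K2 a = (case a of K1 \<Rightarrow> int 7 | K2 \<Rightarrow> 13 - int 7 | _ \<Rightarrow> 0)"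
      by (cases a; simp)+
  qed
  then show False using no_colouring_if_edge_dead[OF _ _ _ dead2_12] by auto
qed

theorem theorem4:
  shows
    "(\<forall>n\<in>{12, 13}. \<not> (\<exists>C. completely_regular_code (with_proj (hypercube n)) C \<and>
        has_intersection_array (with_proj (hypercube n)) C [11, 4] [3, 6])) \<and>
     \<not> (\<exists>C. completely_regular_code (with_proj (hypercube 12)) C \<and>
        has_quotient_matrix (with_proj (hypercube 12)) C
          (mat_of_rows_list 3 [[1, 11, 0], [3, 5, 4], [0, 6, 6]])) \<and>
     \<not> (\<exists>C. completely_regular_code (with_proj (hypercube 13)) C \<and>
        has_quotient_matrix (with_proj (hypercube 13)) C
          (mat_of_rows_list 3 [[2, 11, 0], [3, 6, 4], [0, 6, 7]])) \<and>
     (\<forall>n\<in>{12, 13}. \<not> (\<exists>C. completely_regular_code (with_proj (hypercube n)) C \<and>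
        has_intersection_array (with_proj (hypercube n)) C [10, 3] [4, 7])) \<and>
     \<not> (\<exists>C. completely_regular_code (with_proj (hypercube 12)) C \<and>
        has_quotient_matrix (with_proj (hypercube 12)) C
          (mat_of_rows_list 3 [[2, 10, 0], [4, 5, 3], [0, 7, 5]])) \<and>
     \<not> (\<exists>C. completely_regular_code (with_proj (hypercube 13)) C \<and>
        has_quotient_matrix (with_proj (hypercube 13)) C
          (mat_of_rows_list 3 [[3, 10, 0], [4, 6, 3], [0, 7, 6]]))"
    using no_code_11_4_3_6 no_code_10_3_4_7 by (auto dest!: intersection_array_of_quotient_matrix)

end
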